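(* Let $(\Sigma,\sigma)$ be a mixing shift of finite type with $K\times K$ adjacency matrix $A$, and let $\tau^{CH}$ be the trace on $C(H,\alpha)$ determined by the measure of maximal entropy. Let $\lambda$ be the Perron–Frobenius eigenvalue of $A$ and let $u_l$ (row vector) and $u_r$ (column vector) be left and right Perron–Frobenius eigenvectors of $A$ normalized so that $u_lu_r=1$. Then for every $[X,N]\in K_0(C(H,\alpha))$ (with $X\in C(A)$, $N\geq 0$), $$\tau^{CH}_*[X,N]=\lambda^{-2N}u_lXu_r.$$
   Context: **Shift of finite type.** $A$ is a non-degenerate (no zero row or column) $K\times K$ matrix with non-negative integer entries; its graph has vertices $v_1,\dots,v_K$ and $A_{ij}$ edges from $v_i$ to $v_j$; an edge $e$ goes from $i(e)$ to $t(e)$. $\Sigma$ is the compact space of bi-infinite edge paths $x=(x_n)_{n\in\mathbb Z}$, $t(x_n)=i(x_{n+1})$, and $\sigma(x)_n=x_{n+1}$. It is mixing iff $A$ is primitive. **Homoclinic algebra.** $x,y\in\Sigma$ are homoclinic if $x_n=y_n$ for all but finitely many $n$. For two paths $\xi,\eta$ of length $2N$, indexed by $-N+1,\dots,N$, both from $v_i$ to $v_j$, let $E_{N,v_i,v_j}(\xi,\eta)$ be the set of pairs $(x,y)$ with $x_n=\xi_n,\ y_n=\eta_n$ for $-N+1\le n\le N$ and $x_n=y_n$ for all other $n$. These sets are a base of compact open sets for an étale topology on the homoclinic equivalence relation, which is an amenable groupoid; $H=H(\Sigma,\sigma)$ is its groupoid $C^*$-algebra (AF) and $e_{N,v_i,v_j}(\xi,\eta)\in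 H$ is the characteristic function of $E_{N,v_i,v_j}(\xi,\eta)$. The automorphism $\alpha$ of $H$ is $\alpha(f)(x,y)=f(\sigma^{-1}x,\sigma^{-1}y)$. $K_0(H)$ is the inductive limit of $M_K(\mathbb Z)\to M_K(\mathbb Z)\to\cdots$ with maps $X\mapsto AXA$; $[X,N]$ is the class of $X$ in the $N$th group, and the projection $e_{N,v_i,v_j}(\xi,\xi)$ has class $[e_{ij},N]$. **Mapping cylinder.** $C(H,\alpha)=\{f:\mathbb R\to H\text{ continuous}: f(t+1)=\alpha(f(t))\}$. Evaluation at $0$ induces an injection $K_0(C(H,\alpha))\to K_0(H)$ with image $\ker(\mathrm{id}-\alpha_* )$. With $C(A)=\{X\in M_K(\mathbb Z):AX=XA\}$, this identifies $K_0(C(H,\alpha))$ with the inductive limit of $C(A)\to C(A)\to\cdots$, maps $X\mapsto AXA$, with elements written $[X,N]$, $X\in C(A)$, $N\ge0$. **Traces.** Let $\mu$ be the measure of maximal entropy (Parry measure) of $(\Sigma,\sigma)$, a $\sigma$-invariant probability measure. The trace on $H$ is $\tau(f)=\int_\Sigma f(x,x)\,d\mu(x)$ for continuous compactly supported $f$ on the groupoid; it is $\alpha$-invariant. The trace on $C(H,\alpha)$ is $\tau^{CH}(f)=\int_0^1\tau(f(t))\,dt$, and $\tau^{CH}_*:K_0(C(H,\alpha))\to\mathbb R$ is the induced map. *)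

theory Defs
  imports "HOL-Probability.Probability" "HOL-Algebra.Ring"
begin

section \<open>Perron--Frobenius data of a non-negative integer matrix\<close>

definition nondegenerate :: "nat^'k^'k \<Rightarrow> bool" where
  "nondegenerate A \<longleftrightarrow> (\<forall>i. \<exists>j. A $ i $ j \<noteq> 0) \<and> (\<forall>j. \<exists>i. A $ i $ j \<noteq> 0)"

definition complex_eigenvalues :: "nat^'k^'k \<Rightarrow> complex set" where
  "complex_eigenvalues A = {\<kappa>. \<exists>v. v \<noteq> 0 \<and> map_matrix of_nat A *v v = \<kappa> *s v}"

definition perron_frobenius_eigenvalue :: "nat^'k^'k \<Rightarrow> real \<Rightarrow> bool" where
  "perron_frobenius_eigenvalue A lam \<longleftrightarrow>
     complex_of_real lam \<in> complex_eigenvalues A \<and> (\<forall>\<kappa>\<in>complex_eigenvalues A. cmod \<kappa> \<le> lam)"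

definition left_pf_eigenvector :: "nat^'k^'k \<Rightarrow> real \<Rightarrow> real^'k \<Rightarrow> bool" where
  "left_pf_eigenvector A lam u \<longleftrightarrow> (\<forall>i. u $ i > 0) \<and> u v* map_matrix real A = lam *\<^sub>R u"

definition right_pf_eigenvector :: "nat^'k^'k \<Rightarrow> real \<Rightarrow> real^'k \<Rightarrow> bool" where
  "right_pf_eigenvector A lam u \<longleftrightarrow> (\<forall>i. u $ i > 0) \<and> map_matrix real A *v u = lam *\<^sub>R u"


section \<open>The shift of finite type\<close>

text \<open>The graph of \<open>A\<close> has vertex set \<open>'k\<close>; its edges are the triples \<open>(i, j, m)\<close> with
  \<open>m < A $ i $ j\<close>, such an edge going from \<open>i\<close> to \<open>j\<close>.\<close>

type_synonym 'k edge = "'k \<times> 'k \<times> nat"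

definition edges :: "nat^'k^'k \<Rightarrow> 'k edge set" where
  "edges A = {(i, j, m). m < A $ i $ j}"

definition src :: "'k edge \<Rightarrow> 'k" where "src e = fst e"
definition tgt :: "'k edge \<Rightarrow> 'k" where "tgt e = fst (snd e)"

type_synonym 'k biseq = "int \<Rightarrow> 'k edge"

definition shift_space :: "nat^'k^'k \<Rightarrow> 'k biseq set" where
  "shift_space A = {x. \<forall>n. x n \<in> edges A \<and> tgt (x n) = src (x (n + 1))}"

definition shift :: "'k biseq \<Rightarrow> 'k biseq" where
  "shift x = (\<lambda>n. x (n + 1))"

definition shift_inv :: "'k biseq \<Rightarrow> 'k biseq" where
  "shift_inv x = (\<lambda>n. x (n - 1))"

definition shift_topology :: "nat^'k^'k \<Rightarrow> 'k biseq topology" where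
  "shift_topology A =
     subtopology (product_topology (\<lambda>_. discrete_topology (edges A)) UNIV) (shift_space A)"

definition shift_borel :: "nat^'k^'k \<Rightarrow> 'k biseq measure" where
  "shift_borel A = sigma (shift_space A) {U. openin (shift_topology A) U}"

definition mixing :: "nat^'k^'k \<Rightarrow> bool" where
  "mixing A \<longleftrightarrow>
     (\<forall>U V. openin (shift_topology A) U \<and> openin (shift_topology A) V \<and> U \<noteq> {} \<and> V \<noteq> {}
        \<longrightarrow> (\<exists>n0. \<forall>n\<ge>n0. (shift ^^ n) ` U \<inter> V \<noteq> {}))"


section \<open>Measures of maximal entropy\<close>

text \<open>A finite measurable partition is given as the level sets of a simple function \<open>P\<close>;
  \<open>itinerary T P n\<close> then encodes the refinement of its preimages under \<open>T ^^ k\<close>, \<open>k < n\<close>.\<close>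

definition itinerary :: "('a \<Rightarrow> 'a) \<Rightarrow> ('a \<Rightarrow> nat) \<Rightarrow> nat \<Rightarrow> 'a \<Rightarrow> nat list" where
  "itinerary T P n x = map (\<lambda>k. P ((T ^^ k) x)) [0..<n]"

definition partition_entropy :: "'a measure \<Rightarrow> ('a \<Rightarrow> 'a) \<Rightarrow> ('a \<Rightarrow> nat) \<Rightarrow> nat \<Rightarrow> real" where
  "partition_entropy M T P n =
     prob_space.entropy M (exp 1) (count_space (itinerary T P n ` space M)) (itinerary T P n)"

definition ks_entropy :: "'a measure \<Rightarrow> ('a \<Rightarrow> 'a) \<Rightarrow> ereal" where
  "ks_entropy M T =
     (SUP P \<in> {P. simple_function M P}. ereal (lim (\<lambda>n. partition_entropy M T P n / real n)))"

definition invariant_probs :: "nat^'k^'k \<Rightarrow> 'k biseq measure set" where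
  "invariant_probs A =
     {\<mu>. prob_space \<mu> \<and> sets \<mu> = sets (shift_borel A) \<and>
         shift \<in> measurable \<mu> \<mu> \<and> distr \<mu> \<mu> shift = \<mu>}"

definition measure_of_maximal_entropy :: "nat^'k^'k \<Rightarrow> 'k biseq measure \<Rightarrow> bool" where
  "measure_of_maximal_entropy A \<mu> \<longleftrightarrow>
     \<mu> \<in> invariant_probs A \<and> (\<forall>\<nu>\<in>invariant_probs A. ks_entropy \<nu> shift \<le> ks_entropy \<mu> shift)"


section \<open>The homoclinic groupoid\<close>

definition homoclinic :: "nat^'k^'k \<Rightarrow> ('k biseq \<times> 'k biseq) set" where
  "homoclinic A = {(x, y). x \<in> shift_space A \<and> y \<in> shift_space A \<and> finite {n. x n \<noteq> y n}}"

fun edge_path :: "nat^'k^'k \<Rightarrow> 'k \<Rightarrow> 'k \<Rightarrow> 'k edge list \<Rightarrow> bool" where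
  "edge_path A i j [] \<longleftrightarrow> i = j"
| "edge_path A i j (e # es) \<longleftrightarrow> e \<in> edges A \<and> src e = i \<and> edge_path A (tgt e) j es"

definition centred_path :: "nat^'k^'k \<Rightarrow> nat \<Rightarrow> 'k \<Rightarrow> 'k \<Rightarrow> 'k edge list \<Rightarrow> bool" where
  "centred_path A N i j \<xi> \<longleftrightarrow> edge_path A i j \<xi> \<and> length \<xi> = 2 * N"

text \<open>A path of length \<open>2 * N\<close> is indexed by \<open>{1 - N..N}\<close>, so its edge at position \<open>n\<close> is the
  list entry \<open>n + N - 1\<close>. The vertex conditions follow from the others if \<open>N > 0\<close>; for \<open>N = 0\<close>
  they record the vertex at which the empty path sits.\<close>

definition basic_bisection ::
    "nat^'k^'k \<Rightarrow> nat \<Rightarrow> 'k \<Rightarrow> 'k \<Rightarrow> 'k edge list \<Rightarrow> 'k edge list \<Rightarrow> ('k biseq \<times> 'k biseq) set" where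
  "basic_bisection A N i j \<xi> \<eta> =
     {(x, y). x \<in> shift_space A \<and> y \<in> shift_space A \<and>
        src (x (1 - int N)) = i \<and> src (x (int N + 1)) = j \<and>
        (\<forall>n\<in>{1 - int N..int N}. x n = \<xi> ! nat (n + int N - 1) \<and> y n = \<eta> ! nat (n + int N - 1)) \<and>
        (\<forall>n. n \<notin> {1 - int N..int N} \<longrightarrow> x n = y n)}"

definition homoclinic_topology :: "nat^'k^'k \<Rightarrow> ('k biseq \<times> 'k biseq) topology" where
  "homoclinic_topology A = topology_generated_by
     {basic_bisection A N i j \<xi> \<eta> | N i j \<xi> \<eta>. centred_path A N i j \<xi> \<and> centred_path A N i j \<eta>}"


section \<open>The homoclinic algebra\<close>

text \<open>Functions on the groupoid are extended by zero and so regarded as kernels (infinite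
  matrices) indexed by bi-infinite sequences.\<close>

type_synonym 'x kernel = "'x \<Rightarrow> 'x \<Rightarrow> complex"

definition compactly_supported :: "nat^'k^'k \<Rightarrow> 'k biseq kernel set" where
  "compactly_supported A =
     {f. (\<forall>x y. (x, y) \<notin> homoclinic A \<longrightarrow> f x y = 0) \<and>
         continuous_map (homoclinic_topology A) euclidean (\<lambda>(x, y). f x y) \<and>
         (\<exists>C. compactin (homoclinic_topology A) C \<and> (\<forall>x y. (x, y) \<notin> C \<longrightarrow> f x y = 0))}"

text \<open>\<open>kernel_norm_le f c\<close>: the matrix \<open>f\<close> defines an operator of norm at most \<open>c\<close> on
  square-summable families.\<close>

definition kernel_norm_le :: "'x kernel \<Rightarrow> real \<Rightarrow> bool" where
  "kernel_norm_le f c \<longleftrightarrow>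
     (\<forall>F a b. finite F \<longrightarrow>
        cmod (\<Sum>x\<in>F. \<Sum>y\<in>F. cnj (a x) * f x y * b y)
          \<le> c * L2_set (\<lambda>x. cmod (a x)) F * L2_set (\<lambda>y. cmod (b y)) F)"

text \<open>The groupoid is amenable, so its algebra is the reduced one. The regular representation at
  \<open>x\<close> lives on the square-summable families on the homoclinic class of \<open>x\<close>, where a function
  \<open>f\<close> acts as the matrix \<open>f y z\<close>. The direct sum over all classes represents \<open>f\<close> by its
  kernel, so that the reduced norm is the operator norm of the kernel, and the completion consists
  of the bounded operators (again given by their matrices) that are norm limits of continuous
  compactly supported functions.\<close>

definition homoclinic_carrier :: "nat^'k^'k \<Rightarrow> 'k biseq kernel set" where
  "homoclinic_carrier A =
     {f. \<forall>\<epsilon>>0. \<exists>g\<in>compactly_supported A. kernel_norm_le (\<lambda>x y. f x y - g x y) \<epsilon>}"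

record 'a star_ring = "'a ring" +
  star :: "'a \<Rightarrow> 'a"

definition homoclinic_algebra :: "nat^'k^'k \<Rightarrow> 'k biseq kernel star_ring" where
  "homoclinic_algebra A =
     \<lparr> carrier = homoclinic_carrier A,
       monoid.mult = (\<lambda>f g x y. infsum (\<lambda>z. f x z * g z y) UNIV),
       one = (\<lambda>x y. if x = y \<and> x \<in> shift_space A then 1 else 0),
       zero = (\<lambda>x y. 0),
       add = (\<lambda>f g x y. f x y + g x y),
       star = (\<lambda>f x y. cnj (f y x)) \<rparr>"

definition bisection_elem ::
    "nat^'k^'k \<Rightarrow> nat \<Rightarrow> 'k \<Rightarrow> 'k \<Rightarrow> 'k edge list \<Rightarrow> 'k edge list \<Rightarrow> 'k biseq kernel" where
  "bisection_elem A N i j \<xi> \<eta> = (\<lambda>x y. if (x, y) \<in> basic_bisection A N i j \<xi> \<eta> then 1 else 0)"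

definition shift_aut :: "'k biseq kernel \<Rightarrow> 'k biseq kernel" where
  "shift_aut f = (\<lambda>x y. f (shift_inv x) (shift_inv y))"

text \<open>The formula for the trace stays valid on the completion, since
  \<open>\<bar>f x x\<bar>\<close> is bounded by the operator norm of \<open>f\<close>.\<close>

definition trace_H :: "'k biseq measure \<Rightarrow> 'k biseq kernel \<Rightarrow> complex" where
  "trace_H \<mu> f = (LINT x|\<mu>. f x x)"


section \<open>The mapping cylinder\<close>

definition cylinder_carrier :: "nat^'k^'k \<Rightarrow> (real \<Rightarrow> 'k biseq kernel) set" where
  "cylinder_carrier A =
     {f. (\<forall>t. f t \<in> homoclinic_carrier A) \<and>
         (\<forall>t. \<forall>\<epsilon>>0. \<exists>\<delta>>0. \<forall>s. \<bar>s - t\<bar> < \<delta> \<longrightarrow> kernel_norm_le (\<lambda>x y. f s x y - f t x y) \<epsilon>) \<and>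
         (\<forall>t. f (t + 1) = shift_aut (f t))}"

definition mapping_cylinder :: "nat^'k^'k \<Rightarrow> (real \<Rightarrow> 'k biseq kernel) star_ring" where
  "mapping_cylinder A = (let H = homoclinic_algebra A in
     \<lparr> carrier = cylinder_carrier A,
       monoid.mult = (\<lambda>f g t. f t \<otimes>\<^bsub>H\<^esub> g t),
       one = (\<lambda>t. \<one>\<^bsub>H\<^esub>),
       zero = (\<lambda>t. \<zero>\<^bsub>H\<^esub>),
       add = (\<lambda>f g t. f t \<oplus>\<^bsub>H\<^esub> g t),
       star = (\<lambda>f t. star H (f t)) \<rparr>)"

definition trace_CH :: "'k biseq measure \<Rightarrow> (real \<Rightarrow> 'k biseq kernel) \<Rightarrow> complex" where
  "trace_CH \<mu> f = integral {0..1} (\<lambda>t. trace_H \<mu> (f t))"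


section \<open>The group \<open>K0\<close> of a unital algebra with involution\<close>

text \<open>A square matrix is a pair of its size and its entries, which vanish outside the size; a
  projection \<open>(n, p)\<close> is a self-adjoint idempotent of \<open>M\<^sub>n(R)\<close>.\<close>

definition mats :: "('a, 'm) star_ring_scheme \<Rightarrow> nat \<Rightarrow> nat \<Rightarrow> (nat \<Rightarrow> nat \<Rightarrow> 'a) set" where
  "mats R m n = {p. \<forall>i j. if i < m \<and> j < n then p i j \<in> carrier R else p i j = \<zero>\<^bsub>R\<^esub>}"

definition mats_mult ::
    "('a, 'm) star_ring_scheme \<Rightarrow> nat \<Rightarrow> (nat \<Rightarrow> nat \<Rightarrow> 'a) \<Rightarrow> (nat \<Rightarrow> nat \<Rightarrow> 'a) \<Rightarrow> (nat \<Rightarrow> nat \<Rightarrow> 'a)" where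
  "mats_mult R n p q = (\<lambda>i j. \<Oplus>\<^bsub>R\<^esub>k\<in>{..<n}. p i k \<otimes>\<^bsub>R\<^esub> q k j)"

definition mats_star ::
    "('a, 'm) star_ring_scheme \<Rightarrow> (nat \<Rightarrow> nat \<Rightarrow> 'a) \<Rightarrow> (nat \<Rightarrow> nat \<Rightarrow> 'a)" where
  "mats_star R p = (\<lambda>i j. star R (p j i))"

type_synonym 'a sqmat = "nat \<times> (nat \<Rightarrow> nat \<Rightarrow> 'a)"

definition projections :: "('a, 'm) star_ring_scheme \<Rightarrow> 'a sqmat set" where
  "projections R = {(n, p). p \<in> mats R n n \<and> mats_star R p = p \<and> mats_mult R n p p = p}"

definition mvn_equiv :: "('a, 'm) star_ring_scheme \<Rightarrow> 'a sqmat \<Rightarrow> 'a sqmat \<Rightarrow> bool" where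
  "mvn_equiv R = (\<lambda>(n, p) (m, q).
     \<exists>v\<in>mats R m n. mats_mult R m (mats_star R v) v = p \<and> mats_mult R n v (mats_star R v) = q)"

definition dsum :: "('a, 'm) star_ring_scheme \<Rightarrow> 'a sqmat \<Rightarrow> 'a sqmat \<Rightarrow> 'a sqmat" where
  "dsum R = (\<lambda>(n, p) (m, q).
     (n + m, \<lambda>i j. if i < n \<and> j < n then p i j
                   else if n \<le> i \<and> n \<le> j then q (i - n) (j - n) else \<zero>\<^bsub>R\<^esub>))"

definition zero_proj :: "('a, 'm) star_ring_scheme \<Rightarrow> 'a sqmat" where
  "zero_proj R = (0, \<lambda>i j. \<zero>\<^bsub>R\<^esub>)"

text \<open>A pair \<open>(p, q)\<close> of projections stands for the formal difference \<open>[p] - [q]\<close>.\<close>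

definition K0_rel :: "('a, 'm) star_ring_scheme \<Rightarrow> (('a sqmat \<times> 'a sqmat) \<times> ('a sqmat \<times> 'a sqmat)) set" where
  "K0_rel R =
     {((p, q), (p', q')). {p, q, p', q'} \<subseteq> projections R \<and>
        (\<exists>r\<in>projections R. mvn_equiv R (dsum R (dsum R p q') r) (dsum R (dsum R p' q) r))}"

definition K0 :: "('a, 'm) star_ring_scheme \<Rightarrow> ('a sqmat \<times> 'a sqmat) set monoid" where
  "K0 R =
     \<lparr> carrier = (projections R \<times> projections R) // K0_rel R,
       monoid.mult = (\<lambda>z w. \<Union>(p, q)\<in>z. \<Union>(p', q')\<in>w. K0_rel R `` {(dsum R p p', dsum R q q')}),
       one = K0_rel R `` {(zero_proj R, zero_proj R)} \<rparr>"

definition K0_class :: "('a, 'm) star_ring_scheme \<Rightarrow> 'a \<Rightarrow> ('a sqmat \<times> 'a sqmat) set" where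
  "K0_class R e =
     K0_rel R `` {((1, \<lambda>i j. if i = 0 \<and> j = 0 then e else \<zero>\<^bsub>R\<^esub>), zero_proj R)}"

definition K0_map ::
    "('b, 'n) star_ring_scheme \<Rightarrow> ('a \<Rightarrow> 'b) \<Rightarrow> ('a sqmat \<times> 'a sqmat) set \<Rightarrow> ('b sqmat \<times> 'b sqmat) set" where
  "K0_map S \<phi> z =
     (\<Union>((n, p), (m, q))\<in>z. K0_rel S `` {((n, \<lambda>i j. \<phi> (p i j)), (m, \<lambda>i j. \<phi> (q i j)))})"

definition K0_trace :: "('a \<Rightarrow> complex) \<Rightarrow> ('a sqmat \<times> 'a sqmat) set \<Rightarrow> complex" where
  "K0_trace \<tau> z =
     the_elem ((\<lambda>((n, p), (m, q)). (\<Sum>i<n. \<tau> (p i i)) - (\<Sum>i<m. \<tau> (q i i))) ` z)"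


section \<open>The inductive limit and the classes \<open>[X, N]\<close>\<close>

definition connecting :: "nat^'k^'k \<Rightarrow> int^'k^'k \<Rightarrow> int^'k^'k" where
  "connecting A X = map_matrix int A ** X ** map_matrix int A"

definition limit_rel :: "nat^'k^'k \<Rightarrow> (((int^'k^'k) \<times> nat) \<times> ((int^'k^'k) \<times> nat)) set" where
  "limit_rel A =
     {((X, N), (Y, M)). \<exists>k l. N + k = M + l \<and> (connecting A ^^ k) X = (connecting A ^^ l) Y}"

definition limit_class :: "nat^'k^'k \<Rightarrow> int^'k^'k \<Rightarrow> nat \<Rightarrow> ((int^'k^'k) \<times> nat) set" where
  "limit_class A X N = limit_rel A `` {(X, N)}"

definition limit_group :: "nat^'k^'k \<Rightarrow> ((int^'k^'k) \<times> nat) set monoid" where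
  "limit_group A =
     \<lparr> carrier = UNIV // limit_rel A,
       monoid.mult = (\<lambda>c d. \<Union>(X, N)\<in>c. \<Union>(Y, M)\<in>d.
          limit_class A ((connecting A ^^ M) X + (connecting A ^^ N) Y) (N + M)),
       one = limit_class A 0 0 \<rparr>"

definition matrix_unit :: "'k \<Rightarrow> 'k \<Rightarrow> int^'k^'k" where
  "matrix_unit i j = (\<chi> a b. if a = i \<and> b = j then 1 else 0)"

text \<open>The identification of the inductive limit with the \<open>K0\<close> group of the homoclinic algebra:
  the homomorphism sending \<open>[e\<^sub>i\<^sub>j, N]\<close> to the class of the corresponding projections. For primitive
  \<open>A\<close> the classes \<open>[e\<^sub>i\<^sub>j, N]\<close> for which there is a path of length \<open>2 * N\<close> from \<open>i\<close> to \<open>j\<close>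
  generate the limit, so this homomorphism is unique; it is the isomorphism.\<close>

definition limit_to_K0 :: "nat^'k^'k \<Rightarrow> ((int^'k^'k) \<times> nat) set \<Rightarrow>
    ('k biseq kernel sqmat \<times> 'k biseq kernel sqmat) set" where
  "limit_to_K0 A = (SOME \<Phi>. \<Phi> \<in> hom (limit_group A) (K0 (homoclinic_algebra A)) \<and>
     (\<forall>N i j \<xi>. centred_path A N i j \<xi> \<longrightarrow>
        \<Phi> (limit_class A (matrix_unit i j) N) =
          K0_class (homoclinic_algebra A) (bisection_elem A N i j \<xi> \<xi>)))"

definition centralizer :: "nat^'k^'k \<Rightarrow> (int^'k^'k) set" where
  "centralizer A = {X. map_matrix int A ** X = X ** map_matrix int A}"

text \<open>The element \<open>z\<close> of the \<open>K0\<close> group of the mapping cylinder is the one written \<open>[X, N]\<close>: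
  evaluation at \<open>0\<close>, which is injective on \<open>K0\<close>, sends it to \<open>[X, N]\<close>.\<close>

definition is_cylinder_class :: "nat^'k^'k \<Rightarrow>
    ((real \<Rightarrow> 'k biseq kernel) sqmat \<times> (real \<Rightarrow> 'k biseq kernel) sqmat) set \<Rightarrow>
    int^'k^'k \<Rightarrow> nat \<Rightarrow> bool" where
  "is_cylinder_class A z X N \<longleftrightarrow>
     z \<in> carrier (K0 (mapping_cylinder A)) \<and> X \<in> centralizer A \<and>
     K0_map (homoclinic_algebra A) (\<lambda>f. f 0) z = limit_to_K0 A (limit_class A X N)"

end

theory Submission
  imports Defs
begin

text \<open>
  Traces of projections are locally constant in norm: if \<open>p\<close> and \<open>q\<close> are close, then \<open>p - p q p\<close> is
  small in the corner of \<open>p\<close>, its powers and those of \<open>q - q p q\<close> lose the same amount of trace in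
  each step, and both sequences tend to zero, so that \<open>p\<close> and \<open>q\<close> have equal trace; no functional
  calculus is needed. Hence \<open>t \<mapsto> \<tau> (f t)\<close> is constant for a projection \<open>f\<close> over the mapping cylinder,
  and the trace of a class is the trace of its evaluation at \<open>0\<close>.

  In \<open>K0 H\<close> both sides are additive in the matrix. The pairing \<open>X \<mapsto> u\<^sub>l X u\<^sub>r\<close> is multiplied by \<open>\<lambda>\<^sup>2\<close>
  under \<open>X \<mapsto> A X A\<close>, so it suffices to treat matrix units at a level \<open>N\<close> where all pairs of
  vertices are joined by paths of length \<open>2 N\<close>. There the class is that of the indicator of a cylinder
  set, whose measure has to be \<open>\<lambda> ^ (- 2 N) u\<^sub>l(i) u\<^sub>r(j)\<close>.

  This is Parry's formula. The Parry measure has entropy \<open>ln \<lambda>\<close>. For an arbitrary invariant measure, the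
  entropy is attained on the partition into edges (a Fano estimate replaces arbitrary partitions
  by cylinders), Gibbs' inequality against the Parry transition probabilities bounds it by \<open>ln \<lambda>\<close>,
  and equality forces these transition probabilities; uniqueness of the left eigenvector then
  determines the measure.
\<close>

section \<open>Algebras with involution and their \<open>K0\<close> groups\<close>

text \<open>Elements of H are infinite kernels known only as norm limits, so identities cannot be
  checked on them directly. The way out is a dense subalgebra of local kernels, which vanish unless
  \<open>x\<close> and \<open>y\<close> agree outside a central window and otherwise depend only on
  the two windows and their end vertices. There products are finite matrix products indexed by paths
  and the trace is a weighted matrix trace; the laws pass to the closure by continuity.

  \<open>limit_to_K0\<close> is given by \<open>SOME\<close>, so a homomorphism with its defining
  property must be built first. The formula on generators is compatible with
  \<open>X \<mapsto> A X A\<close> only at pairs of vertices joined by paths of the right length, so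
  every class is first pushed up to a level where mixing provides all paths.

  In the entropy part, strong subadditivity makes block entropies concave in the length; this gives
  the convergence that \<open>lim\<close> presupposes and bounds the limit by every single
  increment. Maximality only compares with existing invariant measures, so the Parry measure has to
  be constructed, by Caratheodory extension from cylinder sets.\<close>

lemma (in comm_monoid) finprod_lessThan_add:
  fixes n m :: nat
  assumes "\<And>k. k < n + m \<Longrightarrow> f k \<in> carrier G"
  shows "finprod G f {..<n + m} = finprod G f {..<n} \<otimes> finprod G (\<lambda>k. f (n + k)) {..<m}"
  using assms
proof (induction m)
  case 0
  then have "finprod G f {..<n} \<in> carrier G" by (intro finprod_closed) auto
  then show ?case by simp
next
  case (Suc m)
  have c1: "finprod G f {..<n} \<in> carrier G" using Suc by (intro finprod_closed) auto
  have c2: "finprod G (\<lambda>k. f (n + k)) {..<m} \<in> carrier G" using Suc by (intro finprod_closed) auto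
  have c3: "f (n + m) \<in> carrier G" using Suc by auto
  have "finprod G f {..<n + Suc m} = f (n + m) \<otimes> finprod G f {..<n + m}"
    using Suc.prems by (simp add: lessThan_Suc Pi_def)
  also have "\<dots> = f (n + m) \<otimes> (finprod G f {..<n} \<otimes> finprod G (\<lambda>k. f (n + k)) {..<m})"
    using Suc by simp
  also have "\<dots> = finprod G f {..<n} \<otimes> (f (n + m) \<otimes> finprod G (\<lambda>k. f (n + k)) {..<m})"
    using c1 c2 c3 by (simp add: m_ac)
  also have "f (n + m) \<otimes> finprod G (\<lambda>k. f (n + k)) {..<m} = finprod G (\<lambda>k. f (n + k)) {..<Suc m}"
    using Suc.prems by (simp add: lessThan_Suc Pi_def)
  finally show ?case .
qed

lemma (in comm_monoid) finprod_swap: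
  assumes "finite I" "finite J" "\<And>i j. i \<in> I \<Longrightarrow> j \<in> J \<Longrightarrow> f i j \<in> carrier G"
  shows "finprod G (\<lambda>i. finprod G (f i) J) I = finprod G (\<lambda>j. finprod G (\<lambda>i. f i j) I) J"
  using assms(1) assms(3)
proof (induction I)
  case empty
  then show ?case by (simp add: finprod_one_eqI)
next
  case (insert x I)
  have c1: "finprod G (f i) J \<in> carrier G" if "i \<in> insert x I" for i
    using that insert by (intro finprod_closed) auto
  have c2: "finprod G (\<lambda>i. f i j) I \<in> carrier G" if "j \<in> J" for j
    using that insert by (intro finprod_closed) auto
  have "finprod G (\<lambda>i. finprod G (f i) J) (insert x I)
      = finprod G (f x) J \<otimes> finprod G (\<lambda>j. finprod G (\<lambda>i. f i j) I) J"
    using insert c1 by (simp add: Pi_def)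
  also have "\<dots> = finprod G (\<lambda>j. f x j \<otimes> finprod G (\<lambda>i. f i j) I) J"
    using insert c2 by (subst finprod_multf) (auto simp: Pi_def)
  also have "\<dots> = finprod G (\<lambda>j. finprod G (\<lambda>i. f i j) (insert x I)) J"
    using insert by (intro finprod_cong') (auto simp: Pi_def)
  finally show ?case .
qed

text \<open>Only algebra enters here, no norm, so that the same \<open>K0\<close> calculus serves
  both the homoclinic algebra and the mapping cylinder.\<close>

locale star_algebra = ring R for R :: "('a, 'm) star_ring_scheme" (structure) +
  assumes star_closed [simp]: "a \<in> carrier R \<Longrightarrow> star R a \<in> carrier R"
    and star_star [simp]: "a \<in> carrier R \<Longrightarrow> star R (star R a) = a"
    and star_add: "\<lbrakk>a \<in> carrier R; b \<in> carrier R\<rbrakk> \<Longrightarrow> star R (a \<oplus> b) = star R a \<oplus> star R b"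
    and star_mult: "\<lbrakk>a \<in> carrier R; b \<in> carrier R\<rbrakk> \<Longrightarrow> star R (a \<otimes> b) = star R b \<otimes> star R a"
begin

lemma star_zero [simp]: "star R \<zero> = \<zero>"
proof -
  have "star R \<zero> \<oplus> star R \<zero> = star R \<zero>" using star_add[of \<zero> \<zero>] by simp
  then show ?thesis by (metis add.l_cancel_one' star_closed zero_closed)
qed

lemma star_finsum:
  assumes "finite I" "\<And>i. i \<in> I \<Longrightarrow> f i \<in> carrier R"
  shows "star R (finsum R f I) = finsum R (\<lambda>i. star R (f i)) I"
  using assms
proof (induction I)
  case (insert x I)
  then have "finsum R f I \<in> carrier R" by (intro finsum_closed) auto
  then show ?case using insert by (simp add: star_add Pi_def)
qed simp

section \<open>Rectangular matrices and projections over the algebra\<close>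

lemma mats_carrier: "p \<in> mats R m n \<Longrightarrow> p i j \<in> carrier R"
  unfolding mats_def by (auto split: if_splits) (metis zero_closed)

lemma mats_outside: "p \<in> mats R m n \<Longrightarrow> \<not> (i < m \<and> j < n) \<Longrightarrow> p i j = \<zero>"
  unfolding mats_def by auto

lemma matsI:
  "(\<And>i j. i < m \<Longrightarrow> j < n \<Longrightarrow> p i j \<in> carrier R) \<Longrightarrow> (\<And>i j. \<not> (i < m \<and> j < n) \<Longrightarrow> p i j = \<zero>)
     \<Longrightarrow> p \<in> mats R m n"
  unfolding mats_def by auto

lemma mats_mult_closed [simp]:
  assumes "p \<in> mats R m n" "q \<in> mats R n l"
  shows "mats_mult R n p q \<in> mats R m l"
proof (rule matsI)
  fix i j
  show "mats_mult R n p q i j \<in> carrier R" unfolding mats_mult_def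
    using assms by (intro finsum_closed) (auto simp: mats_carrier)
  assume "\<not> (i < m \<and> j < l)"
  then consider "\<not> i < m" | "\<not> j < l" by blast
  then show "mats_mult R n p q i j = \<zero>" unfolding mats_mult_def
    by cases (use assms in \<open>auto intro!: add.finprod_one_eqI simp: mats_outside mats_carrier\<close>)
qed

lemma mats_star_closed [simp]: "p \<in> mats R m n \<Longrightarrow> mats_star R p \<in> mats R n m"
  by (rule matsI) (auto simp: mats_star_def mats_carrier mats_outside)

lemma mats_star_star [simp]: "p \<in> mats R m n \<Longrightarrow> mats_star R (mats_star R p) = p"
  by (auto simp: mats_star_def mats_carrier fun_eq_iff)

lemma mats_mult_assoc:
  assumes p: "p \<in> mats R m n" and q: "q \<in> mats R n l" and r: "r \<in> mats R l h"
  shows "mats_mult R l (mats_mult R n p q) r = mats_mult R n p (mats_mult R l q r)"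
proof (intro ext)
  fix i j
  note c = p[THEN mats_carrier] q[THEN mats_carrier] r[THEN mats_carrier]
  have "mats_mult R l (mats_mult R n p q) r i j = (\<Oplus>k\<in>{..<l}. \<Oplus>a\<in>{..<n}. p i a \<otimes> q a k \<otimes> r k j)"
    unfolding mats_mult_def using c by (simp add: finsum_ldistr)
  also have "\<dots> = (\<Oplus>a\<in>{..<n}. \<Oplus>k\<in>{..<l}. p i a \<otimes> q a k \<otimes> r k j)"
    using c by (intro add.finprod_swap) auto
  also have "\<dots> = mats_mult R n p (mats_mult R l q r) i j"
    unfolding mats_mult_def using c by (simp add: finsum_rdistr m_assoc)
  finally show "mats_mult R l (mats_mult R n p q) r i j = mats_mult R n p (mats_mult R l q r) i j" .
qed

lemma mats_star_mult:
  assumes p: "p \<in> mats R m n" and q: "q \<in> mats R n l"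
  shows "mats_star R (mats_mult R n p q) = mats_mult R n (mats_star R q) (mats_star R p)"
  using p[THEN mats_carrier] q[THEN mats_carrier]
  by (auto simp: fun_eq_iff mats_star_def mats_mult_def star_finsum star_mult)

text \<open>Blocks may be rectangular because the partial isometries that realise an equivalence
  between projections of different sizes are not square; \<open>dsum\<close> is the square
  case.\<close>

definition block :: "nat \<Rightarrow> nat \<Rightarrow> (nat \<Rightarrow> nat \<Rightarrow> 'a) \<Rightarrow> (nat \<Rightarrow> nat \<Rightarrow> 'a) \<Rightarrow> nat \<Rightarrow> nat \<Rightarrow> 'a" where
  "block n m p q = (\<lambda>i j. if i < n \<and> j < m then p i j
     else if n \<le> i \<and> m \<le> j then q (i - n) (j - m) else \<zero>)"

lemma dsum_eq: "dsum R (n, p) (m, q) = (n + m, block n n p q)"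
  by (simp add: dsum_def block_def)

lemma block_closed [simp]:
  "p \<in> mats R n m \<Longrightarrow> q \<in> mats R n' m' \<Longrightarrow> block n m p q \<in> mats R (n + n') (m + m')"
  by (rule matsI) (auto simp: block_def mats_carrier intro!: mats_outside[of p n m] mats_outside[of q n' m'])

lemma block_star [simp]:
  "p \<in> mats R n m \<Longrightarrow> q \<in> mats R n' m' \<Longrightarrow>
    mats_star R (block n m p q) = block m n (mats_star R p) (mats_star R q)"
  by (auto simp: fun_eq_iff block_def mats_star_def)

lemma block_mult:
  assumes p: "p \<in> mats R n m" and q: "q \<in> mats R n' m'"
    and p': "p' \<in> mats R m l" and q': "q' \<in> mats R m' l'"
  shows "mats_mult R (m + m') (block n m p q) (block m l p' q') =
    block n l (mats_mult R m p p') (mats_mult R m' q q')"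
proof (intro ext)
  fix i j
  note c [simp] = p[THEN mats_carrier] q[THEN mats_carrier] p'[THEN mats_carrier] q'[THEN mats_carrier]
  have b [simp]: "block n m p q a b \<in> carrier R" "block m l p' q' a b \<in> carrier R" for a b
    by (auto simp: block_def)
  have "mats_mult R (m + m') (block n m p q) (block m l p' q') i j =
     (\<Oplus>k\<in>{..<m}. block n m p q i k \<otimes> block m l p' q' k j) \<oplus>
     (\<Oplus>k\<in>{..<m'}. block n m p q i (m + k) \<otimes> block m l p' q' (m + k) j)"
    unfolding mats_mult_def by (subst add.finprod_lessThan_add) auto
  also have "(\<Oplus>k\<in>{..<m}. block n m p q i k \<otimes> block m l p' q' k j) =
     (if i < n \<and> j < l then mats_mult R m p p' i j else \<zero>)"
    unfolding mats_mult_def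
    by (auto intro!: add.finprod_one_eqI finsum_cong' simp: block_def)
  also have "(\<Oplus>k\<in>{..<m'}. block n m p q i (m + k) \<otimes> block m l p' q' (m + k) j) =
     (if n \<le> i \<and> l \<le> j then mats_mult R m' q q' (i - n) (j - l) else \<zero>)"
    unfolding mats_mult_def
    by (auto intro!: add.finprod_one_eqI finsum_cong' simp: block_def)
  finally show "mats_mult R (m + m') (block n m p q) (block m l p' q') i j =
      block n l (mats_mult R m p p') (mats_mult R m' q q') i j"
    using mats_carrier[OF mats_mult_closed[OF p p']] mats_carrier[OF mats_mult_closed[OF q q']]
    by (auto simp: block_def)
qed

lemma projectionsD:
  assumes "(n, p) \<in> projections R"
  shows "p \<in> mats R n n" "mats_star R p = p" "mats_mult R n p p = p"
  using assms by (auto simp: projections_def)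

lemma dsum_projections [simp]:
  "p \<in> projections R \<Longrightarrow> q \<in> projections R \<Longrightarrow> dsum R p q \<in> projections R"
  by (cases p; cases q) (auto simp: dsum_eq projections_def block_mult)

lemma zero_proj_projections [simp]: "zero_proj R \<in> projections R"
  by (auto simp: zero_proj_def projections_def mats_def mats_star_def mats_mult_def fun_eq_iff)

lemma dsum_zero_right: "p \<in> projections R \<Longrightarrow> dsum R p (zero_proj R) = p"
  by (cases p) (auto simp: dsum_eq zero_proj_def block_def fun_eq_iff
      intro!: mats_outside[symmetric, OF projectionsD(1)])

lemma dsum_assoc:
  "p \<in> projections R \<Longrightarrow> q \<in> projections R \<Longrightarrow> r \<in> projections R \<Longrightarrow>
    dsum R (dsum R p q) r = dsum R p (dsum R q r)"
  by (cases p; cases q; cases r) (auto simp: dsum_eq block_def fun_eq_iff diff_diff_left)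

lemma mvn_refl: "p \<in> projections R \<Longrightarrow> mvn_equiv R p p"
  by (cases p) (auto simp: mvn_equiv_def projectionsD intro!: bexI[of _ "snd p"])

lemma mvn_sym: "mvn_equiv R p q \<Longrightarrow> mvn_equiv R q p"
  by (auto simp: mvn_equiv_def intro!: bexI[OF _ mats_star_closed])

text \<open>The composite \<open>w v\<close> of the two partial isometries is the witness. The
  middle projection is absorbed because \<open>q' v\<close> and \<open>v p'\<close> are both
  \<open>v v* v\<close>, and likewise for \<open>w\<close>; idempotency of the outer projections
  finishes each half.\<close>

lemma mvn_trans:
  assumes "mvn_equiv R p q" "mvn_equiv R q r" "p \<in> projections R" "r \<in> projections R"
  shows "mvn_equiv R p r"
proof -
  obtain n p' where p [simp]: "p = (n, p')" by (cases p)
  obtain m q' where q [simp]: "q = (m, q')" by (cases q)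
  obtain l r' where r [simp]: "r = (l, r')" by (cases r)
  obtain v where v: "v \<in> mats R m n" "mats_mult R m (mats_star R v) v = p'"
      "mats_mult R n v (mats_star R v) = q'"
    using assms by (auto simp: mvn_equiv_def)
  obtain w where w: "w \<in> mats R l m" "mats_mult R l (mats_star R w) w = q'"
      "mats_mult R m w (mats_star R w) = r'"
    using assms by (auto simp: mvn_equiv_def)
  note P = projectionsD[OF assms(3)[unfolded p]] and Q = projectionsD[OF assms(4)[unfolded r]]
  note sv = mats_star_closed[OF v(1)] and sw = mats_star_closed[OF w(1)]
  define u where "u = mats_mult R m w v"
  have u: "u \<in> mats R l n" using v w by (simp add: u_def)
  have su: "mats_star R u = mats_mult R m (mats_star R v) (mats_star R w)"
    using v w by (simp add: u_def mats_star_mult)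
  have "mats_mult R l (mats_star R u) u = mats_mult R m (mats_star R v) (mats_mult R l (mats_star R w) (mats_mult R m w v))"
    unfolding su unfolding u_def
    using mats_mult_closed[OF w(1) v(1)] by (rule mats_mult_assoc[OF sv sw])
  also have "mats_mult R l (mats_star R w) (mats_mult R m w v) = mats_mult R m q' v"
    using mats_mult_assoc[OF sw w(1) v(1)] w(2) by simp
  also have "mats_mult R m q' v = mats_mult R n v p'"
    using mats_mult_assoc[OF v(1) sv v(1)] v by simp
  also have "mats_mult R m (mats_star R v) (mats_mult R n v p') = mats_mult R n p' p'"
    using mats_mult_assoc[OF sv v(1) P(1)] v by simp
  also have "\<dots> = p'" by (rule P)
  finally have 1: "mats_mult R l (mats_star R u) u = p'" .
  have "mats_mult R n u (mats_star R u) = mats_mult R m w (mats_mult R n v (mats_mult R m (mats_star R v) (mats_star R w)))"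
    unfolding su unfolding u_def
    using mats_mult_closed[OF sv sw] by (rule mats_mult_assoc[OF w(1) v(1)])
  also have "mats_mult R n v (mats_mult R m (mats_star R v) (mats_star R w)) = mats_mult R m q' (mats_star R w)"
    using mats_mult_assoc[OF v(1) sv sw] v by simp
  also have "\<dots> = mats_mult R l (mats_star R w) r'"
    using mats_mult_assoc[OF sw w(1) sw] w by simp
  also have "mats_mult R m w (mats_mult R l (mats_star R w) r') = mats_mult R l r' r'"
    using mats_mult_assoc[OF w(1) sw Q(1)] w by simp
  also have "\<dots> = r'" by (rule Q)
  finally have 2: "mats_mult R n u (mats_star R u) = r'" .
  show ?thesis using 1 2 u by (auto simp: mvn_equiv_def)
qed

lemma mvn_dsum:
  assumes "mvn_equiv R p p'" "mvn_equiv R q q'"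
  shows "mvn_equiv R (dsum R p q) (dsum R p' q')"
proof -
  obtain n a m b n' a' m' b' where [simp]: "p = (n, a)" "q = (m, b)" "p' = (n', a')" "q' = (m', b')"
    by (cases p; cases q; cases p'; cases q')
  obtain v where v: "v \<in> mats R n' n" "mats_mult R n' (mats_star R v) v = a"
      "mats_mult R n v (mats_star R v) = a'"
    using assms by (auto simp: mvn_equiv_def)
  obtain w where w: "w \<in> mats R m' m" "mats_mult R m' (mats_star R w) w = b"
      "mats_mult R m w (mats_star R w) = b'"
    using assms by (auto simp: mvn_equiv_def)
  show ?thesis
    using v w by (auto simp: mvn_equiv_def dsum_eq block_mult[OF mats_star_closed mats_star_closed]
        block_mult[OF _ _ mats_star_closed mats_star_closed] intro!: bexI[of _ "block n' n v w"])
qed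

text \<open>The witness is \<open>p\<close> with its rows permuted: \<open>v* v\<close> sums over
  all rows, so the permutation drops out, while \<open>v v*\<close> carries it on both
  sides.\<close>

lemma mvn_permute:
  assumes p: "(n, p) \<in> projections R" and \<pi>: "bij_betw \<pi> {..<n} {..<n}"
    and q: "\<And>i j. q i j = (if i < n \<and> j < n then p (\<pi> i) (\<pi> j) else \<zero>)"
  shows "mvn_equiv R (n, p) (n, q)"
proof -
  note P = projectionsD[OF p] and c [simp] = projectionsD(1)[OF p, THEN mats_carrier]
  have st: "star R (p i j) = p j i" for i j
    using P(2) by (metis mats_star_def)
  define v where "v = (\<lambda>i j. if i < n \<and> j < n then p (\<pi> i) j else \<zero>)"
  have v: "v \<in> mats R n n" by (rule matsI) (auto simp: v_def)
  have "mats_mult R n (mats_star R v) v i j = p i j" for i j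
  proof (cases "i < n \<and> j < n")
    case True
    have "mats_mult R n (mats_star R v) v i j = (\<Oplus>k\<in>{..<n}. p i (\<pi> k) \<otimes> p (\<pi> k) j)"
      unfolding mats_mult_def using True by (intro finsum_cong') (auto simp: mats_star_def v_def st)
    also have "\<dots> = (\<Oplus>k\<in>\<pi> ` {..<n}. p i k \<otimes> p k j)"
      using \<pi> by (subst finsum_reindex) (auto simp: bij_betw_def)
    also have "\<dots> = mats_mult R n p p i j"
      using \<pi> by (simp add: bij_betw_def mats_mult_def)
    finally show ?thesis using P by simp
  next
    case False
    then show ?thesis using mats_outside[OF mats_mult_closed[OF mats_star_closed[OF v] v]]
        mats_outside[OF P(1)] by simp
  qed
  moreover have "mats_mult R n v (mats_star R v) i j = q i j" for i j
  proof (cases "i < n \<and> j < n")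
    case True
    have "mats_mult R n v (mats_star R v) i j = (\<Oplus>k\<in>{..<n}. p (\<pi> i) k \<otimes> p k (\<pi> j))"
      unfolding mats_mult_def using True by (intro finsum_cong') (auto simp: mats_star_def v_def st)
    also have "\<dots> = mats_mult R n p p (\<pi> i) (\<pi> j)" by (simp add: mats_mult_def)
    finally show ?thesis using P True q by simp
  next
    case False
    then show ?thesis using mats_outside[OF mats_mult_closed[OF v mats_star_closed[OF v]] False] q[of i j] False by auto
  qed
  ultimately show ?thesis using v by (auto simp: mvn_equiv_def fun_eq_iff)
qed

lemma mvn_dsum_comm:
  assumes "p \<in> projections R" "q \<in> projections R"
  shows "mvn_equiv R (dsum R p q) (dsum R q p)"
proof -
  obtain n a m b where [simp]: "p = (n, a)" "q = (m, b)" by (cases p; cases q)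
  define \<pi> where "\<pi> i = (if i < m then n + i else i - m)" for i
  have "bij_betw \<pi> {..<n + m} {..<n + m}"
    by (rule bij_betw_byWitness[of _ "\<lambda>i. if i < n then m + i else i - n"]) (auto simp: \<pi>_def)
  then have "mvn_equiv R (n + m, block n n a b) (n + m, block m m b a)"
  proof (rule mvn_permute[rotated])
    show "(n + m, block n n a b) \<in> projections R" using dsum_projections[OF assms] by (simp add: dsum_eq)
    show "block m m b a i j = (if i < n + m \<and> j < n + m then block n n a b (\<pi> i) (\<pi> j) else \<zero>)" for i j
      using mats_outside[OF projectionsD(1), of m b i j] mats_outside[OF projectionsD(1), of n a "i - m" "j - m"] assms
      by (auto simp: block_def \<pi>_def)
  qed
  then show ?thesis by (simp add: dsum_eq add.commute)
qed

section \<open>The monoid of Murray-von Neumann classes and its Grothendieck group\<close>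

definition vclass :: "'a sqmat \<Rightarrow> 'a sqmat set" where
  "vclass p = {q \<in> projections R. mvn_equiv R p q}"

text \<open>With the classes packaged as a commutative monoid, the Grothendieck construction becomes
  rewriting with \<open>m_ac\<close>. The product picks representatives by \<open>SOME\<close>;
  \<open>vclass_mult\<close> removes the choice.\<close>

definition vmonoid :: "'a sqmat set monoid" where
  "vmonoid = \<lparr> carrier = vclass ` projections R,
     monoid.mult = (\<lambda>C D. vclass (dsum R (SOME p. p \<in> C) (SOME q. q \<in> D))),
     one = vclass (zero_proj R) \<rparr>"

lemma vclass_eq_iff:
  assumes "p \<in> projections R" "q \<in> projections R"
  shows "vclass p = vclass q \<longleftrightarrow> mvn_equiv R p q"
proof
  assume "vclass p = vclass q"
  moreover have "q \<in> vclass q" using assms by (simp add: vclass_def mvn_refl)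
  ultimately have "q \<in> vclass p" by simp
  then show "mvn_equiv R p q" by (simp add: vclass_def)
next
  assume pq: "mvn_equiv R p q"
  show "vclass p = vclass q"
    unfolding vclass_def using mvn_trans[OF pq] mvn_trans[OF mvn_sym[OF pq]] assms by blast
qed

lemma vclass_carrier [simp]: "p \<in> projections R \<Longrightarrow> vclass p \<in> carrier vmonoid"
  by (simp add: vmonoid_def)

lemma vclass_mult:
  assumes p: "p \<in> projections R" and q: "q \<in> projections R"
  shows "vclass p \<otimes>\<^bsub>vmonoid\<^esub> vclass q = vclass (dsum R p q)"
proof -
  have "p \<in> vclass p" "q \<in> vclass q" using assms by (auto simp: vclass_def mvn_refl)
  then have "(SOME p'. p' \<in> vclass p) \<in> vclass p" "(SOME q'. q' \<in> vclass q) \<in> vclass q"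
    by (auto intro: someI)
  then have "mvn_equiv R (dsum R p q) (dsum R (SOME p'. p' \<in> vclass p) (SOME q'. q' \<in> vclass q))"
    and "dsum R (SOME p'. p' \<in> vclass p) (SOME q'. q' \<in> vclass q) \<in> projections R"
    by (auto simp: vclass_def intro: mvn_dsum)
  then show ?thesis using assms by (simp add: vmonoid_def vclass_eq_iff mvn_sym)
qed

lemma vmonoid_comm_monoid: "comm_monoid vmonoid"
proof (rule comm_monoidI)
  have c: "\<exists>p\<in>projections R. x = vclass p" if "x \<in> carrier vmonoid" for x
    using that by (auto simp: vmonoid_def)
  show one: "\<one>\<^bsub>vmonoid\<^esub> \<in> carrier vmonoid" by (simp add: vmonoid_def)
  show comm: "x \<otimes>\<^bsub>vmonoid\<^esub> y = y \<otimes>\<^bsub>vmonoid\<^esub> x"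
    if x: "x \<in> carrier vmonoid" and y: "y \<in> carrier vmonoid" for x y
  proof -
    obtain p q where "p \<in> projections R" "q \<in> projections R" "x = vclass p" "y = vclass q"
      using c[OF x] c[OF y] by blast
    then show ?thesis by (simp add: vclass_mult vclass_eq_iff mvn_dsum_comm)
  qed
  show "x \<otimes>\<^bsub>vmonoid\<^esub> y \<in> carrier vmonoid"
    if "x \<in> carrier vmonoid" "y \<in> carrier vmonoid" for x y
    using c[OF that(1)] c[OF that(2)] by (auto simp: vclass_mult)
  show "x \<otimes>\<^bsub>vmonoid\<^esub> y \<otimes>\<^bsub>vmonoid\<^esub> z = x \<otimes>\<^bsub>vmonoid\<^esub> (y \<otimes>\<^bsub>vmonoid\<^esub> z)"
    if "x \<in> carrier vmonoid" "y \<in> carrier vmonoid" "z \<in> carrier vmonoid" for x y z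
    using c[OF that(1)] c[OF that(2)] c[OF that(3)] by (auto simp: vclass_mult dsum_assoc)
  have "x \<otimes>\<^bsub>vmonoid\<^esub> \<one>\<^bsub>vmonoid\<^esub> = x" if x: "x \<in> carrier vmonoid" for x
  proof -
    obtain p where "p \<in> projections R" "x = vclass p" using c[OF x] by blast
    then show ?thesis
      using vclass_mult[of p "zero_proj R"] by (simp add: dsum_zero_right vmonoid_def)
  qed
  then show "\<one>\<^bsub>vmonoid\<^esub> \<otimes>\<^bsub>vmonoid\<^esub> x = x" if "x \<in> carrier vmonoid" for x
    using comm one that by metis
qed

text \<open>This is the Grothendieck relation of the class monoid, with \<open>r\<close>
  compensating for the possible failure of cancellation.\<close>

lemma K0_rel_iff:
  "((p, q), (p', q')) \<in> K0_rel R \<longleftrightarrow> {p, q, p', q'} \<subseteq> projections R \<and>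
     (\<exists>r\<in>carrier vmonoid. vclass p \<otimes>\<^bsub>vmonoid\<^esub> vclass q' \<otimes>\<^bsub>vmonoid\<^esub> r =
        vclass p' \<otimes>\<^bsub>vmonoid\<^esub> vclass q \<otimes>\<^bsub>vmonoid\<^esub> r)"
proof (cases "{p, q, p', q'} \<subseteq> projections R")
  case True
  have "vclass p \<otimes>\<^bsub>vmonoid\<^esub> vclass q' \<otimes>\<^bsub>vmonoid\<^esub> vclass r =
        vclass p' \<otimes>\<^bsub>vmonoid\<^esub> vclass q \<otimes>\<^bsub>vmonoid\<^esub> vclass r \<longleftrightarrow>
      mvn_equiv R (dsum R (dsum R p q') r) (dsum R (dsum R p' q) r)" if "r \<in> projections R" for r
    using True that by (simp add: vclass_mult vclass_eq_iff)
  moreover have "carrier vmonoid = vclass ` projections R" by (simp add: vmonoid_def)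
  ultimately show ?thesis using True by (simp add: K0_rel_def)
qed (auto simp: K0_rel_def)

lemma K0_rel_equiv: "equiv (projections R \<times> projections R) (K0_rel R)"
proof -
  interpret V: comm_monoid vmonoid by (rule vmonoid_comm_monoid)
  show ?thesis
  proof (rule equivI)
    show "K0_rel R \<subseteq> (projections R \<times> projections R) \<times> (projections R \<times> projections R)"
      by (auto simp: K0_rel_def)
    show "refl_on (projections R \<times> projections R) (K0_rel R)"
      by (auto simp: refl_on_def K0_rel_iff intro: V.one_closed)
    show "sym (K0_rel R)"
      by (auto simp: sym_def K0_rel_iff)
    show "trans (K0_rel R)"
    proof (rule transI)
      fix a b c
      assume ab: "(a, b) \<in> K0_rel R" and bc: "(b, c) \<in> K0_rel R"
      obtain p q p' q' p'' q'' where [simp]: "a = (p, q)" "b = (p', q')" "c = (p'', q'')"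
        by (cases a; cases b; cases c)
      have pr: "p \<in> projections R" "q \<in> projections R" "p' \<in> projections R"
        "q' \<in> projections R" "p'' \<in> projections R" "q'' \<in> projections R"
        using ab bc by (auto simp: K0_rel_iff)
      obtain r where r: "r \<in> carrier vmonoid" "vclass p \<otimes>\<^bsub>vmonoid\<^esub> vclass q' \<otimes>\<^bsub>vmonoid\<^esub> r =
        vclass p' \<otimes>\<^bsub>vmonoid\<^esub> vclass q \<otimes>\<^bsub>vmonoid\<^esub> r" using ab by (auto simp: K0_rel_iff)
      obtain s where s: "s \<in> carrier vmonoid" "vclass p' \<otimes>\<^bsub>vmonoid\<^esub> vclass q'' \<otimes>\<^bsub>vmonoid\<^esub> s =
        vclass p'' \<otimes>\<^bsub>vmonoid\<^esub> vclass q' \<otimes>\<^bsub>vmonoid\<^esub> s" using bc by (auto simp: K0_rel_iff)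
      note pc [simp] = pr[THEN vclass_carrier] r(1) s(1)
      \<comment> \<open>Adding the two given equations leaves \<open>p'\<close> and
        \<open>q'\<close> on both sides; they become part of the new stabiliser.\<close>
      define t where "t = vclass p' \<otimes>\<^bsub>vmonoid\<^esub> vclass q' \<otimes>\<^bsub>vmonoid\<^esub> r \<otimes>\<^bsub>vmonoid\<^esub> s"
      have "vclass p \<otimes>\<^bsub>vmonoid\<^esub> vclass q'' \<otimes>\<^bsub>vmonoid\<^esub> t =
        (vclass p \<otimes>\<^bsub>vmonoid\<^esub> vclass q' \<otimes>\<^bsub>vmonoid\<^esub> r) \<otimes>\<^bsub>vmonoid\<^esub>
        (vclass p' \<otimes>\<^bsub>vmonoid\<^esub> vclass q'' \<otimes>\<^bsub>vmonoid\<^esub> s)"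
        by (simp add: t_def V.m_ac)
      also have "\<dots> = vclass p'' \<otimes>\<^bsub>vmonoid\<^esub> vclass q \<otimes>\<^bsub>vmonoid\<^esub> t"
        unfolding r(2) s(2) by (simp add: t_def V.m_ac)
      finally show "(a, c) \<in> K0_rel R" using pr by (auto simp: K0_rel_iff t_def intro!: bexI[of _ t])
    qed
  qed
qed

lemma K0_rel_dsum:
  assumes "((p, q), (p', q')) \<in> K0_rel R" "((s, t), (s', t')) \<in> K0_rel R"
  shows "((dsum R p s, dsum R q t), (dsum R p' s', dsum R q' t')) \<in> K0_rel R"
proof -
  interpret V: comm_monoid vmonoid by (rule vmonoid_comm_monoid)
  have pr: "p \<in> projections R" "q \<in> projections R" "p' \<in> projections R" "q' \<in> projections R"
    "s \<in> projections R" "t \<in> projections R" "s' \<in> projections R" "t' \<in> projections R"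
    using assms by (auto simp: K0_rel_iff)
  obtain u where u: "u \<in> carrier vmonoid" "vclass p \<otimes>\<^bsub>vmonoid\<^esub> vclass q' \<otimes>\<^bsub>vmonoid\<^esub> u =
        vclass p' \<otimes>\<^bsub>vmonoid\<^esub> vclass q \<otimes>\<^bsub>vmonoid\<^esub> u" using assms by (auto simp: K0_rel_iff)
  obtain w where w: "w \<in> carrier vmonoid" "vclass s \<otimes>\<^bsub>vmonoid\<^esub> vclass t' \<otimes>\<^bsub>vmonoid\<^esub> w =
        vclass s' \<otimes>\<^bsub>vmonoid\<^esub> vclass t \<otimes>\<^bsub>vmonoid\<^esub> w" using assms by (auto simp: K0_rel_iff)
  note pc [simp] = pr[THEN vclass_carrier] u(1) w(1)
  have "vclass p \<otimes>\<^bsub>vmonoid\<^esub> vclass s \<otimes>\<^bsub>vmonoid\<^esub> (vclass q' \<otimes>\<^bsub>vmonoid\<^esub> vclass t') \<otimes>\<^bsub>vmonoid\<^esub> (u \<otimes>\<^bsub>vmonoid\<^esub> w)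
     = (vclass p \<otimes>\<^bsub>vmonoid\<^esub> vclass q' \<otimes>\<^bsub>vmonoid\<^esub> u) \<otimes>\<^bsub>vmonoid\<^esub> (vclass s \<otimes>\<^bsub>vmonoid\<^esub> vclass t' \<otimes>\<^bsub>vmonoid\<^esub> w)"
    by (simp add: V.m_ac)
  also have "\<dots> = vclass p' \<otimes>\<^bsub>vmonoid\<^esub> vclass s' \<otimes>\<^bsub>vmonoid\<^esub> (vclass q \<otimes>\<^bsub>vmonoid\<^esub> vclass t) \<otimes>\<^bsub>vmonoid\<^esub> (u \<otimes>\<^bsub>vmonoid\<^esub> w)"
    unfolding u(2) w(2) by (simp add: V.m_ac)
  finally show ?thesis using pr
    by (auto simp: K0_rel_iff vclass_mult intro!: bexI[of _ "u \<otimes>\<^bsub>vmonoid\<^esub> w"])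
qed

abbreviation K0_pair :: "'a sqmat \<Rightarrow> 'a sqmat \<Rightarrow> ('a sqmat \<times> 'a sqmat) set" where
  "K0_pair p q \<equiv> K0_rel R `` {(p, q)}"

lemma K0_pair_carrier [simp]:
  "p \<in> projections R \<Longrightarrow> q \<in> projections R \<Longrightarrow> K0_pair p q \<in> carrier (K0 R)"
  by (auto simp: K0_def intro: quotientI)

lemma K0_carrierE:
  assumes "z \<in> carrier (K0 R)"
  obtains p q where "p \<in> projections R" "q \<in> projections R" "z = K0_pair p q"
  using assms by (auto simp: K0_def elim!: quotientE)

lemma K0_pair_eq_iff:
  assumes "p \<in> projections R" "q \<in> projections R" "p' \<in> projections R" "q' \<in> projections R"
  shows "K0_pair p q = K0_pair p' q' \<longleftrightarrow> ((p, q), (p', q')) \<in> K0_rel R"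
  using assms by (intro eq_equiv_class_iff[OF K0_rel_equiv]) auto

lemma K0_pair_self: "p \<in> projections R \<Longrightarrow> q \<in> projections R \<Longrightarrow> (p, q) \<in> K0_pair p q"
  by (rule equiv_class_self[OF K0_rel_equiv]) auto

text \<open>The product in \<open>K0\<close> is a union over all representatives; compatibility with
  direct sums makes all its members the same class, so the union collapses.\<close>

lemma K0_mult_pair:
  assumes "p \<in> projections R" "q \<in> projections R" "p' \<in> projections R" "q' \<in> projections R"
  shows "K0_pair p q \<otimes>\<^bsub>K0 R\<^esub> K0_pair p' q' = K0_pair (dsum R p p') (dsum R q q')"
proof -
  have "K0_pair (dsum R s s') (dsum R t t') = K0_pair (dsum R p p') (dsum R q q')"
    if "(s, t) \<in> K0_pair p q" "(s', t') \<in> K0_pair p' q'" for s t s' t'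
    using equiv_class_eq[OF K0_rel_equiv K0_rel_dsum[of p q s t p' q' s' t']] that by simp
  moreover note K0_pair_self[OF assms(1,2)] K0_pair_self[OF assms(3,4)]
  ultimately show ?thesis by (fastforce simp: K0_def)
qed

lemma K0_comm_group: "comm_group (K0 R)"
proof (rule comm_groupI)
  interpret V: comm_monoid vmonoid by (rule vmonoid_comm_monoid)
  have one_eq: "\<one>\<^bsub>K0 R\<^esub> = K0_pair (zero_proj R) (zero_proj R)" by (simp add: K0_def)
  show "\<one>\<^bsub>K0 R\<^esub> \<in> carrier (K0 R)" by (simp add: one_eq)
  fix x assume "x \<in> carrier (K0 R)"
  then obtain p q where x: "p \<in> projections R" "q \<in> projections R" "x = K0_pair p q"
    by (rule K0_carrierE)
  have z0: "vclass (zero_proj R) = \<one>\<^bsub>vmonoid\<^esub>" by (simp add: vmonoid_def)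
  show "\<one>\<^bsub>K0 R\<^esub> \<otimes>\<^bsub>K0 R\<^esub> x = x"
    using x by (auto simp: one_eq K0_mult_pair K0_pair_eq_iff K0_rel_iff vclass_mult[symmetric] z0 V.m_ac
        intro!: bexI[OF _ V.one_closed])
  show "\<exists>y\<in>carrier (K0 R). y \<otimes>\<^bsub>K0 R\<^esub> x = \<one>\<^bsub>K0 R\<^esub>"
    using x by (intro bexI[of _ "K0_pair q p"])
      (auto simp: one_eq K0_mult_pair K0_pair_eq_iff K0_rel_iff vclass_mult[symmetric] z0 V.m_ac
        intro!: bexI[OF _ V.one_closed])
  fix y assume "y \<in> carrier (K0 R)"
  then obtain p' q' where y: "p' \<in> projections R" "q' \<in> projections R" "y = K0_pair p' q'"
    by (rule K0_carrierE)
  show "x \<otimes>\<^bsub>K0 R\<^esub> y \<in> carrier (K0 R)" using x y by (simp add: K0_mult_pair)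
  show "x \<otimes>\<^bsub>K0 R\<^esub> y = y \<otimes>\<^bsub>K0 R\<^esub> x"
    using x y by (auto simp: K0_mult_pair K0_pair_eq_iff K0_rel_iff vclass_mult[symmetric] V.m_ac
        intro!: bexI[OF _ V.one_closed])
  fix z assume "z \<in> carrier (K0 R)"
  then obtain p'' q'' where z: "p'' \<in> projections R" "q'' \<in> projections R" "z = K0_pair p'' q''"
    by (rule K0_carrierE)
  show "x \<otimes>\<^bsub>K0 R\<^esub> y \<otimes>\<^bsub>K0 R\<^esub> z = x \<otimes>\<^bsub>K0 R\<^esub> (y \<otimes>\<^bsub>K0 R\<^esub> z)"
    using x y z by (simp add: K0_mult_pair dsum_assoc)
qed

section \<open>Classes of projections in the algebra itself\<close>

definition selfadj_idem :: "'a \<Rightarrow> bool" where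
  "selfadj_idem e \<longleftrightarrow> e \<in> carrier R \<and> star R e = e \<and> e \<otimes> e = e"

definition mat1 :: "'a \<Rightarrow> nat \<Rightarrow> nat \<Rightarrow> 'a" where
  "mat1 e = (\<lambda>i j. if i = 0 \<and> j = 0 then e else \<zero>)"

lemma K0_class_eq: "K0_class R e = K0_pair (1, mat1 e) (zero_proj R)"
  by (simp add: K0_class_def mat1_def)

lemma mat1_mats [simp]: "e \<in> carrier R \<Longrightarrow> mat1 e \<in> mats R 1 1" "e \<in> carrier R \<Longrightarrow> mat1 e \<in> mats R (Suc 0) (Suc 0)"
  by (auto simp: mats_def mat1_def)

lemma mat1_mult [simp]:
  "e \<in> carrier R \<Longrightarrow> f \<in> carrier R \<Longrightarrow> mats_mult R (Suc 0) (mat1 e) (mat1 f) = mat1 (e \<otimes> f)"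
  by (auto simp: mats_mult_def mat1_def fun_eq_iff lessThan_Suc)

lemma mat1_star [simp]: "mats_star R (mat1 e) = mat1 (star R e)"
  by (auto simp: mats_star_def mat1_def fun_eq_iff)

lemma mat1_projection [simp]: "selfadj_idem e \<Longrightarrow> (1, mat1 e) \<in> projections R" "selfadj_idem e \<Longrightarrow> (Suc 0, mat1 e) \<in> projections R"
  by (auto simp: selfadj_idem_def projections_def)

lemma K0_class_carrier [simp]: "selfadj_idem e \<Longrightarrow> K0_class R e \<in> carrier (K0 R)"
  by (simp add: K0_class_eq)

lemma K0_class_cong:
  assumes "v \<in> carrier R" "selfadj_idem (star R v \<otimes> v)" "selfadj_idem (v \<otimes> star R v)"
  shows "K0_class R (star R v \<otimes> v) = K0_class R (v \<otimes> star R v)"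
proof -
  interpret V: comm_monoid vmonoid by (rule vmonoid_comm_monoid)
  have "mvn_equiv R (1, mat1 (star R v \<otimes> v)) (1, mat1 (v \<otimes> star R v))"
    using assms by (auto simp: mvn_equiv_def intro!: bexI[of _ "mat1 v"])
  then have "vclass (1, mat1 (star R v \<otimes> v)) = vclass (1, mat1 (v \<otimes> star R v))"
    using assms by (subst vclass_eq_iff) auto
  then show ?thesis using assms
    by (auto simp: K0_class_eq K0_pair_eq_iff K0_rel_iff intro!: bexI[OF _ V.one_closed])
qed

lemma K0_class_zero: "K0_class R \<zero> = \<one>\<^bsub>K0 R\<^esub>"
proof -
  interpret V: comm_monoid vmonoid by (rule vmonoid_comm_monoid)
  have 0: "selfadj_idem \<zero>" by (simp add: selfadj_idem_def)
  have "mvn_equiv R (1, mat1 \<zero>) (zero_proj R)"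
    by (auto simp: mvn_equiv_def zero_proj_def mats_def mats_mult_def mats_star_def fun_eq_iff mat1_def
        lessThan_Suc intro!: exI[of _ "\<lambda>i j. \<zero>"])
  then have "vclass (1, mat1 \<zero>) = vclass (zero_proj R)"
    using 0 by (subst vclass_eq_iff) auto
  moreover have "\<one>\<^bsub>K0 R\<^esub> = K0_pair (zero_proj R) (zero_proj R)" by (simp add: K0_def)
  ultimately show ?thesis using 0
    by (auto simp: K0_class_eq K0_pair_eq_iff K0_rel_iff intro!: bexI[OF _ V.one_closed])
qed

text \<open>The column \<open>v\<close> with entries \<open>e\<close> and \<open>f\<close> has
  \<open>v* v = e + f\<close>, while \<open>v v*\<close> is the diagonal matrix of \<open>e\<close>
  and \<open>f\<close> because the off-diagonal products vanish.\<close>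

lemma K0_class_add:
  assumes e: "selfadj_idem e" and f: "selfadj_idem f" and ef: "e \<otimes> f = \<zero>"
  shows "selfadj_idem (e \<oplus> f)" "K0_class R (e \<oplus> f) = K0_class R e \<otimes>\<^bsub>K0 R\<^esub> K0_class R f"
proof -
  interpret V: comm_monoid vmonoid by (rule vmonoid_comm_monoid)
  have c [simp]: "e \<in> carrier R" "f \<in> carrier R" using e f by (auto simp: selfadj_idem_def)
  \<comment> \<open>The adjoint of \<open>e f = 0\<close>: orthogonality of self-adjoint elements is
    symmetric.\<close>
  have fe: "f \<otimes> e = \<zero>" using star_mult[OF c] ef e f by (simp add: selfadj_idem_def)
  show sum: "selfadj_idem (e \<oplus> f)"
    using e f ef fe by (auto simp: selfadj_idem_def star_add l_distr r_distr)
  define v where "v = (\<lambda>i j :: nat. if j = 0 then if i = (0 :: nat) then e else if i = 1 then f else \<zero> else \<zero>)"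
  have v: "v \<in> mats R 2 1" by (rule matsI) (auto simp: v_def)
  have 2: "{..<2 :: nat} = {0, 1}" by auto
  have "mats_mult R 2 (mats_star R v) v = mat1 (e \<oplus> f)"
    using e f by (auto simp: mats_mult_def mats_star_def v_def fun_eq_iff mat1_def 2 selfadj_idem_def)
  moreover have "mats_mult R 1 v (mats_star R v) = block 1 1 (mat1 e) (mat1 f)"
    using e f ef fe by (auto simp: mats_mult_def mats_star_def v_def fun_eq_iff mat1_def lessThan_Suc selfadj_idem_def block_def)
  ultimately have "mvn_equiv R (1, mat1 (e \<oplus> f)) (dsum R (1, mat1 e) (1, mat1 f))"
    using v by (auto simp: mvn_equiv_def dsum_eq numeral_2_eq_2)
  then have "vclass (1, mat1 (e \<oplus> f)) = vclass (dsum R (1, mat1 e) (1, mat1 f))"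
    using e f sum by (subst vclass_eq_iff) auto
  then show "K0_class R (e \<oplus> f) = K0_class R e \<otimes>\<^bsub>K0 R\<^esub> K0_class R f"
    using e f sum
    by (auto simp: K0_class_eq K0_mult_pair K0_pair_eq_iff K0_rel_iff dsum_zero_right intro!: bexI[OF _ V.one_closed])
qed

lemma K0_class_finsum:
  assumes "finite S" "\<And>s. s \<in> S \<Longrightarrow> selfadj_idem (e s)"
    "\<And>s t. s \<in> S \<Longrightarrow> t \<in> S \<Longrightarrow> s \<noteq> t \<Longrightarrow> e s \<otimes> e t = \<zero>"
  shows "selfadj_idem (finsum R e S) \<and> K0_class R (finsum R e S) = finprod (K0 R) (\<lambda>s. K0_class R (e s)) S"
  using assms
proof (induction S)
  case empty
  interpret K: comm_group "K0 R" by (rule K0_comm_group)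
  show ?case by (simp add: K0_class_zero selfadj_idem_def)
next
  case (insert x S)
  interpret K: comm_group "K0 R" by (rule K0_comm_group)
  have c: "e s \<in> carrier R" if "s \<in> insert x S" for s using insert.prems(1)[OF that] by (simp add: selfadj_idem_def)
  have "e x \<otimes> finsum R e S = finsum R (\<lambda>s. e x \<otimes> e s) S"
    using insert c by (intro finsum_rdistr) auto
  also have "\<dots> = \<zero>" using insert by (intro add.finprod_one_eqI) auto
  finally have "e x \<otimes> finsum R e S = \<zero>" .
  then show ?case
    using K0_class_add[of "e x" "finsum R e S"] insert c by (auto simp: Pi_def)
qed

end

section \<open>Traces and the maps they induce on \<open>K0\<close>\<close>

locale tracial_star_algebra = star_algebra +
  fixes \<tau> :: "'a \<Rightarrow> complex"
  assumes trace_add: "\<lbrakk>a \<in> carrier R; b \<in> carrier R\<rbrakk> \<Longrightarrow> \<tau> (a \<oplus> b) = \<tau> a + \<tau> b"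
    and trace_comm: "\<lbrakk>a \<in> carrier R; b \<in> carrier R\<rbrakk> \<Longrightarrow> \<tau> (a \<otimes> b) = \<tau> (b \<otimes> a)"
begin

lemma trace_zero [simp]: "\<tau> \<zero> = 0"
  using trace_add[of \<zero> \<zero>] by simp

lemma trace_finsum:
  "finite I \<Longrightarrow> (\<And>i. i \<in> I \<Longrightarrow> f i \<in> carrier R) \<Longrightarrow> \<tau> (finsum R f I) = (\<Sum>i\<in>I. \<tau> (f i))"
proof (induction I rule: finite_induct)
  case (insert x I)
  then have "finsum R f I \<in> carrier R" by (intro finsum_closed) auto
  then show ?case using insert by (simp add: trace_add Pi_def)
qed simp

definition mtrace :: "nat \<Rightarrow> (nat \<Rightarrow> nat \<Rightarrow> 'a) \<Rightarrow> complex" where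
  "mtrace n p = (\<Sum>i<n. \<tau> (p i i))"

lemma mtrace_comm:
  assumes p: "p \<in> mats R n m" and q: "q \<in> mats R m n"
  shows "mtrace n (mats_mult R m p q) = mtrace m (mats_mult R n q p)"
proof -
  note c [simp] = p[THEN mats_carrier] q[THEN mats_carrier]
  have "mtrace n (mats_mult R m p q) = (\<Sum>i<n. \<Sum>k<m. \<tau> (p i k \<otimes> q k i))"
    by (simp add: mtrace_def mats_mult_def trace_finsum)
  also have "\<dots> = (\<Sum>k<m. \<Sum>i<n. \<tau> (q k i \<otimes> p i k))"
    by (subst sum.swap) (simp add: trace_comm)
  also have "\<dots> = mtrace m (mats_mult R n q p)"
    by (simp add: mtrace_def mats_mult_def trace_finsum)
  finally show ?thesis .
qed

lemma mtrace_mvn: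
  assumes "mvn_equiv R (n, p) (m, q)"
  shows "mtrace n p = mtrace m q"
  using assms by (auto simp: mvn_equiv_def dest: mtrace_comm[OF mats_star_closed])

lemma mtrace_dsum: "mtrace (n + m) (block n n p q) = mtrace n p + mtrace m q"
proof -
  have "mtrace (n + m) (block n n p q) = (\<Sum>i<n. \<tau> (block n n p q i i)) + (\<Sum>i\<in>{n..<n + m}. \<tau> (block n n p q i i))"
    using sum.atLeastLessThan_concat[of 0 n "n + m" "\<lambda>i. \<tau> (block n n p q i i)"]
    by (simp add: mtrace_def atLeast0LessThan)
  also have "(\<Sum>i\<in>{n..<n + m}. \<tau> (block n n p q i i)) = (\<Sum>i\<in>{0..<m}. \<tau> (block n n p q (i + n) (i + n)))"
    using sum.shift_bounds_nat_ivl[of "\<lambda>i. \<tau> (block n n p q i i)" 0 n m] by (simp add: add.commute)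
  finally show ?thesis by (simp add: mtrace_def block_def atLeast0LessThan)
qed

text \<open>Traces are additive and take values in a group, so the common summand of the relation
  cancels.\<close>

lemma mtrace_K0_rel:
  assumes "(((n, p), (m, q)), ((n', p'), (m', q'))) \<in> K0_rel R"
  shows "mtrace n p - mtrace m q = mtrace n' p' - mtrace m' q'"
proof -
  obtain l r where "mvn_equiv R (dsum R (dsum R (n, p) (m', q')) (l, r)) (dsum R (dsum R (n', p') (m, q)) (l, r))"
    using assms by (auto simp: K0_rel_def)
  from mtrace_mvn[OF this[unfolded dsum_eq]] show ?thesis
    by (simp add: mtrace_dsum) (simp add: algebra_simps)
qed

text \<open>\<open>K0_trace\<close> takes \<open>the_elem\<close> of an image; since all
  representatives have the same difference of traces, that image is a singleton and any member of
  the class may be used.\<close>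

lemma K0_trace_eqI:
  assumes z: "z \<in> carrier (K0 R)" and mem: "((n, p), (m, q)) \<in> z"
  shows "K0_trace \<tau> z = mtrace n p - mtrace m q"
proof -
  obtain p0 q0 where z: "p0 \<in> projections R" "q0 \<in> projections R" "z = K0_pair p0 q0"
    using z by (rule K0_carrierE)
  obtain n0 a m0 b where pq: "p0 = (n0, a)" "q0 = (m0, b)" by (cases p0; cases q0)
  have t: "mtrace n0 a - mtrace m0 b = mtrace n' p' - mtrace m' q'" if "((n', p'), (m', q')) \<in> z" for n' p' m' q'
    using mtrace_K0_rel[of n0 a m0 b n' p' m' q'] that z(3) by (simp add: pq)
  have tz: "(\<lambda>((n, p), (m, q)). (\<Sum>i<n. \<tau> (p i i)) - (\<Sum>i<m. \<tau> (q i i))) x = mtrace n p - mtrace m q"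
    if "x \<in> z" for x
  proof -
    obtain n' p' m' q' where x: "x = ((n', p'), (m', q'))" by (metis surj_pair)
    show ?thesis using t[of n' p' m' q'] t[OF mem] that unfolding x mtrace_def by simp
  qed
  have "(\<lambda>((n, p), (m, q)). (\<Sum>i<n. \<tau> (p i i)) - (\<Sum>i<m. \<tau> (q i i))) ` z = {mtrace n p - mtrace m q}"
  proof (intro equalityI image_subsetI subsetI)
    fix x assume "x \<in> z"
    from tz[OF this] show "(\<lambda>((n, p), (m, q)). (\<Sum>i<n. \<tau> (p i i)) - (\<Sum>i<m. \<tau> (q i i))) x \<in> {mtrace n p - mtrace m q}"
      by blast
  next
    fix y assume "y \<in> {mtrace n p - mtrace m q}"
    then show "y \<in> (\<lambda>((n, p), (m, q)). (\<Sum>i<n. \<tau> (p i i)) - (\<Sum>i<m. \<tau> (q i i))) ` z"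
      by (intro rev_image_eqI[OF mem]) (simp add: mtrace_def)
  qed
  then show ?thesis by (simp add: K0_trace_def)
qed

lemma K0_trace_pair:
  "(n, p) \<in> projections R \<Longrightarrow> (m, q) \<in> projections R \<Longrightarrow>
    K0_trace \<tau> (K0_pair (n, p) (m, q)) = mtrace n p - mtrace m q"
  by (rule K0_trace_eqI[OF K0_pair_carrier K0_pair_self])

lemma K0_trace_mult:
  assumes "z \<in> carrier (K0 R)" "w \<in> carrier (K0 R)"
  shows "K0_trace \<tau> (z \<otimes>\<^bsub>K0 R\<^esub> w) = K0_trace \<tau> z + K0_trace \<tau> w"
proof -
  obtain n p m q where z: "(n, p) \<in> projections R" "(m, q) \<in> projections R" "z = K0_pair (n, p) (m, q)"
    using assms(1) by (metis K0_carrierE surj_pair)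
  obtain n' p' m' q' where w: "(n', p') \<in> projections R" "(m', q') \<in> projections R" "w = K0_pair (n', p') (m', q')"
    using assms(2) by (metis K0_carrierE surj_pair)
  have "dsum R (n, p) (n', p') \<in> projections R" "dsum R (m, q) (m', q') \<in> projections R" using z w by auto
  then show ?thesis using z w
    by (simp add: K0_mult_pair K0_trace_pair dsum_eq mtrace_dsum)
qed

lemma K0_trace_class: "selfadj_idem e \<Longrightarrow> K0_trace \<tau> (K0_class R e) = \<tau> e"
  using K0_trace_pair[OF mat1_projection(1), of e 0 "\<lambda>i j. \<zero>"] zero_proj_projections
  by (simp add: K0_class_eq zero_proj_def mtrace_def) (simp add: mat1_def)

end

text \<open>\<open>nle a c\<close> plays the role of a bound \<open>c\<close> on the norm of \<open>a\<close>.\<close>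

locale normed_tracial_star_algebra = tracial_star_algebra +
  fixes nle :: "'a \<Rightarrow> real \<Rightarrow> bool"
  assumes nle_add: "\<lbrakk>a \<in> carrier R; b \<in> carrier R; nle a x; nle b y\<rbrakk> \<Longrightarrow> nle (a \<oplus> b) (x + y)"
    and nle_mult: "\<lbrakk>a \<in> carrier R; b \<in> carrier R; nle a x; nle b y\<rbrakk> \<Longrightarrow> nle (a \<otimes> b) (x * y)"
    and nle_uminus: "\<lbrakk>a \<in> carrier R; nle a x\<rbrakk> \<Longrightarrow> nle (\<ominus> a) x"
    and nle_zero: "nle \<zero> 0"
    and nle_trace: "\<lbrakk>a \<in> carrier R; nle a x\<rbrakk> \<Longrightarrow> cmod (\<tau> a) \<le> x"
    and nle_bounded: "a \<in> carrier R \<Longrightarrow> \<exists>x. nle a x"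
    and nle_mono: "\<lbrakk>nle a x; x \<le> y\<rbrakk> \<Longrightarrow> nle a y"
begin

section \<open>Traces of projections that are close in norm\<close>

lemma nle_finsum:
  assumes "finite I" "\<And>i. i \<in> I \<Longrightarrow> f i \<in> carrier R" "\<And>i. i \<in> I \<Longrightarrow> nle (f i) x"
  shows "nle (finsum R f I) (real (card I) * x)"
  using assms
proof (induction I)
  case (insert y I)
  then have "finsum R f I \<in> carrier R" by (intro finsum_closed) auto
  then have "nle (f y \<oplus> finsum R f I) (x + real (card I) * x)" using insert by (intro nle_add) auto
  then show ?case using insert by (simp add: Pi_def algebra_simps)
qed (simp add: nle_zero)

lemma nle_mats_mult:
  assumes p: "p \<in> mats R m n" "\<And>i j. nle (p i j) x" and q: "q \<in> mats R n l" "\<And>i j. nle (q i j) y"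
  shows "nle (mats_mult R n p q i j) (real n * (x * y))"
  using nle_finsum[of "{..<n}" "\<lambda>k. p i k \<otimes> q k j" "x * y"] assms
  by (simp add: mats_mult_def nle_mult mats_carrier)

lemma mats_bounded:
  assumes p: "p \<in> mats R m n"
  shows "\<exists>x\<ge>0. \<forall>i j. nle (p i j) x"
proof -
  have "\<forall>i j. \<exists>x. nle (p i j) x" using p by (simp add: mats_carrier nle_bounded)
  then obtain f where f: "\<And>i j. nle (p i j) (f i j)" by metis
  define x where "x = (\<Sum>i<m. \<Sum>j<n. \<bar>f i j\<bar>)"
  have x0: "x \<ge> 0" by (simp add: x_def sum_nonneg)
  have "nle (p i j) x" for i j
  proof (cases "i < m \<and> j < n")
    case True
    have "f i j \<le> \<bar>f i j\<bar>" by simp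
    also have "\<dots> \<le> (\<Sum>j<n. \<bar>f i j\<bar>)"
      using True by (intro member_le_sum[where f = "\<lambda>j. \<bar>f i j\<bar>"]) auto
    also have "\<dots> \<le> x" unfolding x_def
      using True by (intro member_le_sum[where f = "\<lambda>i. (\<Sum>j<n. \<bar>f i j\<bar>)"]) (auto intro: sum_nonneg)
    finally show ?thesis using f nle_mono by blast
  next
    case False
    then show ?thesis using mats_outside[OF p False] nle_mono[OF nle_zero x0] by simp
  qed
  then show ?thesis using x0 by blast
qed

definition madd :: "(nat \<Rightarrow> nat \<Rightarrow> 'a) \<Rightarrow> (nat \<Rightarrow> nat \<Rightarrow> 'a) \<Rightarrow> nat \<Rightarrow> nat \<Rightarrow> 'a" where
  "madd p q = (\<lambda>i j. p i j \<oplus> q i j)"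

definition msub :: "(nat \<Rightarrow> nat \<Rightarrow> 'a) \<Rightarrow> (nat \<Rightarrow> nat \<Rightarrow> 'a) \<Rightarrow> nat \<Rightarrow> nat \<Rightarrow> 'a" where
  "msub p q = (\<lambda>i j. p i j \<ominus> q i j)"

lemma msub_mats: "p \<in> mats R m n \<Longrightarrow> q \<in> mats R m n \<Longrightarrow> msub p q \<in> mats R m n"
  by (rule matsI) (auto simp: msub_def mats_carrier mats_outside minus_eq)

lemma madd_msub: "p \<in> mats R m n \<Longrightarrow> q \<in> mats R m n \<Longrightarrow> madd (msub p q) q = p"
  by (auto simp: fun_eq_iff madd_def msub_def mats_carrier minus_eq a_assoc l_neg)

lemma madd_left_cancel:
  "p \<in> mats R m n \<Longrightarrow> q \<in> mats R m n \<Longrightarrow> r \<in> mats R m n \<Longrightarrow> madd p r = madd q r \<Longrightarrow> p = q"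
  by (auto simp: fun_eq_iff madd_def mats_carrier)

lemma mats_mult_madd_right:
  "p \<in> mats R m n \<Longrightarrow> q \<in> mats R n l \<Longrightarrow> r \<in> mats R n l \<Longrightarrow>
    mats_mult R n p (madd q r) = madd (mats_mult R n p q) (mats_mult R n p r)"
  by (simp add: fun_eq_iff mats_mult_def madd_def mats_carrier r_distr finsum_addf Pi_def)

lemma mats_mult_madd_left:
  "p \<in> mats R m n \<Longrightarrow> q \<in> mats R m n \<Longrightarrow> r \<in> mats R n l \<Longrightarrow>
    mats_mult R n (madd p q) r = madd (mats_mult R n p r) (mats_mult R n q r)"
  by (simp add: fun_eq_iff mats_mult_def madd_def mats_carrier l_distr finsum_addf Pi_def)

lemma mtrace_madd:
  "p \<in> mats R n n \<Longrightarrow> q \<in> mats R n n \<Longrightarrow> mtrace n (madd p q) = mtrace n p + mtrace n q"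
  by (simp add: mtrace_def madd_def trace_add mats_carrier sum.distrib)

text \<open>This is \<open>(p - p q p) ^ k\<close> in the corner of \<open>p\<close>, whose unit is
  \<open>p\<close>. Writing the factor as \<open>p (p - q)\<close> shows that it is small when
  \<open>q\<close> is close to \<open>p\<close>; the two forms act alike on matrices
  \<open>B\<close> with \<open>p B = B\<close>.\<close>

primrec corner_pow ::
    "nat \<Rightarrow> (nat \<Rightarrow> nat \<Rightarrow> 'a) \<Rightarrow> (nat \<Rightarrow> nat \<Rightarrow> 'a) \<Rightarrow> nat \<Rightarrow> nat \<Rightarrow> nat \<Rightarrow> 'a" where
  "corner_pow n p q 0 = p"
| "corner_pow n p q (Suc k) = mats_mult R n (mats_mult R n p (msub p q)) (corner_pow n p q k)"

context
  fixes n p q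
  assumes p: "(n, p) \<in> projections R" and q: "(n, q) \<in> projections R"
begin

abbreviation mm (infixl "\<odot>" 70) where "mm \<equiv> mats_mult R n"

lemma pm [simp]: "p \<in> mats R n n" and qm [simp]: "q \<in> mats R n n" and pp: "p \<odot> p = p" and qq: "q \<odot> q = q"
  using projectionsD[OF p] projectionsD[OF q] by auto

lemma corner_pow_mats [simp]: "corner_pow n p q k \<in> mats R n n"
  by (induction k) (auto intro!: mats_mult_closed msub_mats)

lemma corner_pow_left: "p \<odot> corner_pow n p q k = corner_pow n p q k"
proof (cases k)
  case (Suc k')
  have "p \<odot> (p \<odot> msub p q) = p \<odot> msub p q"
    using mats_mult_assoc[OF pm pm msub_mats[OF pm qm]] by (simp add: pp)
  then show ?thesis
    using mats_mult_assoc[OF pm mats_mult_closed[OF pm msub_mats[OF pm qm]] corner_pow_mats[of k']]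
    by (simp add: Suc)
qed (simp add: pp)

lemma corner_pow_right: "corner_pow n p q k \<odot> p = corner_pow n p q k"
proof (induction k)
  case (Suc k)
  then show ?case
    using mats_mult_assoc[OF mats_mult_closed[OF pm msub_mats[OF pm qm]] corner_pow_mats[of k] pm] by simp
qed (simp add: pp)

text \<open>The powers are fixed by \<open>p\<close> from the left, so passing to the next one
  removes exactly \<open>p q\<close> times the current one. The sum form lets additivity of the
  trace apply directly.\<close>

lemma corner_pow_step: "madd (corner_pow n p q (Suc k)) (p \<odot> (q \<odot> corner_pow n p q k)) = corner_pow n p q k"
proof -
  let ?A = "corner_pow n p q k"
  have "?A = p \<odot> (p \<odot> ?A)" by (simp add: corner_pow_left)
  also have "p \<odot> ?A = madd (msub p q) q \<odot> ?A" by (simp add: madd_msub[OF pm qm])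
  also have "\<dots> = madd (msub p q \<odot> ?A) (q \<odot> ?A)"
    by (rule mats_mult_madd_left[OF msub_mats[OF pm qm] qm corner_pow_mats])
  also have "p \<odot> \<dots> = madd (p \<odot> (msub p q \<odot> ?A)) (p \<odot> (q \<odot> ?A))"
    by (rule mats_mult_madd_right[OF pm mats_mult_closed[OF msub_mats[OF pm qm] corner_pow_mats]
          mats_mult_closed[OF qm corner_pow_mats]])
  also have "p \<odot> (msub p q \<odot> ?A) = corner_pow n p q (Suc k)"
    using mats_mult_assoc[OF pm msub_mats[OF pm qm] corner_pow_mats[of k]] by simp
  finally show ?thesis by simp
qed

text \<open>Only entries are measured, so each matrix product costs a factor \<open>n\<close>; one
  step multiplies by \<open>p\<close> and by \<open>msub p q\<close>, which gives the ratio.\<close>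

lemma corner_pow_bound:
  assumes x: "0 \<le> x" "\<And>i j. nle (p i j) x" and y: "\<And>i j. nle (msub p q i j) y"
  shows "nle (corner_pow n p q k i j) ((real n * (real n * (x * y))) ^ k * x)"
proof (induction k arbitrary: i j)
  case (Suc k)
  have 1: "nle ((p \<odot> msub p q) i j) (real n * (x * y))" for i j
    by (rule nle_mats_mult[OF pm x(2) msub_mats[OF pm qm] y])
  show ?case
    using nle_mats_mult[OF mats_mult_closed[OF pm msub_mats[OF pm qm]] 1 corner_pow_mats Suc.IH, of i j]
    by (simp add: algebra_simps)
qed (simp add: x)

end

text \<open>The powers of \<open>p - p q p\<close> and \<open>q - q p q\<close> in their corners are intertwined by \<open>p q\<close>, so that \<open>p\<close> and \<open>q\<close> lose the same
  amount of trace in each step.\<close>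

lemma corner_pow_intertwine:
  assumes p: "(n, p) \<in> projections R" and q: "(n, q) \<in> projections R"
  shows "mats_mult R n (corner_pow n p q k) (mats_mult R n p q) = mats_mult R n (mats_mult R n p q) (corner_pow n q p k)"
proof (induction k)
  case 0
  note pm = pm[OF p q] and qm = qm[OF p q]
  show ?case
    using mats_mult_assoc[OF pm pm qm] mats_mult_assoc[OF pm qm qm] by (simp add: pp[OF p q] qq[OF p q])
next
  case (Suc k)
  note pm = pm[OF p q] and qm = qm[OF p q]
  let ?A = "corner_pow n p q" and ?B = "corner_pow n q p"
  let ?m = "mats_mult R n"
  note Am = corner_pow_mats[OF p q] and Bm = corner_pow_mats[OF q p]
  note mc = mats_mult_closed[of _ n n _ n]
  have ass: "?m (?m a b) c = ?m a (?m b c)" if "a \<in> mats R n n" "b \<in> mats R n n" "c \<in> mats R n n" for a b c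
    using mats_mult_assoc that by blast
  have B: "?m q (?B k) = ?B k" by (rule corner_pow_left[OF q p])
  have "madd (?m (?A (Suc k)) (?m p q)) (?m (?m p (?m q (?A k))) (?m p q)) = ?m (?A k) (?m p q)"
    using mats_mult_madd_left[OF Am[of "Suc k"] mc[OF pm mc[OF qm Am[of k]]] mc[OF pm qm]]
    by (simp only: corner_pow_step[OF p q])
  also have "\<dots> = ?m (?m p q) (?B k)" by (rule Suc.IH)
  also have "\<dots> = ?m (?m p q) (madd (?B (Suc k)) (?m q (?m p (?B k))))"
    by (simp only: corner_pow_step[OF q p])
  also have "\<dots> = madd (?m (?m p q) (?B (Suc k))) (?m (?m p q) (?m q (?m p (?B k))))"
    by (rule mats_mult_madd_right[OF mc[OF pm qm] Bm mc[OF qm mc[OF pm Bm]]])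
  \<comment> \<open>Inserting \<open>q\<close> in front of \<open>?B k\<close> makes
    \<open>p q (?B k)\<close> appear, to which the induction hypothesis applies.\<close>
  also have "?m (?m p q) (?m q (?m p (?B k))) = ?m p (?m (?m q q) (?m p (?m q (?B k))))"
    using pm qm Bm by (simp add: ass mc B)
  also have "\<dots> = ?m p (?m q (?m p (?m q (?B k))))" by (simp add: qq[OF p q])
  also have "\<dots> = ?m (?m p (?m q (?A k))) (?m p q)"
    using pm qm Bm Am Suc.IH by (simp add: ass mc)
  finally show ?case
    by (rule madd_left_cancel[rotated 3]) (use pm qm Am Bm in \<open>auto intro!: mc simp del: corner_pow.simps\<close>)
qed

lemma mtrace_corner_pow:
  assumes p: "(n, p) \<in> projections R" and q: "(n, q) \<in> projections R"
  shows "mtrace n (corner_pow n p q k) - mtrace n (corner_pow n q p k) = mtrace n p - mtrace n q"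
proof (induction k)
  case (Suc k)
  note pm = pm[OF p q] and qm = qm[OF p q]
  let ?A = "corner_pow n p q" and ?B = "corner_pow n q p"
  let ?m = "mats_mult R n"
  note Am = corner_pow_mats[OF p q] and Bm = corner_pow_mats[OF q p]
  note mc = mats_mult_closed[of _ n n _ n]
  have ass: "?m (?m a b) c = ?m a (?m b c)" if "a \<in> mats R n n" "b \<in> mats R n n" "c \<in> mats R n n" for a b c
    using mats_mult_assoc that by blast
  have tr: "mtrace n (?m a b) = mtrace n (?m b a)" if "a \<in> mats R n n" "b \<in> mats R n n" for a b
    using mtrace_comm that by blast
  have 1: "mtrace n (?A k) = mtrace n (?A (Suc k)) + mtrace n (?m p (?m q (?A k)))"
    using mtrace_madd[OF Am[of "Suc k"] mc[OF pm mc[OF qm Am[of k]]]] by (simp only: corner_pow_step[OF p q])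
  have 2: "mtrace n (?B k) = mtrace n (?B (Suc k)) + mtrace n (?m q (?m p (?B k)))"
    using mtrace_madd[OF Bm[of "Suc k"] mc[OF qm mc[OF pm Bm[of k]]]] by (simp only: corner_pow_step[OF q p])
  \<comment> \<open>The traces lost in one step on the two sides are compared. Cyclicity together
    with \<open>?A k = (?A k) p\<close> turns the first into the trace of \<open>(?A k) p q\<close>,
    which intertwining carries over to the other corner.\<close>
  have "mtrace n (?m p (?m q (?A k))) = mtrace n (?m q (?m (?A k) p))"
    using tr[OF pm mc[OF qm Am[of k]]] by (simp add: ass pm qm Am)
  also have "\<dots> = mtrace n (?m q (?A k))" by (simp only: corner_pow_right[OF p q])
  also have "\<dots> = mtrace n (?m (?m (?A k) p) q)" by (simp only: corner_pow_right[OF p q] tr[OF qm Am])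
  also have "\<dots> = mtrace n (?m (?m p q) (?B k))"
    using corner_pow_intertwine[OF p q, of k] by (simp add: ass pm qm Am)
  also have "\<dots> = mtrace n (?m p (?B k))"
    by (simp add: ass pm qm Bm corner_pow_left[OF q p])
  also have "\<dots> = mtrace n (?m p (?m (?B k) q))" by (simp only: corner_pow_right[OF q p])
  also have "\<dots> = mtrace n (?m q (?m p (?B k)))"
    using tr[OF mc[OF pm Bm] qm, of k] by (simp add: ass pm qm Bm)
  finally have "mtrace n (?m p (?m q (?A k))) = mtrace n (?m q (?m p (?B k)))" .
  then show ?case using 1 2 Suc.IH by (simp del: corner_pow.simps add: algebra_simps)
qed simp

lemma mtrace_projections_close:
  assumes p: "(n, p) \<in> projections R"
  shows "\<exists>e>0. \<forall>q. (n, q) \<in> projections R \<longrightarrow> (\<forall>i<n. \<forall>j<n. nle (q i j \<ominus> p i j) e) \<longrightarrow>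
    mtrace n q = mtrace n p"
proof -
  obtain B where B: "0 \<le> B" "\<And>i j. nle (p i j) B"
    using mats_bounded[OF projectionsD(1)[OF p]] by blast
  \<comment> \<open>A common bound for the entries of \<open>p\<close> and of every admissible
    \<open>q\<close>, since \<open>e\<close> is at most 1.\<close>
  define x where "x = B + 1"
  \<comment> \<open>Chosen so that the ratio in \<open>corner_pow_bound\<close> is at most
    1/2.\<close>
  define e where "e = min 1 (1 / (2 * (real n * (real n * x) + 1)))"
  have x: "0 \<le> x" "0 < x" "B \<le> x" using B by (auto simp: x_def)
  have nx: "0 \<le> real n * (real n * x)" using x by simp
  have e: "0 < e" "e \<le> 1" using nx by (auto simp: e_def intro!: divide_pos_pos)
  define r where "r = real n * (real n * (x * e))"
  have "r = (real n * (real n * x)) * e" by (simp add: r_def)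
  also have "\<dots> \<le> (real n * (real n * x)) * (1 / (2 * (real n * (real n * x) + 1)))"
    using nx by (intro mult_left_mono) (auto simp: e_def)
  also have "\<dots> \<le> 1 / 2" using nx by (simp add: divide_simps)
  finally have r: "0 \<le> r" "r \<le> 1 / 2" using x e by (auto simp: r_def)
  have "mtrace n q = mtrace n p" if q: "(n, q) \<in> projections R" and c: "\<forall>i<n. \<forall>j<n. nle (q i j \<ominus> p i j) e" for q
  proof -
    note pm = projectionsD(1)[OF p] and qm = projectionsD(1)[OF q]
    note cp [simp] = pm[THEN mats_carrier] qm[THEN mats_carrier]
    have qp: "nle (msub q p i j) e" for i j
    proof (cases "i < n \<and> j < n")
      case False
      then have "msub q p i j = \<zero>" using mats_outside[OF msub_mats[OF qm pm]] by blast
      then show ?thesis using nle_mono[OF nle_zero] e by simp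
    qed (use c in \<open>auto simp: msub_def\<close>)
    have pq: "nle (msub p q i j) e" for i j
    proof -
      have "msub p q i j = \<ominus> (msub q p i j)" by (simp add: msub_def minus_eq minus_add a_comm)
      then show ?thesis using nle_uminus[OF _ qp] mats_carrier[OF msub_mats[OF qm pm]] by simp
    qed
    have px: "nle (p i j) x" for i j using B(2) x(3) nle_mono by blast
    have qx: "nle (q i j) x" for i j
    proof -
      have "q i j = msub q p i j \<oplus> p i j"
        using madd_msub[OF qm pm] by (metis madd_def)
      then have "nle (q i j) (e + B)"
        using nle_add[OF mats_carrier[OF msub_mats[OF qm pm]] mats_carrier[OF pm] qp B(2)] by metis
      then show ?thesis by (rule nle_mono) (use e in \<open>simp add: x_def\<close>)
    qed
    have tr: "cmod (mtrace n (corner_pow n a b k)) \<le> real n * (r ^ k * x)"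
      if "(n, a) \<in> projections R" "(n, b) \<in> projections R" "\<And>i j. nle (a i j) x" "\<And>i j. nle (msub a b i j) e" for a b k
    proof -
      have "cmod (mtrace n (corner_pow n a b k)) \<le> (\<Sum>i<n. cmod (\<tau> (corner_pow n a b k i i)))"
        unfolding mtrace_def by (rule norm_sum)
      also have "\<dots> \<le> (\<Sum>i<n. r ^ k * x)"
        unfolding r_def using that x
        by (intro sum_mono nle_trace corner_pow_bound) (auto intro: mats_carrier[OF corner_pow_mats])
      finally show ?thesis by simp
    qed
    have bound: "cmod (mtrace n q - mtrace n p) \<le> 2 * (real n * ((1 / 2) ^ k * x))" for k
    proof -
      have "cmod (mtrace n q - mtrace n p) = cmod (mtrace n (corner_pow n q p k) - mtrace n (corner_pow n p q k))"
        by (simp only: mtrace_corner_pow[OF q p])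
      also have "\<dots> \<le> real n * (r ^ k * x) + real n * (r ^ k * x)"
        using tr[OF q p qx qp] tr[OF p q px pq] norm_triangle_ineq4 by (smt (verit))
      also have "\<dots> \<le> 2 * (real n * ((1 / 2) ^ k * x))"
      proof -
        have "r ^ k * x \<le> (1 / 2) ^ k * x" using power_mono[OF r(2) r(1), of k] x by (intro mult_right_mono) auto
        then have "real n * (r ^ k * x) \<le> real n * ((1 / 2) ^ k * x)" by (intro mult_left_mono) auto
        then show ?thesis by linarith
      qed
      finally show ?thesis .
    qed
    \<comment> \<open>The difference of the traces does not depend on \<open>k\<close>, while its
      bound tends to zero.\<close>
    have "(\<lambda>k. 2 * (real n * ((1 / 2) ^ k * x))) \<longlonglongrightarrow> 2 * (real n * (0 * x))"
      by (intro tendsto_intros LIMSEQ_power_zero) auto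
    then have "cmod (mtrace n q - mtrace n p) \<le> 2 * (real n * (0 * x))"
      by (rule LIMSEQ_le_const) (use bound in blast)
    then show ?thesis by simp
  qed
  then show ?thesis using e(1) by blast
qed

end

section \<open>Bounded kernels\<close>

lemma kernel_norm_leD:
  "kernel_norm_le f c \<Longrightarrow> finite F \<Longrightarrow>
    cmod (\<Sum>x\<in>F. \<Sum>y\<in>F. cnj (a x) * f x y * b y)
      \<le> c * L2_set (\<lambda>x. cmod (a x)) F * L2_set (\<lambda>y. cmod (b y)) F"
  unfolding kernel_norm_le_def by blast

lemma kernel_norm_le_entry:
  assumes "kernel_norm_le f c"
  shows "cmod (f x y) \<le> c"
proof -
  let ?a = "\<lambda>u. if u = x then 1 else 0 :: complex" and ?b = "\<lambda>u. if u = y then 1 else 0 :: complex"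
  have "(\<Sum>u\<in>{x, y}. \<Sum>v\<in>{x, y}. cnj (?a u) * f u v * ?b v) = f x y"
    by (cases "x = y") auto
  moreover have "L2_set (\<lambda>u. cmod (?a u)) {x, y} = 1" "L2_set (\<lambda>u. cmod (?b u)) {x, y} = 1"
    by (cases "x = y"; auto simp: L2_set_def)+
  ultimately show ?thesis using kernel_norm_leD[OF assms, of "{x, y}" ?a ?b] by simp
qed

lemma kernel_norm_le_nonneg: "kernel_norm_le f c \<Longrightarrow> 0 \<le> c"
  using kernel_norm_le_entry[of f c undefined undefined] norm_ge_zero order_trans by blast

lemma kernel_norm_le_mono:
  assumes "kernel_norm_le f c" "c \<le> d"
  shows "kernel_norm_le f d"
  unfolding kernel_norm_le_def
proof (intro allI impI)
  fix F :: "'a set" and a b :: "'a \<Rightarrow> complex"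
  assume "finite F"
  then have "cmod (\<Sum>x\<in>F. \<Sum>y\<in>F. cnj (a x) * f x y * b y)
      \<le> c * L2_set (\<lambda>x. cmod (a x)) F * L2_set (\<lambda>y. cmod (b y)) F"
    by (rule kernel_norm_leD[OF assms(1)])
  also have "\<dots> \<le> d * L2_set (\<lambda>x. cmod (a x)) F * L2_set (\<lambda>y. cmod (b y)) F"
    using assms(2) by (intro mult_right_mono) auto
  finally show "cmod (\<Sum>x\<in>F. \<Sum>y\<in>F. cnj (a x) * f x y * b y)
      \<le> d * L2_set (\<lambda>x. cmod (a x)) F * L2_set (\<lambda>y. cmod (b y)) F" .
qed

lemma kernel_norm_le_zero: "kernel_norm_le (\<lambda>x y. 0) 0"
  by (auto simp: kernel_norm_le_def)

lemma kernel_norm_le_add: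
  assumes "kernel_norm_le f c" "kernel_norm_le g d"
  shows "kernel_norm_le (\<lambda>x y. f x y + g x y) (c + d)"
  unfolding kernel_norm_le_def
proof (intro allI impI)
  fix F :: "'a set" and a b :: "'a \<Rightarrow> complex"
  assume F: "finite F"
  have "(\<Sum>x\<in>F. \<Sum>y\<in>F. cnj (a x) * (f x y + g x y) * b y) =
    (\<Sum>x\<in>F. \<Sum>y\<in>F. cnj (a x) * f x y * b y) + (\<Sum>x\<in>F. \<Sum>y\<in>F. cnj (a x) * g x y * b y)"
    by (simp add: sum.distrib algebra_simps)
  then have "cmod (\<Sum>x\<in>F. \<Sum>y\<in>F. cnj (a x) * (f x y + g x y) * b y) \<le>
    c * L2_set (\<lambda>x. cmod (a x)) F * L2_set (\<lambda>y. cmod (b y)) F +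
    d * L2_set (\<lambda>x. cmod (a x)) F * L2_set (\<lambda>y. cmod (b y)) F"
    using norm_triangle_le[OF add_mono[OF kernel_norm_leD[OF assms(1) F] kernel_norm_leD[OF assms(2) F]]] by simp
  then show "cmod (\<Sum>x\<in>F. \<Sum>y\<in>F. cnj (a x) * (f x y + g x y) * b y) \<le>
    (c + d) * L2_set (\<lambda>x. cmod (a x)) F * L2_set (\<lambda>y. cmod (b y)) F"
    by (simp add: algebra_simps)
qed

lemma kernel_norm_le_uminus:
  assumes "kernel_norm_le f c"
  shows "kernel_norm_le (\<lambda>x y. - f x y) c"
  using assms unfolding kernel_norm_le_def by (simp add: sum_negf)

lemma kernel_norm_le_diff:
  "kernel_norm_le f c \<Longrightarrow> kernel_norm_le g d \<Longrightarrow> kernel_norm_le (\<lambda>x y. f x y - g x y) (c + d)"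
  using kernel_norm_le_add[OF _ kernel_norm_le_uminus[of g d], of f c] by simp

lemma kernel_norm_le_diff_commute:
  "kernel_norm_le (\<lambda>x y. f x y - g x y) c \<Longrightarrow> kernel_norm_le (\<lambda>x y. g x y - f x y) c"
  using kernel_norm_le_uminus[of "\<lambda>x y. f x y - g x y" c] by simp

lemma kernel_norm_le_star:
  assumes "kernel_norm_le f c"
  shows "kernel_norm_le (\<lambda>x y. cnj (f y x)) c"
  unfolding kernel_norm_le_def
proof (intro allI impI)
  fix F :: "'a set" and a b :: "'a \<Rightarrow> complex"
  assume F: "finite F"
  have "(\<Sum>x\<in>F. \<Sum>y\<in>F. cnj (a x) * cnj (f y x) * b y) = cnj (\<Sum>y\<in>F. \<Sum>x\<in>F. cnj (b y) * f y x * a x)"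
    by (subst sum.swap) (simp add: algebra_simps)
  then show "cmod (\<Sum>x\<in>F. \<Sum>y\<in>F. cnj (a x) * cnj (f y x) * b y) \<le>
    c * L2_set (\<lambda>x. cmod (a x)) F * L2_set (\<lambda>y. cmod (b y)) F"
    using kernel_norm_leD[OF assms F, of b a] by (simp only: complex_mod_cnj) (simp add: mult_ac)
qed

text \<open>Testing the form against the image vector itself bounds the square of its norm by
  \<open>c\<close> times its norm times that of \<open>b\<close>. The form uses one index set for
  both arguments, so both vectors are extended by zero to the union of \<open>F\<close> and
  \<open>G\<close>.\<close>

lemma kernel_norm_le_apply:
  assumes f: "kernel_norm_le f c" and F: "finite F" and G: "finite G"
  shows "L2_set (\<lambda>x. cmod (\<Sum>y\<in>G. f x y * b y)) F \<le> c * L2_set (\<lambda>y. cmod (b y)) G"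
proof -
  define v where "v x = (\<Sum>y\<in>G. f x y * b y)" for x
  define a' where "a' x = (if x \<in> F then v x else 0)" for x
  define b' where "b' x = (if x \<in> G then b x else 0)" for x
  let ?H = "F \<union> G"
  have H: "finite ?H" using F G by simp
  have 1: "L2_set (\<lambda>x. cmod (a' x)) ?H = L2_set (\<lambda>x. cmod (v x)) F"
    unfolding L2_set_def a'_def using F G by (intro arg_cong[where f = sqrt] sum.mono_neutral_cong_right) auto
  have 2: "L2_set (\<lambda>x. cmod (b' x)) ?H = L2_set (\<lambda>x. cmod (b x)) G"
    unfolding L2_set_def b'_def using F G by (intro arg_cong[where f = sqrt] sum.mono_neutral_cong_right) auto
  have "(\<Sum>x\<in>?H. \<Sum>y\<in>?H. cnj (a' x) * f x y * b' y) = (\<Sum>x\<in>?H. cnj (a' x) * (\<Sum>y\<in>?H. f x y * b' y))"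
    by (simp add: sum_distrib_left mult_ac)
  also have "\<dots> = (\<Sum>x\<in>?H. cnj (a' x) * v x)"
    unfolding v_def b'_def using F G
    by (intro sum.cong refl arg_cong2[where f = "(*)"] sum.mono_neutral_cong_right) auto
  also have "\<dots> = (\<Sum>x\<in>F. cnj (v x) * v x)"
    unfolding a'_def using F G by (intro sum.mono_neutral_cong_right) auto
  also have "\<dots> = of_real (\<Sum>x\<in>F. (cmod (v x))\<^sup>2)"
    by (simp add: complex_norm_square mult.commute del: of_real_power)
  finally have "cmod (\<Sum>x\<in>?H. \<Sum>y\<in>?H. cnj (a' x) * f x y * b' y) = (\<Sum>x\<in>F. (cmod (v x))\<^sup>2)"
    by (simp only: norm_of_real) (simp add: sum_nonneg)
  also have "\<dots> = (L2_set (\<lambda>x. cmod (v x)) F)\<^sup>2" by (simp add: L2_set_def sum_nonneg)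
  finally have "(L2_set (\<lambda>x. cmod (v x)) F)\<^sup>2 \<le> c * L2_set (\<lambda>x. cmod (v x)) F * L2_set (\<lambda>x. cmod (b x)) G"
    using kernel_norm_leD[OF f H, of a' b'] 1 2 by simp
  then have "L2_set (\<lambda>x. cmod (v x)) F * L2_set (\<lambda>x. cmod (v x)) F \<le> L2_set (\<lambda>x. cmod (v x)) F * (c * L2_set (\<lambda>x. cmod (b x)) G)"
    by (simp add: power2_eq_square mult_ac)
  then show ?thesis
    using kernel_norm_le_nonneg[OF f] L2_set_nonneg[of "\<lambda>x. cmod (v x)" F]
    by (cases "L2_set (\<lambda>x. cmod (v x)) F = 0") (auto simp: v_def[symmetric] mult_le_cancel_left)
qed

lemma kernel_norm_le_apply_left:
  assumes f: "kernel_norm_le f c" and F: "finite F" and G: "finite G"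
  shows "L2_set (\<lambda>z. cmod (\<Sum>x\<in>G. cnj (a x) * f x z)) F \<le> c * L2_set (\<lambda>x. cmod (a x)) G"
proof -
  have "cmod (\<Sum>x\<in>G. cnj (f x z) * a x) = cmod (\<Sum>x\<in>G. cnj (a x) * f x z)" for z
    using complex_mod_cnj[of "\<Sum>x\<in>G. cnj (a x) * f x z"] by (simp add: mult_ac)
  then show ?thesis using kernel_norm_le_apply[OF kernel_norm_le_star[OF f] F G, of a] by simp
qed

lemma kernel_norm_le_column:
  "kernel_norm_le f c \<Longrightarrow> finite F \<Longrightarrow> L2_set (\<lambda>x. cmod (f x y)) F \<le> c"
  using kernel_norm_le_apply[of f c F "{y}" "\<lambda>_. 1"] by (simp add: L2_set_def)

lemma kernel_norm_le_row:
  "kernel_norm_le f c \<Longrightarrow> finite F \<Longrightarrow> L2_set (\<lambda>y. cmod (f x y)) F \<le> c"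
  using kernel_norm_le_apply_left[of f c F "{x}" "\<lambda>_. 1"] by (simp add: L2_set_def)

text \<open>Cauchy-Schwarz over the support of \<open>f\<close>: each index occurs there at most
  \<open>B\<close> times as a row and at most \<open>B\<close> times as a column, so both factors
  are at most \<open>sqrt B\<close> times the norms of the vectors.\<close>

lemma kernel_norm_le_Schur:
  fixes f :: "'x kernel"
  assumes e: "\<And>x y. cmod (f x y) \<le> e" "0 \<le> e"
    and rows: "\<And>x. finite {y. f x y \<noteq> 0}" "\<And>x. card {y. f x y \<noteq> 0} \<le> B"
    and cols: "\<And>y. finite {x. f x y \<noteq> 0}" "\<And>y. card {x. f x y \<noteq> 0} \<le> B"
  shows "kernel_norm_le f (e * real B)"
  unfolding kernel_norm_le_def
proof (intro allI impI)
  fix F :: "'x set" and a b :: "'x \<Rightarrow> complex"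
  assume F: "finite F"
  define S where "S = {(x, y). x \<in> F \<and> y \<in> F \<and> f x y \<noteq> 0}"
  have S: "finite S" unfolding S_def by (rule finite_subset[OF _ finite_cartesian_product[OF F F]]) auto
  have "L2_set (\<lambda>p. cmod (a (fst p))) S \<le> sqrt (real B) * L2_set (\<lambda>x. cmod (a x)) F" (is ?A)
    and "L2_set (\<lambda>p. cmod (b (snd p))) S \<le> sqrt (real B) * L2_set (\<lambda>x. cmod (b x)) F" (is ?B)
  proof -
    have S1: "S = (SIGMA x:F. {y\<in>F. f x y \<noteq> 0})" by (auto simp: S_def)
    have "(\<Sum>p\<in>S. (cmod (a (fst p)))\<^sup>2) = (\<Sum>x\<in>F. \<Sum>y\<in>{y\<in>F. f x y \<noteq> 0}. (cmod (a x))\<^sup>2)"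
      unfolding S1 using F by (subst sum.Sigma) (auto simp: case_prod_unfold)
    also have "\<dots> = (\<Sum>x\<in>F. real (card {y\<in>F. f x y \<noteq> 0}) * (cmod (a x))\<^sup>2)" by simp
    also have "\<dots> \<le> (\<Sum>x\<in>F. real B * (cmod (a x))\<^sup>2)"
      using card_mono[OF rows(1)] rows(2)
      by (intro sum_mono mult_right_mono of_nat_mono order_trans[OF card_mono[OF rows(1)] rows(2)]) auto
    finally show ?A by (simp add: L2_set_def sum_distrib_left[symmetric] real_sqrt_mult[symmetric])
    have S2: "S = (\<lambda>(y, x). (x, y)) ` (SIGMA y:F. {x\<in>F. f x y \<noteq> 0})" by (auto simp: S_def image_iff)
    have "(\<Sum>p\<in>S. (cmod (b (snd p)))\<^sup>2) = (\<Sum>y\<in>F. \<Sum>x\<in>{x\<in>F. f x y \<noteq> 0}. (cmod (b y))\<^sup>2)"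
      unfolding S2 using F by (subst sum.reindex; (subst sum.Sigma)?) (auto simp: inj_on_def case_prod_unfold)
    also have "\<dots> = (\<Sum>y\<in>F. real (card {x\<in>F. f x y \<noteq> 0}) * (cmod (b y))\<^sup>2)" by simp
    also have "\<dots> \<le> (\<Sum>y\<in>F. real B * (cmod (b y))\<^sup>2)"
      by (intro sum_mono mult_right_mono of_nat_mono order_trans[OF card_mono[OF cols(1)] cols(2)]) auto
    finally show ?B by (simp add: L2_set_def sum_distrib_left[symmetric] real_sqrt_mult[symmetric])
  qed
  note AB = this
  have "(\<Sum>x\<in>F. \<Sum>y\<in>F. cnj (a x) * f x y * b y) = (\<Sum>p\<in>F \<times> F. cnj (a (fst p)) * f (fst p) (snd p) * b (snd p))"
    by (simp add: sum.cartesian_product case_prod_unfold)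
  also have "\<dots> = (\<Sum>p\<in>S. cnj (a (fst p)) * f (fst p) (snd p) * b (snd p))"
    using F by (intro sum.mono_neutral_right) (auto simp: S_def)
  finally have "cmod (\<Sum>x\<in>F. \<Sum>y\<in>F. cnj (a x) * f x y * b y) \<le>
      (\<Sum>p\<in>S. cmod (cnj (a (fst p)) * f (fst p) (snd p) * b (snd p)))"
    by (simp only: norm_sum)
  also have "\<dots> \<le> (\<Sum>p\<in>S. e * (\<bar>cmod (a (fst p))\<bar> * \<bar>cmod (b (snd p))\<bar>))"
  proof (intro sum_mono)
    fix p
    have "cmod (a (fst p)) * cmod (f (fst p) (snd p)) * cmod (b (snd p)) \<le> cmod (a (fst p)) * e * cmod (b (snd p))"
      using e by (intro mult_right_mono mult_left_mono) auto
    then show "cmod (cnj (a (fst p)) * f (fst p) (snd p) * b (snd p)) \<le> e * (\<bar>cmod (a (fst p))\<bar> * \<bar>cmod (b (snd p))\<bar>)"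
      by (simp add: norm_mult mult_ac)
  qed
  also have "\<dots> = e * (\<Sum>p\<in>S. \<bar>cmod (a (fst p))\<bar> * \<bar>cmod (b (snd p))\<bar>)" by (simp add: sum_distrib_left)
  also have "\<dots> \<le> e * (L2_set (\<lambda>p. cmod (a (fst p))) S * L2_set (\<lambda>p. cmod (b (snd p))) S)"
    using e by (intro mult_left_mono L2_set_mult_ineq) auto
  also have "\<dots> \<le> e * ((sqrt (real B) * L2_set (\<lambda>x. cmod (a x)) F) * (sqrt (real B) * L2_set (\<lambda>x. cmod (b x)) F))"
    using e AB by (intro mult_left_mono mult_mono) auto
  also have "\<dots> = e * real B * L2_set (\<lambda>x. cmod (a x)) F * L2_set (\<lambda>x. cmod (b x)) F"
    using real_sqrt_mult_self[of "real B"] by (simp add: mult_ac del: real_sqrt_mult_self)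
  finally show "cmod (\<Sum>x\<in>F. \<Sum>y\<in>F. cnj (a x) * f x y * b y) \<le>
      e * real B * L2_set (\<lambda>x. cmod (a x)) F * L2_set (\<lambda>x. cmod (b x)) F" .
qed

section \<open>Products of bounded kernels\<close>

definition kmult :: "'x kernel \<Rightarrow> 'x kernel \<Rightarrow> 'x kernel" where
  "kmult f g = (\<lambda>x y. infsum (\<lambda>z. f x z * g z y) UNIV)"

definition kbounded :: "'x kernel \<Rightarrow> bool" where
  "kbounded f \<longleftrightarrow> (\<exists>c. kernel_norm_le f c)"

text \<open>Rows and columns of bounded kernels are square summable. For a family that is not
  summable \<open>infsum\<close> falls back to 0 and the laws of a product may fail, which is why
  boundedness is carried along.\<close>

lemma kmult_summable:
  assumes "kbounded f" "kbounded g"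
  shows "(\<lambda>z. f x z * g z y) summable_on UNIV"
proof -
  obtain c d where f: "kernel_norm_le f c" and g: "kernel_norm_le g d" using assms by (auto simp: kbounded_def)
  have "(\<Sum>z\<in>F. norm (f x z * g z y)) \<le> c * d" if "finite F" for F
  proof -
    have "(\<Sum>z\<in>F. norm (f x z * g z y)) = (\<Sum>z\<in>F. \<bar>cmod (f x z)\<bar> * \<bar>cmod (g z y)\<bar>)" by (simp add: norm_mult)
    also have "\<dots> \<le> L2_set (\<lambda>z. cmod (f x z)) F * L2_set (\<lambda>z. cmod (g z y)) F" by (rule L2_set_mult_ineq)
    also have "\<dots> \<le> c * d"
      using that kernel_norm_le_nonneg[OF f] by (intro mult_mono kernel_norm_le_row[OF f] kernel_norm_le_column[OF g]) auto
    finally show ?thesis .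
  qed
  then have "(\<lambda>z. norm (f x z * g z y)) summable_on UNIV"
    by (intro nonneg_bdd_above_summable_on) (auto intro!: bdd_aboveI2[where M = "c * d"])
  then show ?thesis by (rule abs_summable_summable)
qed

lemma has_sum_finite_sum:
  fixes f :: "'i \<Rightarrow> 'b \<Rightarrow> 'c :: {topological_comm_monoid_add}"
  assumes "finite I" "\<And>i. i \<in> I \<Longrightarrow> (f i has_sum s i) A"
  shows "((\<lambda>z. \<Sum>i\<in>I. f i z) has_sum (\<Sum>i\<in>I. s i)) A"
  using assms by (induction I) (auto intro!: has_sum_add)

text \<open>The form of the product is a limit of sums over finite sets of intermediate indices
  \<open>z\<close>, each of which pairs two vectors controlled by
  \<open>kernel_norm_le_apply\<close> and its left version.\<close>

lemma kernel_norm_le_mult: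
  assumes f: "kernel_norm_le f c" and g: "kernel_norm_le g d"
  shows "kernel_norm_le (kmult f g) (c * d)"
  unfolding kernel_norm_le_def
proof (intro allI impI)
  fix F :: "'a set" and a b :: "'a \<Rightarrow> complex"
  assume F: "finite F"
  define u where "u z = (\<Sum>x\<in>F. cnj (a x) * f x z)" for z
  define v where "v z = (\<Sum>y\<in>F. g z y * b y)" for z
  have "((\<lambda>z. f x z * g z y) has_sum kmult f g x y) UNIV" for x y
    unfolding kmult_def using kmult_summable[of f g x y] f g
    by (intro has_sum_infsum) (auto simp: kbounded_def)
  then have "((\<lambda>z. cnj (a x) * (f x z * g z y) * b y) has_sum (cnj (a x) * kmult f g x y * b y)) UNIV" for x y
    by (intro has_sum_cmult_left has_sum_cmult_right)
  then have "((\<lambda>z. \<Sum>x\<in>F. \<Sum>y\<in>F. cnj (a x) * (f x z * g z y) * b y) has_sum (\<Sum>x\<in>F. \<Sum>y\<in>F. cnj (a x) * kmult f g x y * b y)) UNIV"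
    using F by (intro has_sum_finite_sum)
  moreover have "(\<Sum>x\<in>F. \<Sum>y\<in>F. cnj (a x) * (f x z * g z y) * b y) = u z * v z" for z
    unfolding u_def v_def sum_product by (intro sum.cong refl) (simp add: mult_ac)
  ultimately have hs: "((\<lambda>z. u z * v z) has_sum (\<Sum>x\<in>F. \<Sum>y\<in>F. cnj (a x) * kmult f g x y * b y)) UNIV" by simp
  have fin: "norm (\<Sum>z\<in>G. u z * v z) \<le> c * d * L2_set (\<lambda>x. cmod (a x)) F * L2_set (\<lambda>y. cmod (b y)) F"
    if G: "finite G" for G
  proof -
    have "norm (\<Sum>z\<in>G. u z * v z) \<le> (\<Sum>z\<in>G. \<bar>cmod (u z)\<bar> * \<bar>cmod (v z)\<bar>)"
      by (rule order_trans[OF norm_sum]) (simp add: norm_mult)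
    also have "\<dots> \<le> L2_set (\<lambda>z. cmod (u z)) G * L2_set (\<lambda>z. cmod (v z)) G" by (rule L2_set_mult_ineq)
    also have "\<dots> \<le> (c * L2_set (\<lambda>x. cmod (a x)) F) * (d * L2_set (\<lambda>x. cmod (b x)) F)"
      unfolding u_def v_def using kernel_norm_le_nonneg[OF f]
      by (intro mult_mono kernel_norm_le_apply_left[OF f G F] kernel_norm_le_apply[OF g G F]) auto
    finally show ?thesis by (simp add: mult_ac)
  qed
  show "cmod (\<Sum>x\<in>F. \<Sum>y\<in>F. cnj (a x) * kmult f g x y * b y) \<le> c * d * L2_set (\<lambda>x. cmod (a x)) F * L2_set (\<lambda>y. cmod (b y)) F"
  proof (rule Lim_norm_ubound)
    show "((\<lambda>G. \<Sum>z\<in>G. u z * v z) \<longlongrightarrow> (\<Sum>x\<in>F. \<Sum>y\<in>F. cnj (a x) * kmult f g x y * b y)) (finite_subsets_at_top UNIV)"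
      using hs by (simp add: has_sum_def)
    show "\<forall>\<^sub>F G in finite_subsets_at_top UNIV. norm (\<Sum>z\<in>G. u z * v z) \<le> c * d * L2_set (\<lambda>x. cmod (a x)) F * L2_set (\<lambda>y. cmod (b y)) F"
      using fin by (intro eventually_finite_subsets_at_top_weakI) auto
  qed simp
qed

lemma kbounded_add: "kbounded f \<Longrightarrow> kbounded g \<Longrightarrow> kbounded (\<lambda>x y. f x y + g x y)"
  unfolding kbounded_def using kernel_norm_le_add by blast

lemma kbounded_diff: "kbounded f \<Longrightarrow> kbounded g \<Longrightarrow> kbounded (\<lambda>x y. f x y - g x y)"
  unfolding kbounded_def using kernel_norm_le_diff by blast

lemma kmult_add_left:
  assumes "kbounded f" "kbounded f'" "kbounded g"
  shows "kmult (\<lambda>x y. f x y + f' x y) g = (\<lambda>x y. kmult f g x y + kmult f' g x y)"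
  unfolding kmult_def using assms
  by (intro ext) (simp add: distrib_right infsum_add kmult_summable)

lemma kmult_add_right:
  assumes "kbounded f" "kbounded g" "kbounded g'"
  shows "kmult f (\<lambda>x y. g x y + g' x y) = (\<lambda>x y. kmult f g x y + kmult f g' x y)"
  unfolding kmult_def using assms
  by (intro ext) (simp add: distrib_left infsum_add kmult_summable)

lemma kmult_diff_left:
  assumes "kbounded f" "kbounded f'" "kbounded g"
  shows "kmult (\<lambda>x y. f x y - f' x y) g = (\<lambda>x y. kmult f g x y - kmult f' g x y)"
  using kmult_add_left[of "\<lambda>x y. f x y - f' x y" f' g] assms
  by (simp add: kbounded_diff fun_eq_iff)

lemma kmult_diff_right:
  assumes "kbounded f" "kbounded g" "kbounded g'"
  shows "kmult f (\<lambda>x y. g x y - g' x y) = (\<lambda>x y. kmult f g x y - kmult f g' x y)"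
  using kmult_add_right[of f "\<lambda>x y. g x y - g' x y" g'] assms
  by (simp add: kbounded_diff fun_eq_iff)

lemma kmult_star: "(\<lambda>x y. cnj (kmult f g y x)) = kmult (\<lambda>x y. cnj (g y x)) (\<lambda>x y. cnj (f y x))"
  unfolding kmult_def by (simp add: fun_eq_iff infsum_cnj[symmetric] mult.commute del: infsum_cnj)

lemma kmult_diff_bound:
  assumes "kernel_norm_le (\<lambda>x y. f x y - f' x y) e" "kernel_norm_le g c"
    "kernel_norm_le f' d" "kernel_norm_le (\<lambda>x y. g x y - g' x y) e'"
  shows "kernel_norm_le (\<lambda>x y. kmult f g x y - kmult f' g' x y) (e * c + d * e')"
proof -
  have b: "kbounded f'" "kbounded g" "kbounded (\<lambda>x y. f x y - f' x y)" "kbounded (\<lambda>x y. g x y - g' x y)"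
    using assms by (auto simp: kbounded_def)
  have b': "kbounded f" "kbounded g'"
    using kbounded_add[OF b(3) b(1)] kbounded_diff[OF b(2) b(4)] by simp_all
  have "(\<lambda>x y. kmult f g x y - kmult f' g' x y) =
    (\<lambda>x y. kmult (\<lambda>x y. f x y - f' x y) g x y + kmult f' (\<lambda>x y. g x y - g' x y) x y)"
    using b b' by (simp add: kmult_diff_left kmult_diff_right)
  then show ?thesis
    using kernel_norm_le_add[OF kernel_norm_le_mult[OF assms(1,2)] kernel_norm_le_mult[OF assms(3,4)]] by simp
qed

subsection \<open>Norm closures of algebras of kernels with finite rows and columns\<close>

definition kclosure :: "'x kernel set \<Rightarrow> 'x kernel set" where
  "kclosure S = {f. \<forall>e>0. \<exists>g\<in>S. kernel_norm_le (\<lambda>x y. f x y - g x y) e}"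

lemma kclosure_superset: "S \<subseteq> kclosure S"
proof
  fix f :: "'a kernel" assume f: "f \<in> S"
  have "kernel_norm_le (\<lambda>x y. f x y - f x y) e" if "e > 0" for e
    unfolding diff_self by (rule kernel_norm_le_mono[OF kernel_norm_le_zero less_imp_le[OF that]])
  then show "f \<in> kclosure S" using f unfolding kclosure_def by (intro CollectI allI impI bexI[of _ f])
qed

lemma kclosure_minimal:
  assumes "S \<subseteq> kclosure T"
  shows "kclosure S \<subseteq> kclosure T"
proof
  fix f assume f: "f \<in> kclosure S"
  show "f \<in> kclosure T" unfolding kclosure_def
  proof (intro CollectI allI impI)
    fix e :: real assume "e > 0"
    then have e: "e / 2 > 0" by simp
    have "\<exists>g\<in>S. kernel_norm_le (\<lambda>x y. f x y - g x y) (e / 2)" using f e unfolding kclosure_def by blast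
    then obtain g where g: "g \<in> S" "kernel_norm_le (\<lambda>x y. f x y - g x y) (e / 2)" by blast
    have "\<exists>h\<in>T. kernel_norm_le (\<lambda>x y. g x y - h x y) (e / 2)" using assms g(1) e unfolding kclosure_def by blast
    then obtain h where h: "h \<in> T" "kernel_norm_le (\<lambda>x y. g x y - h x y) (e / 2)" by blast
    show "\<exists>g\<in>T. kernel_norm_le (\<lambda>x y. f x y - g x y) e"
      using kernel_norm_le_add[OF g(2) h(2)] h(1) by auto
  qed
qed

text \<open>Finite rows, and through the adjoint also finite columns, make associativity on
  \<open>S\<close> an exchange of finite sums; the closure inherits it by approximation, which
  avoids rearranging infinite double sums.\<close>

locale kernel_algebra =
  fixes S :: "'x kernel set"
  assumes S_add: "f \<in> S \<Longrightarrow> g \<in> S \<Longrightarrow> (\<lambda>x y. f x y + g x y) \<in> S"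
    and S_uminus: "f \<in> S \<Longrightarrow> (\<lambda>x y. - f x y) \<in> S"
    and S_zero: "(\<lambda>x y. 0) \<in> S"
    and S_mult: "f \<in> S \<Longrightarrow> g \<in> S \<Longrightarrow> kmult f g \<in> S"
    and S_star: "f \<in> S \<Longrightarrow> (\<lambda>x y. cnj (f y x)) \<in> S"
    and S_bounded: "f \<in> S \<Longrightarrow> kbounded f"
    and S_rows: "f \<in> S \<Longrightarrow> finite {y. f x y \<noteq> 0}"
begin

lemma closureE:
  assumes "f \<in> kclosure S" "e > 0"
  obtains g where "g \<in> S" "kernel_norm_le (\<lambda>x y. f x y - g x y) e"
  using assms unfolding kclosure_def by blast

lemma closure_bounded: "f \<in> kclosure S \<Longrightarrow> kbounded f"
proof -
  assume "f \<in> kclosure S"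
  then obtain g where g: "g \<in> S" "kernel_norm_le (\<lambda>x y. f x y - g x y) 1" using closureE[of f 1] by auto
  then have "kbounded (\<lambda>x y. (f x y - g x y) + g x y)"
    using S_bounded[OF g(1)] g(2) by (intro kbounded_add) (auto simp: kbounded_def)
  then show ?thesis by simp
qed

lemma S_cols: "f \<in> S \<Longrightarrow> finite {x. f x y \<noteq> 0}"
  using S_rows[OF S_star, of f y] by simp

lemma closure_zero: "(\<lambda>x y. 0) \<in> kclosure S"
  using S_zero kclosure_superset by blast

lemma closure_add:
  assumes "f \<in> kclosure S" "g \<in> kclosure S"
  shows "(\<lambda>x y. f x y + g x y) \<in> kclosure S"
  unfolding kclosure_def
proof (intro CollectI allI impI)
  fix e :: real assume "e > 0"
  then have "e / 2 > 0" by simp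
  obtain f' g' where "f' \<in> S" "kernel_norm_le (\<lambda>x y. f x y - f' x y) (e / 2)"
    "g' \<in> S" "kernel_norm_le (\<lambda>x y. g x y - g' x y) (e / 2)"
    by (rule closureE[OF assms(1) \<open>e / 2 > 0\<close>], rule closureE[OF assms(2) \<open>e / 2 > 0\<close>]) (rule that)
  then show "\<exists>h\<in>S. kernel_norm_le (\<lambda>x y. f x y + g x y - h x y) e"
    using kernel_norm_le_add[of "\<lambda>x y. f x y - f' x y" "e / 2" "\<lambda>x y. g x y - g' x y" "e / 2"]
    by (intro bexI[OF _ S_add[of f' g']]) (auto simp: algebra_simps)
qed

lemma closure_uminus:
  assumes "f \<in> kclosure S"
  shows "(\<lambda>x y. - f x y) \<in> kclosure S"
  unfolding kclosure_def
proof (intro CollectI allI impI)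
  fix e :: real assume "e > 0"
  obtain f' where "f' \<in> S" "kernel_norm_le (\<lambda>x y. f x y - f' x y) e"
    by (rule closureE[OF assms(1) \<open>e > 0\<close>]) (rule that)
  then show "\<exists>h\<in>S. kernel_norm_le (\<lambda>x y. - f x y - h x y) e"
    using kernel_norm_le_uminus[of "\<lambda>x y. f x y - f' x y" e]
    by (intro bexI[OF _ S_uminus[of f']]) (auto simp: algebra_simps)
qed

lemma closure_star:
  assumes "f \<in> kclosure S"
  shows "(\<lambda>x y. cnj (f y x)) \<in> kclosure S"
  unfolding kclosure_def
proof (intro CollectI allI impI)
  fix e :: real assume "e > 0"
  obtain f' where "f' \<in> S" "kernel_norm_le (\<lambda>x y. f x y - f' x y) e"
    by (rule closureE[OF assms(1) \<open>e > 0\<close>]) (rule that)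
  then show "\<exists>h\<in>S. kernel_norm_le (\<lambda>x y. cnj (f y x) - h x y) e"
    using kernel_norm_le_star[of "\<lambda>x y. f x y - f' x y" e]
    by (intro bexI[OF _ S_star[of f']]) auto
qed

text \<open>Joint continuity of multiplication at \<open>(f, g)\<close>, stated so that the
  accuracies for nested products can be chosen from the outside inwards.\<close>

lemma closure_mult_approx:
  assumes "f \<in> kclosure S" "g \<in> kclosure S" "e > 0"
  obtains d where "d > 0" "\<And>f' g'. kernel_norm_le (\<lambda>x y. f x y - f' x y) d \<Longrightarrow>
    kernel_norm_le (\<lambda>x y. g x y - g' x y) d \<Longrightarrow>
    kernel_norm_le (\<lambda>x y. kmult f g x y - kmult f' g' x y) e"
proof -
  obtain c c' where c: "kernel_norm_le f c" "kernel_norm_le g c'"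
    using closure_bounded[OF assms(1)] closure_bounded[OF assms(2)] by (auto simp: kbounded_def)
  note c0 = kernel_norm_le_nonneg[OF c(1)] kernel_norm_le_nonneg[OF c(2)]
  \<comment> \<open>The error is at most \<open>d * c' + (c + d) * d\<close>; with \<open>d\<close>
    at most 1 this is bounded by \<open>d * (c + c' + 1)\<close>.\<close>
  define d where "d = min 1 (e / (c + c' + 1))"
  have d: "0 < d" "d \<le> 1" "d * (c + c' + 1) \<le> e"
  proof -
    have "d \<le> e / (c + c' + 1)" by (simp add: d_def)
    then show "d * (c + c' + 1) \<le> e" using c0 by (simp add: pos_le_divide_eq)
    show "0 < d" using c0 assms(3) by (auto simp: d_def intro!: divide_pos_pos)
  qed (simp add: d_def)
  show ?thesis
  proof (rule that[OF d(1)])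
    fix f' g' :: "'x kernel"
    assume a: "kernel_norm_le (\<lambda>x y. f x y - f' x y) d" "kernel_norm_le (\<lambda>x y. g x y - g' x y) d"
    have "kernel_norm_le f' (c + d)" using kernel_norm_le_diff[OF c(1) a(1)] by simp
    from kmult_diff_bound[OF a(1) c(2) this a(2)]
    have "kernel_norm_le (\<lambda>x y. kmult f g x y - kmult f' g' x y) (d * c' + (c + d) * d)" .
    moreover have "d * d \<le> d * 1" using d by (intro mult_left_mono) auto
    then have "d * (c + c') + d * d \<le> e" using d(3) unfolding distrib_left by linarith
    then have "d * c' + (c + d) * d \<le> e" by (simp add: algebra_simps)
    ultimately show "kernel_norm_le (\<lambda>x y. kmult f g x y - kmult f' g' x y) e" by (rule kernel_norm_le_mono)
  qed
qed

lemma closure_mult: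
  assumes "f \<in> kclosure S" "g \<in> kclosure S"
  shows "kmult f g \<in> kclosure S"
  unfolding kclosure_def
proof (intro CollectI allI impI)
  fix e :: real assume "e > 0"
  obtain d where d: "d > 0" "\<And>f' g'. kernel_norm_le (\<lambda>x y. f x y - f' x y) d \<Longrightarrow>
    kernel_norm_le (\<lambda>x y. g x y - g' x y) d \<Longrightarrow>
    kernel_norm_le (\<lambda>x y. kmult f g x y - kmult f' g' x y) e"
    by (rule closure_mult_approx[OF assms \<open>e > 0\<close>]) (rule that)
  obtain f' g' where "f' \<in> S" "kernel_norm_le (\<lambda>x y. f x y - f' x y) d"
    "g' \<in> S" "kernel_norm_le (\<lambda>x y. g x y - g' x y) d"
    by (rule closureE[OF assms(1) d(1)], rule closureE[OF assms(2) d(1)]) (rule that)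
  then show "\<exists>h\<in>S. kernel_norm_le (\<lambda>x y. kmult f g x y - h x y) e"
    by (intro bexI[OF _ S_mult] d(2))
qed

lemma kmult_assoc_finite:
  assumes f: "finite {y. f x y \<noteq> 0}" and h: "finite {z. h z y \<noteq> 0}" and b: "kbounded f" "kbounded g" "kbounded h"
  shows "kmult (kmult f g) h x y = kmult f (kmult g h) x y"
proof -
  define W where "W = {w. f x w \<noteq> 0}"
  define Z where "Z = {z. h z y \<noteq> 0}"
  have 1: "kmult f k x z = (\<Sum>w\<in>W. f x w * k w z)" for k z
    unfolding kmult_def using f by (subst infsum_cong_neutral[where T = W and g = "\<lambda>w. f x w * k w z"]) (auto simp: W_def)
  have 2: "kmult k h w y = (\<Sum>z\<in>Z. k w z * h z y)" for k w
    unfolding kmult_def using h by (subst infsum_cong_neutral[where T = Z and g = "\<lambda>z. k w z * h z y"]) (auto simp: Z_def)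
  show ?thesis
    unfolding 1 2 by (simp add: sum_distrib_left sum_distrib_right mult_ac) (rule sum.swap)
qed

lemma closure_mult_assoc:
  assumes f: "f \<in> kclosure S" and g: "g \<in> kclosure S" and h: "h \<in> kclosure S"
  shows "kmult (kmult f g) h = kmult f (kmult g h)"
proof (intro ext)
  fix x y
  note fg = closure_mult[OF f g] and gh = closure_mult[OF g h]
  have "cmod (kmult (kmult f g) h x y - kmult f (kmult g h) x y) \<le> 0 + e" if "e > 0" for e
  proof -
    have e: "e / 2 > 0" using that by simp
    obtain d1 where d1: "d1 > 0" "\<And>f' g'. kernel_norm_le (\<lambda>x y. kmult f g x y - f' x y) d1 \<Longrightarrow>
      kernel_norm_le (\<lambda>x y. h x y - g' x y) d1 \<Longrightarrow>
      kernel_norm_le (\<lambda>x y. kmult (kmult f g) h x y - kmult f' g' x y) (e / 2)"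
      by (rule closure_mult_approx[OF fg h e]) (rule that)
    obtain d2 where d2: "d2 > 0" "\<And>f' g'. kernel_norm_le (\<lambda>x y. f x y - f' x y) d2 \<Longrightarrow>
      kernel_norm_le (\<lambda>x y. g x y - g' x y) d2 \<Longrightarrow>
      kernel_norm_le (\<lambda>x y. kmult f g x y - kmult f' g' x y) d1"
      by (rule closure_mult_approx[OF f g d1(1)]) (rule that)
    obtain d3 where d3: "d3 > 0" "\<And>f' g'. kernel_norm_le (\<lambda>x y. f x y - f' x y) d3 \<Longrightarrow>
      kernel_norm_le (\<lambda>x y. kmult g h x y - g' x y) d3 \<Longrightarrow>
      kernel_norm_le (\<lambda>x y. kmult f (kmult g h) x y - kmult f' g' x y) (e / 2)"
      by (rule closure_mult_approx[OF f gh e]) (rule that)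
    obtain d4 where d4: "d4 > 0" "\<And>f' g'. kernel_norm_le (\<lambda>x y. g x y - f' x y) d4 \<Longrightarrow>
      kernel_norm_le (\<lambda>x y. h x y - g' x y) d4 \<Longrightarrow>
      kernel_norm_le (\<lambda>x y. kmult g h x y - kmult f' g' x y) d3"
      by (rule closure_mult_approx[OF g h d3(1)]) (rule that)
    \<comment> \<open>One accuracy for all three factors: \<open>d2\<close> and \<open>d4\<close>
      serve the inner products, \<open>d1\<close> and \<open>d3\<close> the outer ones.\<close>
    define d where "d = min (min d1 d2) (min d3 d4)"
    have d: "d > 0" "d \<le> d1" "d \<le> d2" "d \<le> d3" "d \<le> d4" using d1 d2 d3 d4 by (auto simp: d_def)
    obtain f' where f': "f' \<in> S" "kernel_norm_le (\<lambda>x y. f x y - f' x y) d" by (rule closureE[OF f d(1)]) (rule that)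
    obtain g' where g': "g' \<in> S" "kernel_norm_le (\<lambda>x y. g x y - g' x y) d" by (rule closureE[OF g d(1)]) (rule that)
    obtain h' where h': "h' \<in> S" "kernel_norm_le (\<lambda>x y. h x y - h' x y) d" by (rule closureE[OF h d(1)]) (rule that)
    note m = kernel_norm_le_mono[OF f'(2)] kernel_norm_le_mono[OF g'(2)] kernel_norm_le_mono[OF h'(2)]
    have "kernel_norm_le (\<lambda>x y. kmult (kmult f g) h x y - kmult (kmult f' g') h' x y) (e / 2)"
      by (rule d1(2)[OF d2(2)[OF m(1)[OF d(3)] m(2)[OF d(3)]] m(3)[OF d(2)]])
    moreover have "kernel_norm_le (\<lambda>x y. kmult f (kmult g h) x y - kmult f' (kmult g' h') x y) (e / 2)"
      by (rule d3(2)[OF m(1)[OF d(4)] d4(2)[OF m(2)[OF d(5)] m(3)[OF d(5)]]])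
    moreover have "kmult (kmult f' g') h' = kmult f' (kmult g' h')"
      using f' g' h' by (intro ext kmult_assoc_finite S_rows S_cols S_bounded)
    ultimately have "cmod (kmult (kmult f g) h x y - kmult f' (kmult g' h') x y) \<le> e / 2"
      "cmod (kmult f (kmult g h) x y - kmult f' (kmult g' h') x y) \<le> e / 2"
      by (auto dest: kernel_norm_le_entry)
    then show ?thesis
      using norm_triangle_ineq4[of "kmult (kmult f g) h x y - kmult f' (kmult g' h') x y"
        "kmult f (kmult g h) x y - kmult f' (kmult g' h') x y"] by simp
  qed
  then have "cmod (kmult (kmult f g) h x y - kmult f (kmult g h) x y) \<le> 0" by (rule field_le_epsilon)
  then show "kmult (kmult f g) h x y = kmult f (kmult g h) x y" by simp
qed

lemma closure_support:
  assumes "\<And>f. f \<in> S \<Longrightarrow> f x y = 0" "f \<in> kclosure S"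
  shows "f x y = 0"
proof -
  have "cmod (f x y) \<le> 0 + e" if e: "e > 0" for e
  proof -
    obtain g where g: "g \<in> S" "kernel_norm_le (\<lambda>x y. f x y - g x y) e" using closureE[OF assms(2) e] .
    then show ?thesis using kernel_norm_le_entry[OF g(2), of x y] assms(1)[OF g(1)] by simp
  qed
  then have "cmod (f x y) \<le> 0" by (rule field_le_epsilon)
  then show ?thesis by simp
qed

end

section \<open>The shift space\<close>

lemma finite_edges [simp]: "finite (edges A)" for A :: "nat^'k^'k"
proof -
  have "edges A \<subseteq> (\<Union>i. \<Union>j. (\<lambda>m. (i, j, m)) ` {..<A $ i $ j})" by (auto simp: edges_def)
  then show ?thesis by (rule finite_subset) auto
qed

lemma shift_spaceD:
  assumes "x \<in> shift_space A"
  shows "x n \<in> edges A" "tgt (x n) = src (x (n + 1))"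
  using assms by (auto simp: shift_space_def)

section \<open>Words, windows and splicing\<close>

definition window :: "int \<Rightarrow> nat \<Rightarrow> (int \<Rightarrow> 'e) \<Rightarrow> 'e list" where
  "window a n x = map (\<lambda>k. x (a + int k)) [0..<n]"

lemma length_window [simp]: "length (window a n x) = n"
  by (simp add: window_def)

lemma window_nth: "k < n \<Longrightarrow> window a n x ! k = x (a + int k)"
  by (simp add: window_def)

lemma window_0 [simp]: "window a 0 x = []"
  by (simp add: window_def)

lemma window_eq_iff: "window a n x = window a n y \<longleftrightarrow> (\<forall>k. a \<le> k \<and> k < a + int n \<longrightarrow> x k = y k)"
proof
  assume e: "window a n x = window a n y"
  show "\<forall>k. a \<le> k \<and> k < a + int n \<longrightarrow> x k = y k"
  proof (intro allI impI)
    fix k assume k: "a \<le> k \<and> k < a + int n"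
    then have l: "nat (k - a) < n" "a + int (nat (k - a)) = k" by auto
    have "window a n x ! nat (k - a) = window a n y ! nat (k - a)" by (simp add: e)
    then show "x k = y k" using window_nth[OF l(1), of a x] window_nth[OF l(1), of a y] l(2) by simp
  qed
qed (simp add: list_eq_iff_nth_eq window_nth)

lemma window_append: "window a (n + m) x = window a n x @ window (a + int n) m x"
  by (simp add: list_eq_iff_nth_eq window_nth nth_append)

lemma window_Suc: "window a (Suc n) x = x a # window (a + 1) n x"
  using window_append[of a 1 n x] by (simp add: window_def)

lemma window_Suc_right: "window a (Suc n) x = window a n x @ [x (a + int n)]"
  using window_append[of a n 1 x] by (simp add: window_def)

lemma edge_path_append:
  "edge_path A i j (u @ v) \<longleftrightarrow> (\<exists>k. edge_path A i k u \<and> edge_path A k j v)"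
  by (induction u arbitrary: i) auto

lemma edge_path_window:
  assumes "x \<in> shift_space A"
  shows "edge_path A (src (x a)) (src (x (a + int n))) (window a n x)"
proof (induction n arbitrary: a)
  case (Suc n)
  show ?case using Suc[of "a + 1"] shift_spaceD[OF assms, of a] by (simp add: window_Suc algebra_simps)
qed simp

lemma edge_path_edges: "edge_path A i j w \<Longrightarrow> set w \<subseteq> edges A"
  by (induction w arbitrary: i) auto

lemma edge_path_nth:
  "edge_path A i j w \<Longrightarrow> k < length w \<Longrightarrow> w ! k \<in> edges A"
  "edge_path A i j w \<Longrightarrow> w \<noteq> [] \<Longrightarrow> src (w ! 0) = i"
  "edge_path A i j w \<Longrightarrow> Suc k < length w \<Longrightarrow> tgt (w ! k) = src (w ! Suc k)"
  "edge_path A i j w \<Longrightarrow> w \<noteq> [] \<Longrightarrow> tgt (w ! (length w - 1)) = j"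
proof -
  show "edge_path A i j w \<Longrightarrow> k < length w \<Longrightarrow> w ! k \<in> edges A"
    using edge_path_edges nth_mem by blast
  show "edge_path A i j w \<Longrightarrow> w \<noteq> [] \<Longrightarrow> src (w ! 0) = i"
    by (cases w) auto
  show "edge_path A i j w \<Longrightarrow> w \<noteq> [] \<Longrightarrow> tgt (w ! (length w - 1)) = j"
    by (induction w arbitrary: i) (auto simp: nth_Cons' neq_Nil_conv)
  show "edge_path A i j w \<Longrightarrow> Suc k < length w \<Longrightarrow> tgt (w ! k) = src (w ! Suc k)"
  proof (induction w arbitrary: i k)
    case (Cons e w)
    then show ?case by (cases k; cases w) auto
  qed simp
qed

lemma finite_paths: "finite {w. edge_path A i j w \<and> length w = n}" for A :: "nat^'k^'k"
  by (rule finite_subset[OF _ finite_lists_length_eq[OF finite_edges[of A], of n]])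
    (auto dest: edge_path_edges)

definition patch :: "int \<Rightarrow> 'e list \<Rightarrow> (int \<Rightarrow> 'e) \<Rightarrow> int \<Rightarrow> 'e" where
  "patch a w x = (\<lambda>n. if a \<le> n \<and> n < a + int (length w) then w ! nat (n - a) else x n)"

lemma window_patch [simp]: "length w = n \<Longrightarrow> window a n (patch a w x) = w"
  by (auto simp: list_eq_iff_nth_eq window_nth patch_def)

lemma patch_outside: "\<not> (a \<le> n \<and> n < a + int (length w)) \<Longrightarrow> patch a w x n = x n"
  by (auto simp: patch_def)

lemma patch_shift_space:
  assumes x: "x \<in> shift_space A" and w: "edge_path A (src (x a)) (src (x (a + int (length w)))) w"
  shows "patch a w x \<in> shift_space A" "src (patch a w x a) = src (x a)"
    "src (patch a w x (a + int (length w))) = src (x (a + int (length w)))"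
proof -
  note e = edge_path_nth[OF w]
  have *: "patch a w x n \<in> edges A \<and> tgt (patch a w x n) = src (patch a w x (n + 1))" for n
  proof -
    have in1: "patch a w x m = w ! k" if "k < length w" "m = a + int k" for m k
      using that by (auto simp: patch_def)
    \<comment> \<open>The endpoint hypothesis enters only at the junctions, at \<open>a - 1\<close>
      and at the last letter of \<open>w\<close>; elsewhere both edges come from \<open>x\<close> or
      both from \<open>w\<close>.\<close>
    consider "n < a - 1" | "n = a - 1" | k where "Suc k < length w" "n = a + int k"
      | "w \<noteq> []" "n = a + int (length w) - 1" | "n \<ge> a + int (length w)" "n \<ge> a"
    proof -
      consider "n < a - 1" | "n = a - 1" | "n \<ge> a" "n \<ge> a + int (length w)"
        | "n \<ge> a" "n < a + int (length w)" by linarith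
      then show ?thesis
      proof cases
        case 4
        then have "w \<noteq> []" by auto
        show ?thesis
        proof (cases "n = a + int (length w) - 1")
          case False
          then show ?thesis using that(3)[of "nat (n - a)"] 4 by auto
        qed (use that \<open>w \<noteq> []\<close> in auto)
      qed (use that in auto)
    qed
    then show ?thesis
    proof cases
      case 2
      then show ?thesis
        using shift_spaceD[OF x, of n] e(2) by (cases w) (auto simp: patch_def)
    next
      case (3 k)
      then show ?thesis using in1[of k n] in1[of "Suc k" "n + 1"] e(1)[of k] e(3)[of k] by simp
    next
      case 4
      then have l: "length w - 1 < length w" "n = a + int (length w - 1)" by (simp_all add: of_nat_diff Suc_leI)
      have "patch a w x n = w ! (length w - 1)" by (rule in1[OF l])
      moreover have "patch a w x (n + 1) = x (a + int (length w))" using 4 by (simp add: patch_def)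
      ultimately show ?thesis using e(1)[OF l(1)] e(4)[OF 4(1)] by simp
    qed (use shift_spaceD[OF x, of n] in \<open>auto simp: patch_outside\<close>)
  qed
  then show "patch a w x \<in> shift_space A" by (auto simp: shift_space_def)
  show "src (patch a w x a) = src (x a)"
    using e(2) by (cases w) (auto simp: patch_def)
  show "src (patch a w x (a + int (length w))) = src (x (a + int (length w)))"
    by (simp add: patch_def)
qed

text \<open>Nondegeneracy gives every vertex an incoming and an outgoing edge, so \<open>w\<close>
  can be prolonged forever on both sides. For empty \<open>w\<close> the endpoints coincide and the
  two half-infinite paths meet at that vertex.\<close>

lemma shift_space_extend:
  fixes A :: "nat^'k^'k"
  assumes A: "nondegenerate A" and w: "edge_path A i j w"
  obtains x where "x \<in> shift_space A" "window a (length w) x = w" "src (x a) = i" "src (x (a + int (length w))) = j"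
proof -
  have "\<exists>e\<in>edges A. src e = i" for i
  proof -
    obtain j where "A $ i $ j \<noteq> 0" using A unfolding nondegenerate_def by blast
    then have "(i, j, 0) \<in> edges A" "src (i, j, 0 :: nat) = i" by (auto simp: edges_def src_def)
    then show ?thesis by blast
  qed
  then obtain nxt where nxt: "\<And>i. nxt i \<in> edges A" "\<And>i. src (nxt i) = i" by metis
  have "\<exists>e\<in>edges A. tgt e = j" for j
  proof -
    obtain i where "A $ i $ j \<noteq> 0" using A unfolding nondegenerate_def by blast
    then have "(i, j, 0) \<in> edges A" "tgt (i, j, 0 :: nat) = j" by (auto simp: edges_def tgt_def)
    then show ?thesis by blast
  qed
  then obtain prv where prv: "\<And>i. prv i \<in> edges A" "\<And>i. tgt (prv i) = i" by metis
  define r where "r = rec_nat (nxt j) (\<lambda>_ e. nxt (tgt e))"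
  define l where "l = rec_nat (prv i) (\<lambda>_ e. prv (src e))"
  have r: "r 0 = nxt j" "r (Suc n) = nxt (tgt (r n))" for n by (auto simp: r_def)
  have l: "l 0 = prv i" "l (Suc n) = prv (src (l n))" for n by (auto simp: l_def)
  have re: "r n \<in> edges A" for n by (cases n) (auto simp: r nxt)
  have le: "l n \<in> edges A" for n by (cases n) (auto simp: l prv)
  define x where "x n = (if n < a then l (nat (a - 1 - n)) else if n < a + int (length w) then w ! nat (n - a)
     else r (nat (n - a - int (length w))))" for n
  note e = edge_path_nth[OF w]
  have in1: "x m = w ! k" if "k < length w" "m = a + int k" for m k
    using that by (auto simp: x_def)
  have ij: "w = [] \<Longrightarrow> i = j" using w by simp
  have *: "x n \<in> edges A \<and> tgt (x n) = src (x (n + 1))" for n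
  proof -
    consider k where "n = a - 1 - int (Suc k)" | "n = a - 1" | k where "Suc k < length w" "n = a + int k"
      | "w \<noteq> []" "n = a + int (length w) - 1" | k where "n = a + int (length w) + int k"
    proof -
      consider "n < a - 1" | "n = a - 1" | "n \<ge> a" "n \<ge> a + int (length w)"
        | "n \<ge> a" "n < a + int (length w)" by linarith
      then show ?thesis
      proof cases
        case 1 then show ?thesis using that(1)[of "nat (a - n - 2)"] by auto
      next
        case 3 then show ?thesis using that(5)[of "nat (n - a - int (length w))"] by auto
      next
        case 4
        then have "w \<noteq> []" by auto
        show ?thesis
        proof (cases "n = a + int (length w) - 1")
          case False
          then show ?thesis using that(3)[of "nat (n - a)"] 4 by auto
        qed (use that \<open>w \<noteq> []\<close> in auto)
      qed (use that in auto)
    qed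
    then show ?thesis
    proof cases
      case (1 k)
      then have "x n = l (Suc k)" "x (n + 1) = l k" by (auto simp: x_def nat_add_distrib)
      then show ?thesis using le by (simp add: l prv)
    next
      case 2
      then have "x n = prv i" by (simp add: x_def l)
      moreover have "src (x (n + 1)) = i"
        using 2 e(2) ij by (cases w) (auto simp: x_def r nxt)
      ultimately show ?thesis by (simp add: prv)
    next
      case (3 k)
      then show ?thesis using in1[of k n] in1[of "Suc k" "n + 1"] e(1)[of k] e(3)[of k] by simp
    next
      case 4
      then have "x (n + 1) = nxt j" by (simp add: x_def r)
      have l: "length w - 1 < length w" "n = a + int (length w - 1)" using 4 by (simp_all add: of_nat_diff Suc_leI)
      have "x n = w ! (length w - 1)" by (rule in1[OF l])
      then show ?thesis using \<open>x (n + 1) = nxt j\<close> e(1)[OF l(1)] e(4)[OF 4(1)] by (simp add: nxt)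
    next
      case (5 k)
      then have "x n = r k" "x (n + 1) = r (Suc k)" by (auto simp: x_def nat_add_distrib)
      then show ?thesis using re by (simp add: r nxt)
    qed
  qed
  show ?thesis
  proof (rule that)
    show "x \<in> shift_space A" using * by (auto simp: shift_space_def)
    show "window a (length w) x = w" by (auto simp: list_eq_iff_nth_eq window_nth in1)
    show "src (x a) = i" using e(2) ij by (cases w) (auto simp: x_def r nxt)
    show "src (x (a + int (length w))) = j" by (simp add: x_def r nxt)
  qed
qed

definition cwin :: "nat \<Rightarrow> 'k biseq \<Rightarrow> 'k edge list" where
  "cwin N x = window (1 - int N) (2 * N) x"

lemma length_cwin [simp]: "length (cwin N x) = 2 * N"
  by (simp add: cwin_def)

lemma cwin_eq_iff: "cwin N x = cwin N y \<longleftrightarrow> (\<forall>n\<in>{1 - int N..int N}. x n = y n)"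
  unfolding cwin_def window_eq_iff by (auto simp: Ball_def)

lemma cwin_eq_mono: "N \<le> M \<Longrightarrow> cwin M x = cwin M y \<Longrightarrow> cwin N x = cwin N y"
  unfolding cwin_eq_iff by force

lemma cwin_Suc: "cwin (Suc N) x = x (- int N) # cwin N x @ [x (int N + 1)]"
proof -
  have "cwin (Suc N) x = window (- int N) (Suc (Suc (2 * N))) x" by (simp add: cwin_def)
  also have "\<dots> = x (- int N) # window (- int N + 1) (2 * N) x @ [x (- int N + 1 + int (2 * N))]"
    by (subst window_Suc, subst window_Suc_right) (rule refl)
  finally show ?thesis by (simp add: cwin_def algebra_simps)
qed

lemma finite_cwin: "finite (cwin N ` shift_space A)" for A :: "nat^'k^'k"
proof (rule finite_subset[OF _ finite_lists_length_eq[OF finite_edges[of A], of "2 * N"]])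
  show "cwin N ` shift_space A \<subseteq> {xs. set xs \<subseteq> edges A \<and> length xs = 2 * N}"
    using shift_spaceD(1) by (fastforce simp: cwin_def window_def)
qed

section \<open>Topology of the shift space\<close>

lemma topspace_shift: "topspace (shift_topology A) = shift_space A"
  by (auto simp: shift_topology_def shift_space_def)

text \<open>A basic set of the product topology restricts finitely many coordinates, and these lie
  in one central window, so cylinders over central windows form a base.\<close>

lemma openin_shift_iff:
  fixes A :: "nat^'k^'k"
  shows "openin (shift_topology A) U \<longleftrightarrow>
    U \<subseteq> shift_space A \<and> (\<forall>x\<in>U. \<exists>N. \<forall>y\<in>shift_space A. cwin N y = cwin N x \<longrightarrow> y \<in> U)"
proof
  assume "openin (shift_topology A) U"
  then obtain T where T: "openin (product_topology (\<lambda>_. discrete_topology (edges A)) UNIV) T" "U = T \<inter> shift_space A"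
    by (auto simp: shift_topology_def openin_subtopology)
  show "U \<subseteq> shift_space A \<and> (\<forall>x\<in>U. \<exists>N. \<forall>y\<in>shift_space A. cwin N y = cwin N x \<longrightarrow> y \<in> U)"
  proof (intro conjI ballI)
    fix x assume x: "x \<in> U"
    then have "x \<in> T" using T by simp
    then obtain V where V: "finite {i. V i \<noteq> edges A}" "\<And>i. V i \<subseteq> edges A" "x \<in> Pi\<^sub>E UNIV V" "Pi\<^sub>E UNIV V \<subseteq> T"
      using T(1) unfolding openin_product_topology_alt by auto
    \<comment> \<open>The successor is there because the window \<open>{1 - int N..int N}\<close>
      reaches only to \<open>1 - int N\<close> on the left; the entry 0 covers the case without
      restrictions.\<close>
    define N where "N = Suc (nat (Max (insert 0 (abs ` {i. V i \<noteq> edges A}))))"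
    have N: "i \<in> {1 - int N..int N}" if "V i \<noteq> edges A" for i
    proof -
      have "\<bar>i\<bar> \<le> Max (insert 0 (abs ` {i. V i \<noteq> edges A}))" using V(1) that by (intro Max_ge) auto
      moreover have "Max (insert 0 (abs ` {i. V i \<noteq> edges A})) \<le> int N - 1" by (simp add: N_def)
      ultimately have "\<bar>i\<bar> \<le> int N - 1" by linarith
      then show ?thesis unfolding atLeastAtMost_iff by linarith
    qed
    have "y \<in> U" if y: "y \<in> shift_space A" "cwin N y = cwin N x" for y
    proof -
      have "y i \<in> V i" for i
      proof (cases "V i = edges A")
        case False
        then have "y i = x i" using N[OF False] y(2) by (auto simp: cwin_eq_iff)
        then show ?thesis using V(3) by auto
      qed (use shift_spaceD(1)[OF y(1)] in auto)
      then show ?thesis using V(4) T(2) y(1) by auto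
    qed
    then show "\<exists>N. \<forall>y\<in>shift_space A. cwin N y = cwin N x \<longrightarrow> y \<in> U" by blast
  qed (use T in auto)
next
  assume U: "U \<subseteq> shift_space A \<and> (\<forall>x\<in>U. \<exists>N. \<forall>y\<in>shift_space A. cwin N y = cwin N x \<longrightarrow> y \<in> U)"
  show "openin (shift_topology A) U"
  proof (subst openin_subopen, intro ballI)
    fix x assume x: "x \<in> U"
    then obtain N where N: "\<forall>y\<in>shift_space A. cwin N y = cwin N x \<longrightarrow> y \<in> U" using U by blast
    define V where "V i = (if i \<in> {1 - int N..int N} then {x i} else edges A)" for i
    have fin: "finite {i. V i \<noteq> edges A}"
      by (rule finite_subset[of _ "{1 - int N..int N}"]) (auto simp: V_def)
    have xs: "x \<in> shift_space A" using x U by blast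
    have "openin (product_topology (\<lambda>_. discrete_topology (edges A)) UNIV) (Pi\<^sub>E UNIV V)"
      using fin shift_spaceD(1)[OF xs] by (subst openin_PiE_gen) (auto simp: V_def)
    then have "openin (shift_topology A) (Pi\<^sub>E UNIV V \<inter> shift_space A)"
      by (auto simp: shift_topology_def openin_subtopology)
    moreover have "x \<in> Pi\<^sub>E UNIV V \<inter> shift_space A" using xs shift_spaceD(1)[OF xs] by (auto simp: V_def)
    moreover have "Pi\<^sub>E UNIV V \<inter> shift_space A \<subseteq> U"
    proof
      fix y assume y: "y \<in> Pi\<^sub>E UNIV V \<inter> shift_space A"
      then have "y i \<in> V i" for i by auto
      then have "y i = x i" if "i \<in> {1 - int N..int N}" for i using that unfolding V_def by (metis singletonD)
      then show "y \<in> U" using N y by (auto simp: cwin_eq_iff)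
    qed
    ultimately show "\<exists>T. openin (shift_topology A) T \<and> x \<in> T \<and> T \<subseteq> U" by blast
  qed
qed

text \<open>A product of finite discrete spaces is compact, and each path condition is closed, being
  the preimage of a set of pairs under two neighbouring coordinates.\<close>

lemma compact_space_shift: "compact_space (shift_topology A)" for A :: "nat^'k^'k"
proof -
  let ?P = "product_topology (\<lambda>_ :: int. discrete_topology (edges A)) UNIV"
  have "compact_space ?P"
    by (simp add: compact_space_product_topology compact_space_discrete_topology)
  have "closedin ?P (shift_space A)"
  proof -
    have eq: "shift_space A = (\<Inter>n. {x \<in> topspace ?P. (x n, x (n + 1)) \<in> {(e, f). tgt e = src f}})"
      by (auto simp: shift_space_def)
    have "closedin ?P {x \<in> topspace ?P. (x n, x (n + 1)) \<in> {(e, f). e \<in> edges A \<and> f \<in> edges A \<and> tgt e = src f}}" for n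
    proof (rule closedin_continuous_map_preimage)
      show "continuous_map ?P (discrete_topology (edges A \<times> edges A)) (\<lambda>x. (x n, x (n + 1)))"
        unfolding prod_topology_discrete_topology
        by (intro continuous_map_pairedI continuous_map_product_projection) auto
    qed auto
    moreover have "{x \<in> topspace ?P. (x n, x (n + 1)) \<in> {(e, f). e \<in> edges A \<and> f \<in> edges A \<and> tgt e = src f}}
      = {x \<in> topspace ?P. (x n, x (n + 1)) \<in> {(e, f). tgt e = src f}}" for n
      by auto
    ultimately have "closedin ?P {x \<in> topspace ?P. (x n, x (n + 1)) \<in> {(e, f). tgt e = src f}}" for n
      by (simp only:)
    then show ?thesis unfolding eq by (intro closedin_INT) auto
  qed
  then have "compactin ?P (shift_space A)"
    using \<open>compact_space ?P\<close> by (simp add: closedin_compact_space)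
  then show ?thesis
    unfolding shift_topology_def by (rule compact_space_subtopology)
qed


lemma shift_pow: "(shift ^^ n) x = (\<lambda>k. x (k + int n))"
  by (induction n) (auto simp: shift_def algebra_simps)

lemma mixing_paths:
  fixes A :: "nat^'k^'k"
  assumes A: "nondegenerate A" and m: "mixing A"
  obtains n0 where "\<And>n i j. n \<ge> n0 \<Longrightarrow> \<exists>w. edge_path A i j w \<and> length w = n"
proof -
  \<comment> \<open>Reaching \<open>U j\<close> from \<open>U i\<close> after \<open>n\<close>
    shifts yields a path of length \<open>n\<close> from \<open>i\<close> to \<open>j\<close>. These
    sets are open, as position 0 lies in the window of level 1, and nonempty by
    nondegeneracy.\<close>
  define U where "U i = {x \<in> shift_space A. src (x 0) = i}" for i
  have "openin (shift_topology A) (U i)" for i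
    unfolding openin_shift_iff U_def
    by (intro conjI ballI exI[of _ "1 :: nat"]) (auto simp: cwin_eq_iff)
  moreover have "U i \<noteq> {}" for i
  proof -
    obtain x where "x \<in> shift_space A" "src (x 0) = i"
      by (rule shift_space_extend[OF A, of i i "[]" 0]) auto
    then show ?thesis by (auto simp: U_def)
  qed
  ultimately have "\<exists>n0. \<forall>n\<ge>n0. (shift ^^ n) ` U i \<inter> U j \<noteq> {}" for i j
    using m[unfolded mixing_def, rule_format, of "U i" "U j"] by simp
  then obtain N where N: "\<And>i j n. n \<ge> N i j \<Longrightarrow> (shift ^^ n) ` U i \<inter> U j \<noteq> {}" by metis
  define n0 where "n0 = (\<Sum>i\<in>UNIV. \<Sum>j\<in>UNIV. N i j)"
  have le: "N i j \<le> n0" for i j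
  proof -
    have "N i j \<le> (\<Sum>j\<in>UNIV. N i j)" by (rule member_le_sum) auto
    also have "\<dots> \<le> n0" unfolding n0_def by (rule member_le_sum) auto
    finally show ?thesis .
  qed
  show ?thesis
  proof (rule that[of n0])
    fix n i j assume "n0 \<le> n"
    then have "N i j \<le> n" using le[of i j] by simp
    then obtain x where x: "x \<in> U i" "(shift ^^ n) x \<in> U j" using N[of i j n] by blast
    then have "edge_path A i j (window 0 n x)"
      using edge_path_window[of x A 0 n] by (simp add: U_def shift_pow)
    then show "\<exists>w. edge_path A i j w \<and> length w = n" by (intro exI[of _ "window 0 n x"]) simp
  qed
qed

subsection \<open>The Borel sets\<close>

text \<open>Locally constant functions on the shift space, with the level of the window that they
  read made explicit.\<close>

definition determined :: "nat^'k^'k \<Rightarrow> nat \<Rightarrow> ('k biseq \<Rightarrow> 'b) \<Rightarrow> bool" where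
  "determined A N f \<longleftrightarrow> (\<forall>x\<in>shift_space A. \<forall>y\<in>shift_space A. cwin N x = cwin N y \<longrightarrow> f x = f y)"

lemma determined_mono: "determined A N f \<Longrightarrow> N \<le> M \<Longrightarrow> determined A M f"
  unfolding determined_def using cwin_eq_mono by blast

lemma determined_comp: "determined A N f \<Longrightarrow> determined A N (\<lambda>x. g (f x))"
  unfolding determined_def by metis

lemma determined_cwin: "determined A N (cwin N)"
  unfolding determined_def by simp

lemma determined_window: "1 - int N \<le> a \<Longrightarrow> a + int n \<le> int N + 1 \<Longrightarrow> determined A N (window a n)"
  unfolding determined_def cwin_eq_iff window_eq_iff by auto

lemma determined_window_ex: "\<exists>N. determined A N (window a n)"
  by (rule exI, rule determined_window[of "nat \<bar>a\<bar> + 1 + n"]) auto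

lemma determined_coord: "1 - int N \<le> n \<Longrightarrow> n \<le> int N \<Longrightarrow> determined A N (\<lambda>x. x n)"
  unfolding determined_def cwin_eq_iff by auto

lemma determined_finite: "determined A N f \<Longrightarrow> finite (f ` shift_space A)" for A :: "nat^'k^'k"
proof -
  assume f: "determined A N f"
  have "f x = (f \<circ> inv_into (shift_space A) (cwin N)) (cwin N x)" if "x \<in> shift_space A" for x
  proof -
    have "cwin N x \<in> cwin N ` shift_space A" using that by simp
    note i = inv_into_into[OF this] f_inv_into_f[OF this]
    show ?thesis
      using f[unfolded determined_def, rule_format, OF i(1) that i(2)] by simp
  qed
  then have "f ` shift_space A \<subseteq> (f \<circ> inv_into (shift_space A) (cwin N)) ` (cwin N ` shift_space A)" by auto
  then show ?thesis using finite_cwin finite_surj by blast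
qed

lemma determined_openin: "determined A N f \<Longrightarrow> openin (shift_topology A) {x \<in> shift_space A. P (f x)}" for A :: "nat^'k^'k"
  unfolding openin_shift_iff
proof (intro conjI ballI exI[of _ N] impI)
  fix x y assume "determined A N f" "x \<in> {x \<in> shift_space A. P (f x)}" "y \<in> shift_space A" "cwin N y = cwin N x"
  moreover from this have "f y = f x" unfolding determined_def by blast
  ultimately show "y \<in> {x \<in> shift_space A. P (f x)}" by simp
qed auto

lemma shift_borel_subset: "{U. openin (shift_topology A) U} \<subseteq> Pow (shift_space A)"
  using openin_subset topspace_shift by blast

lemma space_shift_borel [simp]: "space (shift_borel A) = shift_space A"
  unfolding shift_borel_def using shift_borel_subset by (rule space_measure_of)

lemma sets_shift_borel: "sets (shift_borel A) = sigma_sets (shift_space A) {U. openin (shift_topology A) U}"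
  unfolding shift_borel_def using shift_borel_subset by (rule sets_measure_of)

definition cylinder_sets :: "nat^'k^'k \<Rightarrow> 'k biseq set set" where
  "cylinder_sets A = {{x \<in> shift_space A. cwin N x \<in> S} | N S. True}"

lemma sets_shift_borel_cylinder:
  fixes A :: "nat^'k^'k"
  shows "sets (shift_borel A) = sigma_sets (shift_space A) (cylinder_sets A)"
  unfolding sets_shift_borel
proof (intro sigma_sets_eqI)
  fix U assume "U \<in> {U. openin (shift_topology A) U}"
  then have U: "U \<subseteq> shift_space A" "\<And>x. x \<in> U \<Longrightarrow> \<exists>N. \<forall>y\<in>shift_space A. cwin N y = cwin N x \<longrightarrow> y \<in> U"
    by (auto simp: openin_shift_iff)
  \<comment> \<open>The union of all cylinders of level \<open>N\<close> that are contained in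
    \<open>U\<close>; countably many levels exhaust \<open>U\<close>.\<close>
  define V where "V N = {x \<in> shift_space A. cwin N x \<in> {w. \<forall>y\<in>shift_space A. cwin N y = w \<longrightarrow> y \<in> U}}" for N
  have "U = (\<Union>N. V N)" using U unfolding V_def by auto
  moreover have "V N \<in> cylinder_sets A" for N unfolding cylinder_sets_def V_def by blast
  ultimately show "U \<in> sigma_sets (shift_space A) (cylinder_sets A)"
    by (auto intro!: sigma_sets.Union intro: sigma_sets.Basic)
next
  fix U assume "U \<in> cylinder_sets A"
  then show "U \<in> sigma_sets (shift_space A) {U. openin (shift_topology A) U}"
    unfolding cylinder_sets_def using determined_openin[OF determined_cwin, of A] by (auto intro!: sigma_sets.Basic)
qed

lemma determined_sets:
  fixes A :: "nat^'k^'k"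
  shows "determined A N f \<Longrightarrow> {x \<in> shift_space A. P (f x)} \<in> sets (shift_borel A)"
  unfolding sets_shift_borel using determined_openin by (intro sigma_sets.Basic) blast

lemma determined_measurable:
  fixes A :: "nat^'k^'k"
  assumes "determined A N f" "sets M = sets (shift_borel A)"
  shows "f \<in> measurable M (count_space UNIV)"
proof (rule measurableI)
  have sp: "space M = shift_space A" using sets_eq_imp_space_eq[OF assms(2)] by simp
  fix S
  have "f -` S \<inter> space M = {x \<in> shift_space A. f x \<in> S}" by (auto simp: sp)
  then show "f -` S \<inter> space M \<in> sets M" using determined_sets[OF assms(1)] assms(2) by simp
qed simp

lemma determined_simple_function:
  fixes A :: "nat^'k^'k"
  assumes "determined A N f" "sets M = sets (shift_borel A)"
  shows "simple_function M f"
proof -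
  show ?thesis
    using sets_eq_imp_space_eq[OF assms(2)] determined_finite[OF assms(1)] measurable_sets[OF determined_measurable[OF assms]]
    by (auto simp: simple_function_def)
qed

section \<open>Entropy of measure-preserving systems\<close>

text \<open>From \<open>ln t \<le> t - 1\<close>, with equality only at \<open>t = 1\<close>. Since
  \<open>ln 0 = 0\<close> here, a zero of \<open>q\<close> is not punished by an infinite term,
  hence the absolute continuity hypothesis. The mass of \<open>q\<close> may be smaller than that of
  \<open>p\<close>, so comparison laws need not be normalised exactly.\<close>

lemma Gibbs_inequality:
  fixes p q :: "'v \<Rightarrow> real"
  assumes V: "finite V" and p: "\<And>v. v \<in> V \<Longrightarrow> 0 \<le> p v" and q: "\<And>v. v \<in> V \<Longrightarrow> 0 \<le> q v"
    and ac: "\<And>v. v \<in> V \<Longrightarrow> q v = 0 \<Longrightarrow> p v = 0" and le: "sum q V \<le> sum p V"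
  shows "(\<Sum>v\<in>V. p v * ln (q v)) \<le> (\<Sum>v\<in>V. p v * ln (p v))"
    and "(\<Sum>v\<in>V. p v * ln (q v)) = (\<Sum>v\<in>V. p v * ln (p v)) \<Longrightarrow> v \<in> V \<Longrightarrow> p v = q v"
proof -
  have pt: "p v * ln (q v) - p v * ln (p v) \<le> q v - p v" if v: "v \<in> V" for v
  proof (cases "p v = 0")
    case False
    then have pq: "0 < p v" "0 < q v" using p[OF v] q[OF v] ac[OF v] by (auto simp: less_le)
    have "p v * ln (q v / p v) \<le> p v * (q v / p v - 1)"
      using pq by (intro mult_left_mono ln_le_minus_one) auto
    then show ?thesis using pq by (simp add: ln_div algebra_simps)
  qed (use q v in auto)
  have pteq: "p v = q v" if v: "v \<in> V" and e: "p v * ln (q v) - p v * ln (p v) = q v - p v" for v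
  proof (cases "p v = 0")
    case False
    then have pq: "0 < p v" "0 < q v" using p[OF v] q[OF v] ac[OF v] by (auto simp: less_le)
    have "p v * ln (q v / p v) = p v * (q v / p v - 1)" using e pq by (simp add: ln_div algebra_simps)
    then have "ln (q v / p v) = q v / p v - 1" using pq by simp
    then have "q v / p v = 1" using pq by (intro ln_eq_minus_one) auto
    then show ?thesis using pq by simp
  qed (use e in simp)
  have "(\<Sum>v\<in>V. p v * ln (q v) - p v * ln (p v)) \<le> (\<Sum>v\<in>V. q v - p v)"
    by (intro sum_mono pt)
  then show "(\<Sum>v\<in>V. p v * ln (q v)) \<le> (\<Sum>v\<in>V. p v * ln (p v))" using le by (simp add: sum_subtractf)
  assume e: "(\<Sum>v\<in>V. p v * ln (q v)) = (\<Sum>v\<in>V. p v * ln (p v))" and v: "v \<in> V"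
  have "(\<Sum>v\<in>V. (q v - p v) - (p v * ln (q v) - p v * ln (p v))) \<le> 0"
    using e le by (simp add: sum_subtractf)
  moreover have nn: "0 \<le> (q v - p v) - (p v * ln (q v) - p v * ln (p v))" if "v \<in> V" for v using pt[OF that] by simp
  ultimately have "(\<Sum>v\<in>V. (q v - p v) - (p v * ln (q v) - p v * ln (p v))) = 0"
    by (intro antisym sum_nonneg) auto
  then have "(q v - p v) - (p v * ln (q v) - p v * ln (p v)) = 0"
    using sum_nonneg_eq_0_iff[OF V, of "\<lambda>v. (q v - p v) - (p v * ln (q v) - p v * ln (p v))"] nn v by blast
  then show "p v = q v" using pteq[OF v] by simp
qed

lemma concave_seq_upper:
  fixes a :: "nat \<Rightarrow> real"
  assumes conc: "\<And>n. a (n + 2) + a n \<le> 2 * a (n + 1)"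
  shows "a (m + k) \<le> a m + real k * (a (m + 1) - a m)"
proof -
  have d: "a (m + k + 1) - a (m + k) \<le> a (m + 1) - a m" for k
  proof (induction k)
    case (Suc k)
    then show ?case using conc[of "m + k"] by simp
  qed simp
  show ?thesis
  proof (induction k)
    case (Suc k)
    then show ?case using d[of k] by (simp add: algebra_simps)
  qed simp
qed

text \<open>Increments decrease, so \<open>a n\<close> is at least \<open>n\<close> times its next
  increment; this makes \<open>a n / n\<close> decreasing. The linear upper bound from any index
  \<open>m\<close> on then keeps the limit below the increment at \<open>m\<close>.\<close>

lemma concave_seq_limit:
  fixes a :: "nat \<Rightarrow> real"
  assumes nn: "\<And>n. 0 \<le> a n" and conc: "\<And>n. a (n + 2) + a n \<le> 2 * a (n + 1)"
  obtains L where "(\<lambda>n. a n / real n) \<longlonglongrightarrow> L" "\<And>m. L \<le> a (m + 1) - a m"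
proof -
  define d where "d n = a (n + 1) - a n" for n
  have d: "d (Suc n) \<le> d n" for n using conc[of n] by (simp add: d_def)
  have up: "a (m + k) \<le> a m + real k * d m" for m k
    using concave_seq_upper[of a m k] conc by (simp add: d_def)
  have low: "real n * d n \<le> a n" for n
  proof (induction n)
    case (Suc n)
    have "real (Suc n) * d (Suc n) \<le> real (Suc n) * d n" using d by (intro mult_left_mono) auto
    also have "\<dots> = real n * d n + d n" by (simp add: algebra_simps)
    also have "\<dots> \<le> a (Suc n)" using Suc by (simp add: d_def)
    finally show ?case .
  qed (simp add: nn)
  \<comment> \<open>The shift avoids the term at 0, which is a division by zero.\<close>
  define b where "b n = a (Suc n) / real (Suc n)" for n
  have "b (Suc n) \<le> b n" for n
  proof -
    have "real (Suc n) * a (Suc (Suc n)) \<le> real (Suc (Suc n)) * a (Suc n)"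
      using low[of "Suc n"] by (simp add: d_def algebra_simps)
    then show ?thesis unfolding b_def by (simp add: divide_simps mult.commute)
  qed
  then have "decseq b" by (rule decseq_SucI)
  moreover have "0 \<le> b n" for n using nn by (simp add: b_def)
  ultimately obtain L where "b \<longlonglongrightarrow> L" using decseq_convergent[of b 0] by blast
  then have L: "(\<lambda>n. a n / real n) \<longlonglongrightarrow> L" unfolding b_def by (rule LIMSEQ_imp_Suc)
  moreover have "L \<le> a (m + 1) - a m" for m
  proof (rule tendsto_le[OF _ _ L])
    have "(\<lambda>n. (a m - real m * d m) / real n + d m) \<longlonglongrightarrow> 0 + d m"
      by (intro tendsto_intros lim_const_over_n)
    then show "(\<lambda>n. (a m - real m * d m) / real n + d m) \<longlonglongrightarrow> a (m + 1) - a m" by (simp add: d_def)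
    have "a n / real n \<le> (a m - real m * d m) / real n + d m" if n: "n \<ge> m + 1" for n
    proof -
      have "a n \<le> a m + real (n - m) * d m" using up[of m "n - m"] n by simp
      then have "a n \<le> (a m - real m * d m) + d m * real n" using n by (simp add: of_nat_diff algebra_simps)
      then have "a n / real n \<le> ((a m - real m * d m) + d m * real n) / real n" by (rule divide_right_mono) simp
      then show ?thesis using n by (simp add: add_divide_distrib)
    qed
    then show "\<forall>\<^sub>F n in sequentially. a n / real n \<le> (a m - real m * d m) / real n + d m"
      unfolding eventually_sequentially by blast
  qed simp
  ultimately show ?thesis using that by blast
qed

section \<open>Entropy of random variables with finitely many values\<close>

context prob_space
begin

definition pr :: "('a \<Rightarrow> 'v) \<Rightarrow> 'v \<Rightarrow> real" where
  "pr X v = prob (X -` {v} \<inter> space M)"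

definition ent :: "('a \<Rightarrow> 'v) \<Rightarrow> real" where
  "ent X = entropy (exp 1) (count_space (X ` space M)) X"

lemma pr_nonneg [simp]: "0 \<le> pr X v" and pr_le_1: "pr X v \<le> 1"
  by (simp_all add: pr_def)

lemma pr_outside: "v \<notin> X ` space M \<Longrightarrow> pr X v = 0"
proof -
  assume "v \<notin> X ` space M"
  then have "X -` {v} \<inter> space M = {}" by auto
  then show ?thesis by (simp add: pr_def)
qed

lemma pr_cong: "(\<And>x. x \<in> space M \<Longrightarrow> X x = v \<longleftrightarrow> Y x = w) \<Longrightarrow> pr X v = pr Y w"
  unfolding pr_def by (intro arg_cong[where f = prob]) auto

lemma sum_pr:
  fixes f :: "'v \<Rightarrow> real"
  assumes X: "simple_function M X" and V: "finite V" "X ` space M \<subseteq> V"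
  shows "(\<Sum>v\<in>V. pr X v * f v) = expectation (\<lambda>x. f (X x))"
proof -
  have "expectation (\<lambda>x. f (X x)) = expectation (\<lambda>x. \<Sum>v\<in>V. f v * indicator (X -` {v} \<inter> space M) x)"
  proof (intro Bochner_Integration.integral_cong refl)
    fix x assume x: "x \<in> space M"
    have "(\<Sum>v\<in>V. f v * indicator (X -` {v} \<inter> space M) x) = (\<Sum>v\<in>V. if v = X x then f v else 0)"
      using x by (intro sum.cong) auto
    also have "\<dots> = f (X x)" using V x by (simp add: subset_iff image_iff) blast
    finally show "f (X x) = (\<Sum>v\<in>V. f v * indicator (X -` {v} \<inter> space M) x)" by simp
  qed
  also have "\<dots> = (\<Sum>v\<in>V. f v * prob (X -` {v} \<inter> space M))"
    using X V by (subst Bochner_Integration.integral_sum)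
      (auto dest: simple_functionD(2) intro!: integrable_mult_right integrable_real_indicator simp: emeasure_eq_measure)
  finally show ?thesis by (simp add: pr_def mult.commute)
qed

lemma expectation_cong: "(\<And>x. x \<in> space M \<Longrightarrow> f x = g x) \<Longrightarrow> expectation f = (expectation g :: real)"
  by (intro Bochner_Integration.integral_cong) auto

lemma sum_pr_1:
  "simple_function M X \<Longrightarrow> finite V \<Longrightarrow> X ` space M \<subseteq> V \<Longrightarrow> (\<Sum>v\<in>V. pr X v) = 1"
  using sum_pr[of X V "\<lambda>_. 1"] by (simp add: prob_space)

lemma ent_eq:
  assumes X: "simple_function M X" and V: "finite V" "X ` space M \<subseteq> V"
  shows "ent X = - (\<Sum>v\<in>V. pr X v * ln (pr X v))"
proof -
  interpret information_space M "exp 1" by unfold_locales simp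
  have "ent X = - (\<Sum>v\<in>X ` space M. pr X v * log (exp 1) (pr X v))"
    unfolding ent_def pr_def
    by (rule entropy_simple_distributed[OF simple_distributedI[OF X]]) auto
  also have "\<dots> = - (\<Sum>v\<in>X ` space M. pr X v * ln (pr X v))" by (simp add: log_def)
  also have "(\<Sum>v\<in>X ` space M. pr X v * ln (pr X v)) = (\<Sum>v\<in>V. pr X v * ln (pr X v))"
    using V by (intro sum.mono_neutral_left) (auto simp: pr_outside)
  finally show ?thesis .
qed

lemma ent_eq_expectation:
  "simple_function M X \<Longrightarrow> ent X = - expectation (\<lambda>x. ln (pr X (X x)))"
  using ent_eq[of X "X ` space M"] sum_pr[of X "X ` space M" "\<lambda>v. ln (pr X v)"]
  by (simp add: simple_functionD)

lemma ent_nonneg: "simple_function M X \<Longrightarrow> 0 \<le> ent X"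
proof -
  assume X: "simple_function M X"
  have "pr X v * ln (pr X v) \<le> 0" for v
    using pr_le_1[of X v] pr_nonneg[of X v] ln_le_zero_iff[of "pr X v"]
    by (cases "pr X v = 0") (auto simp del: pr_nonneg intro!: mult_nonneg_nonpos simp: less_le)
  then show ?thesis using ent_eq[OF X, of "X ` space M"] X
    by (simp add: simple_functionD sum_nonpos)
qed

lemma ent_cong:
  assumes X: "simple_function M X" and eq: "\<And>x. x \<in> space M \<Longrightarrow> X x = Y x"
  shows "ent X = ent Y"
proof -
  have Y: "simple_function M Y" using X eq simple_function_cong[of M X Y] by blast
  have "pr X v = pr Y v" for v by (rule pr_cong) (simp add: eq)
  moreover have "X ` space M = Y ` space M" using eq by (intro image_cong) auto
  ultimately show ?thesis
    using ent_eq[OF X simple_functionD(1)[OF X]] ent_eq[OF Y simple_functionD(1)[OF Y]] by simp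
qed

lemma ent_mono:
  assumes X: "simple_function M X" and eq: "\<And>x. x \<in> space M \<Longrightarrow> Y x = f (X x)"
  shows "ent Y \<le> ent X"
proof -
  interpret information_space M "exp 1" by unfold_locales simp
  have fX: "simple_function M (f \<circ> X)" using X by (rule simple_function_compose)
  have "ent Y = ent (f \<circ> X)" by (rule ent_cong[OF fX, symmetric]) (simp add: eq)
  also have "\<dots> \<le> ent X" unfolding ent_def by (rule entropy_data_processing[OF X])
  finally show ?thesis .
qed

lemma sum_pr_marginal:
  assumes X: "simple_function M X" and Z: "simple_function M Z"
  shows "(\<Sum>x\<in>X ` space M. pr (\<lambda>x. (X x, Z x)) (x, z)) = pr Z z"
proof -
  have "(\<Sum>x\<in>X ` space M. pr (\<lambda>x. (X x, Z x)) (x, z)) = prob (\<Union>x\<in>X ` space M. (\<lambda>x. (X x, Z x)) -` {(x, z)} \<inter> space M)"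
    unfolding pr_def using simple_functionD[OF X] simple_functionD(2)[OF simple_function_Pair[OF X Z]]
    by (intro finite_measure_finite_Union[symmetric]) (auto simp: disjoint_family_on_def)
  also have "(\<Union>x\<in>X ` space M. (\<lambda>x. (X x, Z x)) -` {(x, z)} \<inter> space M) = Z -` {z} \<inter> space M" by auto
  finally show ?thesis by (simp add: pr_def)
qed

text \<open>Gibbs' inequality against the law under which \<open>X\<close> and \<open>Y\<close> are
  conditionally independent given \<open>Z\<close>, each with its true joint law with
  \<open>Z\<close>.\<close>

lemma ent_submodular:
  assumes X: "simple_function M X" and Y: "simple_function M Y" and Z: "simple_function M Z"
  shows "ent (\<lambda>x. (X x, Y x, Z x)) + ent Z \<le> ent (\<lambda>x. (X x, Z x)) + ent (\<lambda>x. (Y x, Z x))"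
proof -
  define W where "W x = (X x, Y x, Z x)" for x
  have YZ: "simple_function M (\<lambda>x. (Y x, Z x))" and XZ: "simple_function M (\<lambda>x. (X x, Z x))"
    and W: "simple_function M W"
    unfolding W_def using X Y Z by (auto intro!: simple_function_Pair)
  note fin = simple_functionD(1)[OF X] simple_functionD(1)[OF Y] simple_functionD(1)[OF Z]
  define V where "V = X ` space M \<times> Y ` space M \<times> Z ` space M"
  have V: "finite V" "W ` space M \<subseteq> V" using fin by (auto simp: V_def W_def)
  let ?xz = "\<lambda>v. pr (\<lambda>x. (X x, Z x)) (fst v, snd (snd v))"
  let ?yz = "\<lambda>v. pr (\<lambda>x. (Y x, Z x)) (snd v)"
  let ?z = "\<lambda>v. pr Z (snd (snd v))"
  define q where "q v = ?xz v * ?yz v / ?z v" for v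
  have zero: "pr W v = 0" if "?xz v = 0 \<or> ?yz v = 0 \<or> ?z v = 0" for v
  proof -
    have "pr W v \<le> ?xz v" "pr W v \<le> ?yz v" "pr W v \<le> ?z v"
      unfolding pr_def using simple_functionD(2)[OF XZ] simple_functionD(2)[OF YZ] simple_functionD(2)[OF Z]
      by (intro finite_measure_mono; auto simp: W_def)+
    then show ?thesis using that pr_nonneg[of W v] by linarith
  qed
  have ac: "pr W v = 0" if "q v = 0" for v
    using zero[of v] that by (auto simp: q_def)
  have "sum q V = (\<Sum>x\<in>X ` space M. \<Sum>y\<in>Y ` space M. \<Sum>z\<in>Z ` space M. pr (\<lambda>x. (X x, Z x)) (x, z) * pr (\<lambda>x. (Y x, Z x)) (y, z) / pr Z z)"
    unfolding V_def q_def sum.cartesian_product' by simp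
  also have "\<dots> = (\<Sum>x\<in>X ` space M. \<Sum>z\<in>Z ` space M. \<Sum>y\<in>Y ` space M. pr (\<lambda>x. (X x, Z x)) (x, z) * pr (\<lambda>x. (Y x, Z x)) (y, z) / pr Z z)"
    by (intro sum.cong refl sum.swap)
  also have "\<dots> = (\<Sum>x\<in>X ` space M. \<Sum>z\<in>Z ` space M. pr (\<lambda>x. (X x, Z x)) (x, z) * pr Z z / pr Z z)"
    by (simp add: sum_divide_distrib[symmetric] sum_distrib_left[symmetric] sum_pr_marginal[OF Y Z])
  also have "\<dots> = (\<Sum>z\<in>Z ` space M. \<Sum>x\<in>X ` space M. pr (\<lambda>x. (X x, Z x)) (x, z) * pr Z z / pr Z z)"
    by (rule sum.swap)
  also have "\<dots> = (\<Sum>z\<in>Z ` space M. pr Z z * pr Z z / pr Z z)"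
    by (simp only: sum_divide_distrib[symmetric] sum_distrib_right[symmetric] sum_pr_marginal[OF X Z])
  \<comment> \<open>Values of probability zero contribute 0 on both sides, because division by zero
    yields 0.\<close>
  also have "\<dots> = (\<Sum>z\<in>Z ` space M. pr Z z)" by (intro sum.cong) auto
  also have "\<dots> = 1" by (rule sum_pr_1[OF Z fin(3) order_refl])
  also have "\<dots> = sum (pr W) V" using sum_pr_1[OF W V] by simp
  finally have le: "sum q V \<le> sum (pr W) V" by simp
  have "(\<Sum>v\<in>V. pr W v * ln (q v)) \<le> (\<Sum>v\<in>V. pr W v * ln (pr W v))"
    by (rule Gibbs_inequality(1)[OF V(1) _ _ ac le]) (auto simp: q_def)
  moreover have "(\<Sum>v\<in>V. pr W v * ln (q v)) =
      (\<Sum>v\<in>V. pr W v * ln (?xz v) + pr W v * ln (?yz v) - pr W v * ln (?z v))"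
  proof (intro sum.cong refl)
    fix v
    show "pr W v * ln (q v) = pr W v * ln (?xz v) + pr W v * ln (?yz v) - pr W v * ln (?z v)"
    proof (cases "?xz v = 0 \<or> ?yz v = 0 \<or> ?z v = 0")
      case False
      then have "0 < ?xz v" "0 < ?yz v" "0 < ?z v" by (auto simp: less_le)
      then show ?thesis by (simp add: q_def ln_mult ln_div algebra_simps)
    qed (simp add: zero)
  qed
  moreover have "\<dots> = - ent (\<lambda>x. (X x, Z x)) - ent (\<lambda>x. (Y x, Z x)) + ent Z"
    using sum_pr[OF W V, of "\<lambda>v. ln (?xz v)"] sum_pr[OF W V, of "\<lambda>v. ln (?yz v)"] sum_pr[OF W V, of "\<lambda>v. ln (?z v)"]
      ent_eq_expectation[OF XZ] ent_eq_expectation[OF YZ] ent_eq_expectation[OF Z]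
    by (simp add: sum.distrib sum_subtractf W_def)
  ultimately show ?thesis using ent_eq[OF W V] by (simp add: W_def[abs_def])
qed

text \<open>Gibbs' inequality is applied to the distribution that guesses \<open>X = Y\<close> with probability \<open>1 - \<theta>\<close>.\<close>

lemma ent_Fano:
  fixes X Y :: "'a \<Rightarrow> 'v"
  assumes X: "simple_function M X" and Y: "simple_function M Y"
    and \<theta>: "0 < \<theta>" "\<theta> < 1" and K: "K = real (card (X ` space M))"
  shows "ent (\<lambda>x. (X x, Y x)) - ent Y \<le> - ln (1 - \<theta>) + prob {x \<in> space M. X x \<noteq> Y x} * ln (K / \<theta>)"
proof -
  define V where "V = X ` space M \<times> Y ` space M"
  \<comment> \<open>A conditional law of \<open>X\<close> given \<open>Y = y\<close>: mass
    \<open>1 - \<theta>\<close> on \<open>y\<close> and \<open>\<theta> / K\<close> on every other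
    value of \<open>X\<close>. The total is at most 1, whether or not \<open>y\<close> is a value of
    \<open>X\<close>.\<close>
  define r :: "'v \<times> 'v \<Rightarrow> real" where "r = (\<lambda>(x, y). if x = y then 1 - \<theta> else \<theta> / K)"
  define q where "q v = pr Y (snd v) * r v" for v
  have fin: "finite (X ` space M)" "finite (Y ` space M)" using X Y by (auto dest: simple_functionD)
  have XY: "simple_function M (\<lambda>x. (X x, Y x))" using X Y by (rule simple_function_Pair)
  have ne: "X ` space M \<noteq> {}" using not_empty by blast
  have K1: "1 \<le> K" using fin ne unfolding K by (simp add: Suc_leI card_gt_0_iff)
  have V: "finite V" "(\<lambda>x. (X x, Y x)) ` space M \<subseteq> V" using fin by (auto simp: V_def)
  have r: "0 < r v" "r v \<le> 1" for v
    using \<theta> K1 by (auto simp: r_def divide_simps split: prod.split)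
  have D: "{x \<in> space M. X x \<noteq> Y x} \<in> events"
  proof -
    have "{x \<in> space M. X x \<noteq> Y x} = (\<lambda>x. (X x, Y x)) -` {(a, b). a \<noteq> b} \<inter> space M" by auto
    also have "\<dots> \<in> events" by (rule simple_functionD(2)[OF XY])
    finally show ?thesis .
  qed
  have rsum: "(\<Sum>x\<in>X ` space M. r (x, y)) \<le> 1" for y
  proof -
    have "(\<Sum>x\<in>X ` space M. r (x, y)) \<le> (\<Sum>x\<in>X ` space M. (if x = y then 1 - \<theta> else 0) + \<theta> / K)"
      using \<theta> K1 by (intro sum_mono) (auto simp: r_def)
    also have "\<dots> = (if y \<in> X ` space M then 1 - \<theta> else 0) + \<theta>"
      using fin K1 by (simp add: sum.distrib K[symmetric])
    finally show ?thesis using \<theta> by (auto split: if_splits)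
  qed
  have "sum q V = (\<Sum>y\<in>Y ` space M. pr Y y * (\<Sum>x\<in>X ` space M. r (x, y)))"
    unfolding V_def q_def sum.cartesian_product' by (subst sum.swap) (simp add: sum_distrib_left)
  also have "\<dots> \<le> (\<Sum>y\<in>Y ` space M. pr Y y * 1)"
    by (intro sum_mono mult_left_mono rsum) auto
  also have "\<dots> = 1" using sum_pr_1[OF Y fin(2)] by simp
  also have "\<dots> = (\<Sum>v\<in>V. pr (\<lambda>x. (X x, Y x)) v)" using sum_pr_1[OF XY V] by simp
  finally have le: "sum q V \<le> (\<Sum>v\<in>V. pr (\<lambda>x. (X x, Y x)) v)" .
  have ac: "pr (\<lambda>x. (X x, Y x)) v = 0" if "q v = 0" for v
  proof -
    have "pr Y (snd v) = 0" using that r(1)[of v] by (simp add: q_def)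
    moreover have "pr (\<lambda>x. (X x, Y x)) v \<le> pr Y (snd v)"
      unfolding pr_def using simple_functionD(2)[OF Y] by (intro finite_measure_mono) auto
    ultimately show ?thesis using pr_nonneg[of "\<lambda>x. (X x, Y x)" v] by linarith
  qed
  have "(\<Sum>v\<in>V. pr (\<lambda>x. (X x, Y x)) v * ln (q v)) \<le> (\<Sum>v\<in>V. pr (\<lambda>x. (X x, Y x)) v * ln (pr (\<lambda>x. (X x, Y x)) v))"
    by (rule Gibbs_inequality(1)[OF V(1) _ _ ac le]) (auto simp: q_def less_imp_le[OF r(1)])
  then have 1: "ent (\<lambda>x. (X x, Y x)) \<le> - (\<Sum>v\<in>V. pr (\<lambda>x. (X x, Y x)) v * ln (q v))"
    using ent_eq[OF XY V] by simp
  have "(\<Sum>v\<in>V. pr (\<lambda>x. (X x, Y x)) v * ln (q v)) =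
      (\<Sum>v\<in>V. pr (\<lambda>x. (X x, Y x)) v * ln (pr Y (snd v)) + pr (\<lambda>x. (X x, Y x)) v * ln (r v))"
  proof (intro sum.cong refl)
    fix v
    show "pr (\<lambda>x. (X x, Y x)) v * ln (q v) =
      pr (\<lambda>x. (X x, Y x)) v * ln (pr Y (snd v)) + pr (\<lambda>x. (X x, Y x)) v * ln (r v)"
    proof (cases "q v = 0")
      case True
      then show ?thesis using ac[OF True] by simp
    next
      case False
      then have "0 < pr Y (snd v)" using pr_nonneg[of Y "snd v"] by (auto simp: q_def less_le)
      then show ?thesis using r(1)[of v] by (simp add: q_def ln_mult algebra_simps)
    qed
  qed
  also have "\<dots> = expectation (\<lambda>x. ln (pr Y (Y x))) + (\<Sum>v\<in>V. pr (\<lambda>x. (X x, Y x)) v * ln (r v))"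
    using sum_pr[OF XY V, of "\<lambda>v. ln (pr Y (snd v))"] by (simp add: sum.distrib)
  also have "(\<Sum>v\<in>V. pr (\<lambda>x. (X x, Y x)) v * ln (r v)) = expectation (\<lambda>x. ln (r (X x, Y x)))"
    using sum_pr[OF XY V, of "\<lambda>v. ln (r v)"] by simp
  finally have 2: "(\<Sum>v\<in>V. pr (\<lambda>x. (X x, Y x)) v * ln (q v)) =
    expectation (\<lambda>x. ln (pr Y (Y x))) + expectation (\<lambda>x. ln (r (X x, Y x)))" .
  \<comment> \<open>Adding the negative constant \<open>ln (1 - \<theta>)\<close> also where
    \<open>X\<close> and \<open>Y\<close> differ makes the lower bound a constant plus a multiple of
    an indicator.\<close>
  have 3: "expectation (\<lambda>x. ln (r (X x, Y x))) \<ge> expectation (\<lambda>x. ln (1 - \<theta>) + ln (\<theta> / K) * indicator {x \<in> space M. X x \<noteq> Y x} x)"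
  proof (intro integral_mono)
    show "integrable M (\<lambda>x. ln (1 - \<theta>) + ln (\<theta> / K) * indicator {x \<in> space M. X x \<noteq> Y x} x)"
      using D by (intro Bochner_Integration.integrable_add integrable_mult_right) (auto simp: emeasure_eq_measure)
    have "simple_function M (\<lambda>x. ln (r (X x, Y x)))"
      using simple_function_compose[OF XY, of "\<lambda>v. ln (r v)"] by (simp add: comp_def)
    then show "integrable M (\<lambda>x. ln (r (X x, Y x)))"
      by (intro integrable_simple_function) (auto simp: emeasure_eq_measure)
    fix x assume "x \<in> space M"
    then show "ln (1 - \<theta>) + ln (\<theta> / K) * indicator {x \<in> space M. X x \<noteq> Y x} x \<le> ln (r (X x, Y x))"
      using \<theta> by (auto simp: r_def)
  qed
  have 4: "expectation (\<lambda>x. ln (1 - \<theta>) + ln (\<theta> / K) * indicator {x \<in> space M. X x \<noteq> Y x} x) =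
    ln (1 - \<theta>) + ln (\<theta> / K) * prob {x \<in> space M. X x \<noteq> Y x}"
    using D by (subst Bochner_Integration.integral_add) (auto simp: prob_space emeasure_eq_measure)
  have 5: "ln (\<theta> / K) = - ln (K / \<theta>)" using \<theta> K1 by (simp add: ln_div)
  show ?thesis using 1 2 3 4 ent_eq_expectation[OF Y] unfolding 5 by (simp add: algebra_simps)
qed

text \<open>Fano's bound involves only the number of values of \<open>X\<close>, so \<open>d\<close>
  works for every \<open>Y\<close>, however many values it takes; this matters because the size of
  the approximating cylinder partition is not known in advance. Half of \<open>e\<close> goes into
  the choice of \<open>\<theta>\<close>, the other half pays for the disagreement.\<close>

lemma ent_close:
  fixes X :: "'a \<Rightarrow> 'v"
  assumes X: "simple_function M X" and e: "e > 0"
  obtains d where "d > 0" "\<And>Y :: 'a \<Rightarrow> 'v. simple_function M Y \<Longrightarrow> prob {x \<in> space M. X x \<noteq> Y x} \<le> d \<Longrightarrow>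
    ent (\<lambda>x. (X x, Y x)) - ent Y \<le> e"
proof -
  define \<theta> where "\<theta> = 1 - exp (- e / 2)"
  have \<theta>: "0 < \<theta>" "\<theta> < 1" "- ln (1 - \<theta>) = e / 2" using e by (auto simp: \<theta>_def)
  define K where "K = real (card (X ` space M))"
  have K1: "1 \<le> K"
    using X not_empty unfolding K_def by (simp add: Suc_leI card_gt_0_iff simple_functionD)
  define c where "c = ln (K / \<theta>)"
  have c: "0 \<le> c" using \<theta> K1 unfolding c_def by (intro ln_ge_zero) (auto simp: divide_simps)
  define d where "d = e / 2 / (c + 1)"
  have d: "0 < d" "d * c \<le> e / 2"
  proof -
    show "0 < d" using e c by (auto simp: d_def intro!: divide_pos_pos)
    then have "d * c \<le> d * (c + 1)" by simp
    also have "\<dots> = e / 2" unfolding d_def by (rule nonzero_eq_divide_eq[THEN iffD1, OF _ refl]) (use c in simp)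
    finally show "d * c \<le> e / 2" .
  qed
  show ?thesis
  proof (rule that[OF d(1)])
    fix Y :: "'a \<Rightarrow> 'v" assume Y: "simple_function M Y" and le: "prob {x \<in> space M. X x \<noteq> Y x} \<le> d"
    have "ent (\<lambda>x. (X x, Y x)) - ent Y \<le> e / 2 + prob {x \<in> space M. X x \<noteq> Y x} * c"
      using ent_Fano[OF X Y \<theta>(1,2) K_def] \<theta>(3) by (simp add: c_def)
    also have "prob {x \<in> space M. X x \<noteq> Y x} * c \<le> d * c" using le c by (rule mult_right_mono)
    finally show "ent (\<lambda>x. (X x, Y x)) - ent Y \<le> e" using d(2) by simp
  qed
qed

end

section \<open>Itineraries under a measure-preserving map\<close>

locale mpt = prob_space +
  fixes T
  assumes T [measurable]: "T \<in> measurable M M" and invariant: "distr M M T = M"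
begin

lemma simple_function_T: "simple_function M X \<Longrightarrow> simple_function M (\<lambda>x. X (T x))"
proof -
  assume X: "simple_function M X"
  have "(\<lambda>x. X (T x)) -` {v} \<inter> space M = T -` (X -` {v} \<inter> space M) \<inter> space M" for v
    using measurable_space[OF T] by auto
  then have "(\<lambda>x. X (T x)) -` {v} \<inter> space M \<in> sets M" for v
    using measurable_sets[OF T simple_functionD(2)[OF X]] by simp
  moreover have "finite ((\<lambda>x. X (T x)) ` space M)"
    using measurable_space[OF T] simple_functionD(1)[OF X] by (rule_tac finite_subset[of _ "X ` space M"]) auto
  ultimately show ?thesis by (simp add: simple_function_def)
qed

lemma pr_T:
  assumes X: "simple_function M X"
  shows "pr (\<lambda>x. X (T x)) v = pr X v"
proof -
  have "pr X v = measure (distr M M T) (X -` {v} \<inter> space M)" by (simp add: invariant pr_def)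
  also have "\<dots> = prob (T -` (X -` {v} \<inter> space M) \<inter> space M)"
    by (rule measure_distr[OF T simple_functionD(2)[OF X]])
  also have "T -` (X -` {v} \<inter> space M) \<inter> space M = (\<lambda>x. X (T x)) -` {v} \<inter> space M"
    using measurable_space[OF T] by auto
  finally show ?thesis by (simp add: pr_def)
qed

lemma ent_T:
  assumes X: "simple_function M X"
  shows "ent (\<lambda>x. X (T x)) = ent X"
proof -
  have "(\<lambda>x. X (T x)) ` space M \<subseteq> X ` space M" using measurable_space[OF T] by auto
  then show ?thesis
    using ent_eq[OF simple_function_T[OF X], of "X ` space M"] ent_eq[OF X, of "X ` space M"]
    by (simp add: simple_functionD[OF X] pr_T[OF X])
qed

lemma itinerary_Suc: "itinerary T P (Suc n) x = P x # itinerary T P n (T x)"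
  unfolding itinerary_def by (simp only: upt_conv_Cons zero_less_Suc list.map map_Suc_upt[symmetric] map_map)
    (simp add: funpow_swap1 comp_def)

lemma itinerary_Suc_right: "itinerary T P (Suc n) x = itinerary T P n x @ [P ((T ^^ n) x)]"
  unfolding itinerary_def by simp

lemma simple_function_T_pow: "simple_function M X \<Longrightarrow> simple_function M (\<lambda>x. X ((T ^^ n) x))"
proof (induction n arbitrary: X)
  case (Suc n)
  from Suc.IH[OF simple_function_T[OF Suc.prems]] show ?case by simp
qed simp

lemma simple_function_itinerary:
  assumes P: "simple_function M P"
  shows "simple_function M (itinerary T P n)"
proof (induction n)
  case (Suc n)
  have "simple_function M (\<lambda>x. (P x, itinerary T P n (T x)))"
    using P simple_function_T[OF Suc] by (rule simple_function_Pair)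
  from simple_function_compose[OF this, of "\<lambda>(a, b). a # b"] show ?case
    by (simp add: comp_def itinerary_Suc[abs_def])
qed (simp add: itinerary_def[abs_def])

lemma partition_entropy_eq: "partition_entropy M T P n = ent (itinerary T P n)"
  by (simp add: partition_entropy_def ent_def)

text \<open>Strong subadditivity for the first symbol, the last symbol and the block between them;
  by invariance a block has the same entropy at time 0 and at time 1.\<close>

lemma ent_itinerary_concave:
  assumes P: "simple_function M P"
  shows "ent (itinerary T P (n + 2)) + ent (itinerary T P n) \<le> 2 * ent (itinerary T P (n + 1))"
proof -
  note sI = simple_function_itinerary[OF P]
  define X where "X = P"
  define Y where "Y x = P ((T ^^ (n + 1)) x)" for x
  define Z where "Z x = itinerary T P n (T x)" for x
  have s: "simple_function M X" "simple_function M Y" "simple_function M Z"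
    unfolding X_def Y_def Z_def by (rule P, rule simple_function_T_pow[OF P], rule simple_function_T[OF sI])
  have i1: "itinerary T P (Suc n) x = X x # Z x" for x by (simp add: itinerary_Suc X_def Z_def)
  have i2: "itinerary T P (Suc n) (T x) = Z x @ [Y x]" for x
    by (simp add: itinerary_Suc_right Z_def Y_def funpow_swap1)
  have i3: "itinerary T P (Suc (Suc n)) x = X x # Z x @ [Y x]" for x
    using i2[of x] by (simp only: itinerary_Suc[of P "Suc n"] X_def)
  have "ent (itinerary T P (Suc (Suc n))) \<le> ent (\<lambda>x. (X x, Y x, Z x))"
    using s by (intro ent_mono[where f = "\<lambda>(a, b, c). a # c @ [b]"] simple_function_Pair) (auto simp: i3)
  moreover have "ent (\<lambda>x. (X x, Z x)) \<le> ent (itinerary T P (Suc n))"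
    by (rule ent_mono[where f = "\<lambda>l. (hd l, tl l)", OF sI]) (auto simp: i1)
  moreover have "ent (\<lambda>x. (Y x, Z x)) \<le> ent (\<lambda>x. itinerary T P (Suc n) (T x))"
    by (rule ent_mono[where f = "\<lambda>l. (last l, butlast l)", OF simple_function_T[OF sI]]) (auto simp: i2)
  moreover have "ent (\<lambda>x. itinerary T P (Suc n) (T x)) = ent (itinerary T P (Suc n))" by (rule ent_T[OF sI])
  moreover have "ent Z = ent (itinerary T P n)" unfolding Z_def by (rule ent_T[OF sI])
  ultimately show ?thesis using ent_submodular[OF s] by simp
qed

text \<open>\<open>lim\<close> in \<open>ks_entropy\<close> has a meaning only for convergent
  sequences; concavity supplies the convergence.\<close>

lemma itinerary_entropy_limit:
  assumes P: "simple_function M P"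
  shows "(\<lambda>n. partition_entropy M T P n / real n) \<longlonglongrightarrow> lim (\<lambda>n. partition_entropy M T P n / real n)"
    and "lim (\<lambda>n. partition_entropy M T P n / real n) \<le> ent (itinerary T P (m + 1)) - ent (itinerary T P m)"
proof -
  obtain L where L: "(\<lambda>n. ent (itinerary T P n) / real n) \<longlonglongrightarrow> L"
      "\<And>m. L \<le> ent (itinerary T P (m + 1)) - ent (itinerary T P m)"
    using concave_seq_limit[of "\<lambda>n. ent (itinerary T P n)"] ent_itinerary_concave[OF P]
      ent_nonneg[OF simple_function_itinerary[OF P]] by metis
  have "lim (\<lambda>n. partition_entropy M T P n / real n) = L"
    using L(1) by (simp add: partition_entropy_eq limI)
  then show "(\<lambda>n. partition_entropy M T P n / real n) \<longlonglongrightarrow> lim (\<lambda>n. partition_entropy M T P n / real n)"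
    "lim (\<lambda>n. partition_entropy M T P n / real n) \<le> ent (itinerary T P (m + 1)) - ent (itinerary T P m)"
    using L by (auto simp: partition_entropy_eq)
qed

text \<open>The conditional entropy of \<open>P\<close> given \<open>Q\<close> is paid once per time
  step. The induction runs over the joint itinerary, which refines that of \<open>P\<close>.\<close>

lemma ent_itinerary_compare:
  assumes P: "simple_function M P" and Q: "simple_function M Q"
  shows "ent (itinerary T P n) \<le> ent (itinerary T Q n) + real n * (ent (\<lambda>x. (P x, Q x)) - ent Q)"
proof -
  note sP = simple_function_itinerary[OF P] and sQ = simple_function_itinerary[OF Q]
  have "ent (\<lambda>x. (itinerary T P n x, itinerary T Q n x)) \<le>
    ent (itinerary T Q n) + real n * (ent (\<lambda>x. (P x, Q x)) - ent Q)"
  proof (induction n)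
    case 0
    show ?case using ent_mono[OF sQ[of 0], where Y = "\<lambda>x. (itinerary T P 0 x, itinerary T Q 0 x)" and f = "\<lambda>l. ([], [])"]
      by (simp add: itinerary_def[abs_def])
  next
    case (Suc n)
    define p' where "p' x = itinerary T P n (T x)" for x
    define q' where "q' x = itinerary T Q n (T x)" for x
    have s: "simple_function M p'" "simple_function M q'"
      unfolding p'_def q'_def by (intro simple_function_T sP sQ)+
    \<comment> \<open>Conditioning on more lowers entropy: the new symbol of \<open>P\<close> costs
      at most its entropy given the present \<open>Q\<close>, and the old block of \<open>P\<close>
      costs no more once the present \<open>Q\<close> is known as well.\<close>
    have 1: "ent (\<lambda>x. (P x, (p' x, q' x), Q x)) + ent Q \<le> ent (\<lambda>x. (P x, Q x)) + ent (\<lambda>x. ((p' x, q' x), Q x))"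
      by (rule ent_submodular[OF P simple_function_Pair[OF s] Q])
    have 2: "ent (\<lambda>x. (p' x, Q x, q' x)) + ent q' \<le> ent (\<lambda>x. (p' x, q' x)) + ent (\<lambda>x. (Q x, q' x))"
      by (rule ent_submodular[OF s(1) Q s(2)])
    have 3: "ent (\<lambda>x. ((p' x, q' x), Q x)) \<le> ent (\<lambda>x. (p' x, Q x, q' x))"
      using s Q by (intro ent_mono[where f = "\<lambda>(a, b, c). ((a, c), b)"] simple_function_Pair) auto
    have 4: "ent (\<lambda>x. (itinerary T P (Suc n) x, itinerary T Q (Suc n) x)) \<le> ent (\<lambda>x. (P x, (p' x, q' x), Q x))"
      using simple_function_Pair[OF P simple_function_Pair[OF simple_function_Pair[OF s] Q]]
      by (rule ent_mono[where f = "\<lambda>(a, (b, c), d). (a # b, d # c)"]) (auto simp: itinerary_Suc p'_def q'_def)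
    have 5: "ent (\<lambda>x. (Q x, q' x)) \<le> ent (itinerary T Q (Suc n))"
      by (rule ent_mono[where f = "\<lambda>l. (hd l, tl l)", OF sQ]) (auto simp: itinerary_Suc q'_def)
    have 6: "ent (\<lambda>x. (p' x, q' x)) = ent (\<lambda>x. (itinerary T P n x, itinerary T Q n x))"
      unfolding p'_def q'_def using ent_T[OF simple_function_Pair[OF sP sQ]] by simp
    have 7: "ent q' = ent (itinerary T Q n)" unfolding q'_def by (rule ent_T[OF sQ])
    have "real (Suc n) * (ent (\<lambda>x. (P x, Q x)) - ent Q) =
      real n * (ent (\<lambda>x. (P x, Q x)) - ent Q) + (ent (\<lambda>x. (P x, Q x)) - ent Q)" by (simp add: algebra_simps)
    then show ?case using 1 2 3 4 5 6 7 Suc by linarith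
  qed
  moreover have "ent (itinerary T P n) \<le> ent (\<lambda>x. (itinerary T P n x, itinerary T Q n x))"
    by (rule ent_mono[where f = fst, OF simple_function_Pair[OF sP sQ]]) simp
  ultimately show ?thesis by linarith
qed

end

section \<open>Uniqueness of the measure of maximal entropy\<close>

lemma determined_factor:
  assumes "determined A N f"
  obtains g where "\<And>x. x \<in> shift_space A \<Longrightarrow> f x = g (cwin N x)"
proof -
  have "f x = (f \<circ> inv_into (shift_space A) (cwin N)) (cwin N x)" if "x \<in> shift_space A" for x
  proof -
    have "cwin N x \<in> cwin N ` shift_space A" using that by simp
    note i = inv_into_into[OF this] f_inv_into_f[OF this]
    show ?thesis
      using assms[unfolded determined_def, rule_format, OF i(1) that i(2)] by simp
  qed
  then show ?thesis by (rule that)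
qed

lemma sum_edges_from:
  fixes A :: "nat^'k^'k" and f :: "'k \<Rightarrow> real"
  shows "(\<Sum>e | e \<in> edges A \<and> src e = i. f (tgt e)) = (\<Sum>j\<in>UNIV. real (A $ i $ j) * f j)"
proof -
  have eq: "{e. e \<in> edges A \<and> src e = i} = (\<lambda>(j, m). (i, j, m)) ` (SIGMA j:UNIV. {..<A $ i $ j})"
    by (auto simp: edges_def src_def image_iff)
  have "(\<Sum>e | e \<in> edges A \<and> src e = i. f (tgt e)) = (\<Sum>p\<in>(SIGMA j:UNIV. {..<A $ i $ j}). f (fst p))"
    unfolding eq by (subst sum.reindex) (auto simp: inj_on_def tgt_def case_prod_unfold)
  also have "\<dots> = (\<Sum>j\<in>UNIV. \<Sum>m\<in>{..<A $ i $ j}. f j)" by (subst sum.Sigma) (auto simp: case_prod_unfold)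
  finally show ?thesis by simp
qed

lemma sum_edges_to:
  fixes A :: "nat^'k^'k" and f :: "'k \<Rightarrow> real"
  shows "(\<Sum>e | e \<in> edges A \<and> tgt e = j. f (src e)) = (\<Sum>i\<in>UNIV. real (A $ i $ j) * f i)"
proof -
  have eq: "{e. e \<in> edges A \<and> tgt e = j} = (\<lambda>(i, m). (i, j, m)) ` (SIGMA i:UNIV. {..<A $ i $ j})"
    by (auto simp: edges_def tgt_def image_iff)
  have "(\<Sum>e | e \<in> edges A \<and> tgt e = j. f (src e)) = (\<Sum>p\<in>(SIGMA i:UNIV. {..<A $ i $ j}). f (fst p))"
    unfolding eq by (subst sum.reindex) (auto simp: inj_on_def src_def case_prod_unfold)
  also have "\<dots> = (\<Sum>i\<in>UNIV. \<Sum>m\<in>{..<A $ i $ j}. f i)" by (subst sum.Sigma) (auto simp: case_prod_unfold)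
  finally show ?thesis by simp
qed

section \<open>Perron-Frobenius vectors of the edge graph\<close>

locale pf_data =
  fixes A :: "nat^'k^'k" and lam :: real and l r :: "real^'k"
  assumes nondegenerate: "nondegenerate A"
    and irreducible: "\<And>i j. \<exists>w. edge_path A i j w"
    and left: "left_pf_eigenvector A lam l" and right: "right_pf_eigenvector A lam r"
    and normalized: "l \<bullet> r = 1"
begin

lemma l_pos: "0 < l $ i" and r_pos: "0 < r $ i"
  using left right by (auto simp: left_pf_eigenvector_def right_pf_eigenvector_def)

lemma sum_lr: "(\<Sum>i\<in>UNIV. l $ i * r $ i) = 1"
  using normalized by (simp add: inner_vec_def)

lemma right_edges: "(\<Sum>e | e \<in> edges A \<and> src e = i. r $ tgt e) = lam * r $ i"
proof -
  have "(map_matrix real A *v r) $ i = (lam *\<^sub>R r) $ i" using right by (simp add: right_pf_eigenvector_def)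
  then show ?thesis by (simp add: sum_edges_from matrix_vector_mult_def map_matrix_def)
qed

lemma left_edges: "(\<Sum>e | e \<in> edges A \<and> tgt e = j. l $ src e) = lam * l $ j"
proof -
  have "(l v* map_matrix real A) $ j = (lam *\<^sub>R l) $ j" using left by (simp add: left_pf_eigenvector_def)
  then show ?thesis by (simp add: sum_edges_to vector_matrix_mult_def map_matrix_def mult.commute)
qed

lemma lam_pos: "0 < lam"
proof -
  obtain i j where "A $ i $ j \<noteq> 0" using nondegenerate unfolding nondegenerate_def by blast
  then have "(i, j, 0) \<in> {e. e \<in> edges A \<and> src e = i}" by (auto simp: edges_def src_def)
  then have "0 < (\<Sum>e | e \<in> edges A \<and> src e = i. r $ tgt e)"
    using r_pos by (intro sum_pos2[of _ "(i, j, 0)"]) (auto intro: less_imp_le)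
  then show ?thesis using r_pos[of i] by (simp add: right_edges zero_less_mult_iff)
qed

text \<open>For the largest \<open>c\<close> with \<open>y - c l \<ge> 0\<close>, this left eigenvector has a zero entry, hence
  vanishes along all paths into that vertex.\<close>

lemma left_eigenvector_unique:
  fixes y :: "'k \<Rightarrow> real"
  assumes y: "\<And>i. 0 \<le> y i" "\<And>j. (\<Sum>e | e \<in> edges A \<and> tgt e = j. y (src e)) = lam * y j"
  obtains c where "\<And>i. y i = c * l $ i"
proof -
  define c where "c = Min (range (\<lambda>i. y i / l $ i))"
  have "c \<in> range (\<lambda>i. y i / l $ i)" unfolding c_def by (intro Min_in) auto
  then obtain i0 where i0: "c = y i0 / l $ i0" by auto
  define z where "z i = y i - c * l $ i" for i
  have z: "0 \<le> z i" for i
  proof -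
    have "c \<le> y i / l $ i" unfolding c_def by (intro Min_le) auto
    then show ?thesis using l_pos[of i] by (simp add: z_def pos_le_divide_eq)
  qed
  have z0: "z i0 = 0" using l_pos[of i0] by (simp add: z_def i0)
  have ze: "(\<Sum>e | e \<in> edges A \<and> tgt e = j. z (src e)) = lam * z j" for j
    using y(2)[of j] left_edges[of j]
    by (simp add: z_def sum_subtractf sum_distrib_left[symmetric] algebra_simps)
  have step: "z (src e) = 0" if "e \<in> edges A" "z (tgt e) = 0" for e
  proof -
    have fin: "finite {e'. e' \<in> edges A \<and> tgt e' = tgt e}" by (rule finite_subset[OF _ finite_edges[of A]]) auto
    have "(\<Sum>e' | e' \<in> edges A \<and> tgt e' = tgt e. z (src e')) = 0" using ze[of "tgt e"] that by simp
    then have "\<forall>e'\<in>{e'. e' \<in> edges A \<and> tgt e' = tgt e}. z (src e') = 0"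
      using sum_nonneg_eq_0_iff[OF fin, of "\<lambda>e. z (src e)"] z by simp
    then show ?thesis using that by blast
  qed
  have "edge_path A i j w \<Longrightarrow> z j = 0 \<Longrightarrow> z i = 0" for i j w
    by (induction w arbitrary: i) (use step in auto)
  then have "z i = 0" for i using irreducible[of i i0] z0 by blast
  then show ?thesis using that[of c] by (simp add: z_def)
qed

end

section \<open>Invariant measures on the shift space\<close>

locale sft_measure = mpt \<mu> shift for \<mu> :: "'k::finite biseq measure" +
  fixes A :: "nat^'k^'k"
  assumes sets_mu: "sets \<mu> = sets (shift_borel A)"
begin

lemma space_mu: "space \<mu> = shift_space A"
  using sets_eq_imp_space_eq[OF sets_mu] by simp

lemma simple_determined: "determined A N f \<Longrightarrow> simple_function \<mu> f"
  using determined_simple_function sets_mu by blast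

lemma simple_window: "simple_function \<mu> (window a n)"
  using determined_window_ex simple_determined by blast

lemma simple_coord: "simple_function \<mu> (\<lambda>x. x n)"
  by (rule simple_determined[OF determined_coord, of "nat \<bar>n\<bar> + 1"]) auto

lemma window_shift: "window a n (shift x) = window (a + 1) n x"
  by (auto simp: window_def shift_def algebra_simps)

lemma pr_translate:
  fixes X :: "int \<Rightarrow> 'k biseq \<Rightarrow> 'v"
  assumes "\<And>a. simple_function \<mu> (X a)" "\<And>a x. X a (shift x) = X (a + 1) x"
  shows "pr (X a) v = pr (X b) v"
proof -
  have *: "pr (X (a + int k)) v = pr (X a) v" for a k
  proof (induction k)
    case (Suc k)
    have "pr (X (a + int (Suc k))) v = pr (\<lambda>x. X (a + int k) (shift x)) v"
      by (simp add: assms(2) algebra_simps)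
    then show ?case using Suc pr_T[OF assms(1)] by simp
  qed simp
  show ?thesis using *[of a "nat (b - a)"] *[of b "nat (a - b)"] by (cases "a \<le> b") auto
qed

lemma pr_window: "pr (window a n) v = pr (window 0 n) v"
  by (rule pr_translate[of "\<lambda>a. window a n"]) (auto simp: simple_window window_shift)

lemma pr_src: "pr (\<lambda>x. src (x a)) i = pr (\<lambda>x. src (x 0)) i"
  by (rule pr_translate[of "\<lambda>a x. src (x a)"])
    (auto simp: shift_def intro!: simple_function_compose1[OF simple_coord])

lemma ent_window: "ent (window a n) = ent (window 0 n)"
proof -
  have fin: "finite (window a n ` space \<mu> \<union> window 0 n ` space \<mu>)"
    using simple_functionD(1)[OF simple_window] by simp
  show ?thesis using ent_eq[OF simple_window fin, of a n] ent_eq[OF simple_window fin, of 0 n]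
    by (simp add: pr_window[of a])
qed

text \<open>Windows are the itineraries of the partition into edges, without the coding by natural
  numbers; the argument is that of \<open>ent_itinerary_concave\<close>.\<close>

lemma ent_window_concave: "ent (window 0 (n + 2)) + ent (window 0 n) \<le> 2 * ent (window 0 (n + 1))"
proof -
  have s: "simple_function \<mu> (\<lambda>x. x 0)" "simple_function \<mu> (\<lambda>x. x (int n + 1))" "simple_function \<mu> (window 1 n)"
    by (rule simple_coord simple_window)+
  have w2: "window 0 (n + 2) x = x 0 # window 1 n x @ [x (int n + 1)]" for x :: "'k biseq"
    using window_Suc[of 0 "Suc n" x] window_Suc_right[of 1 n x] by (simp add: add.commute)
  have w1: "window 0 (n + 1) x = x 0 # window 1 n x" for x :: "'k biseq"
    using window_Suc[of 0 n x] by simp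
  have w1': "window 1 (n + 1) x = window 1 n x @ [x (int n + 1)]" for x :: "'k biseq"
    using window_Suc_right[of 1 n x] by (simp add: add.commute)
  have "ent (window 0 (n + 2)) \<le> ent (\<lambda>x. (x 0, x (int n + 1), window 1 n x))"
    by (rule ent_mono[OF simple_function_Pair[OF s(1) simple_function_Pair[OF s(2,3)]],
          where f = "\<lambda>(a, b, c). a # c @ [b]"]) (simp only: w2 prod.case)
  moreover have "ent (\<lambda>x. (x 0, window 1 n x)) \<le> ent (window 0 (n + 1))"
    by (rule ent_mono[OF simple_window, where f = "\<lambda>w. (hd w, tl w)"]) (simp only: w1 list.sel)
  moreover have "ent (\<lambda>x. (x (int n + 1), window 1 n x)) \<le> ent (window 1 (n + 1))"
    by (rule ent_mono[OF simple_window, where f = "\<lambda>w. (last w, butlast w)"]) (simp only: w1' last_snoc butlast_snoc)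
  moreover have "ent (window 1 n) = ent (window 0 n)" "ent (window 1 (n + 1)) = ent (window 0 (n + 1))"
    by (rule ent_window)+
  ultimately show ?thesis using ent_submodular[OF s] by linarith
qed

section \<open>Approximation by functions of finitely many coordinates\<close>

definition approximable :: "('k biseq \<Rightarrow> 'b) \<Rightarrow> bool" where
  "approximable X \<longleftrightarrow> simple_function \<mu> X \<and>
     (\<forall>d>0. \<exists>N Y. determined A N Y \<and> prob {x \<in> space \<mu>. X x \<noteq> Y x} \<le> d)"

lemma simple_neq_sets:
  assumes "simple_function \<mu> X" "simple_function \<mu> Y"
  shows "{x \<in> space \<mu>. X x \<noteq> Y x} \<in> events"
proof -
  have "{x \<in> space \<mu>. X x \<noteq> Y x} = (\<lambda>x. (X x, Y x)) -` {(a, b). a \<noteq> b} \<inter> space \<mu>" by auto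
  also have "\<dots> \<in> events" by (rule simple_functionD(2)[OF simple_function_Pair[OF assms]])
  finally show ?thesis .
qed

lemma approximable_compose:
  assumes "approximable X"
  shows "approximable (\<lambda>x. h (X x))"
  unfolding approximable_def
proof (intro conjI allI impI)
  show "simple_function \<mu> (\<lambda>x. h (X x))"
    using assms by (auto simp: approximable_def intro: simple_function_compose1)
  fix d :: real assume "d > 0"
  then obtain N Y where Y: "determined A N Y" "prob {x \<in> space \<mu>. X x \<noteq> Y x} \<le> d"
    using assms unfolding approximable_def by blast
  have "prob {x \<in> space \<mu>. h (X x) \<noteq> h (Y x)} \<le> prob {x \<in> space \<mu>. X x \<noteq> Y x}"
    using assms simple_determined[OF Y(1)]
    by (intro finite_measure_mono simple_neq_sets) (auto simp: approximable_def)
  then show "\<exists>N Z. determined A N Z \<and> prob {x \<in> space \<mu>. h (X x) \<noteq> Z x} \<le> d"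
    using Y determined_comp[OF Y(1), of h] by (intro exI[of _ N] exI[of _ "\<lambda>x. h (Y x)"]) auto
qed

lemma approximable_Pair:
  assumes "approximable X" "approximable X'"
  shows "approximable (\<lambda>x. (X x, X' x))"
  unfolding approximable_def
proof (intro conjI allI impI)
  have s: "simple_function \<mu> X" "simple_function \<mu> X'" using assms by (auto simp: approximable_def)
  show "simple_function \<mu> (\<lambda>x. (X x, X' x))" using s by (rule simple_function_Pair)
  fix d :: real assume "d > 0"
  then have d: "d / 2 > 0" by simp
  obtain N Y where Y: "determined A N Y" "prob {x \<in> space \<mu>. X x \<noteq> Y x} \<le> d / 2"
    using assms(1) d unfolding approximable_def by blast
  obtain N' Y' where Y': "determined A N' Y'" "prob {x \<in> space \<mu>. X' x \<noteq> Y' x} \<le> d / 2"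
    using assms(2) d unfolding approximable_def by blast
  have "determined A (max N N') Y" "determined A (max N N') Y'"
    using determined_mono[OF Y(1)] determined_mono[OF Y'(1)] by auto
  then have "determined A (max N N') (\<lambda>x. (Y x, Y' x))" unfolding determined_def by blast
  moreover have "prob {x \<in> space \<mu>. (X x, X' x) \<noteq> (Y x, Y' x)} \<le> d"
  proof -
    have "prob {x \<in> space \<mu>. (X x, X' x) \<noteq> (Y x, Y' x)} \<le>
      prob ({x \<in> space \<mu>. X x \<noteq> Y x} \<union> {x \<in> space \<mu>. X' x \<noteq> Y' x})"
      using simple_neq_sets[OF s(1) simple_determined[OF Y(1)]] simple_neq_sets[OF s(2) simple_determined[OF Y'(1)]]
      by (intro finite_measure_mono) auto
    also have "\<dots> \<le> prob {x \<in> space \<mu>. X x \<noteq> Y x} + prob {x \<in> space \<mu>. X' x \<noteq> Y' x}"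
      using simple_neq_sets[OF s(1) simple_determined[OF Y(1)]] simple_neq_sets[OF s(2) simple_determined[OF Y'(1)]]
      by (intro measure_Un_le)
    finally show ?thesis using Y(2) Y'(2) by simp
  qed
  ultimately show "\<exists>N Z. determined A N Z \<and> prob {x \<in> space \<mu>. (X x, X' x) \<noteq> Z x} \<le> d" by blast
qed

lemma simple_function_mem: "B \<in> events \<Longrightarrow> simple_function \<mu> (\<lambda>x. x \<in> B)"
proof -
  assume B: "B \<in> events"
  have "(\<lambda>x. x \<in> B) -` {v} \<inter> space \<mu> = (if v then B else space \<mu> - B)" for v
    using sets.sets_into_space[OF B] by (cases v) auto
  then show ?thesis using B by (auto simp: simple_function_def)
qed

text \<open>Induction over the generated sigma-algebra. For a countable union, the finite partial
  unions exhaust it up to small measure by continuity from below, and each of them is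
  approximable.\<close>

lemma approximable_set: "B \<in> events \<Longrightarrow> approximable (\<lambda>x. x \<in> B)"
proof -
  assume "B \<in> events"
  then have "B \<in> sigma_sets (shift_space A) (cylinder_sets A)"
    by (simp add: sets_mu sets_shift_borel_cylinder)
  then show ?thesis
  proof (induction rule: sigma_sets.induct)
    case (Basic B)
    then obtain N S where B: "B = {x \<in> shift_space A. cwin N x \<in> S}" by (auto simp: cylinder_sets_def)
    have dt: "determined A N (\<lambda>x. x \<in> B)" unfolding determined_def B by auto
    show ?case unfolding approximable_def
      using dt simple_determined[OF dt] by (intro conjI allI impI exI[of _ N] exI[of _ "\<lambda>x. x \<in> B"]) auto
  next
    case Empty
    have dt: "determined A 0 (\<lambda>x. x \<in> {})" unfolding determined_def by auto
    show ?case unfolding approximable_def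
      using dt simple_determined[OF dt] by (intro conjI allI impI exI[of _ 0] exI[of _ "\<lambda>x. x \<in> {}"]) auto
  next
    case (Compl B)
    have B: "B \<in> events" using Compl(1) by (simp add: sets_mu sets_shift_borel_cylinder)
    have s: "simple_function \<mu> (\<lambda>x. x \<in> shift_space A - B)"
      using B by (intro simple_function_mem) (auto simp: space_mu[symmetric])
    show ?case unfolding approximable_def
    proof (intro conjI allI impI s)
      fix d :: real assume "d > 0"
      then obtain N Y where Y: "determined A N Y" "prob {x \<in> space \<mu>. (x \<notin> B) \<noteq> Y x} \<le> d"
        using approximable_compose[OF Compl(2), of Not] unfolding approximable_def by blast
      have "{x \<in> space \<mu>. (x \<in> shift_space A - B) \<noteq> Y x} = {x \<in> space \<mu>. (x \<notin> B) \<noteq> Y x}" by (auto simp: space_mu)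
      then show "\<exists>N Y. determined A N Y \<and> prob {x \<in> space \<mu>. (x \<in> shift_space A - B) \<noteq> Y x} \<le> d"
        using Y by (intro exI[of _ N] exI[of _ Y]) simp
    qed
  next
    case (Union B)
    have B: "B i \<in> events" for i using Union(1) by (simp add: sets_mu sets_shift_borel_cylinder)
    define C where "C n = (\<Union>i<n. B i)" for n :: nat
    have C: "C n \<in> events" for n using B by (auto simp: C_def)
    have appC: "approximable (\<lambda>x. x \<in> C n)" for n
    proof (induction n)
      case 0
      have dt: "determined A 0 (\<lambda>x. x \<in> C 0)" unfolding determined_def C_def by auto
      show ?case unfolding approximable_def
        using dt simple_determined[OF dt] by (intro conjI allI impI exI[of _ 0] exI[of _ "\<lambda>x. x \<in> C 0"]) auto
    next
      case (Suc n)
      have "(\<lambda>x. x \<in> C (Suc n)) = (\<lambda>x. (\<lambda>(a, b). a \<or> b) (x \<in> C n, x \<in> B n))"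
        by (auto simp: C_def lessThan_Suc)
      then show ?case using approximable_compose[OF approximable_Pair[OF Suc Union(2)[of n]], of "\<lambda>(a, b). a \<or> b"] by simp
    qed
    have lim: "(\<lambda>n. prob (C n)) \<longlonglongrightarrow> prob (\<Union>n. C n)"
      using C by (intro finite_Lim_measure_incseq) (force simp: incseq_def C_def)+
    have un: "(\<Union>n. C n) = \<Union> (range B)" by (auto simp: C_def)
    have UB: "\<Union> (range B) \<in> events" using B by auto
    show ?case unfolding approximable_def
    proof (intro conjI allI impI)
      show "simple_function \<mu> (\<lambda>x. x \<in> \<Union> (range B))" using UB by (rule simple_function_mem)
      fix d :: real assume "d > 0"
      then have d: "d / 2 > 0" by simp
      obtain n where n: "\<bar>prob (C n) - prob (\<Union> (range B))\<bar> < d / 2"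
        using LIMSEQ_D[OF lim d] by (auto simp: un)
      obtain N Y where Y: "determined A N Y" "prob {x \<in> space \<mu>. (x \<in> C n) \<noteq> Y x} \<le> d / 2"
        using appC[of n] d unfolding approximable_def by blast
      have sub: "C n \<subseteq> \<Union> (range B)" by (auto simp: C_def)
      have ev: "{x \<in> space \<mu>. (x \<in> C n) \<noteq> Y x} \<in> events"
        using simple_neq_sets[OF simple_function_mem[OF C] simple_determined[OF Y(1)]] .
      have "prob {x \<in> space \<mu>. (x \<in> \<Union> (range B)) \<noteq> Y x} \<le>
        prob ((\<Union> (range B) - C n) \<union> {x \<in> space \<mu>. (x \<in> C n) \<noteq> Y x})"
        using ev UB C sub by (intro finite_measure_mono) auto
      also have "\<dots> \<le> prob (\<Union> (range B) - C n) + prob {x \<in> space \<mu>. (x \<in> C n) \<noteq> Y x}"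
        using ev UB C by (intro measure_Un_le) auto
      also have "prob (\<Union> (range B) - C n) = prob (\<Union> (range B)) - prob (C n)"
        using UB C by (intro finite_measure_Diff) (auto simp: C_def)
      finally have "prob {x \<in> space \<mu>. (x \<in> \<Union> (range B)) \<noteq> Y x} \<le> d"
        using Y(2) n by linarith
      then show "\<exists>N Y. determined A N Y \<and> prob {x \<in> space \<mu>. (x \<in> \<Union> (range B)) \<noteq> Y x} \<le> d"
        using Y(1) by (intro exI[of _ N] exI[of _ Y] conjI)
    qed
  qed
qed

text \<open>The values carry no structure, so \<open>X x\<close> is encoded as a singleton set of
  values; this set is assembled one value at a time from the approximable fibres and decoded with
  \<open>the_elem\<close>.\<close>

lemma simple_approximable:
  assumes X: "simple_function \<mu> X"
  shows "approximable X"
proof -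
  have *: "approximable (\<lambda>x. {v \<in> V. X x = v \<and> x \<in> space \<mu>})" if "finite V" for V
    using that
  proof (induction V)
    case empty
    have dt: "determined A 0 (\<lambda>x. {} :: 'a set)" unfolding determined_def by auto
    show ?case unfolding approximable_def
      using dt simple_determined[OF dt] by (intro conjI allI impI exI[of _ 0] exI[of _ "\<lambda>x. {}"]) auto
  next
    case (insert u V)
    let ?h = "\<lambda>(a, b). (if a then insert u b else b)"
    have "approximable (\<lambda>x. x \<in> X -` {u} \<inter> space \<mu>)" by (rule approximable_set[OF simple_functionD(2)[OF X]])
    from approximable_compose[OF approximable_Pair[OF this insert(3)], of ?h]
    have "approximable (\<lambda>x. ?h (x \<in> X -` {u} \<inter> space \<mu>, {v \<in> V. X x = v \<and> x \<in> space \<mu>}))" .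
    moreover have "(\<lambda>x. ?h (x \<in> X -` {u} \<inter> space \<mu>, {v \<in> V. X x = v \<and> x \<in> space \<mu>})) =
        (\<lambda>x. {v \<in> insert u V. X x = v \<and> x \<in> space \<mu>})" by (rule ext) auto
    ultimately show ?case by simp
  qed
  have "approximable (\<lambda>x. the_elem {v \<in> X ` space \<mu>. X x = v \<and> x \<in> space \<mu>})"
    by (rule approximable_compose[OF *[OF simple_functionD(1)[OF X]]])
  moreover have eq: "the_elem {v \<in> X ` space \<mu>. X x = v \<and> x \<in> space \<mu>} = X x" if "x \<in> space \<mu>" for x
  proof -
    have "{v \<in> X ` space \<mu>. X x = v \<and> x \<in> space \<mu>} = {X x}" using that by auto
    then show ?thesis by simp
  qed
  ultimately show ?thesis
    unfolding approximable_def using X by (simp add: eq cong: conj_cong)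
qed

text \<open>Replacing \<open>P\<close> by a locally constant \<open>Q\<close> close to it costs at
  most \<open>e\<close> per step. The itinerary of \<open>Q\<close> of length \<open>n\<close> is
  read off a window of length \<open>n + 2 * N\<close>, whose entropy grows at most linearly with
  the increment at \<open>m\<close> as slope; the extra \<open>2 * N\<close> disappears in the
  limit.\<close>

lemma ks_limit_le:
  assumes P: "simple_function \<mu> P"
  shows "lim (\<lambda>n. partition_entropy \<mu> shift P n / real n) \<le> ent (window 0 (m + 1)) - ent (window 0 m)"
proof (rule field_le_epsilon)
  fix e :: real assume e: "e > 0"
  define d where "d = ent (window 0 (m + 1)) - ent (window 0 m)"
  obtain \<delta> where \<delta>: "\<delta> > 0" "\<And>Y. simple_function \<mu> Y \<Longrightarrow> prob {x \<in> space \<mu>. P x \<noteq> Y x} \<le> \<delta> \<Longrightarrow>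
    ent (\<lambda>x. (P x, Y x)) - ent Y \<le> e"
    by (rule ent_close[OF P e]) (rule that)
  obtain N Q where Q: "determined A N Q" "prob {x \<in> space \<mu>. P x \<noteq> Q x} \<le> \<delta>"
    using simple_approximable[OF P] \<delta>(1) unfolding approximable_def by blast
  note sQ = simple_determined[OF Q(1)]
  obtain g where g: "\<And>x. x \<in> shift_space A \<Longrightarrow> Q x = g (cwin N x)" 
    by (rule determined_factor[OF Q(1)]) (rule that)
  have 1: "ent (itinerary shift P n) \<le> ent (itinerary shift Q n) + real n * e" for n
    using ent_itinerary_compare[OF P sQ, of n] mult_left_mono[OF \<delta>(2)[OF sQ Q(2)], of "real n"] by simp
  have 2: "ent (itinerary shift Q n) \<le> ent (window (1 - int N) (n + 2 * N))" for n
  proof (rule ent_mono[OF simple_window])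
    fix x assume "x \<in> space \<mu>"
    then have sx: "(shift ^^ k) x \<in> shift_space A" for k
      by (auto simp: space_mu shift_pow shift_space_def algebra_simps)
    have "cwin N ((shift ^^ k) x) = take (2 * N) (drop k (window (1 - int N) (n + 2 * N) x))" if "k < n" for k
      using that by (auto simp: list_eq_iff_nth_eq cwin_def window_nth shift_pow algebra_simps)
    then show "itinerary shift Q n x = map (\<lambda>k. g (take (2 * N) (drop k (window (1 - int N) (n + 2 * N) x)))) [0..<n]"
      unfolding itinerary_def by (simp add: g[OF sx])
  qed
  have 3: "partition_entropy \<mu> shift P n / real n \<le> (ent (window 0 m) + (2 * real N - real m) * d) / real n + (d + e)"
    if n: "n \<ge> m + 1" for n
  proof -
    have "ent (window (1 - int N) (n + 2 * N)) = ent (window 0 (m + (n + 2 * N - m)))"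
      using n ent_window[of "1 - int N" "n + 2 * N"] by simp
    also have "\<dots> \<le> ent (window 0 m) + real (n + 2 * N - m) * d"
      unfolding d_def by (rule concave_seq_upper[OF ent_window_concave])
    also have "real (n + 2 * N - m) = real n + (2 * real N - real m)" using n by (simp add: of_nat_diff)
    finally have "ent (itinerary shift P n) \<le> (ent (window 0 m) + (2 * real N - real m) * d) + (d + e) * real n"
      using 1[of n] 2[of n] by (simp add: algebra_simps)
    then have "ent (itinerary shift P n) / real n \<le> ((ent (window 0 m) + (2 * real N - real m) * d) + (d + e) * real n) / real n"
      by (rule divide_right_mono) simp
    then show ?thesis using n by (simp add: partition_entropy_eq add_divide_distrib)
  qed
  have "lim (\<lambda>n. partition_entropy \<mu> shift P n / real n) \<le> 0 + (d + e)"
  proof (rule tendsto_le[OF _ _ itinerary_entropy_limit(1)[OF P]])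
    show "(\<lambda>n. (ent (window 0 m) + (2 * real N - real m) * d) / real n + (d + e)) \<longlonglongrightarrow> 0 + (d + e)"
      by (intro tendsto_intros lim_const_over_n)
    show "\<forall>\<^sub>F n in sequentially. partition_entropy \<mu> shift P n / real n \<le>
        (ent (window 0 m) + (2 * real N - real m) * d) / real n + (d + e)"
      unfolding eventually_sequentially using 3 by blast
  qed simp
  then show "lim (\<lambda>n. partition_entropy \<mu> shift P n / real n) \<le> ent (window 0 (m + 1)) - ent (window 0 m) + e"
    by (simp add: d_def)
qed

lemma ks_entropy_le: "ks_entropy \<mu> shift \<le> ereal (ent (window 0 (m + 1)) - ent (window 0 m))"
  unfolding ks_entropy_def
proof (rule SUP_least)
  fix P :: "'k biseq \<Rightarrow> nat" assume "P \<in> {P. simple_function \<mu> P}"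
  then have "simple_function \<mu> P" by simp
  from ks_limit_le[OF this, of m]
  show "ereal (lim (\<lambda>n. partition_entropy \<mu> shift P n / real n)) \<le> ereal (ent (window 0 (m + 1)) - ent (window 0 m))"
    by simp
qed

end


section \<open>The entropy bound and the case of equality\<close>

locale pf_measure = pf_data A lam l r + sft_measure \<mu> A
  for A :: "nat^'k::finite^'k" and lam l r \<mu>
begin

lemma expectation_src:
  fixes f :: "'k \<Rightarrow> real"
  shows "expectation (\<lambda>x. f (src (x a))) = expectation (\<lambda>x. f (src (x 0)))"
proof -
  have s: "simple_function \<mu> (\<lambda>x. src (x a))" for a
    by (rule simple_function_compose1[OF simple_coord])
  show ?thesis
    using sum_pr[OF s finite_class.finite_UNIV subset_UNIV, of a f] sum_pr[OF s finite_class.finite_UNIV subset_UNIV, of 0 f]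
    by (simp add: pr_src[of a])
qed

text \<open>The comparison law prolongs a block by an edge \<open>e\<close> with probability
  \<open>r $ tgt e / (lam * r $ src e)\<close>. The logarithm of this is a difference of vertex
  terms minus \<open>ln lam\<close>; by invariance the vertex terms have equal expectations and
  cancel. Blocks are nonempty because their last edge fixes the vertex from which to
  continue.\<close>

lemma entropy_increment:
  assumes m: "m \<ge> 1"
  shows "ent (window 0 (m + 1)) - ent (window 0 m) \<le> ln lam" (is ?le)
    and "ln lam \<le> ent (window 0 (m + 1)) - ent (window 0 m) \<Longrightarrow> x \<in> space \<mu> \<Longrightarrow>
      pr (window 0 (m + 1)) (window 0 (m + 1) x) =
      pr (window 0 m) (window 0 m x) * (r $ tgt (x (int m)) / (lam * r $ src (x (int m))))"
proof -
  define V where "V = window 0 (m + 1) ` space \<mu>"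
  define P where "P e = r $ tgt e / (lam * r $ src e)" for e
  define q where "q v = pr (window 0 m) (butlast v) * P (last v)" for v
  have P0: "0 < P e" for e using r_pos lam_pos by (simp add: P_def)
  note s = simple_window[of 0 "m + 1"] and s' = simple_window[of 0 m]
  have V: "finite V" "window 0 (m + 1) ` space \<mu> \<subseteq> V"
    unfolding V_def using simple_functionD(1)[OF s] by auto
  have w: "window 0 (m + 1) x = window 0 m x @ [x (int m)]" for x :: "'k biseq"
    using window_Suc_right[of 0 m x] by simp
  have lastw: "last (window 0 m x) = x (int m - 1)" for x :: "'k biseq"
    using m window_Suc_right[of 0 "m - 1" x] by (simp add: of_nat_diff)
  have ac: "pr (window 0 (m + 1)) v = 0" if "q v = 0" for v
  proof -
    have "pr (window 0 m) (butlast v) = 0" using that P0[of "last v"] by (simp add: q_def)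
    moreover have "pr (window 0 (m + 1)) v \<le> pr (window 0 m) (butlast v)"
      unfolding pr_def using simple_functionD(2)[OF s'] by (intro finite_measure_mono) (auto simp: w[simplified])
    ultimately show ?thesis using pr_nonneg[of "window 0 (m + 1)" v] by linarith
  qed
  \<comment> \<open>All one-edge prolongations of occurring blocks; the total of \<open>q\<close>
    over them is exactly 1, by the eigenvector equation at the last vertex.\<close>
  define U where "U = (SIGMA u:window 0 m ` space \<mu>. {e. e \<in> edges A \<and> src e = tgt (last u)})"
  have fin: "finite (window 0 m ` space \<mu>)" using simple_functionD(1)[OF s'] .
  have fine: "finite {e. e \<in> edges A \<and> src e = i}" for i by (rule finite_subset[OF _ finite_edges[of A]]) auto
  have "sum q V \<le> (\<Sum>(u, e)\<in>U. q (u @ [e]))"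
  proof -
    have "V \<subseteq> (\<lambda>(u, e). u @ [e]) ` U"
    proof
      fix v assume "v \<in> V"
      then obtain x where x: "x \<in> space \<mu>" "v = window 0 (m + 1) x" by (auto simp: V_def)
      have "x (int m) \<in> edges A" "src (x (int m)) = tgt (x (int m - 1))"
        using x shift_spaceD[of x A] shift_spaceD(2)[of x A "int m - 1"] by (auto simp: space_mu)
      then have "(window 0 m x, x (int m)) \<in> U" using x by (auto simp: U_def lastw)
      then show "v \<in> (\<lambda>(u, e). u @ [e]) ` U" using x w by (force intro!: image_eqI[of _ _ "(window 0 m x, x (int m))"])
    qed
    then have "sum q V \<le> sum q ((\<lambda>(u, e). u @ [e]) ` U)"
      using fin fine P0 by (intro sum_mono2) (auto simp: U_def q_def less_imp_le)
    also have "\<dots> = (\<Sum>(u, e)\<in>U. q (u @ [e]))"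
      by (subst sum.reindex) (auto simp: inj_on_def case_prod_unfold)
    finally show ?thesis .
  qed
  also have "\<dots> = (\<Sum>u\<in>window 0 m ` space \<mu>. \<Sum>e | e \<in> edges A \<and> src e = tgt (last u). q (u @ [e]))"
    unfolding U_def using fin fine by (intro sum.Sigma[symmetric]) auto
  also have "\<dots> = (\<Sum>u\<in>window 0 m ` space \<mu>. pr (window 0 m) u)"
  proof (intro sum.cong refl)
    fix u
    have "(\<Sum>e | e \<in> edges A \<and> src e = tgt (last u). q (u @ [e])) =
      (\<Sum>e | e \<in> edges A \<and> src e = tgt (last u). pr (window 0 m) u / (lam * r $ tgt (last u)) * (r $ tgt e))"
      by (intro sum.cong) (auto simp: q_def P_def)
    also have "\<dots> = pr (window 0 m) u / (lam * r $ tgt (last u)) * (lam * r $ tgt (last u))"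
      by (simp only: sum_distrib_left[symmetric] right_edges)
    also have "\<dots> = pr (window 0 m) u" using lam_pos r_pos[of "tgt (last u)"] by simp
    finally show "(\<Sum>e | e \<in> edges A \<and> src e = tgt (last u). q (u @ [e])) = pr (window 0 m) u" .
  qed
  also have "\<dots> = 1" by (rule sum_pr_1[OF s' fin order_refl])
  also have "1 = (\<Sum>v\<in>V. pr (window 0 (m + 1)) v)" using sum_pr_1[OF s V] by simp
  finally have le: "sum q V \<le> (\<Sum>v\<in>V. pr (window 0 (m + 1)) v)" .
  have q0: "0 \<le> q v" for v using P0[of "last v"] by (simp add: q_def)
  have G1: "(\<Sum>v\<in>V. pr (window 0 (m + 1)) v * ln (q v)) \<le> (\<Sum>v\<in>V. pr (window 0 (m + 1)) v * ln (pr (window 0 (m + 1)) v))"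
    by (rule Gibbs_inequality(1)[OF V(1) _ _ _ le]) (simp_all only: q0 ac pr_nonneg)
  have G2: "pr (window 0 (m + 1)) v = q v"
    if "(\<Sum>v\<in>V. pr (window 0 (m + 1)) v * ln (q v)) = (\<Sum>v\<in>V. pr (window 0 (m + 1)) v * ln (pr (window 0 (m + 1)) v))" "v \<in> V" for v
    by (rule Gibbs_inequality(2)[OF V(1) _ _ _ le that]) (simp_all only: q0 ac pr_nonneg)
  have "(\<Sum>v\<in>V. pr (window 0 (m + 1)) v * ln (q v)) =
      (\<Sum>v\<in>V. pr (window 0 (m + 1)) v * ln (pr (window 0 m) (butlast v)) + pr (window 0 (m + 1)) v * ln (P (last v)))"
  proof (intro sum.cong refl)
    fix v
    show "pr (window 0 (m + 1)) v * ln (q v) =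
      pr (window 0 (m + 1)) v * ln (pr (window 0 m) (butlast v)) + pr (window 0 (m + 1)) v * ln (P (last v))"
    proof (cases "q v = 0")
      case True
      then show ?thesis using ac[OF True] by simp
    next
      case False
      then have "0 < pr (window 0 m) (butlast v)"
        using pr_nonneg[of "window 0 m" "butlast v"] by (auto simp: q_def less_le)
      then show ?thesis using P0[of "last v"] by (simp add: q_def ln_mult algebra_simps)
    qed
  qed
  also have "\<dots> = expectation (\<lambda>x. ln (pr (window 0 m) (butlast (window 0 (m + 1) x)))) +
      expectation (\<lambda>x. ln (P (last (window 0 (m + 1) x))))"
    using sum_pr[OF s V, of "\<lambda>v. ln (pr (window 0 m) (butlast v))"] sum_pr[OF s V, of "\<lambda>v. ln (P (last v))"]
    by (simp add: sum.distrib)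
  also have "\<dots> = expectation (\<lambda>x. ln (pr (window 0 m) (window 0 m x))) + expectation (\<lambda>x. ln (P (x (int m))))"
    by (simp only: w butlast_snoc last_snoc)
  also have "expectation (\<lambda>x. ln (pr (window 0 m) (window 0 m x))) = - ent (window 0 m)"
    using ent_eq_expectation[OF s'] by simp
  also have "expectation (\<lambda>x. ln (P (x (int m)))) = - ln lam"
  proof -
    have "expectation (\<lambda>x. ln (P (x (int m)))) =
      expectation (\<lambda>x. ln (r $ src (x (int m + 1))) - ln (r $ src (x (int m))) - ln lam)"
    proof (intro expectation_cong)
      fix x assume "x \<in> space \<mu>"
      then have "tgt (x (int m)) = src (x (int m + 1))" by (auto simp: space_mu shift_spaceD)
      then show "ln (P (x (int m))) = ln (r $ src (x (int m + 1))) - ln (r $ src (x (int m))) - ln lam"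
        using r_pos[of "src (x (int m + 1))"] r_pos[of "src (x (int m))"] lam_pos by (simp add: P_def ln_div ln_mult)
    qed
    also have "\<dots> = expectation (\<lambda>x. ln (r $ src (x (int m + 1)))) - expectation (\<lambda>x. ln (r $ src (x (int m)))) - ln lam"
    proof -
      have i: "integrable \<mu> (\<lambda>x. ln (r $ src (x a)))" for a
        by (intro integrable_simple_function simple_function_compose1[OF simple_coord])
          (auto simp: emeasure_eq_measure)
      show ?thesis using i by (simp add: prob_space)
    qed
    also have "\<dots> = - ln lam" by (simp add: expectation_src[of "\<lambda>i. ln (r $ i)" "int m + 1"] expectation_src[of "\<lambda>i. ln (r $ i)" "int m"])
    finally show ?thesis .
  qed
  finally have e: "(\<Sum>v\<in>V. pr (window 0 (m + 1)) v * ln (q v)) = - ent (window 0 m) - ln lam" by simp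
  have e': "(\<Sum>v\<in>V. pr (window 0 (m + 1)) v * ln (pr (window 0 (m + 1)) v)) = - ent (window 0 (m + 1))"
    using ent_eq[OF s V] by simp
  show ?le using G1 e e' by simp
  assume "ln lam \<le> ent (window 0 (m + 1)) - ent (window 0 m)" and x: "x \<in> space \<mu>"
  then have "(\<Sum>v\<in>V. pr (window 0 (m + 1)) v * ln (q v)) = (\<Sum>v\<in>V. pr (window 0 (m + 1)) v * ln (pr (window 0 (m + 1)) v))"
    using G1 e e' by simp
  from G2[OF this, of "window 0 (m + 1) x"] x
  have "pr (window 0 (m + 1)) (window 0 (m + 1) x) = q (window 0 (m + 1) x)" by (simp add: V_def)
  also have "q (window 0 (m + 1) x) = pr (window 0 m) (window 0 m x) * P (x (int m))"
    unfolding q_def by (simp only: w butlast_snoc last_snoc)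
  finally show "pr (window 0 (m + 1)) (window 0 (m + 1) x) =
      pr (window 0 m) (window 0 m x) * (r $ tgt (x (int m)) / (lam * r $ src (x (int m))))"
    by (simp only: P_def)
qed

text \<open>All increments are squeezed to equality, so the measure is a Markov chain with the Parry
  transitions. Stationarity makes the vertex law divided by \<open>r\<close> a left eigenvector; by
  uniqueness it is a multiple of \<open>l\<close>, and total mass 1 fixes the multiple.\<close>

lemma maximal_entropy_prob:
  assumes ks: "ereal (ln lam) \<le> ks_entropy \<mu> shift"
  shows "edge_path A i j w \<Longrightarrow> w \<noteq> [] \<Longrightarrow> pr (window a (length w)) w = l $ i * r $ j / lam ^ length w"
    and "pr (\<lambda>x. src (x a)) i = l $ i * r $ i"
proof -
  define P where "P e = r $ tgt e / (lam * r $ src e)" for e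
  have inc: "ln lam \<le> ent (window 0 (m + 1)) - ent (window 0 m)" for m
    using order_trans[OF ks ks_entropy_le[of m]] by simp
  have step: "pr (window 0 (m + 1)) (window 0 (m + 1) x) = pr (window 0 m) (window 0 m x) * P (x (int m))"
    if "m \<ge> 1" "x \<in> space \<mu>" for m x
    unfolding P_def by (rule entropy_increment(2)[OF that(1) inc that(2)])
  define \<pi> where "\<pi> i = pr (\<lambda>x. src (x 0)) i" for i
  have img: "(\<lambda>x. x 0) ` space \<mu> \<subseteq> edges A" by (auto simp: space_mu shift_spaceD)
  have tgt_sum: "(\<Sum>e | e \<in> edges A \<and> tgt e = j. pr (\<lambda>x. x 0) e) = \<pi> j" for j
  proof -
    have "(\<Sum>e | e \<in> edges A \<and> tgt e = j. pr (\<lambda>x. x 0) e) = (\<Sum>e\<in>edges A. pr (\<lambda>x. x 0) e * (if tgt e = j then 1 else 0))"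
      by (intro sum.mono_neutral_cong_left) auto
    also have "\<dots> = expectation (\<lambda>x. if tgt (x 0) = j then 1 else 0)"
      by (rule sum_pr[OF simple_coord finite_edges img])
    also have "\<dots> = expectation (\<lambda>x. (\<lambda>i. if i = j then 1 else 0) (src (x 1)))"
      using shift_spaceD(2)[of _ A 0] by (intro expectation_cong) (simp add: space_mu)
    also have "\<dots> = expectation (\<lambda>x. (\<lambda>i. if i = j then 1 else 0) (src (x 0)))"
      by (rule expectation_src)
    also have "\<dots> = (\<Sum>i\<in>UNIV. pr (\<lambda>x. src (x 0)) i * (if i = j then 1 else 0))"
      by (rule sum_pr[symmetric]) (auto intro: simple_function_compose1[OF simple_coord])
    also have "\<dots> = \<pi> j" by (simp add: \<pi>_def if_distrib[where f = "\<lambda>u. _ * u"] cong: if_cong)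
    finally show ?thesis .
  qed
  have pr1: "pr (window 0 1) [e] = pr (\<lambda>x. x 0) e" for e :: "'k edge"
    by (rule pr_cong) (simp add: window_def)
  \<comment> \<open>The transition law is available only after at least one edge, so the law of a
    single edge is found by summing over the preceding edge and using invariance.\<close>
  have one: "pr (\<lambda>x. x 0) e = \<pi> (src e) * P e" if e: "e \<in> edges A" for e
  proof -
    have two: "pr (\<lambda>x. (x 0, x 1)) (e', e) = (if e' \<in> edges A \<and> tgt e' = src e then pr (\<lambda>x. x 0) e' * P e else 0)" for e'
    proof (cases "e' \<in> edges A \<and> tgt e' = src e")
      case True
      then have "edge_path A (src e') (tgt e) [e', e]" using e by simp
      then obtain x where x: "x \<in> shift_space A" "window 0 (length [e', e]) x = [e', e]"
        using shift_space_extend[OF nondegenerate] by blast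
      then have xe: "x 0 = e'" "x 1 = e" by (auto simp: window_def)
      have "pr (\<lambda>x. (x 0, x 1)) (e', e) = pr (window 0 (1 + 1)) (window 0 (1 + 1) x)"
        by (rule pr_cong) (auto simp: window_def xe)
      also have "\<dots> = pr (window 0 1) (window 0 1 x) * P (x 1)" using step[of 1 x] x by (simp add: space_mu)
      also have "window 0 1 x = [e']" by (simp add: window_def xe)
      finally show ?thesis using True pr1[of e'] by (simp add: xe)
    next
      case False
      have "(\<lambda>x. (x 0, x 1)) -` {(e', e)} \<inter> space \<mu> = {}"
      proof (rule equals0I)
        fix x assume "x \<in> (\<lambda>x. (x 0, x 1)) -` {(e', e)} \<inter> space \<mu>"
        then have "x \<in> shift_space A" "x 0 = e'" "x 1 = e" by (simp_all add: space_mu)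
        then show False using False shift_spaceD[of x A 0] by simp
      qed
      then have "pr (\<lambda>x. (x 0, x 1)) (e', e) = 0" by (simp add: pr_def)
      then show ?thesis by (simp only: if_not_P[OF False])
    qed
    have "pr (\<lambda>x. x 0) e = pr (\<lambda>x. x 1) e"
      by (rule pr_translate[of "\<lambda>a x. x a"]) (auto simp: simple_coord shift_def)
    also have "\<dots> = (\<Sum>e'\<in>(\<lambda>x. x 0) ` space \<mu>. pr (\<lambda>x. (x 0, x 1)) (e', e))"
      by (rule sum_pr_marginal[symmetric, OF simple_coord simple_coord])
    also have "\<dots> = (\<Sum>e'\<in>edges A. pr (\<lambda>x. (x 0, x 1)) (e', e))"
      using img by (intro sum.mono_neutral_left) (auto intro!: pr_outside)
    also have "\<dots> = (\<Sum>e' | e' \<in> edges A \<and> tgt e' = src e. pr (\<lambda>x. x 0) e' * P e)"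
      by (intro sum.mono_neutral_cong_right) (auto simp: two)
    also have "\<dots> = \<pi> (src e) * P e" by (simp only: sum_distrib_right[symmetric] tgt_sum)
    finally show ?thesis .
  qed
  have "\<exists>c. \<forall>i. \<pi> i / r $ i = c * l $ i"
  proof (rule left_eigenvector_unique[of "\<lambda>i. \<pi> i / r $ i"])
    show "0 \<le> \<pi> i / r $ i" for i using r_pos[of i] by (simp add: \<pi>_def)
    show "(\<Sum>e | e \<in> edges A \<and> tgt e = j. \<pi> (src e) / r $ src e) = lam * (\<pi> j / r $ j)" for j
    proof -
      have "\<pi> j = (\<Sum>e | e \<in> edges A \<and> tgt e = j. \<pi> (src e) / r $ src e * (r $ j / lam))"
        unfolding tgt_sum[symmetric, of j] by (intro sum.cong refl) (auto simp: one P_def)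
      also have "\<dots> = (\<Sum>e | e \<in> edges A \<and> tgt e = j. \<pi> (src e) / r $ src e) * (r $ j / lam)"
        by (simp only: sum_distrib_right)
      finally show ?thesis using lam_pos r_pos[of j] by (simp add: field_simps)
    qed
  qed blast
  then obtain c where c: "\<And>i. \<pi> i / r $ i = c * l $ i" by blast
  have c': "\<pi> i = c * (l $ i * r $ i)" for i using c[of i] r_pos[of i] by (simp add: field_simps)
  have "(\<Sum>i\<in>UNIV. \<pi> i) = 1"
    unfolding \<pi>_def by (rule sum_pr_1) (auto intro: simple_function_compose1[OF simple_coord])
  then have "c = 1" by (simp add: c' sum_distrib_left[symmetric] sum_lr)
  then have \<pi>: "\<pi> i = l $ i * r $ i" for i using c' by simp
  then show "pr (\<lambda>x. src (x a)) i = l $ i * r $ i" by (simp add: pr_src[of a] \<pi>_def)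
  have main: "edge_path A i j w \<Longrightarrow> w \<noteq> [] \<Longrightarrow> pr (window 0 (length w)) w = l $ i * r $ j / lam ^ length w" for i j w
  proof (induction w arbitrary: j rule: rev_induct)
    case (snoc e w)
    obtain k where k: "edge_path A i k w" "e \<in> edges A" "src e = k" "tgt e = j"
      using snoc.prems(1) by (auto simp: edge_path_append)
    show ?case
    proof (cases "w = []")
      case True
      then show ?thesis using k one[OF k(2)] lam_pos r_pos[of k] pr1[of e]
        by (auto simp: \<pi> P_def)
    next
      case False
      obtain x where x: "x \<in> shift_space A" "window 0 (length (w @ [e])) x = w @ [e]"
        using shift_space_extend[OF nondegenerate snoc.prems(1)] by blast
      have x': "window 0 (length w) x = w" "x (int (length w)) = e"
        using x(2) window_Suc_right[of 0 "length w" x] by auto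
      have "pr (window 0 (length w + 1)) (window 0 (length w + 1) x) = pr (window 0 (length w)) w * P e"
        using step[of "length w" x] False x x' by (simp add: space_mu Suc_leI)
      then show ?thesis using snoc.IH[OF k(1) False] x(2) k lam_pos r_pos[of k]
        by (simp add: P_def)
    qed
  qed simp
  show "edge_path A i j w \<Longrightarrow> w \<noteq> [] \<Longrightarrow> pr (window a (length w)) w = l $ i * r $ j / lam ^ length w"
    using main by (simp add: pr_window[of a])
qed

end

section \<open>The Parry measure\<close>

lemma (in prob_space) prob_mem_sum:
  assumes X: "simple_function M X" and S: "finite S"
  shows "prob {x \<in> space M. X x \<in> S} = (\<Sum>v\<in>S. pr X v)"
proof -
  have "{x \<in> space M. X x \<in> S} = (\<Union>v\<in>S. X -` {v} \<inter> space M)" by auto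
  then show ?thesis
    unfolding pr_def using S simple_functionD(2)[OF X]
    by (simp only:) (intro finite_measure_finite_Union, auto simp: disjoint_family_on_def)
qed

text \<open>A level of at least 1 can always be arranged by enlarging the window; the weights of
  words below refer to a first and a last edge.\<close>

lemma cylinder_sets_iff:
  "C \<in> cylinder_sets A \<longleftrightarrow> C \<subseteq> shift_space A \<and> (\<exists>N\<ge>1. determined A N (\<lambda>x. x \<in> C))"
proof
  assume "C \<in> cylinder_sets A"
  then obtain N S where C: "C = {x \<in> shift_space A. cwin N x \<in> S}" by (auto simp: cylinder_sets_def)
  have "determined A N (\<lambda>x. x \<in> C)" unfolding determined_def C by auto
  then have "determined A (N + 1) (\<lambda>x. x \<in> C)" by (rule determined_mono) simp
  then show "C \<subseteq> shift_space A \<and> (\<exists>N\<ge>1. determined A N (\<lambda>x. x \<in> C))"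
    unfolding C by (intro conjI exI[of _ "N + 1"]) auto
next
  assume *: "C \<subseteq> shift_space A \<and> (\<exists>N\<ge>1. determined A N (\<lambda>x. x \<in> C))"
  then obtain N where N: "determined A N (\<lambda>x. x \<in> C)" by blast
  have "C = {x \<in> shift_space A. cwin N x \<in> cwin N ` C}"
    using * N unfolding determined_def by blast
  then show "C \<in> cylinder_sets A" unfolding cylinder_sets_def by blast
qed

lemma ring_of_sets_cylinder: "ring_of_sets (shift_space A) (cylinder_sets A)"
  unfolding ring_of_sets_iff
proof (intro conjI ballI)
  show "cylinder_sets A \<subseteq> Pow (shift_space A)" by (auto simp: cylinder_sets_def)
  show "{} \<in> cylinder_sets A" unfolding cylinder_sets_iff determined_def by auto
  fix C D assume "C \<in> cylinder_sets A" "D \<in> cylinder_sets A"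
  then obtain N M where *: "C \<subseteq> shift_space A" "D \<subseteq> shift_space A"
      "determined A N (\<lambda>x. x \<in> C)" "determined A M (\<lambda>x. x \<in> D)" by (auto simp: cylinder_sets_iff)
  define K where "K = max 1 (max N M)"
  have K: "1 \<le> K" "determined A K (\<lambda>x. x \<in> C)" "determined A K (\<lambda>x. x \<in> D)"
    using determined_mono[OF *(3), of K] determined_mono[OF *(4), of K] by (auto simp: K_def)
  have "determined A K (\<lambda>x. x \<in> C \<union> D)" "determined A K (\<lambda>x. x \<in> C - D)"
    using K unfolding determined_def by blast+
  then show "C \<union> D \<in> cylinder_sets A" "C - D \<in> cylinder_sets A"
    using * K by (auto simp: cylinder_sets_iff)
qed

text \<open>The complements are open and cover a compact space, so finitely many suffice. Continuity
  at the empty set, which the Caratheodory extension asks for, becomes a statement about sequences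
  that are eventually 0.\<close>

lemma cylinder_sets_decreasing_empty:
  fixes A :: "nat^'k^'k" and C :: "nat \<Rightarrow> 'k biseq set"
  assumes C: "range C \<subseteq> cylinder_sets A" "decseq C" "(\<Inter>i. C i) = {}"
  shows "\<exists>n. C n = {}"
proof -
  define U where "U n = shift_space A - C n" for n
  have sub: "C n \<subseteq> shift_space A" for n using C(1) unfolding cylinder_sets_def by blast
  have "openin (shift_topology A) (U n)" for n
  proof -
    have "C n \<in> cylinder_sets A" using C(1) by blast
    then obtain N where "determined A N (\<lambda>x. x \<in> C n)" by (auto simp: cylinder_sets_iff)
    from determined_openin[OF this, of Not] show ?thesis by (simp add: U_def set_diff_eq)
  qed
  moreover have "topspace (shift_topology A) \<subseteq> \<Union> (range U)"
    using C(3) by (auto simp: topspace_shift U_def)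
  ultimately obtain \<F> where F: "finite \<F>" "\<F> \<subseteq> range U" "topspace (shift_topology A) \<subseteq> \<Union> \<F>"
    using compact_space_shift[of A] unfolding compact_space_alt by (metis (no_types, lifting) imageE)
  then obtain I where I: "finite I" "\<F> = U ` I" by (meson finite_subset_image)
  define n where "n = Max (insert 0 I)"
  have "C n \<subseteq> C i" if "i \<in> I" for i
    using decseqD[OF C(2), of i n] Max_ge[of "insert 0 I" i] I(1) that by (simp add: n_def)
  have "C n = {}"
  proof (rule equals0I)
    fix x assume x: "x \<in> C n"
    then have "x \<in> \<Union> (U ` I)" using F(3) sub[of n] by (auto simp: topspace_shift I(2))
    then obtain i where "i \<in> I" "x \<notin> C i" by (auto simp: U_def)
    then show False using \<open>\<And>i. i \<in> I \<Longrightarrow> C n \<subseteq> C i\<close> x by blast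
  qed
  then show ?thesis by blast
qed

section \<open>The content given by the Parry weights of words\<close>

context pf_data
begin

text \<open>The Parry measure of the cylinder of a nonempty word. \<open>wt_snoc\<close> and
  \<open>wt_Cons\<close> are its consistency under prolongation, from the right and the left
  eigenvector equation respectively.\<close>

definition wt :: "'k edge list \<Rightarrow> real" where
  "wt w = l $ src (hd w) * r $ tgt (last w) / lam ^ length w"

lemma wt_pos: "0 < wt w"
  using l_pos r_pos lam_pos by (simp add: wt_def)

lemma wt_snoc:
  "w \<noteq> [] \<Longrightarrow> (\<Sum>e | e \<in> edges A \<and> src e = tgt (last w). wt (w @ [e])) = wt w"
  using right_edges[of "tgt (last w)"] lam_pos
  by (simp add: wt_def sum_divide_distrib[symmetric] sum_distrib_left[symmetric])

lemma wt_Cons: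
  "w \<noteq> [] \<Longrightarrow> (\<Sum>e | e \<in> edges A \<and> tgt e = src (hd w). wt (e # w)) = wt w"
  using left_edges[of "src (hd w)"] lam_pos
  by (simp add: wt_def sum_divide_distrib[symmetric] sum_distrib_right[symmetric])

definition content_at :: "nat \<Rightarrow> 'k biseq set \<Rightarrow> real" where
  "content_at N C = sum wt (cwin N ` C)"

lemma finite_edges_if: "finite {e. e \<in> edges A \<and> R e}"
  by (rule finite_subset[OF _ finite_edges[of A]]) auto

lemma cwin_path: "x \<in> shift_space A \<Longrightarrow> edge_path A (src (x (1 - int N))) (src (x (int N + 1))) (cwin N x)"
  using edge_path_window[of x A "1 - int N" "2 * N"] by (simp add: cwin_def)

lemma cwin_extend:
  assumes "edge_path A i j w" "length w = 2 * N"
  obtains x where "x \<in> shift_space A" "cwin N x = w" "src (x (1 - int N)) = i" "src (x (int N + 1)) = j"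
proof -
  obtain x where "x \<in> shift_space A" "window (1 - int N) (length w) x = w" "src (x (1 - int N)) = i"
      "src (x (1 - int N + int (length w))) = j"
    by (rule shift_space_extend[OF nondegenerate assms(1)])
  then show ?thesis using that[of x] assms(2) by (simp add: cwin_def)
qed

text \<open>A set determined at level \<open>N\<close> contains every sequence whose window is one
  of its own, so its windows of level \<open>Suc N\<close> are exactly the two-sided prolongations.
  Summing the weights over the new right edge and then over the new left edge restores the old
  weight.\<close>

lemma content_at_Suc:
  assumes N: "1 \<le> N" and C: "C \<subseteq> shift_space A" "determined A N (\<lambda>x. x \<in> C)"
  shows "content_at (Suc N) C = content_at N C"
proof -
  let ?I = "\<lambda>w. {e. e \<in> edges A \<and> tgt e = src (hd w)}" and ?O = "\<lambda>w. {e. e \<in> edges A \<and> src e = tgt (last w)}"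
  let ?f = "\<lambda>(w, e, e'). e # w @ [e']"
  define S where "S = (SIGMA w:cwin N ` C. ?I w \<times> ?O w)"
  have ne: "w \<noteq> []" if "w \<in> cwin N ` C" for w
  proof -
    have "length w = 2 * N" using that by auto
    then show ?thesis using N by auto
  qed
  have fin: "finite (cwin N ` C)" by (rule finite_subset[OF _ finite_cwin[of N A]]) (use C in auto)
  have "cwin (Suc N) ` C = ?f ` S"
  proof (intro equalityI subsetI)
    fix v assume "v \<in> cwin (Suc N) ` C"
    then obtain x where x: "x \<in> C" "v = cwin (Suc N) x" by auto
    have xs: "x \<in> shift_space A" using x C by auto
    note p = cwin_path[OF xs, of N]
    have "cwin N x \<noteq> []" using ne x by auto
    then have "hd (cwin N x) = x (1 - int N)" "last (cwin N x) = x (int N)"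
      using N by (auto simp: cwin_def hd_conv_nth last_conv_nth window_nth of_nat_diff)
    then have "(cwin N x, x (- int N), x (int N + 1)) \<in> S"
      using x shift_spaceD[OF xs] shift_spaceD(2)[OF xs, of "- int N"] by (auto simp: S_def)
    then show "v \<in> ?f ` S" using x by (force simp: cwin_Suc)
  next
    fix v assume "v \<in> ?f ` S"
    then obtain x e e' where x: "x \<in> C" "e \<in> ?I (cwin N x)" "e' \<in> ?O (cwin N x)" "v = e # cwin N x @ [e']"
      by (auto simp: S_def)
    have xs: "x \<in> shift_space A" using x C by auto
    note p = cwin_path[OF xs, of N]
    have w: "cwin N x \<noteq> []" using ne x by auto
    have "src (hd (cwin N x)) = src (x (1 - int N))" "tgt (last (cwin N x)) = src (x (int N + 1))"
      using edge_path_nth(2,4)[OF p w] w by (auto simp: hd_conv_nth last_conv_nth)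
    then have "edge_path A (src e) (tgt e') v" using p x by (auto simp: edge_path_append)
    then obtain y where y: "y \<in> shift_space A" "cwin (Suc N) y = v"
      by (rule cwin_extend[where N = "Suc N"]) (use x in auto)
    then have "cwin N y = cwin N x" using x(4) by (simp add: cwin_Suc)
    then have "y \<in> C" using C(2) xs y(1) x(1) unfolding determined_def by blast
    then show "v \<in> cwin (Suc N) ` C" using y by auto
  qed
  then have "content_at (Suc N) C = (\<Sum>(w, e, e')\<in>S. wt (e # w @ [e']))"
    unfolding content_at_def by (simp only:, subst sum.reindex) (auto simp: inj_on_def case_prod_unfold)
  also have "\<dots> = (\<Sum>w\<in>cwin N ` C. \<Sum>(e, e')\<in>?I w \<times> ?O w. wt (e # w @ [e']))"
    unfolding S_def using fin finite_edges_if by (subst sum.Sigma) auto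
  also have "\<dots> = (\<Sum>w\<in>cwin N ` C. \<Sum>e\<in>?I w. \<Sum>e'\<in>?O w. wt ((e # w) @ [e']))"
    by (simp add: sum.cartesian_product)
  also have "\<dots> = (\<Sum>w\<in>cwin N ` C. \<Sum>e\<in>?I w. wt (e # w))"
  proof (intro sum.cong refl)
    fix w e assume "w \<in> cwin N ` C"
    then show "(\<Sum>e'\<in>?O w. wt ((e # w) @ [e'])) = wt (e # w)" using wt_snoc[of "e # w"] ne by simp
  qed
  also have "\<dots> = content_at N C"
    unfolding content_at_def using ne wt_Cons by (intro sum.cong) auto
  finally show ?thesis .
qed

lemma content_at_mono:
  assumes "1 \<le> N" "C \<subseteq> shift_space A" "determined A N (\<lambda>x. x \<in> C)" "N \<le> M"
  shows "content_at M C = content_at N C"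
  using assms(4)
proof (induction rule: dec_induct)
  case (step n)
  then show ?case using content_at_Suc[of n C] determined_mono[OF assms(3), of n] assms by simp
qed simp

text \<open>\<open>LEAST\<close> merely makes a choice; by \<open>content_eq\<close> every
  admissible level gives the same value.\<close>

definition content :: "'k biseq set \<Rightarrow> real" where
  "content C = content_at (LEAST N. 1 \<le> N \<and> determined A N (\<lambda>x. x \<in> C)) C"

lemma content_eq:
  assumes "1 \<le> N" "C \<subseteq> shift_space A" "determined A N (\<lambda>x. x \<in> C)"
  shows "content C = content_at N C"
proof -
  let ?L = "LEAST N. 1 \<le> N \<and> determined A N (\<lambda>x. x \<in> C)"
  have "1 \<le> ?L \<and> determined A ?L (\<lambda>x. x \<in> C)" by (rule LeastI[of _ N]) (use assms in auto)
  moreover have "?L \<le> N" by (rule Least_le) (use assms in auto)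
  ultimately show ?thesis using content_at_mono[of ?L C N] assms by (simp add: content_def)
qed

lemma content_nonneg: "0 \<le> content C"
  unfolding content_def content_at_def by (intro sum_nonneg less_imp_le wt_pos)

lemma content_empty: "content {} = 0"
  by (simp add: content_def content_at_def)

lemma content_Un:
  assumes "C \<in> cylinder_sets A" "D \<in> cylinder_sets A" "C \<inter> D = {}"
  shows "content (C \<union> D) = content C + content D"
proof -
  obtain N M where *: "C \<subseteq> shift_space A" "D \<subseteq> shift_space A"
      "determined A N (\<lambda>x. x \<in> C)" "determined A M (\<lambda>x. x \<in> D)" using assms by (auto simp: cylinder_sets_iff)
  define K where "K = max 1 (max N M)"
  have K: "1 \<le> K" "determined A K (\<lambda>x. x \<in> C)" "determined A K (\<lambda>x. x \<in> D)"
    using determined_mono[OF *(3), of K] determined_mono[OF *(4), of K] by (auto simp: K_def)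
  have "determined A K (\<lambda>x. x \<in> C \<union> D)" using K unfolding determined_def by blast
  moreover have "cwin K ` C \<inter> cwin K ` D = {}"
    using K assms(3) * unfolding determined_def by blast
  moreover have "finite (cwin K ` C)" "finite (cwin K ` D)"
    using * by (auto intro: finite_subset[OF image_mono finite_cwin[of K A]])
  ultimately show ?thesis
    using content_eq[OF K(1)] K * by (simp add: content_at_def image_Un sum.union_disjoint)
qed

lemma content_space: "content (shift_space A) = 1"
proof -
  have "content (shift_space A) = content_at 1 (shift_space A)"
    by (rule content_eq) (auto simp: determined_def)
  also have "cwin 1 ` shift_space A = (\<lambda>(e, e'). [e, e']) ` (SIGMA e:edges A. {e'. e' \<in> edges A \<and> src e' = tgt e})"
  proof (intro equalityI subsetI)
    fix w assume "w \<in> cwin 1 ` shift_space A"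
    then obtain x where x: "x \<in> shift_space A" "w = cwin 1 x" by auto
    have "w = [x 0, x 1]" using x cwin_Suc[of 0 x] by (simp add: cwin_def)
    then show "w \<in> (\<lambda>(e, e'). [e, e']) ` (SIGMA e:edges A. {e'. e' \<in> edges A \<and> src e' = tgt e})"
      using shift_spaceD[OF x(1), of 0] shift_spaceD(1)[OF x(1), of 1] by force
  next
    fix w assume "w \<in> (\<lambda>(e, e'). [e, e']) ` (SIGMA e:edges A. {e'. e' \<in> edges A \<and> src e' = tgt e})"
    then obtain e e' where w: "w = [e, e']" "e \<in> edges A" "e' \<in> edges A" "src e' = tgt e" by auto
    then have "edge_path A (src e) (tgt e') w" by simp
    then obtain x where "x \<in> shift_space A" "cwin 1 x = w" by (rule cwin_extend[where N = 1]) (use w in auto)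
    then show "w \<in> cwin 1 ` shift_space A" by auto
  qed
  then have "content_at 1 (shift_space A) = (\<Sum>(e, e')\<in>(SIGMA e:edges A. {e'. e' \<in> edges A \<and> src e' = tgt e}). wt [e, e'])"
    unfolding content_at_def by (simp only:, subst sum.reindex) (auto simp: inj_on_def case_prod_unfold)
  also have "\<dots> = (\<Sum>e\<in>edges A. \<Sum>e' | e' \<in> edges A \<and> src e' = tgt e. wt ([e] @ [e']))"
    using finite_edges_if by (subst sum.Sigma) auto
  also have "\<dots> = (\<Sum>e\<in>edges A. wt [e])" using wt_snoc[of "[_]"] by (intro sum.cong) auto
  also have "\<dots> = (\<Sum>j\<in>UNIV. \<Sum>e | e \<in> edges A \<and> tgt e = j. wt [e])"
    using sum.group[OF finite_edges[of A], of UNIV tgt "\<lambda>e. wt [e]"] by simp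
  also have "\<dots> = (\<Sum>j\<in>UNIV. l $ j * r $ j)"
  proof (intro sum.cong refl)
    fix j
    have "(\<Sum>e | e \<in> edges A \<and> tgt e = j. wt [e]) = (\<Sum>e | e \<in> edges A \<and> tgt e = j. l $ src e * (r $ j / lam))"
      by (intro sum.cong) (auto simp: wt_def)
    also have "\<dots> = (lam * l $ j) * (r $ j / lam)" by (simp only: sum_distrib_right[symmetric] left_edges)
    also have "\<dots> = l $ j * r $ j" using lam_pos by simp
    finally show "(\<Sum>e | e \<in> edges A \<and> tgt e = j. wt [e]) = l $ j * r $ j" .
  qed
  finally show ?thesis by (simp add: sum_lr)
qed

lemma content_extends:
  obtains \<nu> where "prob_space \<nu>" "sets \<nu> = sets (shift_borel A)"
    "\<And>C. C \<in> cylinder_sets A \<Longrightarrow> measure \<nu> C = content C"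
proof -
  interpret ring_of_sets "shift_space A" "cylinder_sets A" by (rule ring_of_sets_cylinder)
  have "\<exists>\<mu>. (\<forall>s\<in>cylinder_sets A. \<mu> s = ennreal (content s)) \<and>
      measure_space (shift_space A) (sigma_sets (shift_space A) (cylinder_sets A)) \<mu>"
  proof (rule caratheodory_empty_continuous)
    show "positive (cylinder_sets A) (\<lambda>C. ennreal (content C))" by (simp add: positive_def content_empty)
    show "additive (cylinder_sets A) (\<lambda>C. ennreal (content C))"
      by (auto simp: additive_def content_Un content_nonneg ennreal_plus)
    fix C :: "nat \<Rightarrow> 'k biseq set" assume C: "range C \<subseteq> cylinder_sets A" "decseq C" "(\<Inter>i. C i) = {}"
    obtain n where n: "C n = {}" using cylinder_sets_decreasing_empty[OF C] by blast
    have "C m = {}" if "m \<ge> n" for m using decseqD[OF C(2) that] n by auto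
    then have "\<forall>\<^sub>F m in sequentially. ennreal (content (C m)) = 0"
      unfolding eventually_sequentially by (intro exI[of _ n]) (simp add: content_empty)
    then show "(\<lambda>i. ennreal (content (C i))) \<longlonglongrightarrow> 0" by (rule tendsto_eventually)
  qed simp
  then obtain \<mu> where \<mu>: "\<And>s. s \<in> cylinder_sets A \<Longrightarrow> \<mu> s = ennreal (content s)"
      "measure_space (shift_space A) (sigma_sets (shift_space A) (cylinder_sets A)) \<mu>" by blast
  define \<nu> where "\<nu> = measure_of (shift_space A) (cylinder_sets A) \<mu>"
  have sub: "cylinder_sets A \<subseteq> Pow (shift_space A)" by (auto simp: cylinder_sets_def)
  have sp: "space \<nu> = shift_space A" unfolding \<nu>_def by (rule space_measure_of[OF sub])
  have st: "sets \<nu> = sigma_sets (shift_space A) (cylinder_sets A)" unfolding \<nu>_def by (rule sets_measure_of[OF sub])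
  have em: "emeasure \<nu> C = ennreal (content C)" if "C \<in> cylinder_sets A" for C
  proof -
    have "emeasure \<nu> C = \<mu> C"
      using \<mu>(2) that by (intro emeasure_measure_of[OF \<nu>_def sub]) (auto simp: measure_space_def st)
    then show ?thesis using \<mu>(1)[OF that] by simp
  qed
  have "shift_space A \<in> cylinder_sets A" by (auto simp: cylinder_sets_iff determined_def)
  then have "emeasure \<nu> (space \<nu>) = 1" using em[of "shift_space A"] by (simp add: sp content_space)
  then have "prob_space \<nu>" by (rule prob_spaceI)
  then show ?thesis
    using that[of \<nu>] em by (simp add: st sets_shift_borel_cylinder measure_def content_nonneg)
qed

text \<open>The content gives the law of centred windows of even length. Any other window lies in a
  large centred one and its law is a marginal, obtained by dropping edges on the right and on the
  left, where the weights are consistent.\<close>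

lemma pr_window_Parry:
  assumes \<nu>: "prob_space \<nu>" "sets \<nu> = sets (shift_borel A)" "\<And>C. C \<in> cylinder_sets A \<Longrightarrow> measure \<nu> C = content C"
    and w: "edge_path A i j w" "w \<noteq> []"
  shows "prob_space.pr \<nu> (window a (length w)) w = wt w"
proof -
  interpret prob_space \<nu> by fact
  have sp: "space \<nu> = shift_space A" using sets_eq_imp_space_eq[OF \<nu>(2)] by simp
  have sw: "simple_function \<nu> (window a n)" for a n
    using determined_window_ex determined_simple_function[OF _ \<nu>(2)] by blast
  have sc: "simple_function \<nu> (\<lambda>x. x n)" for n
    by (rule determined_simple_function[OF determined_coord \<nu>(2), of "nat \<bar>n\<bar> + 1"]) auto
  have img: "(\<lambda>x. x n) ` space \<nu> \<subseteq> edges A" for n by (auto simp: sp shift_spaceD)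
  have none: "pr X v = 0" if "\<And>x. x \<in> shift_space A \<Longrightarrow> X x \<noteq> v" for X :: "'k biseq \<Rightarrow> 'v" and v
    using that by (intro pr_outside) (auto simp: sp)
  define Q where "Q a n \<longleftrightarrow> (\<forall>i j w. edge_path A i j w \<longrightarrow> length w = n \<longrightarrow> w \<noteq> [] \<longrightarrow> pr (window a n) w = wt w)" for a n
  have centred: "Q (1 - int N) (2 * N)" if N: "1 \<le> N" for N
    unfolding Q_def
  proof (intro allI impI)
    fix i j w assume w: "edge_path A i j w" "length w = 2 * N" "w \<noteq> []"
    define C where "C = {x \<in> shift_space A. cwin N x = w}"
    obtain x where "x \<in> shift_space A" "cwin N x = w" by (rule cwin_extend[OF w(1,2)])
    then have im: "cwin N ` C = {w}" by (auto simp: C_def)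
    have C: "C \<subseteq> shift_space A" "determined A N (\<lambda>x. x \<in> C)" unfolding C_def determined_def by auto
    have "pr (window (1 - int N) (2 * N)) w = prob C"
      unfolding pr_def C_def by (intro arg_cong[where f = prob]) (auto simp: sp cwin_def)
    also have "\<dots> = content C" using C N by (intro \<nu>(3)) (auto simp: cylinder_sets_iff)
    also have "\<dots> = wt w" using content_eq[OF N C] im by (simp add: content_at_def)
    finally show "pr (window (1 - int N) (2 * N)) w = wt w" .
  qed
  have right: "Q a n" if Q: "Q a (Suc n)" for a n
    unfolding Q_def
  proof (intro allI impI)
    fix i j w assume w: "edge_path A i j w" "length w = n" "w \<noteq> []"
    have last: "tgt (last w) = j" using edge_path_nth(4)[OF w(1,3)] w by (simp add: last_conv_nth)
    have "pr (window a n) w = (\<Sum>e\<in>(\<lambda>x. x (a + int n)) ` space \<nu>. pr (\<lambda>x. (x (a + int n), window a n x)) (e, w))"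
      by (rule sum_pr_marginal[symmetric, OF sc sw])
    also have "\<dots> = (\<Sum>e\<in>edges A. pr (\<lambda>x. (x (a + int n), window a n x)) (e, w))"
      using img by (intro sum.mono_neutral_left) (auto intro!: pr_outside)
    also have "\<dots> = (\<Sum>e\<in>edges A. pr (window a (Suc n)) (w @ [e]))"
      by (intro sum.cong refl pr_cong) (auto simp: window_Suc_right w)
    also have "\<dots> = (\<Sum>e | e \<in> edges A \<and> src e = tgt (last w). pr (window a (Suc n)) (w @ [e]))"
    proof (intro sum.mono_neutral_right ballI)
      fix e assume e: "e \<in> edges A - {e. e \<in> edges A \<and> src e = tgt (last w)}"
      show "pr (window a (Suc n)) (w @ [e]) = 0"
      proof (rule none)
        fix x assume x: "x \<in> shift_space A"
        show "window a (Suc n) x \<noteq> w @ [e]"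
          using edge_path_window[OF x, of a "Suc n"] e edge_path_nth(4)[OF _ w(3), of A]
          by (auto simp: edge_path_append last_conv_nth w)
      qed
    qed auto
    also have "\<dots> = (\<Sum>e | e \<in> edges A \<and> src e = tgt (last w). wt (w @ [e]))"
    proof (intro sum.cong refl)
      fix e assume "e \<in> {e. e \<in> edges A \<and> src e = tgt (last w)}"
      then have "edge_path A i (tgt e) (w @ [e])" using w(1) last by (auto simp: edge_path_append)
      from Q[unfolded Q_def, rule_format, OF this] show "pr (window a (Suc n)) (w @ [e]) = wt (w @ [e])" using w(2) by simp
    qed
    also have "\<dots> = wt w" using w(3) by (rule wt_snoc)
    finally show "pr (window a n) w = wt w" .
  qed
  have left: "Q (a + 1) n" if Q: "Q a (Suc n)" for a n
    unfolding Q_def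
  proof (intro allI impI)
    fix i j w assume w: "edge_path A i j w" "length w = n" "w \<noteq> []"
    have first: "src (hd w) = i" using edge_path_nth(2)[OF w(1,3)] w by (simp add: hd_conv_nth)
    have "pr (window (a + 1) n) w = (\<Sum>e\<in>(\<lambda>x. x a) ` space \<nu>. pr (\<lambda>x. (x a, window (a + 1) n x)) (e, w))"
      by (rule sum_pr_marginal[symmetric, OF sc sw])
    also have "\<dots> = (\<Sum>e\<in>edges A. pr (\<lambda>x. (x a, window (a + 1) n x)) (e, w))"
      using img by (intro sum.mono_neutral_left) (auto intro!: pr_outside)
    also have "\<dots> = (\<Sum>e\<in>edges A. pr (window a (Suc n)) (e # w))"
      by (intro sum.cong refl pr_cong) (auto simp: window_Suc w)
    also have "\<dots> = (\<Sum>e | e \<in> edges A \<and> tgt e = src (hd w). pr (window a (Suc n)) (e # w))"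
    proof (intro sum.mono_neutral_right ballI)
      fix e assume e: "e \<in> edges A - {e. e \<in> edges A \<and> tgt e = src (hd w)}"
      show "pr (window a (Suc n)) (e # w) = 0"
      proof (rule none)
        fix x assume x: "x \<in> shift_space A"
        show "window a (Suc n) x \<noteq> e # w"
        proof
          assume eq: "window a (Suc n) x = e # w"
          have "edge_path A (tgt e) (src (x (a + int (Suc n)))) w"
            using edge_path_window[OF x, of a "Suc n"] by (simp add: eq)
          from edge_path_nth(2)[OF this w(3)] show False using e w(3) by (simp add: hd_conv_nth)
        qed
      qed
    qed auto
    also have "\<dots> = (\<Sum>e | e \<in> edges A \<and> tgt e = src (hd w). wt (e # w))"
    proof (intro sum.cong refl)
      fix e assume "e \<in> {e. e \<in> edges A \<and> tgt e = src (hd w)}"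
      then have "edge_path A (src e) j (e # w)" using w(1) first by auto
      from Q[unfolded Q_def, rule_format, OF this] show "pr (window a (Suc n)) (e # w) = wt (e # w)" using w(2) by simp
    qed
    also have "\<dots> = wt w" using w(3) by (rule wt_Cons)
    finally show "pr (window (a + 1) n) w = wt w" .
  qed
  have rightk: "Q a (n + k) \<Longrightarrow> Q a n" for a n k by (induction k) (auto dest: right)
  have leftk: "Q (a - int k) (n + k) \<Longrightarrow> Q a n" for a n k
  proof (induction k arbitrary: n)
    case (Suc k)
    from Suc.prems have "Q (a - int (Suc k) + 1) (n + k)" by (intro left) simp
    then show ?case by (intro Suc.IH) simp
  qed simp
  define N where "N = nat \<bar>a\<bar> + length w + 1"
  have "Q (1 - int N) (2 * N)" by (rule centred) (simp add: N_def)
  moreover have N1: "1 - int N \<le> a" "a + int (length w) \<le> int N + 1" by (auto simp: N_def)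
  then have "1 - int N = a - int (nat (a - (1 - int N)))" by simp
  moreover have "2 * N = (length w + nat (a - (1 - int N))) + nat (int N + 1 - a - int (length w))"
    by (rule of_nat_eq_iff[where 'a = int, THEN iffD1]) (use N1 in simp)
  ultimately have "Q (a - int (nat (a - (1 - int N)))) (length w + nat (a - (1 - int N)))"
    by (metis rightk)
  then have "Q a (length w)" by (rule leftk)
  then show ?thesis using w unfolding Q_def by blast
qed

text \<open>The weight of a word does not depend on its position, which gives invariance on cylinder
  sets and hence everywhere. A word of length \<open>n\<close> has weight at most a constant over
  \<open>lam ^ n\<close>, so block entropies are at least \<open>n * ln lam\<close> up to a
  constant.\<close>

lemma Parry_measure_exists:
  obtains \<nu> where "\<nu> \<in> invariant_probs A" "ereal (ln lam) \<le> ks_entropy \<nu> shift"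
proof -
  obtain \<nu> where \<nu>: "prob_space \<nu>" "sets \<nu> = sets (shift_borel A)"
    "\<And>C. C \<in> cylinder_sets A \<Longrightarrow> measure \<nu> C = content C" 
    by (rule content_extends) (rule that)
  interpret prob_space \<nu> by fact
  have P: "pr (window a (length w)) w = wt w" if "edge_path A i j w" "w \<noteq> []" for a i j w
    by (rule pr_window_Parry[OF \<nu>(1,2) _ that]) (rule \<nu>(3))
  have sp: "space \<nu> = shift_space A" using sets_eq_imp_space_eq[OF \<nu>(2)] by simp
  have stn: "sets \<nu> = sigma_sets (shift_space A) (cylinder_sets A)" using \<nu>(2) by (simp add: sets_shift_borel_cylinder)
  have sub: "cylinder_sets A \<subseteq> Pow (shift_space A)" by (auto simp: cylinder_sets_def)
  have sw: "simple_function \<nu> (window a n)" for a n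
    using determined_window_ex determined_simple_function[OF _ \<nu>(2)] by blast
  have sh: "shift x \<in> shift_space A" if "x \<in> shift_space A" for x
    using that by (auto simp: shift_space_def shift_def)
  have pre: "shift -` {x \<in> shift_space A. cwin N x \<in> S} \<inter> space \<nu> = {x \<in> space \<nu>. window (2 - int N) (2 * N) x \<in> S}" for N S
  proof -
    have "cwin N (shift x) = window (2 - int N) (2 * N) x" for x :: "'k biseq"
      by (auto simp: cwin_def window_def shift_def algebra_simps)
    then show ?thesis using sh by (auto simp: sp)
  qed
  have T: "shift \<in> measurable \<nu> \<nu>"
  proof (rule measurable_sigma_sets[OF stn sub])
    show "shift \<in> space \<nu> \<rightarrow> shift_space A" using sh by (auto simp: sp)
    fix C assume "C \<in> cylinder_sets A"
    then obtain N S where C: "C = {x \<in> shift_space A. cwin N x \<in> S}" by (auto simp: cylinder_sets_def)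
    have "{x \<in> space \<nu>. window (2 - int N) (2 * N) x \<in> S} = window (2 - int N) (2 * N) -` S \<inter> space \<nu>" by auto
    then show "shift -` C \<inter> space \<nu> \<in> events" unfolding C pre using simple_functionD(2)[OF sw] by simp
  qed
  have cyl: "prob (shift -` C \<inter> space \<nu>) = prob C" if C: "C \<in> cylinder_sets A" for C
  proof -
    obtain N where N: "C \<subseteq> shift_space A" "1 \<le> N" "determined A N (\<lambda>x. x \<in> C)"
      using C by (auto simp: cylinder_sets_iff)
    define S where "S = cwin N ` C"
    have fin: "finite S" unfolding S_def by (rule finite_subset[OF image_mono[OF N(1)] finite_cwin])
    have CS: "C = {x \<in> shift_space A. cwin N x \<in> S}"
      unfolding S_def using N(1,3) unfolding determined_def by blast
    have wt: "pr (window a (2 * N)) w = wt w" if wS: "w \<in> S" for a w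
    proof -
      obtain x where x: "x \<in> shift_space A" "w = cwin N x" using wS N(1) unfolding S_def by blast
      have lw: "length w = 2 * N" using x by simp
      then have "w \<noteq> []" using N(2) by auto
      then show ?thesis using P[OF cwin_path[OF x(1), of N, folded x(2)], of a] lw by simp
    qed
    have "prob (shift -` C \<inter> space \<nu>) = (\<Sum>w\<in>S. pr (window (2 - int N) (2 * N)) w)"
      by (subst CS, subst pre) (rule prob_mem_sum[OF sw fin])
    also have "\<dots> = (\<Sum>w\<in>S. pr (window (1 - int N) (2 * N)) w)" by (simp add: wt)
    also have "\<dots> = prob {x \<in> space \<nu>. window (1 - int N) (2 * N) x \<in> S}" by (rule prob_mem_sum[OF sw fin, symmetric])
    also have "{x \<in> space \<nu>. window (1 - int N) (2 * N) x \<in> S} = C" by (subst CS) (simp add: sp cwin_def)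
    finally show ?thesis .
  qed
  have inv: "distr \<nu> \<nu> shift = \<nu>"
  proof (rule measure_eqI_generator_eq[where E = "cylinder_sets A" and \<Omega> = "shift_space A" and A = "\<lambda>_. shift_space A"])
    interpret ring_of_sets "shift_space A" "cylinder_sets A" by (rule ring_of_sets_cylinder)
    show "Int_stable (cylinder_sets A)" by (auto simp: Int_stable_def)
    show "cylinder_sets A \<subseteq> Pow (shift_space A)" by (rule sub)
    show "emeasure (distr \<nu> \<nu> shift) C = emeasure \<nu> C" if "C \<in> cylinder_sets A" for C
      using cyl[OF that] T that by (subst emeasure_distr) (auto simp: stn emeasure_eq_measure)
    show "range (\<lambda>_. shift_space A) \<subseteq> cylinder_sets A" by (auto simp: cylinder_sets_iff determined_def)
    show "emeasure (distr \<nu> \<nu> shift) (shift_space A) \<noteq> \<infinity>"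
      using T by (simp add: emeasure_distr sp[symmetric] emeasure_eq_measure)
  qed (simp_all add: stn)
  interpret mpt \<nu> shift by unfold_locales (rule T, rule inv)
  \<comment> \<open>Partitions are \<open>nat\<close>-valued in \<open>ks_entropy\<close>, so edges
    are coded by \<open>to_nat\<close>.\<close>
  define P0 :: "'k biseq \<Rightarrow> nat" where "P0 x = to_nat (x 0)" for x
  have sP0: "simple_function \<nu> P0"
  proof -
    have "determined A 1 P0" unfolding determined_def cwin_eq_iff P0_def by auto
    then show ?thesis using determined_simple_function \<nu>(2) by blast
  qed
  \<comment> \<open>A crude bound for the numerators of all weights, independent of the length of
    the word.\<close>
  define c where "c = (\<Sum>i\<in>UNIV. \<Sum>j\<in>UNIV. l $ i * r $ j)"
  have c: "l $ i * r $ j \<le> c" for i j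
  proof -
    have nn: "0 \<le> l $ i * r $ j" for i j using l_pos[of i] r_pos[of j] by simp
    have "l $ i * r $ j \<le> (\<Sum>j\<in>UNIV. l $ i * r $ j)" using nn by (intro member_le_sum) auto
    also have "\<dots> \<le> c" unfolding c_def using nn
      by (intro member_le_sum[where f = "\<lambda>i. \<Sum>j\<in>UNIV. l $ i * r $ j"]) (auto intro: sum_nonneg)
    finally show ?thesis .
  qed
  have c0: "0 < c" using c[of undefined undefined] l_pos[of undefined] r_pos[of undefined]
    by (smt (verit) mult_pos_pos)
  have lower: "real n * ln lam - ln c \<le> partition_entropy \<nu> shift P0 n" if n: "n \<ge> 1" for n
  proof -
    have "real n * ln lam - ln c = expectation (\<lambda>x. real n * ln lam - ln c)" by (simp add: prob_space)
    also have "\<dots> \<le> expectation (\<lambda>x. - ln (pr (window 0 n) (window 0 n x)))"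
    proof (intro integral_mono)
      show "integrable \<nu> (\<lambda>x. - ln (pr (window 0 n) (window 0 n x)))"
        by (intro integrable_simple_function simple_function_compose1[OF sw, where g = "\<lambda>v. - ln (pr (window 0 n) v)"])
          (auto simp: emeasure_eq_measure)
      fix x assume "x \<in> space \<nu>"
      then have x: "x \<in> shift_space A" by (simp add: sp)
      have ne: "window 0 n x \<noteq> []" using n by (auto simp: window_def)
      have pw: "pr (window 0 n) (window 0 n x) = wt (window 0 n x)"
        using P[OF edge_path_window[OF x, of 0 n] ne, of 0] by simp
      have "wt (window 0 n x) \<le> c / lam ^ n"
        unfolding wt_def using c lam_pos by (simp add: divide_right_mono)
      then have "ln (wt (window 0 n x)) \<le> ln (c / lam ^ n)" using wt_pos[of "window 0 n x"] by (rule ln_mono)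
      also have "\<dots> = ln c - real n * ln lam" using c0 lam_pos by (simp add: ln_div ln_realpow)
      finally show "real n * ln lam - ln c \<le> - ln (pr (window 0 n) (window 0 n x))" by (simp add: pw)
    qed simp
    also have "\<dots> = ent (window 0 n)" using ent_eq_expectation[OF sw, of 0 n] by simp
    also have "\<dots> \<le> ent (itinerary shift P0 n)"
    proof (rule ent_mono[OF simple_function_itinerary[OF sP0], where f = "map from_nat"])
      fix x :: "'k biseq"
      show "window 0 n x = map from_nat (itinerary shift P0 n x)"
        by (simp add: itinerary_def window_def P0_def shift_pow)
    qed
    finally show ?thesis by (simp add: partition_entropy_eq)
  qed
  have "ln lam - 0 \<le> lim (\<lambda>n. partition_entropy \<nu> shift P0 n / real n)"
  proof (rule tendsto_le[OF _ itinerary_entropy_limit(1)[OF sP0]])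
    show "(\<lambda>n. ln lam - ln c / real n) \<longlonglongrightarrow> ln lam - 0" by (intro tendsto_intros lim_const_over_n)
    have "ln lam - ln c / real n \<le> partition_entropy \<nu> shift P0 n / real n" if "n \<ge> 1" for n
    proof -
      have "(real n * ln lam - ln c) / real n \<le> partition_entropy \<nu> shift P0 n / real n"
        using lower[OF that] by (rule divide_right_mono) simp
      then show ?thesis using that by (simp add: diff_divide_distrib)
    qed
    then show "\<forall>\<^sub>F n in sequentially. ln lam - ln c / real n \<le> partition_entropy \<nu> shift P0 n / real n"
      unfolding eventually_sequentially by blast
  qed simp
  then have "ereal (ln lam) \<le> ereal (lim (\<lambda>n. partition_entropy \<nu> shift P0 n / real n))" by simp
  also have "\<dots> \<le> ks_entropy \<nu> shift" unfolding ks_entropy_def using sP0 by (intro SUP_upper) simp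
  finally show ?thesis using that[of \<nu>] \<nu>(1,2) T inv by (simp add: invariant_probs_def)
qed

lemma measure_of_maximal_entropy_cylinder:
  assumes "measure_of_maximal_entropy A \<mu>"
  shows "prob_space \<mu>" "sets \<mu> = sets (shift_borel A)" "space \<mu> = shift_space A"
    and "edge_path A i j w \<Longrightarrow> length w = 2 * N \<Longrightarrow>
      measure \<mu> {x \<in> shift_space A. cwin N x = w \<and> src (x (1 - int N)) = i \<and> src (x (int N + 1)) = j} =
      l $ i * r $ j / lam ^ (2 * N)"
proof -
  have \<mu>: "prob_space \<mu>" "sets \<mu> = sets (shift_borel A)" "shift \<in> measurable \<mu> \<mu>" "distr \<mu> \<mu> shift = \<mu>"
    using assms by (auto simp: measure_of_maximal_entropy_def invariant_probs_def)
  show "prob_space \<mu>" "sets \<mu> = sets (shift_borel A)" by fact+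
  interpret prob_space \<mu> by fact
  interpret pf_measure A lam l r \<mu> by unfold_locales (use \<mu> in auto)
  show sp: "space \<mu> = shift_space A" by (rule space_mu)
  obtain \<nu> where "\<nu> \<in> invariant_probs A" "ereal (ln lam) \<le> ks_entropy \<nu> shift" by (rule Parry_measure_exists)
  then have ks: "ereal (ln lam) \<le> ks_entropy \<mu> shift"
    using assms unfolding measure_of_maximal_entropy_def by (meson order_trans)
  note M = maximal_entropy_prob[OF ks]
  assume w: "edge_path A i j w" "length w = 2 * N"
  show "prob {x \<in> shift_space A. cwin N x = w \<and> src (x (1 - int N)) = i \<and> src (x (int N + 1)) = j} =
      l $ i * r $ j / lam ^ (2 * N)"
  proof (cases "w = []")
    \<comment> \<open>For the empty word the window says nothing, the endpoints coincide, and the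
      event is that the vertex at which the edge at position 1 starts is \<open>i\<close>. A
      nonempty word fixes both end vertices by itself.\<close>
    case True
    then have "{x \<in> shift_space A. cwin N x = w \<and> src (x (1 - int N)) = i \<and> src (x (int N + 1)) = j} =
        (\<lambda>x. src (x 1)) -` {i} \<inter> space \<mu>"
      using w by (auto simp: sp cwin_def)
    then show ?thesis using M(2)[of 1 i] True w by (simp add: pr_def)
  next
    case False
    have "src (x (1 - int N)) = i \<and> src (x (int N + 1)) = j" if x: "x \<in> shift_space A" "cwin N x = w" for x
    proof -
      note p = cwin_path[OF x(1), of N, unfolded x(2)]
      show ?thesis
        using edge_path_nth(2)[OF p False] edge_path_nth(2)[OF w(1) False]
          edge_path_nth(4)[OF p False] edge_path_nth(4)[OF w(1) False] by simp
    qed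
    then have "{x \<in> shift_space A. cwin N x = w \<and> src (x (1 - int N)) = i \<and> src (x (int N + 1)) = j} =
        window (1 - int N) (length w) -` {w} \<inter> space \<mu>"
      using w by (auto simp: sp cwin_def)
    then show ?thesis using M(1)[OF w(1) False, of "1 - int N"] w by (simp add: pr_def)
  qed
qed

end

section \<open>The homoclinic algebra as a closure of local kernels\<close>

definition agree :: "nat \<Rightarrow> 'k biseq \<Rightarrow> 'k biseq \<Rightarrow> bool" where
  "agree N x y \<longleftrightarrow> (\<forall>n. n \<notin> {1 - int N..int N} \<longrightarrow> x n = y n)"

definition ends :: "nat \<Rightarrow> 'k biseq \<Rightarrow> 'k \<times> 'k" where
  "ends N x = (src (x (1 - int N)), src (x (int N + 1)))"

text \<open>The endpoints are recorded separately because the window is empty for \<open>N = 0\<close>.\<close>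

definition loc :: "nat^'k^'k \<Rightarrow> nat \<Rightarrow> ('k \<times> 'k \<Rightarrow> 'k edge list \<Rightarrow> 'k edge list \<Rightarrow> complex) \<Rightarrow> 'k biseq kernel" where
  "loc A N F = (\<lambda>x y. if x \<in> shift_space A \<and> y \<in> shift_space A \<and> agree N x y
     then F (ends N x) (cwin N x) (cwin N y) else 0)"

definition local_kernels :: "nat^'k^'k \<Rightarrow> 'k biseq kernel set" where
  "local_kernels A = {loc A N F | N F. True}"

definition paths :: "nat^'k^'k \<Rightarrow> nat \<Rightarrow> 'k \<times> 'k \<Rightarrow> 'k edge list set" where
  "paths A N p = {w. edge_path A (fst p) (snd p) w \<and> length w = 2 * N}"

lemma finite_paths' [simp]: "finite (paths A N p)" for A :: "nat^'k^'k"
  unfolding paths_def by (rule finite_paths)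

lemma agree_refl [simp]: "agree N x x" and agree_sym: "agree N x y \<Longrightarrow> agree N y x"
  and agree_trans: "agree N x y \<Longrightarrow> agree N y z \<Longrightarrow> agree N x z"
  by (auto simp: agree_def)

lemma agree_mono: "agree N x y \<Longrightarrow> N \<le> M \<Longrightarrow> agree M x y"
  unfolding agree_def by auto

lemma agree_cwin_eq: "agree N x y \<Longrightarrow> cwin N x = cwin N y \<Longrightarrow> x = y"
  unfolding agree_def cwin_eq_iff by (rule ext) blast

text \<open>The vertex at the left end of the window is also the target of the edge at
  \<open>- int N\<close>, which lies outside the window.\<close>

lemma agree_ends:
  assumes "x \<in> shift_space A" "y \<in> shift_space A" "agree N x y"
  shows "ends N x = ends N y"
proof -
  have "x (- int N) = y (- int N)" "x (int N + 1) = y (int N + 1)" using assms(3) by (auto simp: agree_def)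
  then show ?thesis
    using shift_spaceD(2)[OF assms(1), of "- int N"] shift_spaceD(2)[OF assms(2), of "- int N"]
    by (simp add: ends_def)
qed

lemma agree_Suc: "agree N x y \<longleftrightarrow> agree (Suc N) x y \<and> x (- int N) = y (- int N) \<and> x (int N + 1) = y (int N + 1)"
proof
  assume *: "agree (Suc N) x y \<and> x (- int N) = y (- int N) \<and> x (int N + 1) = y (int N + 1)"
  have "x n = y n" if "n \<notin> {1 - int N..int N}" for n
  proof -
    consider "n = - int N" | "n = int N + 1" | "n \<notin> {1 - int (Suc N)..int (Suc N)}"
      using \<open>n \<notin> {1 - int N..int N}\<close> by fastforce
    then show ?thesis using * by cases (auto simp: agree_def)
  qed
  then show "agree N x y" by (auto simp: agree_def)
qed (auto simp: agree_def)

lemma cwin_in_paths: "x \<in> shift_space A \<Longrightarrow> cwin N x \<in> paths A N (ends N x)"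
  using edge_path_window[of x A "1 - int N" "2 * N"] by (simp add: paths_def ends_def cwin_def)

lemma patch_cwin:
  assumes x: "x \<in> shift_space A" and w: "w \<in> paths A N (ends N x)"
  shows "patch (1 - int N) w x \<in> shift_space A" "agree N x (patch (1 - int N) w x)"
    "cwin N (patch (1 - int N) w x) = w"
proof -
  have l: "length w = 2 * N" using w by (simp add: paths_def)
  have e: "1 - int N + int (length w) = int N + 1" by (simp add: l)
  show "patch (1 - int N) w x \<in> shift_space A"
    by (rule patch_shift_space[OF x]) (use w in \<open>simp add: paths_def ends_def e\<close>)
  show "cwin N (patch (1 - int N) w x) = w" by (simp add: cwin_def l)
  show "agree N x (patch (1 - int N) w x)"
    unfolding agree_def using patch_outside[of "1 - int N" _ w x] by (auto simp: l)
qed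

text \<open>Splicing is the inverse. Local kernels of level \<open>N\<close> thereby become matrices
  indexed by paths, with one block for each pair of end vertices.\<close>

lemma bij_betw_cwin:
  assumes x: "x \<in> shift_space A"
  shows "bij_betw (cwin N) {z \<in> shift_space A. agree N x z} (paths A N (ends N x))"
proof (rule bij_betw_byWitness[of _ "\<lambda>w. patch (1 - int N) w x"])
  show "\<forall>z\<in>{z \<in> shift_space A. agree N x z}. patch (1 - int N) (cwin N z) x = z"
  proof
    fix z assume z: "z \<in> {z \<in> shift_space A. agree N x z}"
    have "cwin N z \<in> paths A N (ends N x)"
      using cwin_in_paths[of z A N] z agree_ends[OF x _, of z N] by auto
    note s = patch_cwin[OF x this]
    show "patch (1 - int N) (cwin N z) x = z"
      using z s(2,3) agree_trans[OF agree_sym[OF s(2)], of z] by (intro agree_cwin_eq) auto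
  qed
  show "\<forall>w\<in>paths A N (ends N x). cwin N (patch (1 - int N) w x) = w"
    using patch_cwin(3)[OF x] by blast
  show "cwin N ` {z \<in> shift_space A. agree N x z} \<subseteq> paths A N (ends N x)"
    using cwin_in_paths agree_ends[OF x] by fastforce
  show "(\<lambda>w. patch (1 - int N) w x) ` paths A N (ends N x) \<subseteq> {z \<in> shift_space A. agree N x z}"
    using patch_cwin[OF x] by blast
qed

lemma finite_agree: "finite {z \<in> shift_space A. agree N x z}"
  and card_agree: "card {z \<in> shift_space A. agree N x z} \<le> card (cwin N ` shift_space A)"
  for A :: "nat^'k^'k"
proof -
  have inj: "inj_on (cwin N) {z \<in> shift_space A. agree N x z}"
    by (rule inj_onI) (auto intro: agree_cwin_eq[OF agree_trans[OF agree_sym]])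
  have sub: "cwin N ` {z \<in> shift_space A. agree N x z} \<subseteq> cwin N ` shift_space A" by auto
  show "finite {z \<in> shift_space A. agree N x z}"
    using inj_on_finite[OF inj sub finite_cwin] .
  show "card {z \<in> shift_space A. agree N x z} \<le> card (cwin N ` shift_space A)"
    by (rule card_inj_on_le[OF inj sub finite_cwin])
qed

text \<open>Schur's bound, with the number of windows of level \<open>N\<close> bounding the nonzero
  entries in each row and column.\<close>

lemma agree_supported_norm:
  fixes A :: "nat^'k^'k"
  assumes supp: "\<And>x y. f x y \<noteq> 0 \<Longrightarrow> x \<in> shift_space A \<and> y \<in> shift_space A \<and> agree N x y"
    and e: "\<And>x y. cmod (f x y) \<le> e" "0 \<le> e"
  shows "kernel_norm_le f (e * real (card (cwin N ` shift_space A)))"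
proof (rule kernel_norm_le_Schur[OF e])
  have r: "{y. f x y \<noteq> 0} \<subseteq> {z \<in> shift_space A. agree N x z}" for x using supp by blast
  have c: "{x. f x y \<noteq> 0} \<subseteq> {z \<in> shift_space A. agree N y z}" for y using supp agree_sym by blast
  show "finite {y. f x y \<noteq> 0}" "finite {x. f x y \<noteq> 0}" for x y
    using finite_subset[OF r finite_agree] finite_subset[OF c finite_agree] by auto
  show "card {y. f x y \<noteq> 0} \<le> card (cwin N ` shift_space A)" for x
    using card_mono[OF finite_agree r] card_agree order_trans by blast
  show "card {x. f x y \<noteq> 0} \<le> card (cwin N ` shift_space A)" for y
    using card_mono[OF finite_agree c] card_agree order_trans by blast
qed

text \<open>A kernel of level \<open>N\<close> requires \<open>x\<close> and \<open>y\<close> to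
  agree at the two edges next to its window and reads only their inner vertices; at level
  \<open>Suc N\<close> the agreement becomes equality of the first and of the last letters.\<close>

lemma loc_Suc:
  "loc A N F = loc A (Suc N) (\<lambda>p u v. if hd u = hd v \<and> last u = last v
     then F (tgt (hd u), src (last u)) (butlast (tl u)) (butlast (tl v)) else 0)"
proof (intro ext)
  fix x y
  have "ends N x = (tgt (x (- int N)), src (x (int N + 1)))" if "x \<in> shift_space A"
    using shift_spaceD(2)[OF that, of "- int N"] by (simp add: ends_def)
  then show "loc A N F x y = loc A (Suc N) (\<lambda>p u v. if hd u = hd v \<and> last u = last v
     then F (tgt (hd u), src (last u)) (butlast (tl u)) (butlast (tl v)) else 0) x y"
    unfolding loc_def by (auto simp: cwin_Suc agree_Suc[of N])
qed

lemma loc_raise: "N \<le> M \<Longrightarrow> \<exists>G. loc A N F = loc A M G"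
proof (induction rule: dec_induct)
  case (step n)
  then obtain G where "loc A N F = loc A n G" by blast
  then show ?case using loc_Suc[of A n G] by (intro exI) (rule trans)
qed blast

lemma local_kernelsE:
  assumes "f \<in> local_kernels A"
  obtains N where "\<And>M. N \<le> M \<Longrightarrow> \<exists>F. f = loc A M F"
  using assms loc_raise unfolding local_kernels_def by blast

lemma local_kernels_common:
  assumes "f \<in> local_kernels A" "g \<in> local_kernels A"
  obtains N F G where "f = loc A N F" "g = loc A N G"
proof -
  obtain N where N: "\<And>M. N \<le> M \<Longrightarrow> \<exists>F. f = loc A M F" 
    by (rule local_kernelsE[OF assms(1)]) (rule that)
  obtain N' where N': "\<And>M. N' \<le> M \<Longrightarrow> \<exists>F. g = loc A M F" 
    by (rule local_kernelsE[OF assms(2)]) (rule that)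
  show ?thesis using N[of "max N N'"] N'[of "max N N'"] that by auto
qed

text \<open>Only intermediate \<open>z\<close> that agree with \<open>x\<close> off the window
  contribute; they share its end vertices and are reindexed by their windows.\<close>

lemma loc_mult:
  fixes A :: "nat^'k^'k"
  shows "kmult (loc A N F) (loc A N G) = loc A N (\<lambda>p u v. \<Sum>w\<in>paths A N p. F p u w * G p w v)"
proof (intro ext)
  fix x y
  let ?Z = "{z \<in> shift_space A. agree N x z}"
  show "kmult (loc A N F) (loc A N G) x y = loc A N (\<lambda>p u v. \<Sum>w\<in>paths A N p. F p u w * G p w v) x y"
  proof (cases "x \<in> shift_space A \<and> y \<in> shift_space A \<and> agree N x y")
    case True
    have "kmult (loc A N F) (loc A N G) x y = infsum (\<lambda>z. loc A N F x z * loc A N G z y) ?Z"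
      unfolding kmult_def by (rule infsum_cong_neutral) (auto simp: loc_def)
    also have "\<dots> = (\<Sum>z\<in>?Z. loc A N F x z * loc A N G z y)"
      by (rule infsum_finite[OF finite_agree])
    also have "\<dots> = (\<Sum>z\<in>?Z. F (ends N x) (cwin N x) (cwin N z) * G (ends N x) (cwin N z) (cwin N y))"
    proof (intro sum.cong refl)
      fix z assume z: "z \<in> ?Z"
      then have "ends N z = ends N x" using agree_ends[of z A x N] True agree_sym by auto
      moreover have "agree N z y" using z True agree_sym agree_trans by blast
      ultimately show "loc A N F x z * loc A N G z y = F (ends N x) (cwin N x) (cwin N z) * G (ends N x) (cwin N z) (cwin N y)"
        using z True by (simp add: loc_def)
    qed
    also have "\<dots> = (\<Sum>w\<in>paths A N (ends N x). F (ends N x) (cwin N x) w * G (ends N x) w (cwin N y))"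
      using True by (intro sum.reindex_bij_betw bij_betw_cwin) simp
    finally show ?thesis using True by (simp add: loc_def)
  next
    case False
    have zero: "loc A N F x z * loc A N G z y = 0" for z
      using False agree_trans by (auto simp: loc_def)
    have "kmult (loc A N F) (loc A N G) x y = 0" unfolding kmult_def zero by simp
    moreover have "loc A N H x y = 0" for H using False by (auto simp: loc_def)
    ultimately show ?thesis by simp
  qed
qed

lemma loc_bounded: "kbounded (loc A N F)" for A :: "nat^'k^'k"
proof -
  let ?W = "cwin N ` shift_space A"
  define e where "e = (\<Sum>p\<in>UNIV \<times> ?W \<times> ?W. cmod (F (fst p) (fst (snd p)) (snd (snd p))))"
  have fin: "finite (UNIV \<times> ?W \<times> ?W :: (('k \<times> 'k) \<times> _) set)"
    by (intro finite_cartesian_product finite_cwin) simp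
  have e0: "0 \<le> e" by (simp add: e_def sum_nonneg)
  have "cmod (loc A N F x y) \<le> e" for x y
  proof (cases "x \<in> shift_space A \<and> y \<in> shift_space A \<and> agree N x y")
    case True
    then have "cmod (F (ends N x) (cwin N x) (cwin N y)) \<le> e"
      unfolding e_def using fin
      by (intro member_le_sum[where f = "\<lambda>p. cmod (F (fst p) (fst (snd p)) (snd (snd p)))" and i = "(ends N x, cwin N x, cwin N y)", simplified]) auto
    then show ?thesis using True by (simp add: loc_def)
  qed (use e0 in \<open>auto simp: loc_def\<close>)
  moreover have "x \<in> shift_space A \<and> y \<in> shift_space A \<and> agree N x y" if "loc A N F x y \<noteq> 0" for x y
    using that by (auto simp: loc_def split: if_splits)
  ultimately show ?thesis
    unfolding kbounded_def using agree_supported_norm[of "loc A N F" A N e] e0 by blast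
qed

lemma local_kernel_algebra: "kernel_algebra (local_kernels A)" for A :: "nat^'k^'k"
proof
  fix f g assume f: "f \<in> local_kernels A"
  then obtain N F where F: "f = loc A N F" by (auto simp: local_kernels_def)
  have "(\<lambda>x y. - f x y) = loc A N (\<lambda>p u v. - F p u v)" by (auto simp: F loc_def fun_eq_iff)
  then show "(\<lambda>x y. - f x y) \<in> local_kernels A" by (auto simp: local_kernels_def)
  have "(\<lambda>x y. cnj (f y x)) = loc A N (\<lambda>p u v. cnj (F p v u))"
    by (auto simp: F loc_def fun_eq_iff agree_sym dest: agree_ends)
  then show "(\<lambda>x y. cnj (f y x)) \<in> local_kernels A" by (auto simp: local_kernels_def)
  show "kbounded f" by (simp add: F loc_bounded)
  show "finite {y. f x y \<noteq> 0}" for x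
    by (rule finite_subset[OF _ finite_agree[of A N x]]) (auto simp: F loc_def split: if_splits)
  assume g: "g \<in> local_kernels A"
  obtain N F G where FG: "f = loc A N F" "g = loc A N G" by (rule local_kernels_common[OF f g])
  have "(\<lambda>x y. f x y + g x y) = loc A N (\<lambda>p u v. F p u v + G p u v)" by (auto simp: FG loc_def fun_eq_iff)
  then show "(\<lambda>x y. f x y + g x y) \<in> local_kernels A" by (auto simp: local_kernels_def)
  show "kmult f g \<in> local_kernels A" by (auto simp: FG loc_mult local_kernels_def)
next
  have "(\<lambda>x y. 0) = loc A 0 (\<lambda>p u v. 0)" by (auto simp: loc_def fun_eq_iff)
  then show "(\<lambda>x y. 0) \<in> local_kernels A" by (auto simp: local_kernels_def)
qed

subsection \<open>The topology of the homoclinic relation\<close>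

lemma homoclinic_iff:
  "(x, y) \<in> homoclinic A \<longleftrightarrow> x \<in> shift_space A \<and> y \<in> shift_space A \<and> (\<exists>N. agree N x y)"
proof -
  have "finite {n. x n \<noteq> y n} \<longleftrightarrow> (\<exists>N. agree N x y)"
  proof
    assume fin: "finite {n. x n \<noteq> y n}"
    define N where "N = nat (Max (insert 0 (abs ` {n. x n \<noteq> y n}))) + 1"
    have "n \<in> {1 - int N..int N}" if "x n \<noteq> y n" for n
    proof -
      have "\<bar>n\<bar> \<le> Max (insert 0 (abs ` {n. x n \<noteq> y n}))" using fin that by (intro Max_ge) auto
      then have "\<bar>n\<bar> \<le> int N - 1" unfolding N_def by linarith
      then show ?thesis unfolding atLeastAtMost_iff by linarith
    qed
    then show "\<exists>N. agree N x y" unfolding agree_def by blast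
  next
    assume "\<exists>N. agree N x y"
    then obtain N where "agree N x y" by blast
    then have "{n. x n \<noteq> y n} \<subseteq> {1 - int N..int N}" by (auto simp: agree_def)
    then show "finite {n. x n \<noteq> y n}" by (rule finite_subset) simp
  qed
  then show ?thesis by (auto simp: homoclinic_def)
qed

text \<open>For \<open>x\<close> and \<open>y\<close> that agree off the window, this is the basic
  bisection of level \<open>N\<close> through \<open>(x, y)\<close>, named by the point instead of
  by words.\<close>

definition nb :: "nat^'k^'k \<Rightarrow> nat \<Rightarrow> 'k biseq \<Rightarrow> 'k biseq \<Rightarrow> ('k biseq \<times> 'k biseq) set" where
  "nb A N x y = {(x', y'). x' \<in> shift_space A \<and> y' \<in> shift_space A \<and> agree N x' y' \<and>
     ends N x' = ends N x \<and> cwin N x' = cwin N x \<and> cwin N y' = cwin N y}"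

lemma basic_bisection_iff:
  assumes "length \<xi> = 2 * N" "length \<eta> = 2 * N"
  shows "(x, y) \<in> basic_bisection A N i j \<xi> \<eta> \<longleftrightarrow> x \<in> shift_space A \<and> y \<in> shift_space A \<and>
    ends N x = (i, j) \<and> cwin N x = \<xi> \<and> cwin N y = \<eta> \<and> agree N x y"
proof -
  have c: "cwin N z = \<zeta> \<longleftrightarrow> (\<forall>n\<in>{1 - int N..int N}. z n = \<zeta> ! nat (n + int N - 1))"
    if "length \<zeta> = 2 * N" for z :: "'a biseq" and \<zeta>
  proof
    assume e: "cwin N z = \<zeta>"
    show "\<forall>n\<in>{1 - int N..int N}. z n = \<zeta> ! nat (n + int N - 1)"
    proof
      fix n assume n: "n \<in> {1 - int N..int N}"
      then have "nat (n + int N - 1) < 2 * N" by auto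
      then show "z n = \<zeta> ! nat (n + int N - 1)" using n unfolding e[symmetric] cwin_def by (simp add: window_nth)
    qed
  next
    assume e: "\<forall>n\<in>{1 - int N..int N}. z n = \<zeta> ! nat (n + int N - 1)"
    show "cwin N z = \<zeta>"
    proof (rule nth_equalityI)
      fix k assume "k < length (cwin N z)"
      then have k: "k < 2 * N" by simp
      then show "cwin N z ! k = \<zeta> ! k" using bspec[OF e, of "1 - int N + int k"] by (simp add: cwin_def window_nth)
    qed (simp add: that)
  qed
  show ?thesis
    unfolding basic_bisection_def agree_def ends_def c[OF assms(1)] c[OF assms(2)] by auto
qed

lemma nb_eq: "nb A N x y = basic_bisection A N (fst (ends N x)) (snd (ends N x)) (cwin N x) (cwin N y)"
  by (auto simp: nb_def basic_bisection_iff)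

lemma nb_self: "x \<in> shift_space A \<Longrightarrow> y \<in> shift_space A \<Longrightarrow> agree N x y \<Longrightarrow> (x, y) \<in> nb A N x y"
  by (simp add: nb_def)

lemma nb_open:
  assumes "x \<in> shift_space A" "y \<in> shift_space A" "agree N x y"
  shows "openin (homoclinic_topology A) (nb A N x y)"
proof -
  have "centred_path A N (fst (ends N x)) (snd (ends N x)) (cwin N x)"
    "centred_path A N (fst (ends N x)) (snd (ends N x)) (cwin N y)"
    using cwin_in_paths[OF assms(1), of N] cwin_in_paths[OF assms(2), of N] agree_ends[OF assms]
    by (auto simp: paths_def centred_path_def)
  then show ?thesis unfolding homoclinic_topology_def nb_eq by (intro topology_generated_by_Basis) blast
qed

text \<open>The right end vertex is read from the edge at \<open>int N + 1\<close>, just outside the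
  window of level \<open>N\<close>; hence the strict inequality.\<close>

lemma ends_cwin_mono:
  assumes "N < M" "cwin M x = cwin M y"
  shows "ends N x = ends N y"
  using assms unfolding cwin_eq_iff ends_def by auto

lemma nb_nested:
  assumes "(x, y) \<in> nb A N u v" "N \<le> M"
  shows "nb A M x y \<subseteq> nb A N u v"
proof
  fix p assume p: "p \<in> nb A M x y"
  obtain x' y' where [simp]: "p = (x', y')" by (cases p)
  have c: "cwin M x' = cwin M x" "cwin M y' = cwin M y" "agree M x' y'" using p by (auto simp: nb_def)
  have "agree N x' y'" unfolding agree_def
  proof (intro allI impI)
    fix n assume n: "n \<notin> {1 - int N..int N}"
    show "x' n = y' n"
    proof (cases "n \<in> {1 - int M..int M}")
      case True
      then have "x' n = x n" "y' n = y n" using c by (auto simp: cwin_eq_iff)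
      moreover have "x n = y n" using assms(1) n by (auto simp: nb_def agree_def)
      ultimately show ?thesis by simp
    qed (use c(3) in \<open>auto simp: agree_def\<close>)
  qed
  moreover have "ends N x' = ends N x"
    using p ends_cwin_mono[OF _ c(1), of N] assms(2) by (cases "N = M") (auto simp: nb_def)
  ultimately show "p \<in> nb A N u v"
    using p assms cwin_eq_mono[OF assms(2) c(1)] cwin_eq_mono[OF assms(2) c(2)] by (auto simp: nb_def)
qed

text \<open>The topology is generated by the bisections as a subbase. Because those around a fixed
  point are nested, an intersection of two neighbourhoods contains all bisections of high level, so
  they form a neighbourhood base.\<close>

lemma nb_base:
  assumes "openin (homoclinic_topology A) U" "(x, y) \<in> U"
  shows "\<exists>N. \<forall>M\<ge>N. agree M x y \<and> nb A M x y \<subseteq> U"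
proof -
  have "generate_topology_on {basic_bisection A N i j \<xi> \<eta> | N i j \<xi> \<eta>. centred_path A N i j \<xi> \<and> centred_path A N i j \<eta>} U"
    using assms(1) unfolding homoclinic_topology_def by (rule openin_topology_generated_by)
  then show ?thesis using assms(2)
  proof (induction rule: generate_topology_on.induct)
    case (Int a b)
    then obtain N N' where "\<forall>M\<ge>N. agree M x y \<and> nb A M x y \<subseteq> a" "\<forall>M\<ge>N'. agree M x y \<and> nb A M x y \<subseteq> b" by auto
    then show ?case by (intro exI[of _ "max N N'"]) auto
  next
    case (UN K)
    then show ?case by (meson Union_iff Union_upper order_trans)
  next
    case (Basis s)
    then obtain N i j \<xi> \<eta> where s: "s = basic_bisection A N i j \<xi> \<eta>" "centred_path A N i j \<xi>" "centred_path A N i j \<eta>" by blast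
    have l: "length \<xi> = 2 * N" "length \<eta> = 2 * N" using s by (auto simp: centred_path_def)
    have xy: "x \<in> shift_space A" "y \<in> shift_space A" "ends N x = (i, j)" "cwin N x = \<xi>" "cwin N y = \<eta>" "agree N x y"
      using Basis(2) unfolding s(1) basic_bisection_iff[OF l] by auto
    have "s = nb A N x y" using xy by (simp add: s(1) nb_eq)
    then show ?case using nb_nested[OF nb_self[OF xy(1,2,6)]] agree_mono[OF xy(6)] by blast
  qed simp
qed

lemma topspace_homoclinic: "topspace (homoclinic_topology A) = homoclinic A"
proof (intro equalityI subsetI)
  fix p assume p: "p \<in> topspace (homoclinic_topology A)"
  obtain x y where [simp]: "p = (x, y)" by (cases p)
  obtain N i j \<xi> \<eta> where s: "p \<in> basic_bisection A N i j \<xi> \<eta>" "length \<xi> = 2 * N" "length \<eta> = 2 * N"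
    using p by (auto simp: homoclinic_topology_def centred_path_def)
  then show "p \<in> homoclinic A" using basic_bisection_iff[OF s(2,3)] by (auto simp: homoclinic_iff)
next
  fix p assume p: "p \<in> homoclinic A"
  obtain x y where [simp]: "p = (x, y)" by (cases p)
  obtain N where *: "x \<in> shift_space A" "y \<in> shift_space A" "agree N x y" using p by (auto simp: homoclinic_iff)
  show "p \<in> topspace (homoclinic_topology A)"
    using openin_subset[OF nb_open[OF *]] nb_self[OF *] by auto
qed

text \<open>For each word \<open>w\<close>, splicing \<open>w\<close> into \<open>x\<close> is
  continuous on the closed, hence compact, set of those \<open>x\<close> whose end vertices
  \<open>w\<close> joins; the set in question is the union of the graphs of these finitely many
  maps.\<close>

lemma compact_agree:
  fixes A :: "nat^'k^'k"
  shows "compactin (homoclinic_topology A) {(x, y). x \<in> shift_space A \<and> y \<in> shift_space A \<and> agree N x y}"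
proof -
  define D where "D w = {x \<in> shift_space A. w \<in> paths A N (ends N x)}" for w
  define g where "g w x = (x, patch (1 - int N) w x)" for w and x :: "'k biseq"
  have det: "determined A (Suc N) (\<lambda>x. w \<in> paths A N (ends N x))" for w
    unfolding determined_def using ends_cwin_mono[of N "Suc N"] by (metis lessI)
  have "compactin (homoclinic_topology A) (g w ` D w)" for w
  proof (rule image_compactin)
    have "openin (shift_topology A) (shift_space A - D w)"
    proof -
      have "shift_space A - D w = {x \<in> shift_space A. \<not> w \<in> paths A N (ends N x)}" by (auto simp: D_def)
      then show ?thesis using determined_openin[OF det[of w], where P = Not] by simp
    qed
    then have "closedin (shift_topology A) (D w)"
      by (simp add: closedin_def topspace_shift) (auto simp: D_def)
    then have "compactin (shift_topology A) (D w)"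
      using closedin_compact_space[OF compact_space_shift] by blast
    then show "compactin (subtopology (shift_topology A) (D w)) (D w)"
      by (simp add: compactin_subtopology)
    have "D w \<subseteq> shift_space A" by (auto simp: D_def)
    then have tD: "topspace (subtopology (shift_topology A) (D w)) = D w" by (auto simp: topspace_shift)
    have gin: "g w x \<in> homoclinic A" if "x \<in> D w" for x
      using that patch_cwin[of x A w N] by (auto simp: g_def D_def homoclinic_iff)
    show "continuous_map (subtopology (shift_topology A) (D w)) (homoclinic_topology A) (g w)"
      unfolding continuous_map_def
    proof (intro conjI allI impI)
      show "g w \<in> topspace (subtopology (shift_topology A) (D w)) \<rightarrow> topspace (homoclinic_topology A)"
        using gin by (auto simp: tD topspace_homoclinic)
      fix U assume U: "openin (homoclinic_topology A) U"
      have "openin (shift_topology A) {x \<in> D w. g w x \<in> U}"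
        unfolding openin_shift_iff
      proof (intro conjI ballI)
        show "{x \<in> D w. g w x \<in> U} \<subseteq> shift_space A" by (auto simp: D_def)
        fix x assume x: "x \<in> {x \<in> D w. g w x \<in> U}"
        then obtain M0 where M0: "\<forall>M\<ge>M0. agree M x (patch (1 - int N) w x) \<and> nb A M x (patch (1 - int N) w x) \<subseteq> U"
          using nb_base[OF U, of x "patch (1 - int N) w x"] by (auto simp: g_def)
        define M where "M = max M0 N"
        \<comment> \<open>One level more than \<open>M\<close>, so that the end vertices at level
          \<open>M\<close> are determined as well.\<close>
        have "y \<in> {x \<in> D w. g w x \<in> U}" if y: "y \<in> shift_space A" "cwin (Suc M) y = cwin (Suc M) x" for y
        proof -
          have eN: "ends N y = ends N x" and eM: "ends M y = ends M x"
            by (rule ends_cwin_mono[OF _ y(2)], simp add: M_def)+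
          have yD: "y \<in> D w" using x y eN by (simp add: D_def)
          have cM: "cwin M y = cwin M x" by (rule cwin_eq_mono[OF _ y(2)]) simp
          have "cwin M (patch (1 - int N) w y) = cwin M (patch (1 - int N) w x)"
            using cM unfolding cwin_eq_iff by (simp add: patch_def)
          moreover have "patch (1 - int N) w y \<in> shift_space A" "agree N y (patch (1 - int N) w y)"
            using patch_cwin[of y A w N] yD by (auto simp: D_def)
          ultimately have "g w y \<in> nb A M x (patch (1 - int N) w x)"
            using y(1) eM cM agree_mono[of N y "patch (1 - int N) w y" M] by (simp add: nb_def g_def M_def)
          moreover have "nb A M x (patch (1 - int N) w x) \<subseteq> U" using M0 by (simp add: M_def)
          ultimately show ?thesis using yD by blast
        qed
        then show "\<exists>M. \<forall>y\<in>shift_space A. cwin M y = cwin M x \<longrightarrow> y \<in> {x \<in> D w. g w x \<in> U}" by blast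
      qed
      then show "openin (subtopology (shift_topology A) (D w)) {x \<in> topspace (subtopology (shift_topology A) (D w)). g w x \<in> U}"
        unfolding tD openin_subtopology by (intro exI[of _ "{x \<in> D w. g w x \<in> U}"]) auto
    qed
  qed
  then have "compactin (homoclinic_topology A) (\<Union> ((\<lambda>w. g w ` D w) ` (cwin N ` shift_space A)))"
    using finite_cwin by (intro compactin_Union) auto
  moreover have "\<Union> ((\<lambda>w. g w ` D w) ` (cwin N ` shift_space A)) = {(x, y). x \<in> shift_space A \<and> y \<in> shift_space A \<and> agree N x y}"
  proof (intro equalityI subsetI)
    fix p assume "p \<in> \<Union> ((\<lambda>w. g w ` D w) ` (cwin N ` shift_space A))"
    then obtain w x where "x \<in> shift_space A" "w \<in> paths A N (ends N x)" "p = (x, patch (1 - int N) w x)"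
      by (auto simp: D_def g_def)
    then show "p \<in> {(x, y). x \<in> shift_space A \<and> y \<in> shift_space A \<and> agree N x y}"
      using patch_cwin[of x A w N] by simp
  next
    fix p assume "p \<in> {(x, y). x \<in> shift_space A \<and> y \<in> shift_space A \<and> agree N x y}"
    then obtain x y where p: "p = (x, y)" "x \<in> shift_space A" "y \<in> shift_space A" "agree N x y" by auto
    have w: "cwin N y \<in> paths A N (ends N x)" using cwin_in_paths[OF p(3), of N] agree_ends[OF p(2-4)] by simp
    have "patch (1 - int N) (cwin N y) x = y"
      using patch_cwin[OF p(2) w] p(4) agree_trans[OF agree_sym] by (intro agree_cwin_eq[of N]) auto
    then have "p = g (cwin N y) x" by (simp add: g_def p(1))
    then show "p \<in> \<Union> ((\<lambda>w. g w ` D w) ` (cwin N ` shift_space A))" using p w by (auto simp: D_def)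
  qed
  ultimately show ?thesis by simp
qed

text \<open>A local kernel can be rewritten at any higher level and is constant on the bisections of
  that level, which gives continuity; its support lies in the compact set of
  \<open>compact_agree\<close>.\<close>

lemma local_compactly_supported: "local_kernels A \<subseteq> compactly_supported A" for A :: "nat^'k^'k"
proof
  fix f assume f: "f \<in> local_kernels A"
  then obtain N F where F: "f = loc A N F" by (auto simp: local_kernels_def)
  obtain M0 where M0: "\<And>M. M0 \<le> M \<Longrightarrow> \<exists>F. f = loc A M F"
    by (rule local_kernelsE[OF f]) (rule that)
  have "continuous_map (homoclinic_topology A) euclidean (\<lambda>(x, y). f x y)"
    unfolding continuous_map_def
  proof (intro conjI allI impI)
    fix U :: "complex set"
    show "openin (homoclinic_topology A) {p \<in> topspace (homoclinic_topology A). (case p of (x, y) \<Rightarrow> f x y) \<in> U}"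
    proof (subst openin_subopen, intro ballI)
      fix p assume p: "p \<in> {p \<in> topspace (homoclinic_topology A). (case p of (x, y) \<Rightarrow> f x y) \<in> U}"
      obtain x y where xy: "p = (x, y)" by (cases p)
      obtain N' where a: "x \<in> shift_space A" "y \<in> shift_space A" "agree N' x y"
        using p by (auto simp: topspace_homoclinic homoclinic_iff xy)
      define M where "M = max M0 N'"
      have aM: "agree M x y" using agree_mono[OF a(3), of M] by (simp add: M_def)
      obtain G where G: "f = loc A M G" using M0[of M] by (auto simp: M_def)
      have "nb A M x y \<subseteq> {p \<in> topspace (homoclinic_topology A). (case p of (x, y) \<Rightarrow> f x y) \<in> U}"
      proof
        fix q assume q: "q \<in> nb A M x y"
        then have "q \<in> topspace (homoclinic_topology A)" using openin_subset[OF nb_open[OF a(1,2) aM]] by blast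
        moreover have "(case q of (x, y) \<Rightarrow> f x y) = f x y" using q a aM by (auto simp: nb_def G loc_def)
        ultimately show "q \<in> {p \<in> topspace (homoclinic_topology A). (case p of (x, y) \<Rightarrow> f x y) \<in> U}"
          using p xy by simp
      qed
      then show "\<exists>T. openin (homoclinic_topology A) T \<and> p \<in> T \<and>
          T \<subseteq> {p \<in> topspace (homoclinic_topology A). (case p of (x, y) \<Rightarrow> f x y) \<in> U}"
        using nb_open[OF a(1,2) aM] nb_self[OF a(1,2) aM] xy by blast
    qed
  qed simp
  moreover have "\<exists>C. compactin (homoclinic_topology A) C \<and> (\<forall>x y. (x, y) \<notin> C \<longrightarrow> f x y = 0)"
    by (rule exI, rule conjI[OF compact_agree[of A N]]) (auto simp: F loc_def)
  moreover have "\<forall>x y. (x, y) \<notin> homoclinic A \<longrightarrow> f x y = 0" by (auto simp: F loc_def homoclinic_iff)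
  ultimately show "f \<in> compactly_supported A" by (simp add: compactly_supported_def)
qed

text \<open>By compactness \<open>f\<close> is almost constant on the bisections of one high level
  \<open>M\<close> around points of \<open>C\<close>, and sampling it there gives a local kernel.
  The error lives where \<open>x\<close> and \<open>y\<close> agree off the window of a fixed level
  \<open>M0\<close>, so Schur's bound does not grow when \<open>M\<close> is increased to improve
  the accuracy.\<close>

lemma compactly_supported_closure: "compactly_supported A \<subseteq> kclosure (local_kernels A)" for A :: "nat^'k^'k"
proof
  fix f assume f: "f \<in> compactly_supported A"
  define T where "T = homoclinic_topology A"
  have cont: "continuous_map T euclidean (\<lambda>(x, y). f x y)" using f by (simp add: compactly_supported_def T_def)
  obtain C where C: "compactin T C" "\<And>x y. (x, y) \<notin> C \<Longrightarrow> f x y = 0"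
    using f by (auto simp: compactly_supported_def T_def)
  have CT: "C \<subseteq> homoclinic A" using compactin_subset_topspace[OF C(1)] by (simp add: T_def topspace_homoclinic)
  \<comment> \<open>The analogue of a Lebesgue number: nestedness reduces a finite cover by
    bisections to one level, and two values on one covering bisection differ by less than
    \<open>e\<close>.\<close>
  have unif: "\<exists>M\<ge>M0. \<forall>(x, y)\<in>C. agree M x y \<and> (\<forall>(x', y')\<in>nb A M x y. cmod (f x' y' - f x y) < e)" if e: "e > 0" for e M0
  proof -
    have "\<exists>M. agree M x y \<and> nb A M x y \<subseteq> {q \<in> topspace T. (case q of (x, y) \<Rightarrow> f x y) \<in> ball (f x y) (e / 2)}"
      if xy: "(x, y) \<in> C" for x y
    proof -
      define U where "U = {q \<in> topspace T. (case q of (x, y) \<Rightarrow> f x y) \<in> ball (f x y) (e / 2)}"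
      have U: "openin (homoclinic_topology A) U" unfolding U_def T_def[symmetric]
        by (rule openin_continuous_map_preimage[OF cont]) simp
      moreover have "(x, y) \<in> U" using xy CT e by (auto simp: U_def T_def topspace_homoclinic)
      ultimately obtain N where "\<forall>M\<ge>N. agree M x y \<and> nb A M x y \<subseteq> U" using nb_base by blast
      then show ?thesis unfolding U_def by (intro exI[of _ N]) simp
    qed
    note ex = this
    define m where "m x y = (SOME M. agree M x y \<and> nb A M x y \<subseteq> {q \<in> topspace T. (case q of (x, y) \<Rightarrow> f x y) \<in> ball (f x y) (e / 2)})" for x y
    have m: "agree (m x y) x y \<and> nb A (m x y) x y \<subseteq> {q \<in> topspace T. (case q of (x, y) \<Rightarrow> f x y) \<in> ball (f x y) (e / 2)}"
      if "(x, y) \<in> C" for x y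
      unfolding m_def by (rule someI_ex[OF ex[OF that]])
    define \<U> where "\<U> = (\<lambda>(x, y). nb A (m x y) x y) ` C"
    have "\<And>U. U \<in> \<U> \<Longrightarrow> openin T U"
      using m CT unfolding \<U>_def T_def by (auto simp: homoclinic_iff intro!: nb_open)
    moreover have "C \<subseteq> \<Union>\<U>"
    proof
      fix p assume p: "p \<in> C"
      obtain x y where xy: "p = (x, y)" by (cases p)
      then have "(x, y) \<in> nb A (m x y) x y" using p m[of x y] CT by (auto simp: homoclinic_iff intro!: nb_self)
      then show "p \<in> \<Union>\<U>" using p xy unfolding \<U>_def by blast
    qed
    ultimately have "\<exists>\<F>. finite \<F> \<and> \<F> \<subseteq> \<U> \<and> C \<subseteq> \<Union>\<F>" by (rule compactinD[OF C(1)])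
    then obtain \<F> where "finite \<F>" "\<F> \<subseteq> \<U>" "C \<subseteq> \<Union>\<F>" by blast
    then obtain D where D: "D \<subseteq> C" "finite D" "C \<subseteq> \<Union> ((\<lambda>(x, y). nb A (m x y) x y) ` D)"
      using finite_subset_image[of \<F> "\<lambda>(x, y). nb A (m x y) x y" C] unfolding \<U>_def by blast
    define M where "M = Max (insert M0 ((\<lambda>(x, y). m x y) ` D))"
    have mM: "m x y \<le> M" if "(x, y) \<in> D" for x y
      unfolding M_def using D(2) that by (intro Max_ge) (auto intro: rev_image_eqI)
    have "agree M x y \<and> (\<forall>(x', y')\<in>nb A M x y. cmod (f x' y' - f x y) < e)" if xy: "(x, y) \<in> C" for x y
    proof -
      obtain u v where uv: "(u, v) \<in> D" "(x, y) \<in> nb A (m u v) u v" using D(3) xy by blast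
      have uvC: "(u, v) \<in> C" using uv D by blast
      have close: "cmod (f x' y' - f u v) < e / 2" if "(x', y') \<in> nb A (m u v) u v" for x' y'
        using m[OF uvC] that by (auto simp: dist_norm norm_minus_commute)
      have "cmod (f x' y' - f x y) < e" if "(x', y') \<in> nb A M x y" for x' y'
      proof -
        have "(x', y') \<in> nb A (m u v) u v" using nb_nested[OF uv(2) mM[OF uv(1)]] that by blast
        from close[OF this] close[OF uv(2)] show ?thesis
          using norm_triangle_ineq4[of "f x' y' - f u v" "f x y - f u v"] by simp
      qed
      moreover have "agree M x y" using uv(2) mM[OF uv(1)] agree_mono by (auto simp: nb_def)
      ultimately show ?thesis by blast
    qed
    moreover have "M0 \<le> M" unfolding M_def using D(2) by (intro Max_ge) auto
    ultimately show ?thesis by blast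
  qed
  have "\<exists>M0. \<forall>(x, y)\<in>C. agree M0 x y" using unif[of 1 0] by (auto simp: Ball_def)
  then obtain M0 where M0: "\<forall>(x, y)\<in>C. agree M0 x y" ..
  define B where "B = real (card (cwin M0 ` shift_space A))"
  show "f \<in> kclosure (local_kernels A)" unfolding kclosure_def
  proof (intro CollectI allI impI)
    fix e :: real assume e: "e > 0"
    have B: "0 \<le> B" by (simp add: B_def)
    define d where "d = e / (B + 1)"
    have d: "d > 0" using e B by (simp add: d_def)
    have "d * B \<le> d * (B + 1)" using d by simp
    also have "\<dots> = e" using B by (simp add: d_def)
    finally have dB: "d * B \<le> e" .
    obtain M where M: "M0 \<le> M" "\<And>x y x' y'. (x, y) \<in> C \<Longrightarrow> (x', y') \<in> nb A M x y \<Longrightarrow> cmod (f x' y' - f x y) < d"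
      using unif[OF d, of M0] by blast
    have CM: "x \<in> shift_space A \<and> y \<in> shift_space A \<and> agree M x y" if "(x, y) \<in> C" for x y
      using that M0 CT agree_mono[OF _ M(1)] by (fastforce simp: homoclinic_iff)
    \<comment> \<open>\<open>q\<close> is a sample point in \<open>C\<close> with the prescribed end
      vertices and windows. Where there is none, \<open>f\<close> vanishes, and so does the local
      kernel.\<close>
    define R where "R p u v q \<longleftrightarrow> q \<in> C \<and> ends M (fst q) = p \<and> cwin M (fst q) = u \<and> cwin M (snd q) = v" for p u v q
    define F where "F p u v = (if \<exists>q. R p u v q then (case SOME q. R p u v q of (x, y) \<Rightarrow> f x y) else 0)" for p u v
    define g where "g = loc A M F"
    have key: "cmod (f x y - g x y) \<le> d \<and> (f x y - g x y \<noteq> 0 \<longrightarrow> x \<in> shift_space A \<and> y \<in> shift_space A \<and> agree M0 x y)" for x y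
    proof (cases "x \<in> shift_space A \<and> y \<in> shift_space A \<and> agree M x y \<and> (\<exists>q. R (ends M x) (cwin M x) (cwin M y) q)")
      case True
      define q where "q = (SOME q. R (ends M x) (cwin M x) (cwin M y) q)"
      have q: "R (ends M x) (cwin M x) (cwin M y) q" unfolding q_def by (rule someI_ex) (use True in blast)
      obtain u v where uv: "q = (u, v)" by (cases q)
      have uvC: "(u, v) \<in> C" "ends M u = ends M x" "cwin M u = cwin M x" "cwin M v = cwin M y" using q by (auto simp: R_def uv)
      have "g x y = f u v" using True by (simp add: g_def loc_def F_def q_def[symmetric] uv)
      moreover have nbq: "(x, y) \<in> nb A M u v" using True uvC by (simp add: nb_def)
      ultimately have "cmod (f x y - g x y) \<le> d" using M(2)[OF uvC(1) nbq] by simp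
      moreover have "agree M0 x y" unfolding agree_def
      proof (intro allI impI)
        fix n assume n: "n \<notin> {1 - int M0..int M0}"
        show "x n = y n"
        proof (cases "n \<in> {1 - int M..int M}")
          case True
          then have "x n = u n" "y n = v n" using uvC(3,4) by (auto simp: cwin_eq_iff)
          moreover have "u n = v n" using M0 uvC(1) n by (auto simp: agree_def)
          ultimately show ?thesis by simp
        next
          case False
          then show ?thesis using True[THEN conjunct2, THEN conjunct2] \<open>x \<in> _ \<and> _\<close> by (auto simp: agree_def)
        qed
      qed
      ultimately show ?thesis using True by blast
    next
      case False
      have "(x, y) \<notin> C"
      proof
        assume "(x, y) \<in> C"
        then have "R (ends M x) (cwin M x) (cwin M y) (x, y)" by (simp add: R_def)
        then show False using False CM[OF \<open>(x, y) \<in> C\<close>] by blast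
      qed
      moreover have "g x y = 0" using False by (auto simp: g_def loc_def F_def)
      ultimately show ?thesis using C(2) d by simp
    qed
    have "kernel_norm_le (\<lambda>x y. f x y - g x y) (d * B)"
      unfolding B_def by (rule agree_supported_norm) (use key d in auto)
    then have "kernel_norm_le (\<lambda>x y. f x y - g x y) e" using dB by (rule kernel_norm_le_mono)
    then show "\<exists>g\<in>local_kernels A. kernel_norm_le (\<lambda>x y. f x y - g x y) e"
      by (intro bexI[of _ g]) (auto simp: g_def local_kernels_def)
  qed
qed

lemma homoclinic_carrier_eq: "homoclinic_carrier A = kclosure (local_kernels A)" for A :: "nat^'k^'k"
proof -
  have "homoclinic_carrier A = kclosure (compactly_supported A)"
    by (simp add: homoclinic_carrier_def kclosure_def)
  moreover have "kclosure (compactly_supported A) \<subseteq> kclosure (local_kernels A)"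
    by (rule kclosure_minimal[OF compactly_supported_closure])
  moreover have "kclosure (local_kernels A) \<subseteq> kclosure (compactly_supported A)"
    using local_compactly_supported kclosure_superset by (intro kclosure_minimal) blast
  ultimately show ?thesis by simp
qed

subsection \<open>The ring structure\<close>

lemma homoclinic_algebra_simps [simp]:
  "carrier (homoclinic_algebra A) = homoclinic_carrier A"
  "f \<otimes>\<^bsub>homoclinic_algebra A\<^esub> g = kmult f g"
  "\<one>\<^bsub>homoclinic_algebra A\<^esub> = (\<lambda>x y. if x = y \<and> x \<in> shift_space A then 1 else 0)"
  "\<zero>\<^bsub>homoclinic_algebra A\<^esub> = (\<lambda>x y. 0)"
  "f \<oplus>\<^bsub>homoclinic_algebra A\<^esub> g = (\<lambda>x y. f x y + g x y)"
  "star (homoclinic_algebra A) f = (\<lambda>x y. cnj (f y x))"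
  by (simp_all add: homoclinic_algebra_def kmult_def)

lemma agree_0: "agree 0 x y \<longleftrightarrow> x = y"
  by (auto simp: agree_def)

lemma one_local: "(\<lambda>x y. if x = y \<and> x \<in> shift_space A then 1 else 0) \<in> local_kernels A"
proof -
  have "(\<lambda>x y. if x = y \<and> x \<in> shift_space A then 1 else 0) = loc A 0 (\<lambda>p u v. 1)"
    by (intro ext) (auto simp: loc_def agree_0)
  then show ?thesis by (auto simp: local_kernels_def)
qed

text \<open>The unit is supported on the shift space; it acts as the identity because limits of
  local kernels vanish elsewhere.\<close>

lemma homoclinic_star_algebra: "star_algebra (homoclinic_algebra A)" for A :: "nat^'k^'k"
proof -
  interpret K: kernel_algebra "local_kernels A" by (rule local_kernel_algebra)
  have supp: "f x y = 0" if "f \<in> kclosure (local_kernels A)" "\<not> (x \<in> shift_space A \<and> y \<in> shift_space A)" for f x y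
    by (rule K.closure_support[OF _ that(1)]) (use that(2) in \<open>auto simp: local_kernels_def loc_def\<close>)
  let ?one = "\<lambda>x y. if x = y \<and> x \<in> shift_space A then 1 else 0"
  have one: "?one \<in> kclosure (local_kernels A)" using one_local kclosure_superset by blast
  have l1: "kmult ?one f = f" if f: "f \<in> kclosure (local_kernels A)" for f
  proof (intro ext)
    fix x y
    have "kmult ?one f x y = infsum (\<lambda>z. ?one x z * f z y) {x}"
      unfolding kmult_def by (rule infsum_cong_neutral) auto
    then show "kmult ?one f x y = f x y" using supp[OF f, of x y] by auto
  qed
  have r1: "kmult f ?one = f" if f: "f \<in> kclosure (local_kernels A)" for f
  proof (intro ext)
    fix x y
    have "kmult f ?one x y = infsum (\<lambda>z. f x z * ?one z y) {y}"
      unfolding kmult_def by (rule infsum_cong_neutral) auto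
    then show "kmult f ?one x y = f x y" using supp[OF f, of x y] by auto
  qed
  have "ring (homoclinic_algebra A)"
  proof (rule ringI)
    show "abelian_group (homoclinic_algebra A)"
    proof (rule abelian_groupI)
      fix f assume "f \<in> carrier (homoclinic_algebra A)"
      then have "(\<lambda>x y. - f x y) \<in> carrier (homoclinic_algebra A)"
        by (simp add: homoclinic_carrier_eq K.closure_uminus)
      then show "\<exists>g\<in>carrier (homoclinic_algebra A). g \<oplus>\<^bsub>homoclinic_algebra A\<^esub> f = \<zero>\<^bsub>homoclinic_algebra A\<^esub>"
        by (intro bexI[of _ "\<lambda>x y. - f x y"]) simp_all
    qed (simp_all add: homoclinic_carrier_eq K.closure_add K.closure_zero add_ac)
    show "monoid (homoclinic_algebra A)"
      by (rule monoidI) (simp_all add: homoclinic_carrier_eq K.closure_mult one K.closure_mult_assoc l1 r1)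
  qed (simp_all add: homoclinic_carrier_eq K.closure_bounded kmult_add_left kmult_add_right)
  then show ?thesis
    by (intro star_algebra.intro star_algebra_axioms.intro)
      (simp_all add: homoclinic_carrier_eq K.closure_star kmult_star)
qed

subsection \<open>The trace\<close>

locale mme = pf_data A lam l r
  for A :: "nat^'k::finite^'k" and lam l r +
  fixes \<mu> :: "'k biseq measure"
  assumes mme: "measure_of_maximal_entropy A \<mu>"
begin

abbreviation H :: "'k biseq kernel star_ring" where "H \<equiv> homoclinic_algebra A"

sublocale prob_space \<mu>
  by (rule measure_of_maximal_entropy_cylinder(1)[OF mme])

sublocale H: star_algebra H
  by (rule homoclinic_star_algebra)

sublocale K: kernel_algebra "local_kernels A"
  by (rule local_kernel_algebra)

lemma sets_mu: "sets \<mu> = sets (shift_borel A)" and space_mu: "space \<mu> = shift_space A"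
  using measure_of_maximal_entropy_cylinder[OF mme] by auto

definition pwt :: "nat \<Rightarrow> 'k \<times> 'k \<Rightarrow> real" where
  "pwt N p = l $ fst p * r $ snd p / lam ^ (2 * N)"

definition cyl :: "nat \<Rightarrow> 'k \<times> 'k \<Rightarrow> 'k edge list \<Rightarrow> 'k biseq set" where
  "cyl N p w = {x \<in> shift_space A. cwin N x = w \<and> ends N x = p}"

lemma determined_ends_cwin: "determined A (Suc N) (\<lambda>x. (cwin N x, ends N x))"
  unfolding determined_def
proof (intro ballI impI)
  fix x y assume "x \<in> shift_space A" "y \<in> shift_space A" and e: "cwin (Suc N) x = cwin (Suc N) y"
  have "cwin N x = cwin N y" by (rule cwin_eq_mono[OF _ e]) simp
  moreover have "ends N x = ends N y" by (rule ends_cwin_mono[OF _ e]) simp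
  ultimately show "(cwin N x, ends N x) = (cwin N y, ends N y)" by simp
qed

lemma cyl_sets: "cyl N p w \<in> events"
  using determined_sets[OF determined_ends_cwin, where P = "\<lambda>(u, q). u = w \<and> q = p"]
  by (simp add: cyl_def sets_mu)

lemma prob_cyl: "w \<in> paths A N p \<Longrightarrow> prob (cyl N p w) = pwt N p"
  using measure_of_maximal_entropy_cylinder(4)[OF mme, of "fst p" "snd p" w N]
  by (cases p) (simp add: paths_def cyl_def ends_def pwt_def)

text \<open>The diagonal of a local kernel is constant on each cylinder given by a path and its end
  vertices, and the measure \<open>pwt N p\<close> of that cylinder depends on the end vertices
  only.\<close>

lemma trace_loc:
  "trace_H \<mu> (loc A N F) = (\<Sum>p\<in>UNIV. \<Sum>w\<in>paths A N p. F p w w * complex_of_real (pwt N p))"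
proof -
  define S where "S = (SIGMA p:UNIV. paths A N p)"
  have S: "finite S" by (auto simp: S_def)
  have "trace_H \<mu> (loc A N F) = (LINT x|\<mu>. (\<Sum>(p, w)\<in>S. F p w w * complex_of_real (indicator (cyl N p w) x)))"
    unfolding trace_H_def
  proof (intro Bochner_Integration.integral_cong refl)
    fix x assume "x \<in> space \<mu>"
    then have x: "x \<in> shift_space A" by (simp add: space_mu)
    have "(\<Sum>(p, w)\<in>S. F p w w * complex_of_real (indicator (cyl N p w) x)) =
      (\<Sum>q\<in>S. if q = (ends N x, cwin N x) then F (ends N x) (cwin N x) (cwin N x) else 0)"
      using x by (intro sum.cong) (auto simp: cyl_def indicator_def)
    also have "\<dots> = F (ends N x) (cwin N x) (cwin N x)"
      using S cwin_in_paths[OF x] by (simp add: S_def)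
    finally show "loc A N F x x = (\<Sum>(p, w)\<in>S. F p w w * complex_of_real (indicator (cyl N p w) x))"
      using x by (simp add: loc_def)
  qed
  also have "\<dots> = (\<Sum>(p, w)\<in>S. F p w w * complex_of_real (prob (cyl N p w)))"
  proof (subst Bochner_Integration.integral_sum)
    fix q
    show "integrable \<mu> (\<lambda>x. case q of (p, w) \<Rightarrow> F p w w * complex_of_real (indicator (cyl N p w) x))"
      using cyl_sets by (cases q) (auto intro!: integrable_mult_right integrable_of_real integrable_real_indicator simp: emeasure_eq_measure)
  next
    show "(\<Sum>q\<in>S. (LINT x|\<mu>. (case q of (p, w) \<Rightarrow> F p w w * complex_of_real (indicator (cyl N p w) x)))) =
      (\<Sum>(p, w)\<in>S. F p w w * complex_of_real (prob (cyl N p w)))"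
      using cyl_sets sets.sets_into_space[OF cyl_sets] by (intro sum.cong refl) (auto simp: Int_absorb2)
  qed
  also have "\<dots> = (\<Sum>(p, w)\<in>S. F p w w * complex_of_real (pwt N p))"
    by (intro sum.cong) (auto simp: S_def prob_cyl)
  also have "\<dots> = (\<Sum>p\<in>UNIV. \<Sum>w\<in>paths A N p. F p w w * complex_of_real (pwt N p))"
    unfolding S_def by (rule sum.Sigma[symmetric]) auto
  finally show ?thesis .
qed

lemma measurable_diag_local: "f \<in> local_kernels A \<Longrightarrow> (\<lambda>x. f x x) \<in> borel_measurable \<mu>"
proof -
  assume "f \<in> local_kernels A"
  then obtain N F where F: "f = loc A N F" by (auto simp: local_kernels_def)
  have "determined A (Suc N) (\<lambda>x. (\<lambda>(w, p). F p w w) (cwin N x, ends N x))"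
    by (rule determined_comp[OF determined_ends_cwin])
  then have "(\<lambda>x. F (ends N x) (cwin N x) (cwin N x)) \<in> measurable \<mu> (count_space UNIV)"
    using determined_measurable[OF _ sets_mu] by simp
  then have "(\<lambda>x. F (ends N x) (cwin N x) (cwin N x)) \<in> borel_measurable \<mu>"
    by (rule measurable_compose) simp
  then show ?thesis
    by (subst measurable_cong[where g = "\<lambda>x. F (ends N x) (cwin N x) (cwin N x)"]) (auto simp: F loc_def space_mu)
qed

text \<open>Norm bounds control every entry, so the diagonal is a pointwise limit of diagonals of
  local kernels.\<close>

lemma measurable_diag: "f \<in> homoclinic_carrier A \<Longrightarrow> (\<lambda>x. f x x) \<in> borel_measurable \<mu>"
proof -
  assume f: "f \<in> homoclinic_carrier A"
  have "\<exists>g\<in>local_kernels A. kernel_norm_le (\<lambda>x y. f x y - g x y) (1 / real (Suc n))" for n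
    using f unfolding homoclinic_carrier_eq kclosure_def by simp
  then have ex: "\<exists>g. g \<in> local_kernels A \<and> kernel_norm_le (\<lambda>x y. f x y - g x y) (1 / real (Suc n))" for n
    by blast
  define g where "g n = (SOME g. g \<in> local_kernels A \<and> kernel_norm_le (\<lambda>x y. f x y - g x y) (1 / real (Suc n)))" for n
  have g: "g n \<in> local_kernels A \<and> kernel_norm_le (\<lambda>x y. f x y - g n x y) (1 / real (Suc n))" for n
    unfolding g_def by (rule someI_ex[OF ex])
  show ?thesis
  proof (rule borel_measurable_LIMSEQ_metric)
    show "(\<lambda>x. g n x x) \<in> borel_measurable \<mu>" for n using g measurable_diag_local by blast
    fix x
    show "(\<lambda>n. g n x x) \<longlonglongrightarrow> f x x"
    proof (rule LIMSEQ_I)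
      fix e :: real assume "e > 0"
      then obtain n0 where n0: "1 / real (Suc n0) < e" using nat_approx_posE by blast
      have "norm (g n x x - f x x) < e" if "n \<ge> n0" for n
      proof -
        have "norm (g n x x - f x x) \<le> 1 / real (Suc n)"
          using kernel_norm_le_entry[OF conjunct2[OF g[of n]], of x x] by (simp add: norm_minus_commute)
        also have "\<dots> \<le> 1 / real (Suc n0)" using that by (simp add: frac_le)
        finally show ?thesis using n0 by simp
      qed
      then show "\<exists>n0. \<forall>n\<ge>n0. norm (g n x x - f x x) < e" by blast
    qed
  qed
qed

lemma integrable_diag:
  assumes "f \<in> homoclinic_carrier A"
  shows "integrable \<mu> (\<lambda>x. f x x)"
proof -
  obtain c where c: "kernel_norm_le f c"
    using K.closure_bounded assms by (auto simp: homoclinic_carrier_eq kbounded_def)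
  then show ?thesis
    using kernel_norm_le_entry[OF c] by (intro integrable_const_bound[where B = c] measurable_diag[OF assms] AE_I2)
qed

lemma trace_bound:
  assumes "kernel_norm_le f c"
  shows "cmod (trace_H \<mu> f) \<le> c"
proof -
  have "cmod (trace_H \<mu> f) \<le> (LINT x|\<mu>. cmod (f x x))"
    unfolding trace_H_def by (rule integral_norm_bound)
  also have "\<dots> \<le> (LINT x|\<mu>. c)"
    by (rule integral_mono') (use kernel_norm_le_entry[OF assms] kernel_norm_le_nonneg[OF assms] in auto)
  finally show ?thesis by (simp add: prob_space)
qed

lemma trace_add':
  "f \<in> homoclinic_carrier A \<Longrightarrow> g \<in> homoclinic_carrier A \<Longrightarrow>
    trace_H \<mu> (\<lambda>x y. f x y + g x y) = trace_H \<mu> f + trace_H \<mu> g"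
  unfolding trace_H_def by (intro Bochner_Integration.integral_add integrable_diag)

lemma trace_diff':
  "f \<in> homoclinic_carrier A \<Longrightarrow> g \<in> homoclinic_carrier A \<Longrightarrow>
    trace_H \<mu> (\<lambda>x y. f x y - g x y) = trace_H \<mu> f - trace_H \<mu> g"
  unfolding trace_H_def by (intro Bochner_Integration.integral_diff integrable_diag)

text \<open>Within a block all paths have the same weight, so the trace there is a multiple of the
  matrix trace.\<close>

lemma trace_comm_local:
  assumes "f \<in> local_kernels A" "g \<in> local_kernels A"
  shows "trace_H \<mu> (kmult f g) = trace_H \<mu> (kmult g f)"
proof -
  obtain N F G where FG: "f = loc A N F" "g = loc A N G" by (rule local_kernels_common[OF assms])
  have "(\<Sum>w\<in>paths A N p. \<Sum>v\<in>paths A N p. F p w v * G p v w * complex_of_real (pwt N p)) =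
      (\<Sum>w\<in>paths A N p. \<Sum>v\<in>paths A N p. G p w v * F p v w * complex_of_real (pwt N p))" for p
    by (subst sum.swap) (simp add: mult.commute)
  then show ?thesis by (simp add: FG loc_mult trace_loc sum_distrib_right)
qed

lemma trace_comm':
  assumes f: "f \<in> homoclinic_carrier A" and g: "g \<in> homoclinic_carrier A"
  shows "trace_H \<mu> (kmult f g) = trace_H \<mu> (kmult g f)"
proof -
  have fc: "f \<in> kclosure (local_kernels A)" "g \<in> kclosure (local_kernels A)" using f g by (auto simp: homoclinic_carrier_eq)
  have sub: "h \<in> homoclinic_carrier A" if "h \<in> local_kernels A" for h
    using that kclosure_superset by (auto simp: homoclinic_carrier_eq)
  have cl: "kmult h k \<in> homoclinic_carrier A" if "h \<in> homoclinic_carrier A" "k \<in> homoclinic_carrier A" for h k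
    using that by (simp add: homoclinic_carrier_eq K.closure_mult)
  have "cmod (trace_H \<mu> (kmult f g) - trace_H \<mu> (kmult g f)) \<le> 0 + e" if "e > 0" for e
  proof -
    have e: "e / 2 > 0" using that by simp
    obtain d1 where d1: "d1 > 0" "\<And>f' g'. kernel_norm_le (\<lambda>x y. f x y - f' x y) d1 \<Longrightarrow>
      kernel_norm_le (\<lambda>x y. g x y - g' x y) d1 \<Longrightarrow> kernel_norm_le (\<lambda>x y. kmult f g x y - kmult f' g' x y) (e / 2)"
      by (rule K.closure_mult_approx[OF fc e]) (rule that)
    obtain d2 where d2: "d2 > 0" "\<And>f' g'. kernel_norm_le (\<lambda>x y. g x y - f' x y) d2 \<Longrightarrow>
      kernel_norm_le (\<lambda>x y. f x y - g' x y) d2 \<Longrightarrow> kernel_norm_le (\<lambda>x y. kmult g f x y - kmult f' g' x y) (e / 2)"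
      by (rule K.closure_mult_approx[OF fc(2,1) e]) (rule that)
    define d where "d = min d1 d2"
    have d: "d > 0" "d \<le> d1" "d \<le> d2" using d1 d2 by (auto simp: d_def)
    obtain f' where f': "f' \<in> local_kernels A" "kernel_norm_le (\<lambda>x y. f x y - f' x y) d"
      by (rule K.closureE[OF fc(1) d(1)]) (rule that)
    obtain g' where g': "g' \<in> local_kernels A" "kernel_norm_le (\<lambda>x y. g x y - g' x y) d"
      by (rule K.closureE[OF fc(2) d(1)]) (rule that)
    note m = kernel_norm_le_mono[OF f'(2)] kernel_norm_le_mono[OF g'(2)]
    have 1: "cmod (trace_H \<mu> (kmult f g) - trace_H \<mu> (kmult f' g')) \<le> e / 2"
      using trace_bound[OF d1(2)[OF m(1)[OF d(2)] m(2)[OF d(2)]]] trace_diff'[OF cl[OF f g] cl[OF sub[OF f'(1)] sub[OF g'(1)]]] by simp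
    have 2: "cmod (trace_H \<mu> (kmult g f) - trace_H \<mu> (kmult g' f')) \<le> e / 2"
      using trace_bound[OF d2(2)[OF m(2)[OF d(3)] m(1)[OF d(3)]]] trace_diff'[OF cl[OF g f] cl[OF sub[OF g'(1)] sub[OF f'(1)]]] by simp
    show ?thesis using 1 2 trace_comm_local[OF f'(1) g'(1)]
      norm_triangle_ineq4[of "trace_H \<mu> (kmult f g) - trace_H \<mu> (kmult f' g')" "trace_H \<mu> (kmult g f) - trace_H \<mu> (kmult g' f')"]
      by simp
  qed
  then have "cmod (trace_H \<mu> (kmult f g) - trace_H \<mu> (kmult g f)) \<le> 0" by (rule field_le_epsilon)
  then show ?thesis by simp
qed

lemma uminus_H: "f \<in> homoclinic_carrier A \<Longrightarrow> \<ominus>\<^bsub>H\<^esub> f = (\<lambda>x y. - f x y)"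
  by (rule H.minus_equality[of "\<lambda>x y. - f x y" f]) (simp_all add: homoclinic_carrier_eq K.closure_uminus)

sublocale T: normed_tracial_star_algebra H "trace_H \<mu>" kernel_norm_le
proof (unfold_locales, goal_cases)
  case (1 a b) then show ?case by (simp add: trace_add')
next
  case (2 a b) then show ?case by (simp add: trace_comm')
next
  case (3 a b x y) then show ?case by (simp add: kernel_norm_le_add)
next
  case (4 a b x y) then show ?case by (simp add: kernel_norm_le_mult)
next
  case (5 a x) then show ?case by (simp add: uminus_H kernel_norm_le_uminus)
next
  case 6 then show ?case by (simp add: kernel_norm_le_zero)
next
  case (7 a x) then show ?case by (simp add: trace_bound)
next
  case (8 a) then show ?case using K.closure_bounded[of a] by (simp add: homoclinic_carrier_eq kbounded_def)
next
  case (9 a x y) then show ?case by (rule kernel_norm_le_mono)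
qed

lemma minus_H: "f \<in> homoclinic_carrier A \<Longrightarrow> g \<in> homoclinic_carrier A \<Longrightarrow> f \<ominus>\<^bsub>H\<^esub> g = (\<lambda>x y. f x y - g x y)"
  by (simp add: H.minus_eq uminus_H)

end

section \<open>The mapping cylinder\<close>

lemma mapping_cylinder_simps [simp]:
  "carrier (mapping_cylinder A) = cylinder_carrier A"
  "f \<otimes>\<^bsub>mapping_cylinder A\<^esub> g = (\<lambda>t. kmult (f t) (g t))"
  "\<one>\<^bsub>mapping_cylinder A\<^esub> = (\<lambda>t. \<one>\<^bsub>homoclinic_algebra A\<^esub>)"
  "\<zero>\<^bsub>mapping_cylinder A\<^esub> = (\<lambda>t x y. 0)"
  "f \<oplus>\<^bsub>mapping_cylinder A\<^esub> g = (\<lambda>t x y. f t x y + g t x y)"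
  "star (mapping_cylinder A) f = (\<lambda>t x y. cnj (f t y x))"
  by (simp_all add: mapping_cylinder_def Let_def)

lemma shift_aut_mult: "shift_aut (kmult f g) = kmult (shift_aut f) (shift_aut g)"
proof (intro ext)
  fix x y :: "'a biseq"
  have "bij (shift_inv :: 'a biseq \<Rightarrow> _)"
    by (rule bij_betw_byWitness[of _ shift]) (auto simp: shift_def shift_inv_def)
  from infsum_reindex_bij_betw[OF this, of "\<lambda>z. f (shift_inv x) z * g z (shift_inv y)"]
  show "shift_aut (kmult f g) x y = kmult (shift_aut f) (shift_aut g) x y"
    by (simp add: shift_aut_def kmult_def)
qed

lemma shift_inv_mem: "shift_inv x \<in> shift_space A \<longleftrightarrow> x \<in> shift_space A"
proof
  assume s: "shift_inv x \<in> shift_space A"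
  have "shift_inv x (n + 1) = x n" "shift_inv x (n + 1 + 1) = x (n + 1)" for n
    by (simp_all add: shift_inv_def add.commute)
  then have "x n \<in> edges A \<and> tgt (x n) = src (x (n + 1))" for n
    using shift_spaceD[OF s, of "n + 1"] by metis
  then show "x \<in> shift_space A" unfolding shift_space_def by blast
next
  assume x: "x \<in> shift_space A"
  have "x (n - 1) \<in> edges A \<and> tgt (x (n - 1)) = src (x n)" for n
    using shift_spaceD[OF x, of "n - 1"] by simp
  then show "shift_inv x \<in> shift_space A" by (simp add: shift_inv_def shift_space_def)
qed

section \<open>Norm-continuous families of kernels\<close>

definition kcontinuous :: "(real \<Rightarrow> 'x kernel) \<Rightarrow> bool" where
  "kcontinuous f \<longleftrightarrow> (\<forall>t. \<forall>e>0. \<exists>d>0. \<forall>s. \<bar>s - t\<bar> < d \<longrightarrow> kernel_norm_le (\<lambda>x y. f s x y - f t x y) e)"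

lemma kcontinuousE:
  assumes "kcontinuous f" "e > 0"
  obtains d where "d > 0" "\<And>s. \<bar>s - t\<bar> < d \<Longrightarrow> kernel_norm_le (\<lambda>x y. f s x y - f t x y) e"
  using assms unfolding kcontinuous_def by blast

lemma cylinder_carrier_iff:
  "f \<in> cylinder_carrier A \<longleftrightarrow> (\<forall>t. f t \<in> homoclinic_carrier A) \<and> kcontinuous f \<and> (\<forall>t. f (t + 1) = shift_aut (f t))"
  by (simp add: cylinder_carrier_def kcontinuous_def)

lemma kcontinuous_const: "kcontinuous (\<lambda>t. g)"
  unfolding kcontinuous_def using kernel_norm_le_mono[OF kernel_norm_le_zero less_imp_le]
  by (auto intro!: exI[of _ 1])

lemma kcontinuous_add:
  assumes "kcontinuous f" "kcontinuous g"
  shows "kcontinuous (\<lambda>t x y. f t x y + g t x y)"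
  unfolding kcontinuous_def
proof (intro allI impI)
  fix t e :: real assume "e > 0"
  then have e: "e / 2 > 0" by simp
  obtain d where d: "d > 0" "\<And>s. \<bar>s - t\<bar> < d \<Longrightarrow> kernel_norm_le (\<lambda>x y. f s x y - f t x y) (e / 2)"
    by (rule kcontinuousE[OF assms(1) e]) (rule that)
  obtain d' where d': "d' > 0" "\<And>s. \<bar>s - t\<bar> < d' \<Longrightarrow> kernel_norm_le (\<lambda>x y. g s x y - g t x y) (e / 2)"
    by (rule kcontinuousE[OF assms(2) e]) (rule that)
  have "kernel_norm_le (\<lambda>x y. (f s x y + g s x y) - (f t x y + g t x y)) e" if "\<bar>s - t\<bar> < min d d'" for s
    using kernel_norm_le_add[OF d(2)[of s] d'(2)[of s]] that by (simp add: algebra_simps)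
  then show "\<exists>d>0. \<forall>s. \<bar>s - t\<bar> < d \<longrightarrow> kernel_norm_le (\<lambda>x y. (f s x y + g s x y) - (f t x y + g t x y)) e"
    using d(1) d'(1) by (intro exI[of _ "min d d'"]) auto
qed

lemma kcontinuous_uminus:
  assumes "kcontinuous f"
  shows "kcontinuous (\<lambda>t x y. - f t x y)"
  unfolding kcontinuous_def
proof (intro allI impI)
  fix t e :: real assume "e > 0"
  then obtain d where "d > 0" "\<And>s. \<bar>s - t\<bar> < d \<Longrightarrow> kernel_norm_le (\<lambda>x y. f s x y - f t x y) e"
    by (rule kcontinuousE[OF assms]) (rule that)
  then show "\<exists>d>0. \<forall>s. \<bar>s - t\<bar> < d \<longrightarrow> kernel_norm_le (\<lambda>x y. - f s x y - - f t x y) e"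
    using kernel_norm_le_uminus[of "\<lambda>x y. f s x y - f t x y" e for s] by (intro exI[of _ d]) simp
qed

lemma kcontinuous_star:
  assumes "kcontinuous f"
  shows "kcontinuous (\<lambda>t x y. cnj (f t y x))"
  unfolding kcontinuous_def
proof (intro allI impI)
  fix t e :: real assume "e > 0"
  then obtain d where "d > 0" "\<And>s. \<bar>s - t\<bar> < d \<Longrightarrow> kernel_norm_le (\<lambda>x y. f s x y - f t x y) e"
    by (rule kcontinuousE[OF assms]) (rule that)
  then show "\<exists>d>0. \<forall>s. \<bar>s - t\<bar> < d \<longrightarrow> kernel_norm_le (\<lambda>x y. cnj (f s y x) - cnj (f t y x)) e"
    using kernel_norm_le_star[of "\<lambda>x y. f s x y - f t x y" e for s] by (intro exI[of _ d]) simp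
qed

context mme
begin

abbreviation CH :: "(real \<Rightarrow> 'k biseq kernel) star_ring" where "CH \<equiv> mapping_cylinder A"

lemma H_laws:
  "f \<in> homoclinic_carrier A \<Longrightarrow> g \<in> homoclinic_carrier A \<Longrightarrow> (\<lambda>x y. f x y + g x y) \<in> homoclinic_carrier A"
  "f \<in> homoclinic_carrier A \<Longrightarrow> (\<lambda>x y. - f x y) \<in> homoclinic_carrier A"
  "f \<in> homoclinic_carrier A \<Longrightarrow> g \<in> homoclinic_carrier A \<Longrightarrow> kmult f g \<in> homoclinic_carrier A"
  "f \<in> homoclinic_carrier A \<Longrightarrow> (\<lambda>x y. cnj (f y x)) \<in> homoclinic_carrier A"
  "(\<lambda>x y. 0) \<in> homoclinic_carrier A"
  by (simp_all add: homoclinic_carrier_eq K.closure_add K.closure_uminus K.closure_mult K.closure_star K.closure_zero)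

lemma kcontinuous_mult:
  assumes f: "kcontinuous f" "\<And>t. f t \<in> homoclinic_carrier A"
    and g: "kcontinuous g" "\<And>t. g t \<in> homoclinic_carrier A"
  shows "kcontinuous (\<lambda>t. kmult (f t) (g t))"
  unfolding kcontinuous_def
proof (intro allI impI)
  fix t e :: real assume e: "e > 0"
  obtain c where c: "c > 0" "\<And>f' g'. kernel_norm_le (\<lambda>x y. f t x y - f' x y) c \<Longrightarrow>
    kernel_norm_le (\<lambda>x y. g t x y - g' x y) c \<Longrightarrow>
    kernel_norm_le (\<lambda>x y. kmult (f t) (g t) x y - kmult f' g' x y) e"
    by (rule K.closure_mult_approx[OF f(2)[of t, unfolded homoclinic_carrier_eq] g(2)[of t, unfolded homoclinic_carrier_eq] e])
      (rule that)
  obtain d where d: "d > 0" "\<And>s. \<bar>s - t\<bar> < d \<Longrightarrow> kernel_norm_le (\<lambda>x y. f s x y - f t x y) c"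
    by (rule kcontinuousE[OF f(1) c(1)]) (rule that)
  obtain d' where d': "d' > 0" "\<And>s. \<bar>s - t\<bar> < d' \<Longrightarrow> kernel_norm_le (\<lambda>x y. g s x y - g t x y) c"
    by (rule kcontinuousE[OF g(1) c(1)]) (rule that)
  have "kernel_norm_le (\<lambda>x y. kmult (f s) (g s) x y - kmult (f t) (g t) x y) e" if "\<bar>s - t\<bar> < min d d'" for s
    using that by (intro kernel_norm_le_diff_commute[OF c(2)] kernel_norm_le_diff_commute[OF d(2)]
      kernel_norm_le_diff_commute[OF d'(2)]) auto
  then show "\<exists>d>0. \<forall>s. \<bar>s - t\<bar> < d \<longrightarrow> kernel_norm_le (\<lambda>x y. kmult (f s) (g s) x y - kmult (f t) (g t) x y) e"
    using d(1) d'(1) by (intro exI[of _ "min d d'"]) auto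
qed

text \<open>The ring laws hold at each \<open>t\<close>; what needs proof is that the operations
  preserve continuity and equivariance under \<open>shift_aut\<close>.\<close>

lemma CH_star_algebra: "star_algebra CH"
proof -
  note carr = cylinder_carrier_iff
  have add: "(\<lambda>t x y. f t x y + g t x y) \<in> cylinder_carrier A"
    if "f \<in> cylinder_carrier A" "g \<in> cylinder_carrier A" for f g
    using that by (auto simp: carr H_laws kcontinuous_add) (simp add: shift_aut_def)
  have um: "(\<lambda>t x y. - f t x y) \<in> cylinder_carrier A" if "f \<in> cylinder_carrier A" for f
    using that by (auto simp: carr H_laws kcontinuous_uminus) (simp add: shift_aut_def)
  have mu: "(\<lambda>t. kmult (f t) (g t)) \<in> cylinder_carrier A"
    if "f \<in> cylinder_carrier A" "g \<in> cylinder_carrier A" for f g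
    using that by (auto simp: carr H_laws kcontinuous_mult shift_aut_mult)
  have st: "(\<lambda>t x y. cnj (f t y x)) \<in> cylinder_carrier A" if "f \<in> cylinder_carrier A" for f
    using that by (auto simp: carr H_laws kcontinuous_star) (simp add: shift_aut_def)
  have ze: "(\<lambda>t x y. 0) \<in> cylinder_carrier A"
    by (auto simp: carr H_laws kcontinuous_const) (simp add: shift_aut_def)
  have sinj: "shift_inv x = shift_inv y \<longleftrightarrow> x = y" for x y :: "'k biseq"
  proof
    assume "shift_inv x = shift_inv y"
    then have "shift (shift_inv x) = shift (shift_inv y)" by simp
    then show "x = y" by (simp add: shift_def shift_inv_def)
  qed simp
  have on: "(\<lambda>t. \<one>\<^bsub>H\<^esub>) \<in> cylinder_carrier A"
    using H.one_closed by (auto simp: carr kcontinuous_const shift_aut_def shift_inv_mem sinj)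
  have c: "f t \<in> homoclinic_carrier A" if "f \<in> cylinder_carrier A" for f t using that by (simp add: carr)
  note one = H.l_one[simplified] H.r_one[simplified]
  have "ring CH"
  proof (rule ringI)
    show "abelian_group CH"
    proof (rule abelian_groupI)
      fix f assume "f \<in> carrier CH"
      then show "\<exists>g\<in>carrier CH. g \<oplus>\<^bsub>CH\<^esub> f = \<zero>\<^bsub>CH\<^esub>"
        using um by (intro bexI[of _ "\<lambda>t x y. - f t x y"]) simp_all
    qed (simp_all add: add ze add_ac)
    show "monoid CH"
    proof (rule monoidI)
      show "\<one>\<^bsub>CH\<^esub> \<in> carrier CH" using on by (simp only: mapping_cylinder_simps)
      show "f \<otimes>\<^bsub>CH\<^esub> g \<otimes>\<^bsub>CH\<^esub> h = f \<otimes>\<^bsub>CH\<^esub> (g \<otimes>\<^bsub>CH\<^esub> h)"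
        if "f \<in> carrier CH" "g \<in> carrier CH" "h \<in> carrier CH" for f g h
        using that H.m_assoc c by (simp add: fun_eq_iff)
    qed (simp_all add: mu c one)
  qed (simp_all add: c K.closure_bounded[folded homoclinic_carrier_eq] kmult_add_left kmult_add_right)
  then show ?thesis
    by (intro star_algebra.intro star_algebra_axioms.intro) (simp_all add: st kmult_star)
qed

sublocale C: star_algebra CH
  by (rule CH_star_algebra)

section \<open>Evaluation of projections over the mapping cylinder\<close>

definition ev :: "real \<Rightarrow> (nat \<Rightarrow> nat \<Rightarrow> real \<Rightarrow> 'k biseq kernel) \<Rightarrow> nat \<Rightarrow> nat \<Rightarrow> 'k biseq kernel" where
  "ev t p = (\<lambda>i j. p i j t)"

lemma CH_carrier: "f \<in> carrier CH \<Longrightarrow> f t \<in> carrier H"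
  by (simp add: cylinder_carrier_iff)

lemma ev_finsum:
  assumes "finite I" "\<And>i. i \<in> I \<Longrightarrow> f i \<in> carrier CH"
  shows "finsum CH f I t = finsum H (\<lambda>i. f i t) I"
  using assms
proof (induction I)
  case empty
  then show ?case by (simp only: C.finsum_empty H.finsum_empty) simp
next
  case (insert x I)
  then have "finsum CH f (insert x I) = f x \<oplus>\<^bsub>CH\<^esub> finsum CH f I" by (intro C.finsum_insert) auto
  moreover have "finsum H (\<lambda>i. f i t) (insert x I) = f x t \<oplus>\<^bsub>H\<^esub> finsum H (\<lambda>i. f i t) I"
    using insert CH_carrier by (intro H.finsum_insert) auto
  ultimately show ?case using insert by simp
qed

lemma ev_mats: "p \<in> mats CH m n \<Longrightarrow> ev t p \<in> mats H m n"
  using CH_carrier[OF C.mats_carrier, of p m n _ _ t] by (intro H.matsI) (auto simp: ev_def C.mats_outside)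

lemma ev_mult:
  assumes "p \<in> mats CH m n" "q \<in> mats CH n k"
  shows "ev t (mats_mult CH n p q) = mats_mult H n (ev t p) (ev t q)"
proof (rule ext, rule ext)
  fix i j
  have "p i k \<otimes>\<^bsub>CH\<^esub> q k j \<in> carrier CH" for k
    by (intro C.m_closed C.mats_carrier[OF assms(1)] C.mats_carrier[OF assms(2)])
  then show "ev t (mats_mult CH n p q) i j = mats_mult H n (ev t p) (ev t q) i j"
    unfolding ev_def mats_mult_def by (subst ev_finsum) auto
qed

lemma ev_star: "ev t (mats_star CH p) = mats_star H (ev t p)"
  by (simp add: ev_def mats_star_def)

lemma ev_projection: "(n, p) \<in> projections CH \<Longrightarrow> (n, ev t p) \<in> projections H"
proof -
  assume p: "(n, p) \<in> projections CH"
  note P = C.projectionsD[OF p]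
  have "mats_mult H n (ev t p) (ev t p) = ev t p" 
    by (rule trans[OF ev_mult[OF P(1) P(1), of t, symmetric] arg_cong[OF P(3), of "ev t"]])
  moreover have "mats_star H (ev t p) = ev t p" 
    by (rule trans[OF ev_star[symmetric] arg_cong[OF P(2), of "ev t"]])
  ultimately show ?thesis unfolding projections_def mem_Collect_eq prod.case
    by (intro conjI ev_mats[OF P(1)])
qed

lemma ev_block: "ev t (C.block n m p q) = H.block n m (ev t p) (ev t q)"
  unfolding ev_def C.block_def H.block_def by (intro ext) simp

lemma ev_mvn:
  assumes "mvn_equiv CH (n, p) (m, q)"
  shows "mvn_equiv H (n, ev t p) (m, ev t q)"
proof -
  obtain v where v: "v \<in> mats CH m n" "mats_mult CH m (mats_star CH v) v = p" "mats_mult CH n v (mats_star CH v) = q"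
    using assms by (auto simp: mvn_equiv_def)
  have "mats_mult H m (mats_star H (ev t v)) (ev t v) = ev t p" "mats_mult H n (ev t v) (mats_star H (ev t v)) = ev t q"
    using ev_mult[OF C.mats_star_closed[OF v(1)] v(1), of t] ev_mult[OF v(1) C.mats_star_closed[OF v(1)], of t] v
    by (auto simp: ev_star)
  then show ?thesis using ev_mats[OF v(1), of t] by (auto simp: mvn_equiv_def)
qed

lemma ev_K0_rel:
  assumes "(((n, p), (m, q)), ((n', p'), (m', q'))) \<in> K0_rel CH"
  shows "(((n, ev t p), (m, ev t q)), ((n', ev t p'), (m', ev t q'))) \<in> K0_rel H"
proof -
  obtain k r where r: "(k, r) \<in> projections CH"
    "mvn_equiv CH (dsum CH (dsum CH (n, p) (m', q')) (k, r)) (dsum CH (dsum CH (n', p') (m, q)) (k, r))"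
    using assms by (auto simp: K0_rel_def)
  have "mvn_equiv H (dsum H (dsum H (n, ev t p) (m', ev t q')) (k, ev t r)) (dsum H (dsum H (n', ev t p') (m, ev t q)) (k, ev t r))"
    using ev_mvn[OF r(2)[unfolded C.dsum_eq], of t] by (simp add: H.dsum_eq ev_block)
  moreover have "{(n, ev t p), (m, ev t q), (n', ev t p'), (m', ev t q')} \<subseteq> projections H"
    using assms ev_projection by (auto simp: K0_rel_def)
  ultimately show ?thesis using ev_projection[OF r(1), of t] by (auto simp: K0_rel_def)
qed

text \<open>Nearby projections have the same trace, so the function is locally constant; its
  vanishing derivative turns this into constancy on the whole line.\<close>

lemma mtrace_ev_constant:
  assumes p: "(n, p) \<in> projections CH"
  shows "T.mtrace n (ev t p) = T.mtrace n (ev 0 p)"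
proof -
  have der: "((\<lambda>t. T.mtrace n (ev t p)) has_derivative (\<lambda>_. 0)) (at t)" for t
  proof -
    obtain e where e: "e > 0" "\<And>q. (n, q) \<in> projections H \<Longrightarrow> (\<forall>i<n. \<forall>j<n. kernel_norm_le (q i j \<ominus>\<^bsub>H\<^esub> ev t p i j) e) \<Longrightarrow>
        T.mtrace n q = T.mtrace n (ev t p)"
      using T.mtrace_projections_close[OF ev_projection[OF p, of t]] by blast
    have pc: "p i j \<in> cylinder_carrier A" for i j using C.mats_carrier[OF C.projectionsD(1)[OF p]] by simp
    have "\<exists>d>0. \<forall>s. \<bar>s - t\<bar> < d \<longrightarrow> kernel_norm_le (\<lambda>x y. p i j s x y - p i j t x y) e" for i j
      using pc[of i j] e(1) by (auto simp: cylinder_carrier_iff kcontinuous_def)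
    note ex = this
    define d where "d i j = (SOME d. d > 0 \<and> (\<forall>s. \<bar>s - t\<bar> < d \<longrightarrow> kernel_norm_le (\<lambda>x y. p i j s x y - p i j t x y) e))" for i j
    have d': "d i j > 0 \<and> (\<forall>s. \<bar>s - t\<bar> < d i j \<longrightarrow> kernel_norm_le (\<lambda>x y. p i j s x y - p i j t x y) e)" for i j
      unfolding d_def by (rule someI_ex[OF ex])
    have d: "d i j > 0" "\<bar>s - t\<bar> < d i j \<Longrightarrow> kernel_norm_le (\<lambda>x y. p i j s x y - p i j t x y) e" for i j s
      by (rule conjunct1[OF d'], rule conjunct2[OF d', rule_format])
    \<comment> \<open>The entry 1 keeps the set nonempty when \<open>n = 0\<close>.\<close>
    define \<delta> where "\<delta> = Min (insert 1 ((\<lambda>(i, j). d i j) ` ({..<n} \<times> {..<n})))"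
    have \<delta>: "\<delta> > 0" unfolding \<delta>_def using d(1) by (subst Min_gr_iff) auto
    have \<delta>d: "\<delta> \<le> d i j" if "i < n" "j < n" for i j
      unfolding \<delta>_def using that by (intro Min_le) auto
    have "T.mtrace n (ev s p) = T.mtrace n (ev t p)" if s: "\<bar>s - t\<bar> < \<delta>" for s
    proof (rule e(2)[OF ev_projection[OF p]], intro allI impI)
      fix i j assume ij: "i < n" "j < n"
      have "kernel_norm_le (\<lambda>x y. p i j s x y - p i j t x y) e" using \<delta>d[OF ij] s by (intro d(2)) simp
      then show "kernel_norm_le (ev s p i j \<ominus>\<^bsub>H\<^esub> ev t p i j) e"
        using pc[of i j] by (simp add: minus_H ev_def cylinder_carrier_iff)
    qed
    note const = this
    show ?thesis
      by (rule has_derivative_transform_within[OF has_derivative_const[of "T.mtrace n (ev t p)"] \<delta> UNIV_I])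
        (rule const[symmetric], simp add: dist_real_def)
  qed
  have "(\<lambda>t. T.mtrace n (ev t p)) constant_on UNIV"
    by (rule has_derivative_zero_constant[OF convex_UNIV, unfolded constant_on_def[symmetric]]) (use der in auto)
  then show ?thesis by (metis (mono_tags, lifting) UNIV_I constant_on_def)
qed

lemma trace_ev_integrable:
  assumes f: "f \<in> cylinder_carrier A"
  shows "(\<lambda>t. trace_H \<mu> (f t)) integrable_on {0..1}"
proof (rule integrable_continuous_interval)
  have "isCont (\<lambda>t. trace_H \<mu> (f t)) t" for t
    unfolding continuous_at_eps_delta
  proof (intro allI impI)
    fix e :: real assume "e > 0"
    then have e: "e / 2 > 0" by simp
    obtain d where d: "d > 0" "\<And>s. \<bar>s - t\<bar> < d \<Longrightarrow> kernel_norm_le (\<lambda>x y. f s x y - f t x y) (e / 2)"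
      by (rule kcontinuousE[of f "e / 2" t]) (use f e that in \<open>auto simp: cylinder_carrier_iff\<close>)
    have "dist (trace_H \<mu> (f s)) (trace_H \<mu> (f t)) < e" if "dist s t < d" for s
    proof -
      have "cmod (trace_H \<mu> (\<lambda>x y. f s x y - f t x y)) \<le> e / 2"
        using that by (intro trace_bound d(2)) (simp add: dist_real_def)
      then show ?thesis using f e trace_diff'[of "f s" "f t"] by (simp add: dist_norm cylinder_carrier_iff)
    qed
    then show "\<exists>d>0. \<forall>s. dist s t < d \<longrightarrow> dist (trace_H \<mu> (f s)) (trace_H \<mu> (f t)) < e" using d(1) by blast
  qed
  then show "continuous_on {0..1} (\<lambda>t. trace_H \<mu> (f t))"
    by (intro continuous_at_imp_continuous_on) blast
qed

lemma trace_CH_projection: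
  assumes p: "(n, p) \<in> projections CH"
  shows "(\<Sum>i<n. trace_CH \<mu> (p i i)) = T.mtrace n (ev 0 p)"
proof -
  have pc: "p i j \<in> cylinder_carrier A" for i j using C.mats_carrier[OF C.projectionsD(1)[OF p]] by simp
  have "(\<Sum>i<n. trace_CH \<mu> (p i i)) = integral {0..1} (\<lambda>t. \<Sum>i<n. trace_H \<mu> (p i i t))"
    unfolding trace_CH_def by (rule Henstock_Kurzweil_Integration.integral_sum[symmetric]) (auto intro: trace_ev_integrable pc)
  also have "(\<lambda>t. \<Sum>i<n. trace_H \<mu> (p i i t)) = (\<lambda>t. T.mtrace n (ev 0 p))"
    using mtrace_ev_constant[OF p] by (simp add: T.mtrace_def ev_def fun_eq_iff)
  finally show ?thesis by simp
qed

text \<open>\<open>K0_map\<close> is a union over representatives. As its value is assumed to lie in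
  \<open>K0 H\<close>, a single evaluated representative determines its trace.\<close>

lemma K0_trace_CH:
  assumes z: "z \<in> carrier (K0 CH)" and w: "K0_map H (\<lambda>f. f 0) z \<in> carrier (K0 H)"
  shows "K0_trace (trace_CH \<mu>) z = K0_trace (trace_H \<mu>) (K0_map H (\<lambda>f. f 0) z)"
proof -
  obtain n p m q where pq: "(n, p) \<in> projections CH" "(m, q) \<in> projections CH" "z = C.K0_pair (n, p) (m, q)"
    using z by (metis C.K0_carrierE surj_pair)
  note mem = C.K0_pair_self[OF pq(1,2), folded pq(3)]
  have rel: "(((n, p), (m, q)), ((n', p'), (m', q'))) \<in> K0_rel CH" if "((n', p'), (m', q')) \<in> z" for n' p' m' q'
    using that by (simp add: pq(3))
  let ?v = "T.mtrace n (ev 0 p) - T.mtrace m (ev 0 q)"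
  have v: "(\<Sum>i<n'. trace_CH \<mu> (p' i i)) - (\<Sum>i<m'. trace_CH \<mu> (q' i i)) = ?v" if "((n', p'), (m', q')) \<in> z" for n' p' m' q'
  proof -
    have "(n', p') \<in> projections CH" "(m', q') \<in> projections CH" using rel[OF that] by (auto simp: K0_rel_def)
    then show ?thesis
      using T.mtrace_K0_rel[OF ev_K0_rel[OF rel[OF that]], of 0] by (simp add: trace_CH_projection)
  qed
  have "(\<lambda>((n, p), (m, q)). (\<Sum>i<n. trace_CH \<mu> (p i i)) - (\<Sum>i<m. trace_CH \<mu> (q i i))) ` z = {?v}"
  proof (intro equalityI image_subsetI subsetI)
    fix x assume x: "x \<in> z"
    obtain n' p' m' q' where xe: "x = ((n', p'), (m', q'))" by (metis surj_pair)
    show "(\<lambda>((n, p), (m, q)). (\<Sum>i<n. trace_CH \<mu> (p i i)) - (\<Sum>i<m. trace_CH \<mu> (q i i))) x \<in> {?v}"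
      using v x unfolding xe by simp
  next
    fix y assume "y \<in> {?v}"
    then show "y \<in> (\<lambda>((n, p), (m, q)). (\<Sum>i<n. trace_CH \<mu> (p i i)) - (\<Sum>i<m. trace_CH \<mu> (q i i))) ` z"
      by (intro rev_image_eqI[OF mem]) (simp add: v[OF mem])
  qed
  then have 1: "K0_trace (trace_CH \<mu>) z = ?v" by (simp add: K0_trace_def)
  have "((n, ev 0 p), (m, ev 0 q)) \<in> K0_map H (\<lambda>f. f 0) z"
    unfolding K0_map_def using mem H.K0_pair_self[OF ev_projection[OF pq(1), of 0] ev_projection[OF pq(2), of 0]]
    by (intro UN_I[OF mem]) (simp add: ev_def)
  from T.K0_trace_eqI[OF w this] 1 show ?thesis by simp
qed

end

section \<open>The inductive limit\<close>

lemma connecting_pow_add: "(connecting A ^^ n) (X + Y) = (connecting A ^^ n) X + (connecting A ^^ n) Y"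
proof -
  have "connecting A (X + Y) = connecting A X + connecting A Y" for X Y
    by (simp add: connecting_def matrix_matrix_mult_def vec_eq_iff distrib_left distrib_right sum.distrib)
  then show ?thesis by (induction n) simp_all
qed

lemma limit_relD:
  assumes "((X, N), (Y, M)) \<in> limit_rel A"
  obtains k l where "N + k = M + l" "(connecting A ^^ k) X = (connecting A ^^ l) Y"
  using assms by (auto simp: limit_rel_def)

lemma limit_relI:
  "N + k = M + l \<Longrightarrow> (connecting A ^^ k) X = (connecting A ^^ l) Y \<Longrightarrow> ((X, N), (Y, M)) \<in> limit_rel A"
  by (auto simp: limit_rel_def)

lemma limit_rel_equiv: "equiv UNIV (limit_rel A)"
proof (rule equivI)
  show "refl (limit_rel A)" by (auto simp: refl_on_def intro: limit_relI[of _ 0 _ 0])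
  show "sym (limit_rel A)" by (auto simp: sym_def limit_rel_def) metis
  show "trans (limit_rel A)"
  proof (rule transI)
    fix a b c assume ab: "(a, b) \<in> limit_rel A" and bc: "(b, c) \<in> limit_rel A"
    obtain X N Y M Z L where [simp]: "a = (X, N)" "b = (Y, M)" "c = (Z, L)" by (cases a; cases b; cases c)
    obtain k l where 1: "N + k = M + l" "(connecting A ^^ k) X = (connecting A ^^ l) Y"
      using ab by (auto elim: limit_relD)
    obtain k' l' where 2: "M + k' = L + l'" "(connecting A ^^ k') Y = (connecting A ^^ l') Z"
      using bc by (auto elim: limit_relD)
    have "(connecting A ^^ (k' + k)) X = (connecting A ^^ (l + k')) Y"
      by (simp add: funpow_add 1(2) add.commute[of l])
    also have "\<dots> = (connecting A ^^ (l + l')) Z" by (simp add: funpow_add 2(2))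
    finally have "((X, N), (Z, L)) \<in> limit_rel A" using 1(1) 2(1) by (intro limit_relI[of _ "k' + k" _ "l + l'"]) auto
    then show "(a, c) \<in> limit_rel A" by simp
  qed
qed simp

lemma limit_class_eqI: "((X, N), (Y, M)) \<in> limit_rel A \<Longrightarrow> limit_class A X N = limit_class A Y M"
  unfolding limit_class_def using equiv_class_eq[OF limit_rel_equiv] by blast

lemma limit_class_mem: "(Y, M) \<in> limit_class A X N \<longleftrightarrow> ((X, N), (Y, M)) \<in> limit_rel A"
  by (simp add: limit_class_def)

lemma limit_class_self: "(X, N) \<in> limit_class A X N"
  by (auto simp: limit_class_mem intro: limit_relI[of _ 0 _ 0])

lemma limit_class_connecting: "limit_class A X N = limit_class A ((connecting A ^^ k) X) (N + k)"
  by (rule limit_class_eqI, rule limit_relI[of _ k _ 0]) auto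

lemma limit_class_carrier: "limit_class A X N \<in> carrier (limit_group A)"
  by (simp add: limit_group_def limit_class_def quotientI)

lemma limit_carrierE:
  assumes "c \<in> carrier (limit_group A)"
  obtains X N where "c = limit_class A X N"
  using assms by (auto simp: limit_group_def limit_class_def elim!: quotientE)

text \<open>All members of the defining union have to coincide: the two representatives are moved to
  one common level, where they are images of \<open>X\<close> and \<open>Y\<close> under the same
  power of the connecting map. Since classes can be brought to a common level, this describes the
  whole operation.\<close>

lemma limit_mult:
  "limit_class A X M \<otimes>\<^bsub>limit_group A\<^esub> limit_class A Y M = limit_class A (X + Y) M"
proof -
  have *: "limit_class A ((connecting A ^^ M') X' + (connecting A ^^ N') Y') (N' + M') = limit_class A (X + Y) M"
    if a: "(X', N') \<in> limit_class A X M" and b: "(Y', M') \<in> limit_class A Y M" for X' N' Y' M'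
  proof -
    obtain k l where 1: "M + k = N' + l" "(connecting A ^^ k) X = (connecting A ^^ l) X'"
      by (rule limit_relD[OF a[unfolded limit_class_mem]])
    obtain k' l' where 2: "M + k' = M' + l'" "(connecting A ^^ k') Y = (connecting A ^^ l') Y'"
      by (rule limit_relD[OF b[unfolded limit_class_mem]])
    have "(connecting A ^^ (l + l')) ((connecting A ^^ M') X') = (connecting A ^^ (M + k' + l)) X'"
      using 2(1) by (simp add: funpow_add[symmetric, THEN fun_cong, simplified comp_def] ac_simps)
    also have "\<dots> = (connecting A ^^ (M + k' + k)) X" by (simp add: funpow_add 1(2))
    finally have x: "(connecting A ^^ (l + l')) ((connecting A ^^ M') X') = (connecting A ^^ (M + k + k')) X"
      by (simp add: ac_simps)
    have "(connecting A ^^ (l + l')) ((connecting A ^^ N') Y') = (connecting A ^^ (M + k + l')) Y'"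
      using 1(1) by (simp add: funpow_add[symmetric, THEN fun_cong, simplified comp_def] ac_simps)
    also have "\<dots> = (connecting A ^^ (M + k + k')) Y" by (simp add: funpow_add 2(2))
    finally have y: "(connecting A ^^ (l + l')) ((connecting A ^^ N') Y') = (connecting A ^^ (M + k + k')) Y" .
    show ?thesis
      by (rule limit_class_eqI, rule limit_relI[of _ "l + l'" _ "M + k + k'"])
        (use 1(1) 2(1) x y in \<open>simp_all add: connecting_pow_add\<close>)
  qed
  have "limit_class A X M \<otimes>\<^bsub>limit_group A\<^esub> limit_class A Y M =
    (\<Union>(X', N')\<in>limit_class A X M. \<Union>(Y', M')\<in>limit_class A Y M.
      limit_class A ((connecting A ^^ M') X' + (connecting A ^^ N') Y') (N' + M'))"
    by (simp add: limit_group_def)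
  also have "\<dots> = (\<Union>x\<in>limit_class A X M. \<Union>y\<in>limit_class A Y M. limit_class A (X + Y) M)"
  proof (rule SUP_cong[OF refl])
    fix x assume "x \<in> limit_class A X M"
    then show "(case x of (X', N') \<Rightarrow> \<Union>(Y', M')\<in>limit_class A Y M.
        limit_class A ((connecting A ^^ M') X' + (connecting A ^^ N') Y') (N' + M')) =
      (\<Union>y\<in>limit_class A Y M. limit_class A (X + Y) M)"
      using * by (cases x) (simp only: prod.case, rule SUP_cong[OF refl], simp only: split_paired_all prod.case)
  qed
  also have "\<dots> = limit_class A (X + Y) M"
    using limit_class_self[of X M A] limit_class_self[of Y M A] by blast
  finally show ?thesis .
qed

lemma (in comm_group) finprod_int_pow:
  "finite S \<Longrightarrow> (\<And>s. s \<in> S \<Longrightarrow> f s \<in> carrier G) \<Longrightarrow> finprod G f S [^] (z :: int) = finprod G (\<lambda>s. f s [^] z) S"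
proof (induction S rule: finite_induct)
  case (insert x S)
  then have "finprod G f S \<in> carrier G" by (intro finprod_closed) auto
  then show ?case using insert by (simp add: Pi_def int_pow_distrib)
qed simp

lemma (in comm_group) int_pow_sum:
  "finite S \<Longrightarrow> x \<in> carrier G \<Longrightarrow> x [^] (\<Sum>s\<in>S. z s :: int) = finprod G (\<lambda>s. x [^] z s) S"
  by (induction S rule: finite_induct) (simp_all add: Pi_def int_pow_mult)

text \<open>Grouping the factors by the value of \<open>h\<close> turns multiplicities into
  exponents. In the application the multiplicities count edges and so are products of entries of
  \<open>A\<close>.\<close>

lemma (in comm_group) finprod_fibres:
  assumes "finite S" "finite I" "\<And>s. s \<in> S \<Longrightarrow> h s \<in> I" "\<And>i. i \<in> I \<Longrightarrow> g i \<in> carrier G"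
  shows "finprod G (\<lambda>s. g (h s)) S = finprod G (\<lambda>i. g i [^] int (card {s \<in> S. h s = i})) I"
  using assms(1,3)
proof (induction S rule: finite_induct)
  case empty
  then show ?case by (simp add: finprod_one_eqI)
next
  case (insert x S)
  have "{s \<in> insert x S. h s = i} = (if h x = i then insert x {s \<in> S. h s = i} else {s \<in> S. h s = i})" for i by auto
  then have c: "int (card {s \<in> insert x S. h s = i}) = (if h x = i then 1 else 0) + int (card {s \<in> S. h s = i})" for i
    using insert(1,2) by (simp add: card_insert_if)
  have "finprod G (\<lambda>i. g i [^] int (card {s \<in> insert x S. h s = i})) I =
    finprod G (\<lambda>i. g i [^] (if h x = i then 1 else 0 :: int) \<otimes> g i [^] int (card {s \<in> S. h s = i})) I"
    unfolding c using assms(4) by (intro finprod_cong') (auto simp: int_pow_mult)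
  also have "\<dots> = finprod G (\<lambda>i. g i [^] (if h x = i then 1 else 0 :: int)) I \<otimes> finprod G (\<lambda>i. g i [^] int (card {s \<in> S. h s = i})) I"
    using assms(4) by (intro finprod_multf) auto
  also have "finprod G (\<lambda>i. g i [^] (if h x = i then 1 else 0 :: int)) I = finprod G (\<lambda>i. if h x = i then g i else \<one>) I"
    using assms(4) by (intro finprod_cong') auto
  also have "\<dots> = g (h x)" using insert(4) assms(2,4) by (intro finprod_singleton) auto
  finally show ?case using insert assms(4) by (simp add: Pi_def)
qed

context mme
begin

section \<open>Matrix units \<open>mu N p \<xi> \<eta>\<close> of the local kernels and their
  classes\<close>

definition mu :: "nat \<Rightarrow> 'k \<times> 'k \<Rightarrow> 'k edge list \<Rightarrow> 'k edge list \<Rightarrow> 'k biseq kernel" where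
  "mu N p \<xi> \<eta> = loc A N (\<lambda>q u v. if q = p \<and> u = \<xi> \<and> v = \<eta> then 1 else 0)"

lemma bisection_elem_eq:
  "length \<xi> = 2 * N \<Longrightarrow> length \<eta> = 2 * N \<Longrightarrow> bisection_elem A N i j \<xi> \<eta> = mu N (i, j) \<xi> \<eta>"
  by (auto simp: bisection_elem_def basic_bisection_iff mu_def loc_def fun_eq_iff)

lemma mu_carrier [simp]: "mu N p \<xi> \<eta> \<in> homoclinic_carrier A"
  using kclosure_superset[of "local_kernels A"] by (auto simp: homoclinic_carrier_eq mu_def local_kernels_def)

lemma mu_star: "(\<lambda>x y. cnj (mu N p \<xi> \<eta> y x)) = mu N p \<eta> \<xi>"
proof (intro ext)
  fix x y
  show "cnj (mu N p \<xi> \<eta> y x) = mu N p \<eta> \<xi> x y"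
  proof (cases "x \<in> shift_space A \<and> y \<in> shift_space A \<and> agree N x y")
    case True
    then have "ends N y = ends N x" "agree N y x" using agree_ends[of x A y N] agree_sym by auto
    then show ?thesis using True by (auto simp: mu_def loc_def)
  next
    case False
    then have "\<not> (y \<in> shift_space A \<and> x \<in> shift_space A \<and> agree N y x)" using agree_sym by blast
    then show ?thesis using False unfolding mu_def loc_def by (simp only: if_False complex_cnj_zero)
  qed
qed

lemma mu_mult:
  "\<eta> \<in> paths A N p \<Longrightarrow> kmult (mu N p \<xi> \<eta>) (mu N p' \<xi>' \<eta>') = (if p = p' \<and> \<eta> = \<xi>' then mu N p \<xi> \<eta>' else (\<lambda>x y. 0))"
proof -
  assume \<eta>: "\<eta> \<in> paths A N p"
  have "(\<Sum>w\<in>paths A N q. (if q = p \<and> u = \<xi> \<and> w = \<eta> then 1 else 0) * (if q = p' \<and> w = \<xi>' \<and> v = \<eta>' then 1 else 0)) =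
    (if p = p' \<and> \<eta> = \<xi>' \<and> q = p \<and> u = \<xi> \<and> v = \<eta>' then 1 else 0 :: complex)" (is "sum ?f _ = ?r") for q u v
  proof -
    have "sum ?f (paths A N q) = (\<Sum>w\<in>paths A N q. if w = \<eta> then ?r else 0)"
      by (intro sum.cong) auto
    also have "\<dots> = ?r" using \<eta> by auto
    finally show ?thesis .
  qed
  then show ?thesis unfolding mu_def loc_mult by (auto simp: loc_def fun_eq_iff)
qed

lemma mu_selfadj_idem: "\<xi> \<in> paths A N p \<Longrightarrow> H.selfadj_idem (mu N p \<xi> \<xi>)"
  by (simp add: H.selfadj_idem_def mu_star mu_mult)

lemma K0_class_mu:
  assumes "\<xi> \<in> paths A N p" "\<eta> \<in> paths A N p"
  shows "K0_class H (mu N p \<xi> \<xi>) = K0_class H (mu N p \<eta> \<eta>)"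
  using H.K0_class_cong[of "mu N p \<eta> \<xi>"] mu_selfadj_idem assms by (simp add: mu_star mu_mult)

sublocale KG: comm_group "K0 H"
  by (rule H.K0_comm_group)

text \<open>The class of a minimal projection in the block of \<open>p\<close>; all paths in the
  block give the same class. Where there is no path, the neutral element is a default, paired with
  exponent 0 for the matrices that are \<open>supported\<close>.\<close>

definition gen :: "nat \<Rightarrow> 'k \<times> 'k \<Rightarrow> ('k biseq kernel sqmat \<times> 'k biseq kernel sqmat) set" where
  "gen N p = (if paths A N p = {} then \<one>\<^bsub>K0 H\<^esub> else K0_class H (mu N p (SOME \<xi>. \<xi> \<in> paths A N p) (SOME \<xi>. \<xi> \<in> paths A N p)))"

lemma gen_eq: "\<xi> \<in> paths A N p \<Longrightarrow> gen N p = K0_class H (mu N p \<xi> \<xi>)"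
  using K0_class_mu[of "SOME \<xi>. \<xi> \<in> paths A N p" N p \<xi>] someI[of "\<lambda>\<xi>. \<xi> \<in> paths A N p" \<xi>]
  by (auto simp: gen_def)

lemma gen_carrier [simp]: "gen N p \<in> carrier (K0 H)"
proof (cases "paths A N p = {}")
  case True
  then show ?thesis by (simp add: gen_def)
next
  case False
  then obtain \<xi> where "\<xi> \<in> paths A N p" by blast
  then show ?thesis using gen_eq H.K0_class_carrier[OF mu_selfadj_idem] by simp
qed

lemma finsum_H: "finite S \<Longrightarrow> (\<And>s. s \<in> S \<Longrightarrow> f s \<in> homoclinic_carrier A) \<Longrightarrow>
    finsum H f S = (\<lambda>x y. \<Sum>s\<in>S. f s x y)"
proof (induction S rule: finite_induct)
  case empty
  show ?case by (simp only: H.finsum_empty) simp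
next
  case (insert s S)
  have "finsum H f (insert s S) = f s \<oplus>\<^bsub>H\<^esub> finsum H f S"
    using insert by (intro H.finsum_insert) auto
  then show ?case using insert by simp
qed

abbreviation exts :: "'k \<times> 'k \<Rightarrow> ('k edge \<times> 'k edge) set" where
  "exts p \<equiv> {e. e \<in> edges A \<and> tgt e = fst p} \<times> {e. e \<in> edges A \<and> src e = snd p}"

lemma finite_exts: "finite (exts p)"
  by (intro finite_cartesian_product finite_edges_if)

lemma ext_paths:
  "\<xi> \<in> paths A N p \<Longrightarrow> (e, e') \<in> exts p \<Longrightarrow> e # \<xi> @ [e'] \<in> paths A (Suc N) (src e, tgt e')"
  by (auto simp: paths_def edge_path_append)

text \<open>The cylinder of \<open>\<xi>\<close> is the disjoint union of the cylinders of its
  two-sided prolongations by one edge.\<close>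

lemma mu_extend:
  assumes \<xi>: "\<xi> \<in> paths A N p"
  shows "mu N p \<xi> \<xi> = finsum H (\<lambda>(e, e'). mu (Suc N) (src e, tgt e') (e # \<xi> @ [e']) (e # \<xi> @ [e'])) (exts p)"
proof -
  have "mu N p \<xi> \<xi> x y = (\<Sum>(e, e')\<in>exts p. mu (Suc N) (src e, tgt e') (e # \<xi> @ [e']) (e # \<xi> @ [e']) x y)" for x y
  proof -
    define Q where "Q \<longleftrightarrow> x \<in> shift_space A \<and> y \<in> shift_space A \<and> agree N x y \<and> cwin N x = \<xi> \<and> cwin N y = \<xi>"
    have l: "length \<xi> = 2 * N" using \<xi> by (simp add: paths_def)
    have *: "mu (Suc N) (src e, tgt e') (e # \<xi> @ [e']) (e # \<xi> @ [e']) x y =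
        (if (e, e') = (x (- int N), x (int N + 1)) then if Q then 1 else 0 else 0)" for e e'
    proof -
      have "ends (Suc N) x = (src (x (- int N)), tgt (x (int N + 1)))" if "x \<in> shift_space A"
        using shift_spaceD(2)[OF that, of "int N + 1"] by (simp add: ends_def add.commute)
      then show ?thesis
        unfolding mu_def loc_def Q_def agree_Suc[of N x y] using l by (auto simp: cwin_Suc)
    qed
    have "(\<Sum>(e, e')\<in>exts p. mu (Suc N) (src e, tgt e') (e # \<xi> @ [e']) (e # \<xi> @ [e']) x y) =
      (\<Sum>q\<in>exts p. if q = (x (- int N), x (int N + 1)) then if Q then 1 else 0 else 0)"
      by (intro sum.cong refl) (simp only: split_paired_all prod.case *)
    also have "\<dots> = (if (x (- int N), x (int N + 1)) \<in> exts p \<and> Q then 1 else 0)"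
      using finite_exts[of p] by (auto simp: sum.delta)
    also have "\<dots> = mu N p \<xi> \<xi> x y"
    proof -
      have "(x (- int N), x (int N + 1)) \<in> exts p \<longleftrightarrow> ends N x = p" if x: "x \<in> shift_space A"
        using shift_spaceD[OF x, of "- int N"] shift_spaceD(1)[OF x, of "int N + 1"]
        by (cases p) (auto simp: ends_def)
      then show ?thesis unfolding mu_def loc_def Q_def by auto
    qed
    finally show ?thesis by simp
  qed
  then show ?thesis by (subst finsum_H[OF finite_exts]) (auto simp: fun_eq_iff case_prod_unfold)
qed

lemma card_exts: "card {q \<in> exts p. (src (fst q), tgt (snd q)) = (a, b)} = A $ a $ fst p * A $ snd p $ b"
proof -
  have "{q \<in> exts p. (src (fst q), tgt (snd q)) = (a, b)} =
      (\<lambda>m. (a, fst p, m)) ` {..<A $ a $ fst p} \<times> (\<lambda>m. (snd p, b, m)) ` {..<A $ snd p $ b}"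
    by (auto simp: edges_def src_def tgt_def)
  then show ?thesis by (simp add: card_cartesian_product card_image inj_on_def)
qed

text \<open>A minimal projection of level \<open>N\<close> splits into orthogonal minimal
  projections of level \<open>Suc N\<close>. Grouping them by end vertices gives products of entries
  of \<open>A\<close> as multiplicities, which is the connecting map
  \<open>X \<mapsto> A X A\<close> on a matrix unit.\<close>

lemma gen_extend:
  assumes "paths A N p \<noteq> {}"
  shows "gen N p = finprod (K0 H) (\<lambda>q. gen (Suc N) q [^]\<^bsub>K0 H\<^esub> (int (A $ fst q $ fst p) * int (A $ snd p $ snd q))) UNIV"
proof -
  obtain \<xi> where \<xi>: "\<xi> \<in> paths A N p" using assms by blast
  let ?e = "\<lambda>(e, e'). mu (Suc N) (src e, tgt e') (e # \<xi> @ [e']) (e # \<xi> @ [e'])"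
  let ?h = "\<lambda>q. (src (fst q), tgt (snd q))"
  have "gen N p = K0_class H (finsum H ?e (exts p))" using gen_eq[OF \<xi>] mu_extend[OF \<xi>] by simp
  also have "\<dots> = finprod (K0 H) (\<lambda>q. K0_class H (?e q)) (exts p)"
  proof (rule conjunct2[OF H.K0_class_finsum[OF finite_exts]])
    fix q assume q: "q \<in> exts p"
    obtain e e' where qe: "q = (e, e')" by (cases q)
    show "H.selfadj_idem (?e q)" using mu_selfadj_idem[OF ext_paths[OF \<xi>, of e e']] q by (simp add: qe)
    fix q' assume q': "q' \<in> exts p" "q \<noteq> q'"
    obtain d d' where qd: "q' = (d, d')" by (cases q')
    show "?e q \<otimes>\<^bsub>H\<^esub> ?e q' = \<zero>\<^bsub>H\<^esub>"
      using mu_mult[OF ext_paths[OF \<xi>, of e e']] q q' by (auto simp: qe qd)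
  qed
  also have "\<dots> = finprod (K0 H) (\<lambda>q. gen (Suc N) (?h q)) (exts p)"
  proof (rule KG.finprod_cong'[OF refl])
    show "(\<lambda>q. gen (Suc N) (?h q)) \<in> exts p \<rightarrow> carrier (K0 H)" by simp
    fix q assume "q \<in> exts p"
    then show "K0_class H (?e q) = gen (Suc N) (?h q)"
      using gen_eq[OF ext_paths[OF \<xi>, of "fst q" "snd q"]] by (cases q) simp
  qed
  also have "\<dots> = finprod (K0 H) (\<lambda>q. gen (Suc N) q [^]\<^bsub>K0 H\<^esub> int (card {s \<in> exts p. ?h s = q})) UNIV"
    by (rule KG.finprod_fibres[OF finite_exts]) auto
  also have "\<dots> = finprod (K0 H) (\<lambda>q. gen (Suc N) q [^]\<^bsub>K0 H\<^esub> (int (A $ fst q $ fst p) * int (A $ snd p $ snd q))) UNIV"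
  proof -
    have "int (card {s \<in> exts p. ?h s = q}) = int (A $ fst q $ fst p) * int (A $ snd p $ snd q)" for q
      using card_exts[of p "fst q" "snd q"] by simp
    then show ?thesis by (simp only:)
  qed
  finally show ?thesis .
qed

section \<open>The homomorphism from the inductive limit to \<open>K0\<close>\<close>

definition Psi :: "nat \<Rightarrow> int^'k^'k \<Rightarrow> ('k biseq kernel sqmat \<times> 'k biseq kernel sqmat) set" where
  "Psi N X = finprod (K0 H) (\<lambda>p. gen N p [^]\<^bsub>K0 H\<^esub> (X $ fst p $ snd p)) UNIV"

lemma Psi_carrier [simp]: "Psi N X \<in> carrier (K0 H)"
  unfolding Psi_def by (intro KG.finprod_closed) simp

lemma Psi_add: "Psi N (X + Y) = Psi N X \<otimes>\<^bsub>K0 H\<^esub> Psi N Y"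
  unfolding Psi_def by (subst KG.finprod_multf[symmetric]) (auto simp: KG.int_pow_mult)

text \<open>At an entry without a path \<open>gen\<close> takes its default, although there may be
  paths at the next level; compatibility with the connecting map is therefore restricted to matrices
  that avoid such entries.\<close>

definition supported :: "nat \<Rightarrow> int^'k^'k \<Rightarrow> bool" where
  "supported N X \<longleftrightarrow> (\<forall>p. X $ fst p $ snd p \<noteq> 0 \<longrightarrow> paths A N p \<noteq> {})"

lemma connecting_nth:
  "connecting A X $ a $ b = (\<Sum>p\<in>UNIV. int (A $ a $ fst p) * int (A $ snd p $ b) * X $ fst p $ snd p)"
proof -
  have "connecting A X $ a $ b = (\<Sum>j\<in>UNIV. \<Sum>i\<in>UNIV. int (A $ a $ i) * X $ i $ j * int (A $ j $ b))"
    by (simp add: connecting_def matrix_matrix_mult_def map_matrix_def sum_distrib_right)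
  also have "\<dots> = (\<Sum>i\<in>UNIV. \<Sum>j\<in>UNIV. int (A $ a $ i) * X $ i $ j * int (A $ j $ b))" by (rule sum.swap)
  also have "\<dots> = (\<Sum>p\<in>UNIV \<times> UNIV. int (A $ a $ fst p) * X $ fst p $ snd p * int (A $ snd p $ b))"
    by (simp add: sum.cartesian_product case_prod_unfold)
  finally show ?thesis by (simp add: mult_ac)
qed

lemma Psi_connecting:
  assumes X: "supported N X"
  shows "Psi (Suc N) (connecting A X) = Psi N X" "supported (Suc N) (connecting A X)"
proof -
  let ?c = "\<lambda>p q. int (A $ fst q $ fst p) * int (A $ snd p $ snd q)"
  have "Psi (Suc N) (connecting A X) =
    finprod (K0 H) (\<lambda>q. finprod (K0 H) (\<lambda>p. gen (Suc N) q [^]\<^bsub>K0 H\<^esub> (?c p q * X $ fst p $ snd p)) UNIV) UNIV"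
    unfolding Psi_def connecting_nth by (simp add: KG.int_pow_sum)
  also have "\<dots> = finprod (K0 H) (\<lambda>p. finprod (K0 H) (\<lambda>q. gen (Suc N) q [^]\<^bsub>K0 H\<^esub> (?c p q * X $ fst p $ snd p)) UNIV) UNIV"
    by (rule KG.finprod_swap) auto
  also have "\<dots> = finprod (K0 H) (\<lambda>p. gen N p [^]\<^bsub>K0 H\<^esub> (X $ fst p $ snd p)) UNIV"
  proof (rule KG.finprod_cong'[OF refl])
    fix p :: "'k \<times> 'k"
    have "finprod (K0 H) (\<lambda>q. gen (Suc N) q [^]\<^bsub>K0 H\<^esub> (?c p q * X $ fst p $ snd p)) UNIV =
      finprod (K0 H) (\<lambda>q. gen (Suc N) q [^]\<^bsub>K0 H\<^esub> ?c p q) UNIV [^]\<^bsub>K0 H\<^esub> (X $ fst p $ snd p)"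
      by (subst KG.finprod_int_pow) (auto simp: KG.int_pow_pow)
    also have "\<dots> = gen N p [^]\<^bsub>K0 H\<^esub> (X $ fst p $ snd p)"
    proof (cases "paths A N p = {}")
      case True
      then have "X $ fst p $ snd p = 0" using X unfolding supported_def by blast
      then show ?thesis by simp
    next
      case False
      then show ?thesis by (simp only: gen_extend[OF False])
    qed
    finally show "finprod (K0 H) (\<lambda>q. gen (Suc N) q [^]\<^bsub>K0 H\<^esub> (?c p q * X $ fst p $ snd p)) UNIV =
      gen N p [^]\<^bsub>K0 H\<^esub> (X $ fst p $ snd p)" .
  qed simp
  finally show "Psi (Suc N) (connecting A X) = Psi N X" by (simp add: Psi_def)
  show "supported (Suc N) (connecting A X)" unfolding supported_def
  proof (intro allI impI)
    fix q :: "'k \<times> 'k" assume "connecting A X $ fst q $ snd q \<noteq> 0"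
    then obtain p where p: "?c p q * X $ fst p $ snd p \<noteq> 0"
      unfolding connecting_nth by (meson sum.not_neutral_contains_not_neutral)
    then have "X $ fst p $ snd p \<noteq> 0" by simp
    then have "paths A N p \<noteq> {}" using X unfolding supported_def by blast
    then obtain \<xi> where \<xi>: "\<xi> \<in> paths A N p" by blast
    have "((fst q, fst p, 0), (snd p, snd q, 0)) \<in> exts p"
      using p by (auto simp: edges_def src_def tgt_def)
    from ext_paths[OF \<xi> this] show "paths A (Suc N) q \<noteq> {}" by (auto simp: src_def tgt_def)
  qed
qed

lemma Psi_connecting_pow:
  assumes "supported N X"
  shows "Psi (N + k) ((connecting A ^^ k) X) = Psi N X"
proof -
  have "supported (N + k) ((connecting A ^^ k) X) \<and> Psi (N + k) ((connecting A ^^ k) X) = Psi N X"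
    using assms by (induction k) (auto simp: Psi_connecting)
  then show ?thesis by simp
qed

lemma Psi_matrix_unit: "Psi N (matrix_unit i j) = gen N (i, j)"
proof -
  have "Psi N (matrix_unit i j) = finprod (K0 H) (\<lambda>p. if (i, j) = p then gen N p else \<one>\<^bsub>K0 H\<^esub>) UNIV"
    unfolding Psi_def by (rule KG.finprod_cong') (auto simp: matrix_unit_def)
  also have "\<dots> = gen N (i, j)" by (rule KG.finprod_singleton) auto
  finally show ?thesis .
qed

text \<open>A homomorphism with the defining property is constructed, so that \<open>SOME\<close>
  delivers one. The candidate first applies the connecting map \<open>n0\<close> times, because from
  level \<open>n0\<close> on every matrix is supported.\<close>

lemma limit_to_K0_spec:
  assumes n0: "\<forall>n\<ge>n0. \<forall>i j. \<exists>w. edge_path A i j w \<and> length w = n"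
  shows "limit_to_K0 A \<in> hom (limit_group A) (K0 H) \<and>
     (\<forall>N i j \<xi>. centred_path A N i j \<xi> \<longrightarrow>
        limit_to_K0 A (limit_class A (matrix_unit i j) N) = K0_class H (bisection_elem A N i j \<xi> \<xi>))"
proof -
  have sup: "supported N X" if "N \<ge> n0" for N X
    unfolding supported_def paths_def using n0[rule_format, of "2 * N"] that by fastforce
  define F where "F = (\<lambda>(X, N). Psi (N + n0) ((connecting A ^^ n0) X))"
  have Fk: "F (X, N) = Psi (N + k + n0) ((connecting A ^^ (k + n0)) X)" for X N k
    using Psi_connecting_pow[OF sup, where N = "N + n0" and X = "(connecting A ^^ n0) X" and k = k]
    by (simp add: F_def funpow_add ac_simps)
  have Frel: "F (X, N) = F (Y, M)" if rel: "((X, N), (Y, M)) \<in> limit_rel A" for X N Y M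
  proof -
    obtain k l where kl: "N + k = M + l" "(connecting A ^^ k) X = (connecting A ^^ l) Y"
      by (rule limit_relD[OF rel])
    have "(connecting A ^^ (k + n0)) X = (connecting A ^^ (l + n0)) Y"
      by (simp add: add.commute[of _ n0] funpow_add kl(2))
    then show ?thesis using Fk[of X N k] Fk[of Y M l] kl(1) by simp
  qed
  have Fadd: "F (X + Y, N) = F (X, N) \<otimes>\<^bsub>K0 H\<^esub> F (Y, N)" for X Y N
    by (simp add: F_def connecting_pow_add Psi_add)
  define \<Phi> where "\<Phi> c = F (SOME q. q \<in> c)" for c
  have \<Phi>: "\<Phi> (limit_class A X N) = F (X, N)" for X N
  proof -
    obtain Y M where q: "(SOME q. q \<in> limit_class A X N) = (Y, M)" by fastforce
    have "(SOME q. q \<in> limit_class A X N) \<in> limit_class A X N" by (rule someI) (rule limit_class_self)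
    then have "((X, N), (Y, M)) \<in> limit_rel A" unfolding q limit_class_mem .
    from Frel[OF this] show ?thesis unfolding \<Phi>_def q by (rule sym)
  qed
  have "\<Phi> \<in> hom (limit_group A) (K0 H)"
  proof (rule homI)
    show "\<Phi> c \<in> carrier (K0 H)" for c unfolding \<Phi>_def F_def by (simp split: prod.split)
    fix c d assume "c \<in> carrier (limit_group A)" "d \<in> carrier (limit_group A)"
    then obtain X N Y M where cd: "c = limit_class A X N" "d = limit_class A Y M" by (metis limit_carrierE)
    have c: "c = limit_class A ((connecting A ^^ M) X) (N + M)" and d: "d = limit_class A ((connecting A ^^ N) Y) (N + M)"
      using limit_class_connecting[of A X N M] limit_class_connecting[of A Y M N] cd by (auto simp: add.commute)
    show "\<Phi> (c \<otimes>\<^bsub>limit_group A\<^esub> d) = \<Phi> c \<otimes>\<^bsub>K0 H\<^esub> \<Phi> d"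
      unfolding c d limit_mult \<Phi> Fadd ..
  qed
  moreover have "\<Phi> (limit_class A (matrix_unit i j) N) = K0_class H (bisection_elem A N i j \<xi> \<xi>)"
    if c: "centred_path A N i j \<xi>" for N i j \<xi>
  proof -
    have \<xi>: "\<xi> \<in> paths A N (i, j)" using c by (simp add: centred_path_def paths_def)
    \<comment> \<open>A path exists at this level already, so the detour through level
      \<open>N + n0\<close> does not change the value, even for \<open>N\<close> below
      \<open>n0\<close>.\<close>
    have "supported N (matrix_unit i j)"
      unfolding supported_def matrix_unit_def using \<xi> by (auto split: if_splits)
    from Psi_connecting_pow[OF this, of n0] show ?thesis
      using c gen_eq[OF \<xi>] by (simp add: \<Phi> F_def Psi_matrix_unit bisection_elem_eq centred_path_def)
  qed
  ultimately have "\<exists>\<Phi>. \<Phi> \<in> hom (limit_group A) (K0 H) \<and>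
     (\<forall>N i j \<xi>. centred_path A N i j \<xi> \<longrightarrow>
        \<Phi> (limit_class A (matrix_unit i j) N) = K0_class H (bisection_elem A N i j \<xi> \<xi>))" by blast
  then show ?thesis unfolding limit_to_K0_def by (rule someI_ex)
qed

section \<open>Traces of the classes \<open>[X, N]\<close>\<close>

lemma trace_mu: "\<xi> \<in> paths A N p \<Longrightarrow> trace_H \<mu> (mu N p \<xi> \<xi>) = complex_of_real (pwt N p)"
proof -
  assume \<xi>: "\<xi> \<in> paths A N p"
  have "trace_H \<mu> (mu N p \<xi> \<xi>) = (\<Sum>q\<in>UNIV. \<Sum>w\<in>paths A N q. if w = \<xi> \<and> q = p then complex_of_real (pwt N p) else 0)"
    unfolding mu_def trace_loc by (intro sum.cong) auto
  also have "\<dots> = (\<Sum>q\<in>UNIV. if q = p then complex_of_real (pwt N p) else 0)"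
    using \<xi> by (intro sum.cong) (auto simp: sum.delta)
  finally show ?thesis by simp
qed

definition pairing :: "int^'k^'k \<Rightarrow> real" where
  "pairing X = l \<bullet> (map_matrix real_of_int X *v r)"

lemma pairing_eq: "pairing X = (\<Sum>i\<in>UNIV. \<Sum>j\<in>UNIV. real_of_int (X $ i $ j) * (l $ i * r $ j))"
  by (simp add: pairing_def inner_vec_def matrix_vector_mult_def map_matrix_def sum_distrib_left mult_ac)

lemma pairing_connecting: "pairing (connecting A X) = lam ^ 2 * pairing X"
proof -
  let ?A = "map_matrix real A" and ?X = "map_matrix real_of_int X"
  have "map_matrix real_of_int (connecting A X) = ?A ** ?X ** ?A"
    by (simp add: connecting_def matrix_matrix_mult_def map_matrix_def vec_eq_iff)
  then have "pairing (connecting A X) = l \<bullet> (?A *v (?X *v (?A *v r)))"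
    by (simp add: pairing_def matrix_vector_mul_assoc matrix_mul_assoc)
  also have "\<dots> = (l v* ?A) \<bullet> (?X *v (?A *v r))" by (simp only: dot_lmul_matrix)
  also have "\<dots> = lam ^ 2 * pairing X"
    using left right
    by (simp add: left_pf_eigenvector_def right_pf_eigenvector_def pairing_def matrix_vector_mult_scaleR power2_eq_square)
  finally show ?thesis .
qed

lemma pairing_connecting_pow: "pairing ((connecting A ^^ k) X) = lam ^ (2 * k) * pairing X"
  by (induction k) (simp_all add: pairing_connecting power2_eq_square)

text \<open>Additivity already gives compatibility with integer multiples, by induction in both
  directions from 0; the matrix units span over the integers.\<close>

lemma additive_matrix_formula:
  fixes h :: "int^'k^'k \<Rightarrow> complex"
  assumes add: "\<And>X Y. h (X + Y) = h X + h Y"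
  shows "h X = (\<Sum>i\<in>UNIV. \<Sum>j\<in>UNIV. of_int (X $ i $ j) * h (matrix_unit i j))"
proof -
  have h0: "h 0 = 0" using add[of 0 0] by simp
  have hsum: "h (sum f S) = (\<Sum>s\<in>S. h (f s))" if "finite S" for f :: "'b \<Rightarrow> int^'k^'k" and S
    using that by (induction S) (simp_all add: h0 add)
  define sc where "sc z E = (\<chi> a b. z * E $ a $ b)" for z :: int and E :: "int^'k^'k"
  have sc_add: "sc (z + w) E = sc z E + sc w E" for z w E by (simp add: sc_def vec_eq_iff algebra_simps)
  have sc1: "sc 1 E = E" "sc 0 E = 0" for E by (simp_all add: sc_def vec_eq_iff)
  have hsc: "h (sc z E) = of_int z * h E" for z E
  proof (induction z rule: int_induct[of _ 0])
    case base
    then show ?case by (simp add: sc1 h0)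
  next
    case (step1 i)
    then show ?case by (simp add: sc_add add sc1 algebra_simps)
  next
    case (step2 i)
    have "h (sc i E) = h (sc (i - 1) E) + h E" using add[of "sc (i - 1) E" "sc 1 E"] sc_add[of "i - 1" 1 E] by (simp add: sc1)
    then show ?case using step2 by (simp add: algebra_simps)
  qed
  have "X = (\<Sum>i\<in>UNIV. \<Sum>j\<in>UNIV. sc (X $ i $ j) (matrix_unit i j))"
  proof -
    have "(\<Sum>i\<in>UNIV. \<Sum>j\<in>UNIV. sc (X $ i $ j) (matrix_unit i j)) $ a $ b = X $ a $ b" for a b
    proof -
      have "sc (X $ i $ j) (matrix_unit i j) $ a $ b = (if j = b then if i = a then X $ a $ b else 0 else 0)" for i j
        by (auto simp: sc_def matrix_unit_def)
      then show ?thesis by (simp add: sum_component)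
    qed
    then show ?thesis by (simp add: vec_eq_iff)
  qed
  then have "h X = h (\<Sum>i\<in>UNIV. \<Sum>j\<in>UNIV. sc (X $ i $ j) (matrix_unit i j))" by simp
  then show ?thesis by (simp add: hsum hsc)
qed

lemma trace_limit_class:
  assumes n0: "\<forall>n\<ge>n0. \<forall>i j. \<exists>w. edge_path A i j w \<and> length w = n"
  shows "K0_trace (trace_H \<mu>) (limit_to_K0 A (limit_class A X N)) = complex_of_real (pairing X / lam ^ (2 * N))"
proof -
  note spec = limit_to_K0_spec[OF n0]
  let ?t = "\<lambda>X N. K0_trace (trace_H \<mu>) (limit_to_K0 A (limit_class A X N))"
  have carr: "limit_to_K0 A (limit_class A X N) \<in> carrier (K0 H)" for X N
    using spec limit_class_carrier by (auto simp: hom_def)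
  have add: "?t (X + Y) N = ?t X N + ?t Y N" for X Y N
  proof -
    have "limit_to_K0 A (limit_class A (X + Y) N) =
        limit_to_K0 A (limit_class A X N) \<otimes>\<^bsub>K0 H\<^esub> limit_to_K0 A (limit_class A Y N)"
      unfolding limit_mult[symmetric]
      by (rule hom_mult[OF spec[THEN conjunct1] limit_class_carrier limit_class_carrier])
    then show ?thesis using T.K0_trace_mult[OF carr carr] by simp
  qed
  \<comment> \<open>The defining property identifies the class of a matrix unit only through a path,
    hence the lower bound on \<open>M\<close>.\<close>
  have unit: "?t (matrix_unit i j) M = complex_of_real (pwt M (i, j))" if M: "M \<ge> n0" for i j M
  proof -
    obtain \<xi> where \<xi>: "edge_path A i j \<xi>" "length \<xi> = 2 * M" using n0[rule_format, of "2 * M" i j] M by auto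
    then have p: "\<xi> \<in> paths A M (i, j)" by (simp add: paths_def)
    have "limit_to_K0 A (limit_class A (matrix_unit i j) M) = K0_class H (mu M (i, j) \<xi> \<xi>)"
      using spec \<xi> by (simp add: centred_path_def bisection_elem_eq)
    then show ?thesis using T.K0_trace_class[OF mu_selfadj_idem[OF p]] trace_mu[OF p] by simp
  qed
  \<comment> \<open>Raising the level by \<open>n0\<close> multiplies the pairing and the
    denominator by the same factor \<open>lam ^ (2 * n0)\<close>.\<close>
  define M where "M = N + n0"
  define Y where "Y = (connecting A ^^ n0) X"
  have "?t X N = ?t Y M" unfolding M_def Y_def by (simp only: limit_class_connecting[of A X N n0])
  also have "\<dots> = (\<Sum>i\<in>UNIV. \<Sum>j\<in>UNIV. of_int (Y $ i $ j) * complex_of_real (pwt M (i, j)))"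
    using additive_matrix_formula[of "\<lambda>X. ?t X M" Y] add unit by (simp add: M_def)
  also have "\<dots> = complex_of_real (pairing Y / lam ^ (2 * M))"
    by (simp add: pairing_eq pwt_def sum_divide_distrib)
  also have "pairing Y / lam ^ (2 * M) = pairing X / lam ^ (2 * N)"
    using lam_pos by (simp add: Y_def M_def pairing_connecting_pow power_add)
  finally show ?thesis .
qed

end

theorem corollary1p4:
  fixes A :: "nat^'k^'k" and \<mu> :: "'k biseq measure" and lam :: real and u\<^sub>l u\<^sub>r :: "real^'k"
    and z :: "((real \<Rightarrow> 'k biseq kernel) sqmat \<times> (real \<Rightarrow> 'k biseq kernel) sqmat) set"
    and X :: "int^'k^'k" and N :: nat
  assumes "nondegenerate A" and "mixing A"
    and "measure_of_maximal_entropy A \<mu>"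
    and "perron_frobenius_eigenvalue A lam"
    and "left_pf_eigenvector A lam u\<^sub>l" and "right_pf_eigenvector A lam u\<^sub>r"
    and "u\<^sub>l \<bullet> u\<^sub>r = 1"
    and "is_cylinder_class A z X N"
  shows "K0_trace (trace_CH \<mu>) z =
    complex_of_real (lam powi (- 2 * int N) * (u\<^sub>l \<bullet> (map_matrix real_of_int X *v u\<^sub>r)))"
proof -
  obtain n0 where n0: "\<forall>n\<ge>n0. \<forall>i j. \<exists>w. edge_path A i j w \<and> length w = n"
    by (rule mixing_paths[OF assms(1,2)]) blast
  interpret mme A lam u\<^sub>l u\<^sub>r \<mu>
    using assms n0 by unfold_locales blast+
  have z: "z \<in> carrier (K0 CH)"
    and ev: "K0_map H (\<lambda>f. f 0) z = limit_to_K0 A (limit_class A X N)"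
    using assms(8) by (auto simp: is_cylinder_class_def)
  have "limit_to_K0 A (limit_class A X N) \<in> carrier (K0 H)"
    using limit_to_K0_spec[OF n0] limit_class_carrier by (auto simp: hom_def)
  then have "K0_trace (trace_CH \<mu>) z = complex_of_real (pairing X / lam ^ (2 * N))"
    using K0_trace_CH[OF z] trace_limit_class[OF n0] by (simp add: ev)
  also have "pairing X / lam ^ (2 * N) = lam powi (- 2 * int N) * (u\<^sub>l \<bullet> (map_matrix real_of_int X *v u\<^sub>r))"
    by (simp add: pairing_def power_int_minus field_simps power_int_def nat_mult_distrib)
  finally show ?thesis .
qed

end
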